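(* Let $a_1,a_2,d_1,d_2$ be positive integers and let $\Lambda$ be a $2$-graph with vertex set $\Lambda^0=\{u,v\}$ such that, for $i=1,2$, $|u\Lambda^{e_i}u|=d_i$, $|u\Lambda^{e_i}v|=a_i$ and $v\Lambda^{e_i}=\emptyset$. Let $r=(r_1,r_2)\in(0,\infty)^2$ and let $\beta\in(0,\infty)$ satisfy $\beta r_i>\ln d_i$ for $i=1,2$. Set $$y_v=1+a_1e^{-\beta r_1}(1-d_1e^{-\beta r_1})^{-1}(1-d_2e^{-\beta r_2})^{-1}+a_2e^{-\beta r_2}(1-d_2e^{-\beta r_2})^{-1}.$$ Then the KMS$_\beta$ states of $(\mathcal{T}C^*(\Lambda),\alpha^r)$ form a $1$-dimensional simplex (a line segment) with extreme points $\phi_1$ and $\phi_2$ satisfying $$\phi_1(t_u)=1,\qquad \phi_1(t_v)=0,$$ $$\phi_2(t_u)=y_v^{-1}\Big(\prod_{i=1}^2(1-d_ie^{-\beta r_i})^{-1}\Big)\big(a_2e^{-\beta r_2}+a_1e^{-\beta r_1}-a_1d_2e^{-\beta(r_1+r_2)}\big),\qquad \phi_2(t_v)=y_v^{-1}.$$ The state $\phi_1$ factors through a state $\psi$ of $\mathcal{T}C^*(u\Lambda u)$ (that is, $\phi_1=\psi\circ q_{\{v\}}$), and the state $\phi_2$ factors through a state of $C^*(\Lambda)$.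
   Context: $\mathbb{N}=\{0,1,2,\dots\}$, and $e_1,e_2$ are the standard generators of $\mathbb{N}^2$. A $2$-graph is a countable category $\Lambda$ with a degree functor $d:\Lambda\to\mathbb{N}^2$ such that whenever $d(\lambda)=m+n$ there are unique $\mu,\nu$ with $\lambda=\mu\nu$, $d(\mu)=m$, $d(\nu)=n$. Elements are called paths; $r(\lambda)$ and $s(\lambda)$ are the codomain and domain; $\mu\nu$ is defined when $s(\mu)=r(\nu)$. $\Lambda^n=d^{-1}(n)$; $\Lambda^0$ is identified with the objects (vertices). $u\Lambda^n=\{\lambda\in\Lambda^n:r(\lambda)=u\}$, $u\Lambda^nv=\{\lambda\in u\Lambda^n:s(\lambda)=v\}$, $u\Lambda u=\{\lambda\in\Lambda:r(\lambda)=s(\lambda)=u\}$ (itself a $2$-graph with one vertex), $u\Lambda^1=u\Lambda^{e_1}\cup u\Lambda^{e_2}$. For $r(\mu)=r(\nu)$, $\Lambda^{\min}(\mu,\nu)=\{(\alpha,\beta)\in\Lambda\times\Lambda:\mu\alpha=\nu\beta,\ d(\mu\alpha)=d(\mu)\vee d(\nu)\}$ (empty if $r(\mu)\neq r(\nu)$). The Toeplitz algebra $\mathcal{T}C^*(\Lambda)$ is the universal $C^*$-algebra generated by partial isometries $\{t_\lambda:\lambda\in\Lambda\}$ such that: (T1) $\{t_z:z\in\Lambda^0\}$ are mutually orthogonal projections; (T2) $t_\lambda t_\mu=t_{\lambda\mu}$ if $s(\lambda)=r(\mu)$; (T3) $t_\lambda^*t_\lambda=t_{s(\lambda)}$; (T4)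 $t_z\ge\sum_{\lambda\in z\Lambda^n}t_\lambda t_\lambda^*$ for $z\in\Lambda^0$, $n\in\mathbb{N}^2$; (T5) $t_\mu^*t_\nu=\sum_{(\alpha,\beta)\in\Lambda^{\min}(\mu,\nu)}t_\alpha t_\beta^*$ (empty sums are $0$). A finite set $E\subset z\Lambda^1$ is exhaustive if for every $\mu\in z\Lambda$ there is $e\in E$ with $\Lambda^{\min}(\mu,e)\neq\emptyset$. The Cuntz--Krieger algebra $C^*(\Lambda)$ is the quotient of $\mathcal{T}C^*(\Lambda)$ by the ideal generated by all $\prod_{e\in E}(t_z-t_et_e^* )$ with $z\in\Lambda^0$ and $E\subset z\Lambda^1$ finite exhaustive. The dynamics $\alpha^r:\mathbb{R}\to\operatorname{Aut}\mathcal{T}C^*(\Lambda)$ is given by $\alpha^r_t(t_\mu t_\nu^* )=e^{it\,r\cdot(d(\mu)-d(\nu))}t_\mu t_\nu^*$. A KMS$_\beta$ state is a state $\phi$ with $\phi(ab)=\phi(b\,\alpha^r_{i\beta}(a))$ for all analytic $a,b$. The map $q_{\{v\}}:\mathcal{T}C^*(\Lambda)\to\mathcal{T}C^*(\Lambda\setminus\{v\})=\mathcal{T}C^*(u\Lambda u)$ is the surjective homomorphism with $q_{\{v\}}(t_\mu)=t_\mu$ if $s(\mu)\ne v$ and $q_{\{v\}}(t_\mu)=0$ if $s(\mu)=v$; its kernel is the ideal generated by $t_v$. A state $\phi$ factors through a state of a quotient if it is the composition of the quotient map with a state of that quotient. *)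

theory Defs
  imports "HOL-Analysis.Analysis" "HOL-Algebra.FiniteProduct" "HOL-Library.Product_Order"
begin

section \<open>2-graphs\<close>

text \<open>A small category is given by its arrows only: an object is identified with its identity
  arrow, so \<open>rng\<close> and \<open>src\<close> return arrows.  Composition is written as in the
  literature, i.e. \<open>cmp \<mu> \<nu>\<close> is meaningful if \<open>src \<mu> = rng \<nu>\<close>.\<close>

record 'p two_graph =
  paths :: "'p set"
  rng :: "'p \<Rightarrow> 'p"
  src :: "'p \<Rightarrow> 'p"
  cmp :: "'p \<Rightarrow> 'p \<Rightarrow> 'p"
  deg :: "'p \<Rightarrow> nat \<times> nat"

locale two_graph =
  fixes \<Lambda> :: "'p two_graph"
  assumes countable_paths: "countable (paths \<Lambda>)"
    and rng_closed: "\<And>\<kappa>. \<kappa> \<in> paths \<Lambda> \<Longrightarrow> rng \<Lambda> \<kappa> \<in> paths \<Lambda>"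
    and src_closed: "\<And>\<kappa>. \<kappa> \<in> paths \<Lambda> \<Longrightarrow> src \<Lambda> \<kappa> \<in> paths \<Lambda>"
    and rng_rng: "\<And>\<kappa>. \<kappa> \<in> paths \<Lambda> \<Longrightarrow> rng \<Lambda> (rng \<Lambda> \<kappa>) = rng \<Lambda> \<kappa>"
    and src_rng: "\<And>\<kappa>. \<kappa> \<in> paths \<Lambda> \<Longrightarrow> src \<Lambda> (rng \<Lambda> \<kappa>) = rng \<Lambda> \<kappa>"
    and rng_src: "\<And>\<kappa>. \<kappa> \<in> paths \<Lambda> \<Longrightarrow> rng \<Lambda> (src \<Lambda> \<kappa>) = src \<Lambda> \<kappa>"
    and src_src: "\<And>\<kappa>. \<kappa> \<in> paths \<Lambda> \<Longrightarrow> src \<Lambda> (src \<Lambda> \<kappa>) = src \<Lambda> \<kappa>"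
    and cmp_closed: "\<And>\<mu> \<nu>. \<mu> \<in> paths \<Lambda> \<Longrightarrow> \<nu> \<in> paths \<Lambda> \<Longrightarrow> src \<Lambda> \<mu> = rng \<Lambda> \<nu>
          \<Longrightarrow> cmp \<Lambda> \<mu> \<nu> \<in> paths \<Lambda>"
    and rng_cmp: "\<And>\<mu> \<nu>. \<mu> \<in> paths \<Lambda> \<Longrightarrow> \<nu> \<in> paths \<Lambda> \<Longrightarrow> src \<Lambda> \<mu> = rng \<Lambda> \<nu>
          \<Longrightarrow> rng \<Lambda> (cmp \<Lambda> \<mu> \<nu>) = rng \<Lambda> \<mu>"
    and src_cmp: "\<And>\<mu> \<nu>. \<mu> \<in> paths \<Lambda> \<Longrightarrow> \<nu> \<in> paths \<Lambda> \<Longrightarrow> src \<Lambda> \<mu> = rng \<Lambda> \<nu>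
          \<Longrightarrow> src \<Lambda> (cmp \<Lambda> \<mu> \<nu>) = src \<Lambda> \<nu>"
    and cmp_assoc: "\<And>\<kappa> \<mu> \<nu>. \<kappa> \<in> paths \<Lambda> \<Longrightarrow> \<mu> \<in> paths \<Lambda> \<Longrightarrow> \<nu> \<in> paths \<Lambda>
          \<Longrightarrow> src \<Lambda> \<kappa> = rng \<Lambda> \<mu> \<Longrightarrow> src \<Lambda> \<mu> = rng \<Lambda> \<nu>
          \<Longrightarrow> cmp \<Lambda> (cmp \<Lambda> \<kappa> \<mu>) \<nu> = cmp \<Lambda> \<kappa> (cmp \<Lambda> \<mu> \<nu>)"
    and cmp_rng: "\<And>\<kappa>. \<kappa> \<in> paths \<Lambda> \<Longrightarrow> cmp \<Lambda> (rng \<Lambda> \<kappa>) \<kappa> = \<kappa>"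
    and cmp_src: "\<And>\<kappa>. \<kappa> \<in> paths \<Lambda> \<Longrightarrow> cmp \<Lambda> \<kappa> (src \<Lambda> \<kappa>) = \<kappa>"
    and deg_rng: "\<And>\<kappa>. \<kappa> \<in> paths \<Lambda> \<Longrightarrow> deg \<Lambda> (rng \<Lambda> \<kappa>) = 0"
    and deg_src: "\<And>\<kappa>. \<kappa> \<in> paths \<Lambda> \<Longrightarrow> deg \<Lambda> (src \<Lambda> \<kappa>) = 0"
    and deg_cmp: "\<And>\<mu> \<nu>. \<mu> \<in> paths \<Lambda> \<Longrightarrow> \<nu> \<in> paths \<Lambda> \<Longrightarrow> src \<Lambda> \<mu> = rng \<Lambda> \<nu>
          \<Longrightarrow> deg \<Lambda> (cmp \<Lambda> \<mu> \<nu>) = deg \<Lambda> \<mu> + deg \<Lambda> \<nu>"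
    and factorization: "\<And>\<kappa> m n. \<kappa> \<in> paths \<Lambda> \<Longrightarrow> deg \<Lambda> \<kappa> = m + n
          \<Longrightarrow> \<exists>!(\<mu>, \<nu>). \<mu> \<in> paths \<Lambda> \<and> \<nu> \<in> paths \<Lambda> \<and> src \<Lambda> \<mu> = rng \<Lambda> \<nu>
                \<and> \<kappa> = cmp \<Lambda> \<mu> \<nu> \<and> deg \<Lambda> \<mu> = m \<and> deg \<Lambda> \<nu> = n"

text \<open>By the factorization property the identity arrows are exactly the paths of degree 0.\<close>

definition vertices :: "'p two_graph \<Rightarrow> 'p set" where
  "vertices \<Lambda> = {\<kappa> \<in> paths \<Lambda>. deg \<Lambda> \<kappa> = 0}"

definition e1 :: "nat \<times> nat" where "e1 = (1, 0)"
definition e2 :: "nat \<times> nat" where "e2 = (0, 1)"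

definition paths_into :: "'p two_graph \<Rightarrow> 'p \<Rightarrow> nat \<times> nat \<Rightarrow> 'p set" where
  "paths_into \<Lambda> z n = {\<kappa> \<in> paths \<Lambda>. deg \<Lambda> \<kappa> = n \<and> rng \<Lambda> \<kappa> = z}"

definition paths_between :: "'p two_graph \<Rightarrow> 'p \<Rightarrow> nat \<times> nat \<Rightarrow> 'p \<Rightarrow> 'p set" where
  "paths_between \<Lambda> z n w = {\<kappa> \<in> paths_into \<Lambda> z n. src \<Lambda> \<kappa> = w}"

definition edges_into :: "'p two_graph \<Rightarrow> 'p \<Rightarrow> 'p set" where
  "edges_into \<Lambda> z = paths_into \<Lambda> z e1 \<union> paths_into \<Lambda> z e2"

definition loop_graph :: "'p two_graph \<Rightarrow> 'p \<Rightarrow> 'p two_graph" where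
  "loop_graph \<Lambda> z = \<Lambda>\<lparr>paths := {\<kappa> \<in> paths \<Lambda>. rng \<Lambda> \<kappa> = z \<and> src \<Lambda> \<kappa> = z}\<rparr>"

definition min_ext :: "'p two_graph \<Rightarrow> 'p \<Rightarrow> 'p \<Rightarrow> ('p \<times> 'p) set" where
  "min_ext \<Lambda> \<mu> \<nu> = {(\<alpha>, \<beta>). rng \<Lambda> \<mu> = rng \<Lambda> \<nu> \<and> \<alpha> \<in> paths \<Lambda> \<and> \<beta> \<in> paths \<Lambda>
      \<and> src \<Lambda> \<mu> = rng \<Lambda> \<alpha> \<and> src \<Lambda> \<nu> = rng \<Lambda> \<beta> \<and> cmp \<Lambda> \<mu> \<alpha> = cmp \<Lambda> \<nu> \<beta>
      \<and> deg \<Lambda> (cmp \<Lambda> \<mu> \<alpha>) = sup (deg \<Lambda> \<mu>) (deg \<Lambda> \<nu>)}"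

definition exhaustive :: "'p two_graph \<Rightarrow> 'p \<Rightarrow> 'p set \<Rightarrow> bool" where
  "exhaustive \<Lambda> z E \<longleftrightarrow> finite E \<and> E \<subseteq> edges_into \<Lambda> z
     \<and> (\<forall>\<mu> \<in> paths \<Lambda>. rng \<Lambda> \<mu> = z \<longrightarrow> (\<exists>e \<in> E. min_ext \<Lambda> \<mu> e \<noteq> {}))"


section \<open>Complex *-algebras with a (semi)norm\<close>

text \<open>The algebras need not be unital.\<close>

record 'a star_algebra = "'a partial_object" +
  azero :: "'a"
  aplus :: "'a \<Rightarrow> 'a \<Rightarrow> 'a" (infixl "\<boxplus>\<index>" 65)
  ascale :: "complex \<Rightarrow> 'a \<Rightarrow> 'a"
  atimes :: "'a \<Rightarrow> 'a \<Rightarrow> 'a" (infixl "\<boxtimes>\<index>" 70)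
  astar :: "'a \<Rightarrow> 'a"
  anorm :: "'a \<Rightarrow> real"

definition aminus :: "'a star_algebra \<Rightarrow> 'a \<Rightarrow> 'a \<Rightarrow> 'a" (infixl "\<boxminus>\<index>" 65) where
  "x \<boxminus>\<^bsub>A\<^esub> y = x \<boxplus>\<^bsub>A\<^esub> ascale A (-1) y"

definition asum :: "'a star_algebra \<Rightarrow> ('i \<Rightarrow> 'a) \<Rightarrow> 'i set \<Rightarrow> 'a" where
  "asum A f I = finprod \<lparr>carrier = carrier A, mult = aplus A, one = azero A\<rparr> f I"

text \<open>The order of a C*-algebra: \<open>x \<le> y\<close> iff \<open>y - x\<close> is of the form
  \<open>c\<^sup>* c\<close>.\<close>

definition ale :: "'a star_algebra \<Rightarrow> 'a \<Rightarrow> 'a \<Rightarrow> bool" where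
  "ale A x y \<longleftrightarrow> (\<exists>c \<in> carrier A. y \<boxminus>\<^bsub>A\<^esub> x = astar A c \<boxtimes>\<^bsub>A\<^esub> c)"

definition star_hom :: "'a star_algebra \<Rightarrow> 'b star_algebra \<Rightarrow> ('a \<Rightarrow> 'b) \<Rightarrow> bool" where
  "star_hom A B h \<longleftrightarrow> h \<in> carrier A \<rightarrow> carrier B
     \<and> (\<forall>x \<in> carrier A. \<forall>y \<in> carrier A. h (x \<boxplus>\<^bsub>A\<^esub> y) = h x \<boxplus>\<^bsub>B\<^esub> h y)
     \<and> (\<forall>c. \<forall>x \<in> carrier A. h (ascale A c x) = ascale B c (h x))
     \<and> (\<forall>x \<in> carrier A. \<forall>y \<in> carrier A. h (x \<boxtimes>\<^bsub>A\<^esub> y) = h x \<boxtimes>\<^bsub>B\<^esub> h y)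
     \<and> (\<forall>x \<in> carrier A. h (astar A x) = astar B (h x))"

text \<open>*-automorphisms of C*-algebras are automatically isometric.\<close>

definition star_automorphism :: "'a star_algebra \<Rightarrow> ('a \<Rightarrow> 'a) \<Rightarrow> bool" where
  "star_automorphism A h \<longleftrightarrow> star_hom A A h \<and> bij_betw h (carrier A) (carrier A)
     \<and> (\<forall>x \<in> carrier A. anorm A (h x) = anorm A x)"

text \<open>As usual for C*-algebras, ideals are two-sided and norm-closed.\<close>

definition closed_ideal :: "'a star_algebra \<Rightarrow> 'a set \<Rightarrow> bool" where
  "closed_ideal A J \<longleftrightarrow> J \<subseteq> carrier A \<and> azero A \<in> J
     \<and> (\<forall>x \<in> J. \<forall>y \<in> J. x \<boxplus>\<^bsub>A\<^esub> y \<in> J)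
     \<and> (\<forall>c. \<forall>x \<in> J. ascale A c x \<in> J)
     \<and> (\<forall>x \<in> J. \<forall>y \<in> carrier A. x \<boxtimes>\<^bsub>A\<^esub> y \<in> J \<and> y \<boxtimes>\<^bsub>A\<^esub> x \<in> J)
     \<and> (\<forall>x \<in> carrier A. (\<forall>\<epsilon>>0. \<exists>y \<in> J. anorm A (x \<boxminus>\<^bsub>A\<^esub> y) < \<epsilon>) \<longrightarrow> x \<in> J)"

definition ideal_generated :: "'a star_algebra \<Rightarrow> 'a set \<Rightarrow> 'a set" where
  "ideal_generated A S = \<Inter>{J. closed_ideal A J \<and> S \<subseteq> J}"

definition coset :: "'a star_algebra \<Rightarrow> 'a set \<Rightarrow> 'a \<Rightarrow> 'a set" where
  "coset A J x = {x \<boxplus>\<^bsub>A\<^esub> j | j. j \<in> J}"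

definition quotient_algebra :: "'a star_algebra \<Rightarrow> 'a set \<Rightarrow> 'a set star_algebra" where
  "quotient_algebra A J =
    \<lparr>carrier = coset A J ` carrier A,
     azero = coset A J (azero A),
     aplus = (\<lambda>X Y. \<Union>x\<in>X. \<Union>y\<in>Y. coset A J (x \<boxplus>\<^bsub>A\<^esub> y)),
     ascale = (\<lambda>c X. \<Union>x\<in>X. coset A J (ascale A c x)),
     atimes = (\<lambda>X Y. \<Union>x\<in>X. \<Union>y\<in>Y. coset A J (x \<boxtimes>\<^bsub>A\<^esub> y)),
     astar = (\<lambda>X. \<Union>x\<in>X. coset A J (astar A x)),
     anorm = (\<lambda>X. Inf (anorm A ` X))\<rparr>"

text \<open>The Hausdorff completion of a seminormed *-algebra: Cauchy sequences modulo null
  sequences.\<close>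

definition cauchy_algebra :: "'a star_algebra \<Rightarrow> (nat \<Rightarrow> 'a) star_algebra" where
  "cauchy_algebra A =
    \<lparr>carrier = {x. range x \<subseteq> carrier A
       \<and> (\<forall>\<epsilon>>0. \<exists>N. \<forall>m\<ge>N. \<forall>n\<ge>N. anorm A (x m \<boxminus>\<^bsub>A\<^esub> x n) < \<epsilon>)},
     azero = (\<lambda>n. azero A),
     aplus = (\<lambda>x y n. x n \<boxplus>\<^bsub>A\<^esub> y n),
     ascale = (\<lambda>c x n. ascale A c (x n)),
     atimes = (\<lambda>x y n. x n \<boxtimes>\<^bsub>A\<^esub> y n),
     astar = (\<lambda>x n. astar A (x n)),
     anorm = (\<lambda>x. lim (\<lambda>n. anorm A (x n)))\<rparr>"

definition null_sequences :: "'a star_algebra \<Rightarrow> (nat \<Rightarrow> 'a) set" where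
  "null_sequences A = {x \<in> carrier (cauchy_algebra A). (\<lambda>n. anorm A (x n)) \<longlonglongrightarrow> 0}"

definition completion :: "'a star_algebra \<Rightarrow> (nat \<Rightarrow> 'a) set star_algebra" where
  "completion A = quotient_algebra (cauchy_algebra A) (null_sequences A)"

definition completion_embed :: "'a star_algebra \<Rightarrow> 'a \<Rightarrow> (nat \<Rightarrow> 'a) set" where
  "completion_embed A x = coset (cauchy_algebra A) (null_sequences A) (\<lambda>n. x)"


section \<open>The Toeplitz and Cuntz-Krieger algebras of a 2-graph\<close>

text \<open>Conditions (T1)-(T5) for a family in a C*-algebra.  If infinitely many paths of some
  degree end in \<open>z\<close>, (T4) means the inequality for all finite partial sums; for finitely many
  paths this is the inequality for the full sum, because the summands are positive.  (T5) is
  meant for graphs with finite \<open>min_ext\<close> sets.\<close>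

definition toeplitz_family :: "'p two_graph \<Rightarrow> 'a star_algebra \<Rightarrow> ('p \<Rightarrow> 'a) \<Rightarrow> bool" where
  "toeplitz_family \<Lambda> A t \<longleftrightarrow>
     (\<forall>\<kappa> \<in> paths \<Lambda>. t \<kappa> \<in> carrier A \<and> t \<kappa> \<boxtimes>\<^bsub>A\<^esub> astar A (t \<kappa>) \<boxtimes>\<^bsub>A\<^esub> t \<kappa> = t \<kappa>)
   \<and> (\<forall>z \<in> vertices \<Lambda>. astar A (t z) = t z \<and> t z \<boxtimes>\<^bsub>A\<^esub> t z = t z)
   \<and> (\<forall>z \<in> vertices \<Lambda>. \<forall>w \<in> vertices \<Lambda>. z \<noteq> w \<longrightarrow> t z \<boxtimes>\<^bsub>A\<^esub> t w = azero A)
   \<and> (\<forall>\<kappa> \<in> paths \<Lambda>. \<forall>\<mu> \<in> paths \<Lambda>. src \<Lambda> \<kappa> = rng \<Lambda> \<mu> \<longrightarrow> t \<kappa> \<boxtimes>\<^bsub>A\<^esub> t \<mu> = t (cmp \<Lambda> \<kappa> \<mu>))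
   \<and> (\<forall>\<kappa> \<in> paths \<Lambda>. astar A (t \<kappa>) \<boxtimes>\<^bsub>A\<^esub> t \<kappa> = t (src \<Lambda> \<kappa>))
   \<and> (\<forall>z \<in> vertices \<Lambda>. \<forall>n G. finite G \<and> G \<subseteq> paths_into \<Lambda> z n
        \<longrightarrow> ale A (asum A (\<lambda>\<kappa>. t \<kappa> \<boxtimes>\<^bsub>A\<^esub> astar A (t \<kappa>)) G) (t z))
   \<and> (\<forall>\<mu> \<in> paths \<Lambda>. \<forall>\<nu> \<in> paths \<Lambda>.
        astar A (t \<mu>) \<boxtimes>\<^bsub>A\<^esub> t \<nu>
          = asum A (\<lambda>(\<alpha>, \<beta>). t \<alpha> \<boxtimes>\<^bsub>A\<^esub> astar A (t \<beta>)) (min_ext \<Lambda> \<mu> \<nu>))"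

text \<open>The free (non-unital) complex *-algebra on the set of paths, consisting of the finitely
  supported functions on nonempty words; the letter \<open>(\<kappa>, False)\<close> stands for the
  generator belonging to \<open>\<kappa>\<close> and \<open>(\<kappa>, True)\<close> for its adjoint.\<close>

type_synonym 'p star_poly = "('p \<times> bool) list \<Rightarrow> complex"

definition free_algebra :: "'p two_graph \<Rightarrow> ('p star_poly \<Rightarrow> real) \<Rightarrow> 'p star_poly star_algebra" where
  "free_algebra \<Lambda> p =
    \<lparr>carrier = {f. finite {w. f w \<noteq> 0} \<and> f [] = 0 \<and> (\<forall>w. f w \<noteq> 0 \<longrightarrow> fst ` set w \<subseteq> paths \<Lambda>)},
     azero = (\<lambda>w. 0),
     aplus = (\<lambda>f g w. f w + g w),
     ascale = (\<lambda>c f w. c * f w),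
     atimes = (\<lambda>f g w. \<Sum>k\<le>length w. f (take k w) * g (drop k w)),
     astar = (\<lambda>f w. cnj (f (map (apsnd Not) (rev w)))),
     anorm = p\<rparr>"

definition free_generator :: "'p \<Rightarrow> 'p star_poly" where
  "free_generator \<kappa> = (\<lambda>w. if w = [(\<kappa>, False)] then 1 else 0)"

definition cstar_seminorm :: "'p two_graph \<Rightarrow> ('p star_poly \<Rightarrow> real) \<Rightarrow> bool" where
  "cstar_seminorm \<Lambda> p \<longleftrightarrow> (let F = free_algebra \<Lambda> p in
     (\<forall>f \<in> carrier F. 0 \<le> p f)
   \<and> (\<forall>f \<in> carrier F. \<forall>g \<in> carrier F. p (f \<boxplus>\<^bsub>F\<^esub> g) \<le> p f + p g)
   \<and> (\<forall>c. \<forall>f \<in> carrier F. p (ascale F c f) = cmod c * p f)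
   \<and> (\<forall>f \<in> carrier F. \<forall>g \<in> carrier F. p (f \<boxtimes>\<^bsub>F\<^esub> g) \<le> p f * p g)
   \<and> (\<forall>f \<in> carrier F. p (astar F f \<boxtimes>\<^bsub>F\<^esub> f) = (p f)\<^sup>2))"

text \<open>The C*-algebras generated by a family indexed by the paths are, up to isomorphism, the
  completions of the free *-algebra in its C*-seminorms.  The universal C*-algebra for (T1)-(T5)
  is therefore the completion in the largest C*-seminorm for which the generators satisfy these
  conditions.  The supremum is finite, since partial isometries have norm at most 1.\<close>

definition toeplitz_norm :: "'p two_graph \<Rightarrow> 'p star_poly \<Rightarrow> real" where
  "toeplitz_norm \<Lambda> f = Sup {p f | p. cstar_seminorm \<Lambda> p
     \<and> toeplitz_family \<Lambda> (completion (free_algebra \<Lambda> p))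
         (\<lambda>\<kappa>. completion_embed (free_algebra \<Lambda> p) (free_generator \<kappa>))}"

type_synonym 'p toeplitz_element = "(nat \<Rightarrow> 'p star_poly) set"

definition toeplitz_algebra :: "'p two_graph \<Rightarrow> 'p toeplitz_element star_algebra" where
  "toeplitz_algebra \<Lambda> = completion (free_algebra \<Lambda> (toeplitz_norm \<Lambda>))"

definition tgen :: "'p two_graph \<Rightarrow> 'p \<Rightarrow> 'p toeplitz_element" where
  "tgen \<Lambda> \<kappa> = completion_embed (free_algebra \<Lambda> (toeplitz_norm \<Lambda>)) (free_generator \<kappa>)"

text \<open>The factors \<open>t\<^sub>z - t\<^sub>e t\<^sub>e\<^sup>*\<close> are commuting subprojections of
  \<open>t\<^sub>z\<close>, so the product over \<open>E\<close> is the product along any enumeration of \<open>E\<close>,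
  followed by \<open>t\<^sub>z\<close>.\<close>

definition gap_product :: "'p two_graph \<Rightarrow> 'p \<Rightarrow> 'p list \<Rightarrow> 'p toeplitz_element" where
  "gap_product \<Lambda> z es = (let A = toeplitz_algebra \<Lambda>; t = tgen \<Lambda> in
     foldr (\<lambda>e x. (t z \<boxminus>\<^bsub>A\<^esub> (t e \<boxtimes>\<^bsub>A\<^esub> astar A (t e))) \<boxtimes>\<^bsub>A\<^esub> x) es (t z))"

definition cuntz_krieger_ideal :: "'p two_graph \<Rightarrow> 'p toeplitz_element set" where
  "cuntz_krieger_ideal \<Lambda> = ideal_generated (toeplitz_algebra \<Lambda>)
     {gap_product \<Lambda> z es | z es. z \<in> vertices \<Lambda> \<and> distinct es \<and> exhaustive \<Lambda> z (set es)}"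

definition cuntz_krieger_algebra :: "'p two_graph \<Rightarrow> 'p toeplitz_element set star_algebra" where
  "cuntz_krieger_algebra \<Lambda> = quotient_algebra (toeplitz_algebra \<Lambda>) (cuntz_krieger_ideal \<Lambda>)"

definition cuntz_krieger_map :: "'p two_graph \<Rightarrow> 'p toeplitz_element \<Rightarrow> 'p toeplitz_element set" where
  "cuntz_krieger_map \<Lambda> = coset (toeplitz_algebra \<Lambda>) (cuntz_krieger_ideal \<Lambda>)"

text \<open>The quotient map from the Toeplitz algebra of \<open>\<Lambda>\<close> onto that of \<open>u\<Lambda>u\<close>
  that kills the vertex \<open>v\<close>, for a graph with vertices \<open>u\<close> and \<open>v\<close> in which no edge
  has range \<open>v\<close>.\<close>

definition removes_vertex ::
  "'p two_graph \<Rightarrow> 'p \<Rightarrow> 'p \<Rightarrow> ('p toeplitz_element \<Rightarrow> 'p toeplitz_element) \<Rightarrow> bool" where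
  "removes_vertex \<Lambda> u v q \<longleftrightarrow>
     star_hom (toeplitz_algebra \<Lambda>) (toeplitz_algebra (loop_graph \<Lambda> u)) q
   \<and> q ` carrier (toeplitz_algebra \<Lambda>) = carrier (toeplitz_algebra (loop_graph \<Lambda> u))
   \<and> (\<forall>\<mu> \<in> paths \<Lambda>. q (tgen \<Lambda> \<mu>) =
        (if src \<Lambda> \<mu> = v then azero (toeplitz_algebra (loop_graph \<Lambda> u))
         else tgen (loop_graph \<Lambda> u) \<mu>))"


section \<open>States, dynamics and KMS states\<close>

text \<open>Functionals are extended by 0 outside the carrier, so that states are equal as functions
  iff they agree on the algebra.\<close>

definition is_state :: "'a star_algebra \<Rightarrow> ('a \<Rightarrow> complex) \<Rightarrow> bool" where
  "is_state A \<phi> \<longleftrightarrow>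
     (\<forall>x. x \<notin> carrier A \<longrightarrow> \<phi> x = 0)
   \<and> (\<forall>x \<in> carrier A. \<forall>y \<in> carrier A. \<phi> (x \<boxplus>\<^bsub>A\<^esub> y) = \<phi> x + \<phi> y)
   \<and> (\<forall>c. \<forall>x \<in> carrier A. \<phi> (ascale A c x) = c * \<phi> x)
   \<and> (\<forall>x \<in> carrier A. \<phi> (astar A x \<boxtimes>\<^bsub>A\<^esub> x) \<in> \<real>\<^sub>\<ge>\<^sub>0)
   \<and> bdd_above {cmod (\<phi> x) | x. x \<in> carrier A \<and> anorm A x \<le> 1}
   \<and> Sup {cmod (\<phi> x) | x. x \<in> carrier A \<and> anorm A x \<le> 1} = 1"

definition toeplitz_dynamics ::
  "'p two_graph \<Rightarrow> real \<times> real \<Rightarrow> (real \<Rightarrow> 'p toeplitz_element \<Rightarrow> 'p toeplitz_element) \<Rightarrow> bool" where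
  "toeplitz_dynamics \<Lambda> r \<alpha> \<longleftrightarrow> (let A = toeplitz_algebra \<Lambda> in
     \<forall>t. star_automorphism A (\<alpha> t)
       \<and> (\<forall>\<mu> \<in> paths \<Lambda>. \<forall>\<nu> \<in> paths \<Lambda>.
            \<alpha> t (tgen \<Lambda> \<mu> \<boxtimes>\<^bsub>A\<^esub> astar A (tgen \<Lambda> \<nu>))
              = ascale A (exp (\<i> * of_real (t *
                   (fst r * (real (fst (deg \<Lambda> \<mu>)) - real (fst (deg \<Lambda> \<nu>)))
                  + snd r * (real (snd (deg \<Lambda> \<mu>)) - real (snd (deg \<Lambda> \<nu>)))))))
                  (tgen \<Lambda> \<mu> \<boxtimes>\<^bsub>A\<^esub> astar A (tgen \<Lambda> \<nu>))))"

definition entire_function :: "'a star_algebra \<Rightarrow> (complex \<Rightarrow> 'a) \<Rightarrow> bool" where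
  "entire_function A F \<longleftrightarrow> range F \<subseteq> carrier A
     \<and> (\<forall>z. \<exists>D \<in> carrier A.
          ((\<lambda>h. anorm A (ascale A (1 / h) (F (z + h) \<boxminus>\<^bsub>A\<^esub> F z) \<boxminus>\<^bsub>A\<^esub> D)) \<longlongrightarrow> 0) (at 0))"

text \<open>\<open>F\<close> is the (unique) entire extension \<open>z \<mapsto> \<alpha>\<^sub>z(x)\<close> of
  the orbit of \<open>x\<close>.\<close>

definition analytic_extension ::
  "'a star_algebra \<Rightarrow> (real \<Rightarrow> 'a \<Rightarrow> 'a) \<Rightarrow> 'a \<Rightarrow> (complex \<Rightarrow> 'a) \<Rightarrow> bool" where
  "analytic_extension A \<alpha> x F \<longleftrightarrow>
     x \<in> carrier A \<and> entire_function A F \<and> (\<forall>t. F (complex_of_real t) = \<alpha> t x)"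

definition analytic_element :: "'a star_algebra \<Rightarrow> (real \<Rightarrow> 'a \<Rightarrow> 'a) \<Rightarrow> 'a \<Rightarrow> bool" where
  "analytic_element A \<alpha> x \<longleftrightarrow> (\<exists>F. analytic_extension A \<alpha> x F)"

definition kms_state ::
  "'a star_algebra \<Rightarrow> (real \<Rightarrow> 'a \<Rightarrow> 'a) \<Rightarrow> real \<Rightarrow> ('a \<Rightarrow> complex) \<Rightarrow> bool" where
  "kms_state A \<alpha> \<beta> \<phi> \<longleftrightarrow> is_state A \<phi>
     \<and> (\<forall>x y F. analytic_extension A \<alpha> x F \<and> analytic_element A \<alpha> y
          \<longrightarrow> \<phi> (x \<boxtimes>\<^bsub>A\<^esub> y) = \<phi> (y \<boxtimes>\<^bsub>A\<^esub> F (\<i> * of_real \<beta>)))"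

definition mix :: "real \<Rightarrow> ('a \<Rightarrow> complex) \<Rightarrow> ('a \<Rightarrow> complex) \<Rightarrow> 'a \<Rightarrow> complex" where
  "mix s \<phi> \<psi> = (\<lambda>x. of_real (1 - s) * \<phi> x + of_real s * \<psi> x)"

definition state_segment :: "('a \<Rightarrow> complex) \<Rightarrow> ('a \<Rightarrow> complex) \<Rightarrow> ('a \<Rightarrow> complex) set" where
  "state_segment \<phi> \<psi> = {mix s \<phi> \<psi> | s. 0 \<le> s \<and> s \<le> 1}"

definition extreme_states :: "('a \<Rightarrow> complex) set \<Rightarrow> ('a \<Rightarrow> complex) set" where
  "extreme_states K = {\<phi> \<in> K. \<forall>\<psi> \<in> K. \<forall>\<eta> \<in> K. \<forall>s. 0 < s \<and> s < 1 \<and> \<phi> = mix s \<psi> \<eta>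
     \<longrightarrow> \<psi> = \<phi> \<and> \<eta> = \<phi>}"

end

theory Submission
  imports Defs "HOL-Library.Poly_Mapping" "HOL-Complex_Analysis.Complex_Analysis"
begin

text \<open>A state is KMS iff \<open>\<phi> (t\<^sub>\<kappa> x) = e\<^bsup>-\<beta> r\<cdot>d(\<kappa>)\<^esup> \<phi> (x t\<^sub>\<kappa>)\<close> for all
  paths \<open>\<kappa>\<close> and *-polynomials \<open>x\<close>.  Together with (T5) this forces
  \<open>\<phi> (t\<^sub>\<mu> t\<^sub>\<nu>\<^sup>*) = 0\<close> for \<open>\<mu> \<noteq> \<nu>\<close>, so a KMS state is determined by its value at \<open>t\<^sub>v\<close>.
  The projections \<open>t\<^sub>\<kappa> t\<^sub>\<kappa>\<^sup>*\<close>, where \<open>\<kappa>\<close> ranges over the paths with source \<open>v\<close>,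
  are mutually orthogonal with values \<open>e\<^bsup>-\<beta> r\<cdot>d(\<kappa>)\<^esup> \<phi> (t\<^sub>v)\<close>, and these weights sum to \<open>y\<^sub>v \<phi> (t\<^sub>v)\<close>;
  hence \<open>\<phi> (t\<^sub>v)\<close> lies in \<open>[0, 1/y\<^sub>v]\<close>.

  The end points are realised in the representation by left multiplication on the path space: average
  the vector states of the paths with source \<open>v\<close>, respectively of the loops at \<open>u\<close>, with weights
  proportional to \<open>e\<^bsup>-\<beta> r\<cdot>d(\<kappa>)\<^esup>\<close>.  Paths with source \<open>v\<close> are maximal, so the
  first average annihilates the Cuntz-Krieger relations; the second one is a state of the Toeplitz algebra
  of \<open>u\<Lambda>u\<close>.  The map \<open>q\<close> deletes the words containing a path with source \<open>v\<close>; it is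
  onto because the norm of the Toeplitz algebra of \<open>u\<Lambda>u\<close> is the quotient norm, the infimum of
  \<open>\<parallel>x (1 - \<Sum>\<^sub>\<kappa> t\<^sub>\<kappa> t\<^sub>\<kappa>\<^sup>*)\<parallel>\<close> over finite sets of paths \<open>\<kappa>\<close> with source \<open>v\<close>.\<close>

section \<open>Seminormed *-algebras, their quotients and completions\<close>

text \<open>The Toeplitz algebra is given only as a completion in a supremum of seminorms: an upper
  bound for its norm has to be proved for every admissible seminorm, and a lower bound has to come
  from exhibiting one. The path representation serves the second purpose. So does the quotient norm
  on \<open>u\<Lambda>u\<close>; it yields lifts of controlled norm, and surjectivity of
  \<open>q\<close> rests on them. Identities are proved between noncommutative polynomials modulo
  seminorm zero, and reach the completion by density. The delicate point of uniqueness is the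
  vanishing for \<mu> \<noteq> \<nu>. Invariance under the dynamics settles it only if r.d(\<mu>)
  and r.d(\<nu>) differ, and they may coincide when r1 / r2 is rational. One use of the KMS relation
  and (T5) reduces the remaining pairs to degrees (m, 0) and (0, n) with source u. There the
  recursion stays in a finite set of values and contracts it by the factor d1^m e^{-\<beta> r1 m} <
  1, so \<beta> r1 > ln d1 is used beyond the convergence of series.\<close>

locale star_alg =
  fixes A :: "'a star_algebra" (structure)
  assumes zero_closed [simp, intro]: "azero A \<in> carrier A"
    and add_closed [simp, intro]: "x \<in> carrier A \<Longrightarrow> y \<in> carrier A \<Longrightarrow> x \<boxplus> y \<in> carrier A"
    and scale_closed [simp, intro]: "x \<in> carrier A \<Longrightarrow> ascale A c x \<in> carrier A"
    and times_closed [simp, intro]: "x \<in> carrier A \<Longrightarrow> y \<in> carrier A \<Longrightarrow> x \<boxtimes> y \<in> carrier A"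
    and star_closed [simp, intro]: "x \<in> carrier A \<Longrightarrow> astar A x \<in> carrier A"
    and add_assoc: "x \<in> carrier A \<Longrightarrow> y \<in> carrier A \<Longrightarrow> z \<in> carrier A \<Longrightarrow> x \<boxplus> y \<boxplus> z = x \<boxplus> (y \<boxplus> z)"
    and add_commute: "x \<in> carrier A \<Longrightarrow> y \<in> carrier A \<Longrightarrow> x \<boxplus> y = y \<boxplus> x"
    and zero_add [simp]: "x \<in> carrier A \<Longrightarrow> azero A \<boxplus> x = x"
    and scale_add: "x \<in> carrier A \<Longrightarrow> y \<in> carrier A \<Longrightarrow> ascale A c (x \<boxplus> y) = ascale A c x \<boxplus> ascale A c y"
    and add_scale: "x \<in> carrier A \<Longrightarrow> ascale A (c + d) x = ascale A c x \<boxplus> ascale A d x"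
    and scale_scale: "x \<in> carrier A \<Longrightarrow> ascale A c (ascale A d x) = ascale A (c * d) x"
    and scale_one [simp]: "x \<in> carrier A \<Longrightarrow> ascale A 1 x = x"
    and scale_nought [simp]: "x \<in> carrier A \<Longrightarrow> ascale A 0 x = azero A"
    and times_assoc: "x \<in> carrier A \<Longrightarrow> y \<in> carrier A \<Longrightarrow> z \<in> carrier A \<Longrightarrow> x \<boxtimes> y \<boxtimes> z = x \<boxtimes> (y \<boxtimes> z)"
    and times_add: "x \<in> carrier A \<Longrightarrow> y \<in> carrier A \<Longrightarrow> z \<in> carrier A \<Longrightarrow> x \<boxtimes> (y \<boxplus> z) = x \<boxtimes> y \<boxplus> x \<boxtimes> z"
    and add_times: "x \<in> carrier A \<Longrightarrow> y \<in> carrier A \<Longrightarrow> z \<in> carrier A \<Longrightarrow> (x \<boxplus> y) \<boxtimes> z = x \<boxtimes> z \<boxplus> y \<boxtimes> z"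
    and scale_times: "x \<in> carrier A \<Longrightarrow> y \<in> carrier A \<Longrightarrow> ascale A c x \<boxtimes> y = ascale A c (x \<boxtimes> y)"
    and times_scale: "x \<in> carrier A \<Longrightarrow> y \<in> carrier A \<Longrightarrow> x \<boxtimes> ascale A c y = ascale A c (x \<boxtimes> y)"
    and star_add: "x \<in> carrier A \<Longrightarrow> y \<in> carrier A \<Longrightarrow> astar A (x \<boxplus> y) = astar A x \<boxplus> astar A y"
    and star_scale: "x \<in> carrier A \<Longrightarrow> astar A (ascale A c x) = ascale A (cnj c) (astar A x)"
    and star_times: "x \<in> carrier A \<Longrightarrow> y \<in> carrier A \<Longrightarrow> astar A (x \<boxtimes> y) = astar A y \<boxtimes> astar A x"
    and star_star [simp]: "x \<in> carrier A \<Longrightarrow> astar A (astar A x) = x"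
    and norm_triangle: "x \<in> carrier A \<Longrightarrow> y \<in> carrier A \<Longrightarrow> anorm A (x \<boxplus> y) \<le> anorm A x + anorm A y"
    and norm_scale: "x \<in> carrier A \<Longrightarrow> anorm A (ascale A c x) = cmod c * anorm A x"
    and norm_times: "x \<in> carrier A \<Longrightarrow> y \<in> carrier A \<Longrightarrow> anorm A (x \<boxtimes> y) \<le> anorm A x * anorm A y"
    and norm_star [simp]: "x \<in> carrier A \<Longrightarrow> anorm A (astar A x) = anorm A x"
begin

lemma add_left_commute:
  "x \<in> carrier A \<Longrightarrow> y \<in> carrier A \<Longrightarrow> z \<in> carrier A \<Longrightarrow> x \<boxplus> (y \<boxplus> z) = y \<boxplus> (x \<boxplus> z)"
  by (metis add_assoc add_commute)

lemmas add_ac = add_assoc add_commute add_left_commute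

lemma add_zero [simp]: "x \<in> carrier A \<Longrightarrow> x \<boxplus> azero A = x"
  using add_commute zero_add by fastforce

lemma minus_closed [simp, intro]: "x \<in> carrier A \<Longrightarrow> y \<in> carrier A \<Longrightarrow> x \<boxminus> y \<in> carrier A"
  by (simp add: aminus_def)

lemma scale_minus_one_cancel: "x \<in> carrier A \<Longrightarrow> x \<boxplus> ascale A (-1) x = azero A"
  using add_scale[of x 1 "-1"] by simp

lemma minus_self [simp]: "x \<in> carrier A \<Longrightarrow> x \<boxminus> x = azero A"
  by (simp add: aminus_def scale_minus_one_cancel)

lemma scale_azero [simp]: "ascale A c (azero A) = azero A"
proof -
  have "ascale A c (azero A) = ascale A c (ascale A 0 (azero A))" by simp
  also have "\<dots> = azero A" by (subst scale_scale) auto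
  finally show ?thesis .
qed

lemma minus_zero [simp]: "x \<in> carrier A \<Longrightarrow> x \<boxminus> azero A = x"
  by (simp add: aminus_def)

lemma minus_add_cancel: "x \<in> carrier A \<Longrightarrow> y \<in> carrier A \<Longrightarrow> y \<boxplus> (x \<boxminus> y) = x"
  by (simp add: aminus_def add_left_commute scale_minus_one_cancel)

lemma minus_trans:
  assumes "x \<in> carrier A" "y \<in> carrier A" "z \<in> carrier A"
  shows "(x \<boxminus> y) \<boxplus> (y \<boxminus> z) = x \<boxminus> z"
proof -
  have "(x \<boxminus> y) \<boxplus> (y \<boxminus> z) = x \<boxplus> (y \<boxplus> ascale A (-1) y) \<boxplus> ascale A (-1) z"
    unfolding aminus_def using assms by (simp add: add_ac)
  thus ?thesis using assms by (simp add: scale_minus_one_cancel aminus_def)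
qed

lemma minus_swap:
  "x \<in> carrier A \<Longrightarrow> y \<in> carrier A \<Longrightarrow> y \<boxminus> x = ascale A (-1) (x \<boxminus> y)"
  by (simp add: aminus_def scale_add scale_scale add_commute)

lemma add_minus_add:
  "x \<in> carrier A \<Longrightarrow> y \<in> carrier A \<Longrightarrow> x' \<in> carrier A \<Longrightarrow> y' \<in> carrier A \<Longrightarrow>
   (x \<boxplus> y) \<boxminus> (x' \<boxplus> y') = (x \<boxminus> x') \<boxplus> (y \<boxminus> y')"
  by (simp add: aminus_def scale_add add_ac)

lemma add_minus_left: "x \<in> carrier A \<Longrightarrow> j \<in> carrier A \<Longrightarrow> (x \<boxplus> j) \<boxminus> x = j"
  by (metis add_commute add_zero minus_self minus_zero add_minus_add zero_closed zero_add)

lemma scale_minus: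
  "x \<in> carrier A \<Longrightarrow> y \<in> carrier A \<Longrightarrow> ascale A c (x \<boxminus> y) = ascale A c x \<boxminus> ascale A c y"
  by (simp add: aminus_def scale_add scale_scale)

lemma times_minus:
  "x \<in> carrier A \<Longrightarrow> y \<in> carrier A \<Longrightarrow> z \<in> carrier A \<Longrightarrow> x \<boxtimes> (y \<boxminus> z) = x \<boxtimes> y \<boxminus> x \<boxtimes> z"
  by (simp add: aminus_def times_add times_scale)

lemma minus_times:
  "x \<in> carrier A \<Longrightarrow> y \<in> carrier A \<Longrightarrow> z \<in> carrier A \<Longrightarrow> (x \<boxminus> y) \<boxtimes> z = x \<boxtimes> z \<boxminus> y \<boxtimes> z"
  by (simp add: aminus_def add_times scale_times)

text \<open>One factor is changed at a time. This decomposition makes products well defined on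
  cosets and keeps products of Cauchy sequences Cauchy.\<close>

lemma times_minus_times:
  assumes "x \<in> carrier A" "y \<in> carrier A" "x' \<in> carrier A" "y' \<in> carrier A"
  shows "x \<boxtimes> y \<boxminus> x' \<boxtimes> y' = (x \<boxminus> x') \<boxtimes> y \<boxplus> x' \<boxtimes> (y \<boxminus> y')"
  using assms by (simp add: minus_times times_minus minus_trans)

lemma star_minus:
  "x \<in> carrier A \<Longrightarrow> y \<in> carrier A \<Longrightarrow> astar A (x \<boxminus> y) = astar A x \<boxminus> astar A y"
  by (simp add: aminus_def star_add star_scale)

lemma norm_zero [simp]: "anorm A (azero A) = 0"
  using norm_scale[of "azero A" 0] by simp

text \<open>Nonnegativity follows from the axioms: the triangle inequality for x and -x gives 0
  \<le> 2 \<open>anorm A x\<close>.\<close>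

lemma norm_nonneg [simp]: "x \<in> carrier A \<Longrightarrow> 0 \<le> anorm A x"
  using norm_triangle[of x "ascale A (-1) x"] by (simp add: norm_scale scale_minus_one_cancel)

lemma norm_minus_commute:
  "x \<in> carrier A \<Longrightarrow> y \<in> carrier A \<Longrightarrow> anorm A (x \<boxminus> y) = anorm A (y \<boxminus> x)"
  by (subst minus_swap) (auto simp: norm_scale)

lemma norm_minus_triangle:
  "x \<in> carrier A \<Longrightarrow> y \<in> carrier A \<Longrightarrow> z \<in> carrier A \<Longrightarrow>
   anorm A (x \<boxminus> z) \<le> anorm A (x \<boxminus> y) + anorm A (y \<boxminus> z)"
  using norm_triangle[of "x \<boxminus> y" "y \<boxminus> z"] by (simp add: minus_trans)

lemma norm_reverse_triangle:
  assumes "x \<in> carrier A" "y \<in> carrier A"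
  shows "\<bar>anorm A x - anorm A y\<bar> \<le> anorm A (x \<boxminus> y)"
  using norm_minus_triangle[of x y "azero A"] norm_minus_triangle[of y x "azero A"] assms
  by (simp add: norm_minus_commute[of y x])

lemma norm_times_minus_times:
  assumes "x \<in> carrier A" "y \<in> carrier A" "x' \<in> carrier A" "y' \<in> carrier A"
  shows "anorm A (x \<boxtimes> y \<boxminus> x' \<boxtimes> y') \<le> anorm A (x \<boxminus> x') * anorm A y + anorm A x' * anorm A (y \<boxminus> y')"
proof -
  have "anorm A (x \<boxtimes> y \<boxminus> x' \<boxtimes> y') \<le> anorm A ((x \<boxminus> x') \<boxtimes> y) + anorm A (x' \<boxtimes> (y \<boxminus> y'))"
    using assms by (subst times_minus_times) (auto intro: norm_triangle)
  also have "\<dots> \<le> anorm A (x \<boxminus> x') * anorm A y + anorm A x' * anorm A (y \<boxminus> y')"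
    using assms by (intro add_mono norm_times) auto
  finally show ?thesis .
qed

lemma comm_monoid_add: "comm_monoid \<lparr>carrier = carrier A, mult = aplus A, one = azero A\<rparr>"
  by unfold_locales (auto simp: add_ac)

lemma asum_empty [simp]: "asum A f {} = azero A"
  by (simp add: asum_def finprod_def)

lemma asum_insert:
  assumes "finite I" "i \<notin> I" "f i \<in> carrier A" "f ` I \<subseteq> carrier A"
  shows "asum A f (insert i I) = f i \<boxplus> asum A f I"
  unfolding asum_def
  using comm_monoid.finprod_insert[OF comm_monoid_add, of I i f] assms by auto

end

section \<open>Quotients by a self-adjoint ideal\<close>

lemma UN_eq_const: "x \<in> X \<Longrightarrow> (\<And>x'. x' \<in> X \<Longrightarrow> f x' = c) \<Longrightarrow> (\<Union>x'\<in>X. f x') = c"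
  by blast

text \<open>Closure under the adjoint is a separate requirement; the quotient inherits its
  involution from it. For null sequences it is immediate, for the Cuntz-Krieger ideal it comes from
  a self-adjoint generating set.\<close>

locale star_ideal = star_alg A for A :: "'a star_algebra" (structure) +
  fixes J :: "'a set"
  assumes ideal_subset: "J \<subseteq> carrier A"
    and ideal_zero: "azero A \<in> J"
    and ideal_add: "x \<in> J \<Longrightarrow> y \<in> J \<Longrightarrow> x \<boxplus> y \<in> J"
    and ideal_scale: "x \<in> J \<Longrightarrow> ascale A c x \<in> J"
    and ideal_times: "x \<in> J \<Longrightarrow> y \<in> carrier A \<Longrightarrow> x \<boxtimes> y \<in> J"
    and times_ideal: "x \<in> carrier A \<Longrightarrow> y \<in> J \<Longrightarrow> x \<boxtimes> y \<in> J"
    and ideal_star: "x \<in> J \<Longrightarrow> astar A x \<in> J"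
begin

lemma in_coset_iff: "x \<in> carrier A \<Longrightarrow> y \<in> coset A J x \<longleftrightarrow> y \<in> carrier A \<and> y \<boxminus> x \<in> J"
  unfolding coset_def
  using ideal_subset add_minus_left minus_add_cancel by (auto 4 4 intro!: exI[of _ "y \<boxminus> x"])

lemma coset_eq_iff:
  assumes "x \<in> carrier A" "y \<in> carrier A"
  shows "coset A J x = coset A J y \<longleftrightarrow> x \<boxminus> y \<in> J"
proof
  have "x \<in> coset A J x" using assms in_coset_iff ideal_zero by simp
  moreover assume "coset A J x = coset A J y"
  ultimately show "x \<boxminus> y \<in> J" using assms in_coset_iff by simp
next
  assume xy: "x \<boxminus> y \<in> J"
  have yx: "y \<boxminus> x \<in> J" using ideal_scale[OF xy, of "-1"] minus_swap[OF assms] by simp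
  show "coset A J x = coset A J y"
  proof (intro Set.set_eqI)
    fix z
    have "z \<boxminus> y \<in> J" if "z \<in> carrier A" "z \<boxminus> x \<in> J"
      using minus_trans[OF that(1) assms] ideal_add[OF that(2) xy] by simp
    moreover have "z \<boxminus> x \<in> J" if "z \<in> carrier A" "z \<boxminus> y \<in> J"
      using minus_trans[OF that(1) assms(2,1)] ideal_add[OF that(2) yx] by simp
    ultimately show "z \<in> coset A J x \<longleftrightarrow> z \<in> coset A J y" using in_coset_iff assms by auto
  qed
qed

lemma coset_carrier: "x \<in> carrier A \<Longrightarrow> y \<in> coset A J x \<Longrightarrow> y \<in> carrier A"
  by (simp add: in_coset_iff)

lemma in_own_coset: "x \<in> carrier A \<Longrightarrow> x \<in> coset A J x"
  by (simp add: in_coset_iff ideal_zero)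

abbreviation (input) "Q \<equiv> quotient_algebra A J"

lemma carrier_quotient: "carrier Q = coset A J ` carrier A"
  and zero_quotient: "azero Q = coset A J (azero A)"
  and norm_quotient: "anorm Q X = Inf (anorm A ` X)"
  by (auto simp: quotient_algebra_def)

text \<open>The operations of \<open>quotient_algebra\<close> are unions over all representatives.
  Once the coset of the result is independent of them, the union is over a constant family and
  collapses.\<close>

lemma add_quotient:
  assumes "x \<in> carrier A" "y \<in> carrier A"
  shows "coset A J x \<boxplus>\<^bsub>Q\<^esub> coset A J y = coset A J (x \<boxplus> y)"
proof -
  have "coset A J (x' \<boxplus> y') = coset A J (x \<boxplus> y)" if "x' \<in> coset A J x" "y' \<in> coset A J y" for x' y'
    using that assms ideal_add
    by (subst coset_eq_iff) (auto simp: in_coset_iff add_minus_add)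
  hence "(\<Union>x'\<in>coset A J x. \<Union>y'\<in>coset A J y. coset A J (x' \<boxplus> y')) = coset A J (x \<boxplus> y)"
    by (intro UN_eq_const[OF in_own_coset] assms)
  thus ?thesis by (simp add: quotient_algebra_def)
qed

lemma scale_quotient:
  assumes "x \<in> carrier A"
  shows "ascale Q c (coset A J x) = coset A J (ascale A c x)"
proof -
  have "coset A J (ascale A c x') = coset A J (ascale A c x)" if "x' \<in> coset A J x" for x'
    using that assms ideal_scale
    by (subst coset_eq_iff) (auto simp: in_coset_iff scale_minus[symmetric])
  hence "(\<Union>x'\<in>coset A J x. coset A J (ascale A c x')) = coset A J (ascale A c x)"
    by (intro UN_eq_const[OF in_own_coset] assms)
  thus ?thesis by (simp add: quotient_algebra_def)
qed

lemma star_quotient: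
  assumes "x \<in> carrier A"
  shows "astar Q (coset A J x) = coset A J (astar A x)"
proof -
  have "coset A J (astar A x') = coset A J (astar A x)" if "x' \<in> coset A J x" for x'
    using that assms ideal_star
    by (subst coset_eq_iff) (auto simp: in_coset_iff star_minus[symmetric])
  hence "(\<Union>x'\<in>coset A J x. coset A J (astar A x')) = coset A J (astar A x)"
    by (intro UN_eq_const[OF in_own_coset] assms)
  thus ?thesis by (simp add: quotient_algebra_def)
qed

lemma times_quotient:
  assumes "x \<in> carrier A" "y \<in> carrier A"
  shows "coset A J x \<boxtimes>\<^bsub>Q\<^esub> coset A J y = coset A J (x \<boxtimes> y)"
proof -
  have "coset A J (x' \<boxtimes> y') = coset A J (x \<boxtimes> y)" if "x' \<in> coset A J x" "y' \<in> coset A J y" for x' y'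
    using that assms
    by (subst coset_eq_iff) (auto simp: in_coset_iff times_minus_times intro: ideal_add ideal_times times_ideal)
  hence "(\<Union>x'\<in>coset A J x. \<Union>y'\<in>coset A J y. coset A J (x' \<boxtimes> y')) = coset A J (x \<boxtimes> y)"
    by (intro UN_eq_const[OF in_own_coset] assms)
  thus ?thesis by (simp add: quotient_algebra_def)
qed

end

section \<open>Cauchy sequences and null sequences\<close>

context star_alg
begin

lemma in_cauchy_carrier:
  "X \<in> carrier (cauchy_algebra A) \<longleftrightarrow> (\<forall>n. X n \<in> carrier A)
     \<and> (\<forall>\<epsilon>>0. \<exists>N. \<forall>m\<ge>N. \<forall>n\<ge>N. anorm A (X m \<boxminus> X n) < \<epsilon>)"
  by (auto simp: cauchy_algebra_def)

lemma cauchy_pointwise: "X \<in> carrier (cauchy_algebra A) \<Longrightarrow> X n \<in> carrier A"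
  by (simp add: in_cauchy_carrier)

lemma const_cauchy: "x \<in> carrier A \<Longrightarrow> (\<lambda>n. x) \<in> carrier (cauchy_algebra A)"
  by (auto simp: in_cauchy_carrier)

lemma cauchy_sel [simp]:
  "azero (cauchy_algebra A) = (\<lambda>n. azero A)"
  "aplus (cauchy_algebra A) X Y = (\<lambda>n. X n \<boxplus> Y n)"
  "ascale (cauchy_algebra A) c X = (\<lambda>n. ascale A c (X n))"
  "atimes (cauchy_algebra A) X Y = (\<lambda>n. X n \<boxtimes> Y n)"
  "astar (cauchy_algebra A) X = (\<lambda>n. astar A (X n))"
  "aminus (cauchy_algebra A) X Y = (\<lambda>n. X n \<boxminus> Y n)"
  by (auto simp: cauchy_algebra_def aminus_def)

lemma cauchy_norm: "anorm (cauchy_algebra A) X = lim (\<lambda>n. anorm A (X n))"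
  by (simp add: cauchy_algebra_def)

lemma cauchy_norm_tendsto:
  assumes "X \<in> carrier (cauchy_algebra A)"
  shows "(\<lambda>n. anorm A (X n)) \<longlonglongrightarrow> anorm (cauchy_algebra A) X"
proof -
  have "Cauchy (\<lambda>n. anorm A (X n))"
    unfolding Cauchy_def dist_real_def
    using assms norm_reverse_triangle by (meson in_cauchy_carrier order_le_less_trans)
  hence "convergent (\<lambda>n. anorm A (X n))" by (rule Cauchy_convergent)
  thus ?thesis by (simp add: convergent_LIMSEQ_iff cauchy_norm)
qed

lemma cauchy_norm_bounded:
  assumes "X \<in> carrier (cauchy_algebra A)"
  obtains B where "B > 0" "\<And>n. anorm A (X n) \<le> B"
proof -
  have "convergent (\<lambda>n. anorm A (X n))" using cauchy_norm_tendsto[OF assms] convergentI by blast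
  hence "Bseq (\<lambda>n. anorm A (X n))" by (rule convergent_imp_Bseq)
  then obtain K where "K > 0" "\<And>n. norm (anorm A (X n)) \<le> K" by (auto elim: BseqE)
  thus ?thesis using that[of K] by (auto simp: abs_le_iff)
qed

text \<open>Each pointwise operation has increments dominated by those of its arguments, with a
  constant that may depend on bounds for the sequences. All closure properties follow from this one
  estimate.\<close>

lemma cauchy_closed_by_bound:
  assumes "\<And>n. Z n \<in> carrier A" "X \<in> carrier (cauchy_algebra A)" "Y \<in> carrier (cauchy_algebra A)" "B > 0"
    and "\<And>m n. anorm A (Z m \<boxminus> Z n) \<le> B * (anorm A (X m \<boxminus> X n) + anorm A (Y m \<boxminus> Y n))"
  shows "Z \<in> carrier (cauchy_algebra A)"
  unfolding in_cauchy_carrier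
proof (intro conjI allI impI assms(1))
  fix \<epsilon> :: real assume "\<epsilon> > 0"
  hence "\<epsilon> / (2 * B) > 0" using assms(4) by simp
  then obtain N M where "\<And>m n. m \<ge> N \<Longrightarrow> n \<ge> N \<Longrightarrow> anorm A (X m \<boxminus> X n) < \<epsilon> / (2 * B)"
     "\<And>m n. m \<ge> M \<Longrightarrow> n \<ge> M \<Longrightarrow> anorm A (Y m \<boxminus> Y n) < \<epsilon> / (2 * B)"
    using assms(2,3) unfolding in_cauchy_carrier by meson
  hence "B * (anorm A (X m \<boxminus> X n) + anorm A (Y m \<boxminus> Y n)) < B * (\<epsilon> / (2 * B) + \<epsilon> / (2 * B))"
    if "m \<ge> max N M" "n \<ge> max N M" for m n
    using that assms(4) by (intro mult_strict_left_mono add_strict_mono) auto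
  moreover have "B * (\<epsilon> / (2 * B) + \<epsilon> / (2 * B)) = \<epsilon>" using assms(4) by (simp add: field_simps)
  ultimately show "\<exists>N. \<forall>m\<ge>N. \<forall>n\<ge>N. anorm A (Z m \<boxminus> Z n) < \<epsilon>"
    using assms(5) by (metis order_le_less_trans)
qed

lemma cauchy_times_closed:
  assumes "X \<in> carrier (cauchy_algebra A)" "Y \<in> carrier (cauchy_algebra A)"
  shows "(\<lambda>n. X n \<boxtimes> Y n) \<in> carrier (cauchy_algebra A)"
proof -
  obtain B where B: "B > 0" "\<And>n. anorm A (X n) \<le> B" using cauchy_norm_bounded[OF assms(1)] by blast
  obtain C where C: "C > 0" "\<And>n. anorm A (Y n) \<le> C" using cauchy_norm_bounded[OF assms(2)] by blast
  note p = cauchy_pointwise[OF assms(1)] cauchy_pointwise[OF assms(2)]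
  have "anorm A (X m \<boxtimes> Y m \<boxminus> X n \<boxtimes> Y n) \<le> max B C * (anorm A (X m \<boxminus> X n) + anorm A (Y m \<boxminus> Y n))" for m n
  proof -
    have "anorm A (X m \<boxtimes> Y m \<boxminus> X n \<boxtimes> Y n)
        \<le> anorm A (X m \<boxminus> X n) * anorm A (Y m) + anorm A (X n) * anorm A (Y m \<boxminus> Y n)"
      using p by (intro norm_times_minus_times) auto
    also have "\<dots> \<le> anorm A (X m \<boxminus> X n) * max B C + max B C * anorm A (Y m \<boxminus> Y n)"
      using p B(2)[of n] C(2)[of m] by (intro add_mono mult_left_mono mult_right_mono) (simp_all add: le_max_iff_disj)
    also have "\<dots> = max B C * (anorm A (X m \<boxminus> X n) + anorm A (Y m \<boxminus> Y n))"
      by algebra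
    finally show ?thesis .
  qed
  moreover have "max B C > 0" using B(1) by simp
  ultimately show ?thesis using assms p by - (rule cauchy_closed_by_bound[of _ X Y "max B C"], auto)
qed

lemma cauchy_add_closed:
  assumes "X \<in> carrier (cauchy_algebra A)" "Y \<in> carrier (cauchy_algebra A)"
  shows "(\<lambda>n. X n \<boxplus> Y n) \<in> carrier (cauchy_algebra A)"
  using assms cauchy_pointwise[OF assms(1)] cauchy_pointwise[OF assms(2)]
  by - (rule cauchy_closed_by_bound[of _ X Y 1], auto simp: add_minus_add intro: norm_triangle)

lemma cauchy_scale_closed:
  assumes "X \<in> carrier (cauchy_algebra A)"
  shows "(\<lambda>n. ascale A c (X n)) \<in> carrier (cauchy_algebra A)"
proof -
  note p = cauchy_pointwise[OF assms(1)]
  have "anorm A (ascale A c (X m) \<boxminus> ascale A c (X n))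
      \<le> (cmod c + 1) * (anorm A (X m \<boxminus> X n) + anorm A (X m \<boxminus> X n))" for m n
  proof -
    have "cmod c * anorm A (X m \<boxminus> X n) \<le> (cmod c + 1) * (anorm A (X m \<boxminus> X n) + anorm A (X m \<boxminus> X n))"
      using p by (intro mult_mono) auto
    thus ?thesis using p by (simp add: scale_minus[symmetric] norm_scale)
  qed
  thus ?thesis using assms p
    by - (rule cauchy_closed_by_bound[of _ X X "cmod c + 1"], auto intro: add_nonneg_pos)
qed

lemma cauchy_star_closed:
  assumes "X \<in> carrier (cauchy_algebra A)"
  shows "(\<lambda>n. astar A (X n)) \<in> carrier (cauchy_algebra A)"
  using assms cauchy_pointwise[OF assms(1)]
  by - (rule cauchy_closed_by_bound[of _ X X 1], auto simp: star_minus[symmetric])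

lemma zero_cauchy: "(\<lambda>n. azero A) \<in> carrier (cauchy_algebra A)"
  by (simp add: const_cauchy)

lemma cauchy_norm_triangle:
  assumes "X \<in> carrier (cauchy_algebra A)" "Y \<in> carrier (cauchy_algebra A)"
  shows "anorm (cauchy_algebra A) (\<lambda>n. X n \<boxplus> Y n) \<le> anorm (cauchy_algebra A) X + anorm (cauchy_algebra A) Y"
  using assms cauchy_pointwise
  by (intro LIMSEQ_le[OF cauchy_norm_tendsto[OF cauchy_add_closed[OF assms]]
        tendsto_add[OF cauchy_norm_tendsto[OF assms(1)] cauchy_norm_tendsto[OF assms(2)]]])
    (auto intro: norm_triangle)

lemma cauchy_norm_times:
  assumes "X \<in> carrier (cauchy_algebra A)" "Y \<in> carrier (cauchy_algebra A)"
  shows "anorm (cauchy_algebra A) (\<lambda>n. X n \<boxtimes> Y n) \<le> anorm (cauchy_algebra A) X * anorm (cauchy_algebra A) Y"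
  using assms cauchy_pointwise
  by (intro LIMSEQ_le[OF cauchy_norm_tendsto[OF cauchy_times_closed[OF assms]]
        tendsto_mult[OF cauchy_norm_tendsto[OF assms(1)] cauchy_norm_tendsto[OF assms(2)]]])
    (auto intro: norm_times)

lemma cauchy_norm_scale:
  assumes "X \<in> carrier (cauchy_algebra A)"
  shows "anorm (cauchy_algebra A) (\<lambda>n. ascale A c (X n)) = cmod c * anorm (cauchy_algebra A) X"
proof -
  have "(\<lambda>n. anorm A (ascale A c (X n))) \<longlonglongrightarrow> cmod c * anorm (cauchy_algebra A) X"
    using tendsto_mult_left[OF cauchy_norm_tendsto[OF assms], of "cmod c"] cauchy_pointwise[OF assms]
    by (simp add: norm_scale)
  thus ?thesis using cauchy_norm_tendsto[OF cauchy_scale_closed[OF assms], of c] LIMSEQ_unique by blast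
qed

lemma cauchy_norm_star:
  "X \<in> carrier (cauchy_algebra A) \<Longrightarrow>
   anorm (cauchy_algebra A) (\<lambda>n. astar A (X n)) = anorm (cauchy_algebra A) X"
  by (simp add: cauchy_norm cauchy_pointwise)

lemma cauchy_star_alg: "star_alg (cauchy_algebra A)"
proof (unfold_locales, unfold cauchy_sel, goal_cases)
  \<comment> \<open>Goals 23 to 26 are the norm axioms, which need limits; goal 7 is commutativity,
    kept apart from the rewriting that settles the rest.\<close>
  case (23 X Y) thus ?case by (rule cauchy_norm_triangle)
next
  case (25 X Y) thus ?case by (rule cauchy_norm_times)
next
  case (24 X c) thus ?case by (rule cauchy_norm_scale)
next
  case (26 X) thus ?case by (rule cauchy_norm_star)
next
  case (7 X Y) thus ?case by (intro ext add_commute cauchy_pointwise)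
qed (simp_all add: cauchy_pointwise zero_cauchy cauchy_add_closed cauchy_scale_closed cauchy_times_closed
      cauchy_star_closed add_assoc scale_add add_scale scale_scale times_assoc times_add add_times
      scale_times times_scale star_add star_scale star_times)

text \<open>The limit seminorm exists for every Cauchy sequence, so being null means that it
  vanishes. The ideal axioms then become inequalities between limits.\<close>

lemma in_null_sequences:
  "X \<in> null_sequences A \<longleftrightarrow> X \<in> carrier (cauchy_algebra A) \<and> anorm (cauchy_algebra A) X = 0"
  unfolding null_sequences_def using cauchy_norm_tendsto[of X] LIMSEQ_unique[of "\<lambda>n. anorm A (X n)"] by auto

lemma null_star_ideal: "star_ideal (cauchy_algebra A) (null_sequences A)"
proof -
  interpret C: star_alg "cauchy_algebra A" by (rule cauchy_star_alg)
  have sq: "anorm (cauchy_algebra A) Z = 0"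
    if "Z \<in> carrier (cauchy_algebra A)" "anorm (cauchy_algebra A) Z \<le> 0" for Z
    using that C.norm_nonneg by fastforce
  show ?thesis
  proof (unfold_locales, goal_cases)
    case 1 thus ?case unfolding in_null_sequences subset_iff by simp
  next
    case 2 thus ?case unfolding in_null_sequences using C.norm_zero by blast
  next
    case (3 X Y)
    thus ?case using C.norm_triangle[of X Y] unfolding in_null_sequences
      by (intro conjI C.add_closed sq) auto
  next
    case (4 X c) thus ?case unfolding in_null_sequences by (metis C.norm_scale C.scale_closed mult_zero_right)
  next
    case (5 X Y)
    thus ?case using C.norm_times[of X Y] unfolding in_null_sequences
      by (intro conjI C.times_closed sq) auto
  next
    case (6 X Y)
    thus ?case using C.norm_times[of X Y] unfolding in_null_sequences
      by (intro conjI C.times_closed sq) auto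
  next
    case (7 X) thus ?case unfolding in_null_sequences by (metis C.norm_star C.star_closed)
  qed
qed

end

section \<open>The completion\<close>

context star_alg
begin

interpretation C: star_ideal "cauchy_algebra A" "null_sequences A"
  by (rule null_star_ideal)

abbreviation "cls \<equiv> coset (cauchy_algebra A) (null_sequences A)"
abbreviation "cauchy_seqs \<equiv> carrier (cauchy_algebra A)"
abbreviation "emb \<equiv> completion_embed A"

lemma carrier_completion: "carrier (completion A) = cls ` cauchy_seqs"
  unfolding completion_def by (rule C.carrier_quotient)

lemma carrier_completionE:
  assumes "x \<in> carrier (completion A)"
  obtains X where "X \<in> cauchy_seqs" "x = cls X"
  using assms by (auto simp: carrier_completion)

lemma cls_in_completion [simp, intro]: "X \<in> cauchy_seqs \<Longrightarrow> cls X \<in> carrier (completion A)"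
  by (auto simp: carrier_completion)

lemma zero_completion: "azero (completion A) = cls (\<lambda>n. azero A)"
  unfolding completion_def C.zero_quotient by simp

lemma add_completion:
  "X \<in> cauchy_seqs \<Longrightarrow> Y \<in> cauchy_seqs \<Longrightarrow> cls X \<boxplus>\<^bsub>completion A\<^esub> cls Y = cls (\<lambda>n. X n \<boxplus> Y n)"
  unfolding completion_def by (simp add: C.add_quotient)

lemma scale_completion:
  "X \<in> cauchy_seqs \<Longrightarrow> ascale (completion A) c (cls X) = cls (\<lambda>n. ascale A c (X n))"
  unfolding completion_def by (simp add: C.scale_quotient)

lemma times_completion:
  "X \<in> cauchy_seqs \<Longrightarrow> Y \<in> cauchy_seqs \<Longrightarrow> cls X \<boxtimes>\<^bsub>completion A\<^esub> cls Y = cls (\<lambda>n. X n \<boxtimes> Y n)"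
  unfolding completion_def by (simp add: C.times_quotient)

lemma star_completion:
  "X \<in> cauchy_seqs \<Longrightarrow> astar (completion A) (cls X) = cls (\<lambda>n. astar A (X n))"
  unfolding completion_def by (simp add: C.star_quotient)

text \<open>Members of a coset differ by null sequences and so have equal limit seminorms; the
  infimum defining the quotient norm is over a single value.\<close>

lemma norm_completion:
  assumes "X \<in> cauchy_seqs"
  shows "anorm (completion A) (cls X) = anorm (cauchy_algebra A) X"
proof -
  have "anorm (cauchy_algebra A) Y = anorm (cauchy_algebra A) X" if "Y \<in> cls X" for Y
  proof -
    have "Y \<in> cauchy_seqs" "Y \<boxminus>\<^bsub>cauchy_algebra A\<^esub> X \<in> null_sequences A"
      using that assms C.in_coset_iff by auto
    thus ?thesis using C.norm_reverse_triangle[of Y X] assms unfolding in_null_sequences by auto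
  qed
  hence "anorm (cauchy_algebra A) ` cls X = {anorm (cauchy_algebra A) X}"
    using C.in_own_coset[OF assms] by blast
  thus ?thesis unfolding completion_def C.norm_quotient by simp
qed

lemma norm_completion_tendsto:
  "X \<in> cauchy_seqs \<Longrightarrow> (\<lambda>n. anorm A (X n)) \<longlonglongrightarrow> anorm (completion A) (cls X)"
  using cauchy_norm_tendsto norm_completion by simp

text \<open>Every element is \<open>cls X\<close> and every operation is computed on
  representatives, so identities hold pointwise and the norm axioms are those of the Cauchy
  algebra.\<close>

lemma completion_star_alg: "star_alg (completion A)"
  by (unfold_locales; (elim carrier_completionE)?; hypsubst?)
    (simp_all only: zero_completion add_completion scale_completion times_completion star_completion
      norm_completion cauchy_add_closed cauchy_scale_closed cauchy_times_closed zero_cauchy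
      cauchy_star_closed cls_in_completion cauchy_norm_scale cauchy_norm_star
      cauchy_norm_triangle cauchy_norm_times,
     (rule arg_cong[where f=cls], rule ext,
      (rule add_commute; simp only: cauchy_pointwise) | use cauchy_pointwise in \<open>simp add: 
      add_assoc scale_add add_scale scale_scale times_assoc times_add add_times
      scale_times times_scale star_add star_scale star_times\<close>)+)

text \<open>The distance from the class of X to its n-th term is the limit over m of the distances
  between X m and X n, which are uniformly small for large n.\<close>

lemma norm_cls_minus_emb:
  assumes "X \<in> cauchy_seqs"
  shows "(\<lambda>n. anorm (completion A) (cls X \<boxminus>\<^bsub>completion A\<^esub> emb (X n))) \<longlonglongrightarrow> 0"
proof (rule LIMSEQ_I)
  fix \<epsilon> :: real assume "\<epsilon> > 0"
  then obtain N where N: "\<And>m n. m \<ge> N \<Longrightarrow> n \<ge> N \<Longrightarrow> anorm A (X m \<boxminus> X n) < \<epsilon> / 2"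
    using assms unfolding in_cauchy_carrier by (meson half_gt_zero)
  have "anorm (completion A) (cls X \<boxminus>\<^bsub>completion A\<^esub> emb (X n)) < \<epsilon>" if "n \<ge> N" for n
  proof -
    let ?Z = "\<lambda>m. X m \<boxminus> X n"
    have c: "(\<lambda>m. X n) \<in> cauchy_seqs" "?Z \<in> cauchy_seqs"
      using const_cauchy cauchy_pointwise[OF assms] assms
      unfolding aminus_def by (auto intro!: cauchy_add_closed cauchy_scale_closed const_cauchy)
    have "cls X \<boxminus>\<^bsub>completion A\<^esub> emb (X n) = cls ?Z"
      unfolding completion_embed_def aminus_def using c assms cauchy_scale_closed[OF c(1)]
      by (simp add: scale_completion add_completion)
    moreover have "anorm (completion A) (cls ?Z) \<le> \<epsilon> / 2"
      using N that by (intro LIMSEQ_le_const2[OF norm_completion_tendsto[OF c(2)]]) (auto intro!: exI[of _ N] less_imp_le)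
    ultimately show ?thesis using \<open>\<epsilon> > 0\<close> by simp
  qed
  moreover have "emb (X n) \<in> carrier (completion A)" for n
    unfolding completion_embed_def using const_cauchy cauchy_pointwise[OF assms] by auto
  ultimately show "\<exists>N. \<forall>n\<ge>N. norm (anorm (completion A) (cls X \<boxminus>\<^bsub>completion A\<^esub> emb (X n)) - 0) < \<epsilon>"
    using assms star_alg.norm_nonneg[OF completion_star_alg] star_alg.minus_closed[OF completion_star_alg]
    by (auto simp: abs_of_nonneg)
qed

lemma emb_closed [simp, intro]: "x \<in> carrier A \<Longrightarrow> emb x \<in> carrier (completion A)"
  and emb_zero: "emb (azero A) = azero (completion A)"
  and emb_add: "x \<in> carrier A \<Longrightarrow> y \<in> carrier A \<Longrightarrow> emb (x \<boxplus> y) = emb x \<boxplus>\<^bsub>completion A\<^esub> emb y"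
  and emb_scale: "x \<in> carrier A \<Longrightarrow> emb (ascale A c x) = ascale (completion A) c (emb x)"
  and emb_times: "x \<in> carrier A \<Longrightarrow> y \<in> carrier A \<Longrightarrow> emb (x \<boxtimes> y) = emb x \<boxtimes>\<^bsub>completion A\<^esub> emb y"
  and emb_star: "x \<in> carrier A \<Longrightarrow> emb (astar A x) = astar (completion A) (emb x)"
  by (simp_all add: completion_embed_def const_cauchy zero_completion add_completion scale_completion
      times_completion star_completion)

lemma norm_emb: "x \<in> carrier A \<Longrightarrow> anorm (completion A) (emb x) = anorm A x"
  unfolding completion_embed_def using norm_completion_tendsto[OF const_cauchy] LIMSEQ_unique tendsto_const by blast

lemma emb_minus:
  "x \<in> carrier A \<Longrightarrow> y \<in> carrier A \<Longrightarrow> emb (x \<boxminus> y) = emb x \<boxminus>\<^bsub>completion A\<^esub> emb y"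
  by (simp add: aminus_def emb_add emb_scale)

lemma cls_eq_iff:
  assumes "X \<in> cauchy_seqs" "Y \<in> cauchy_seqs"
  shows "cls X = cls Y \<longleftrightarrow> (\<lambda>n. anorm A (X n \<boxminus> Y n)) \<longlonglongrightarrow> 0"
proof -
  have "(\<lambda>n. X n \<boxminus> Y n) \<in> cauchy_seqs"
    using assms unfolding aminus_def by (intro cauchy_add_closed cauchy_scale_closed)
  thus ?thesis unfolding C.coset_eq_iff[OF assms] by (simp add: null_sequences_def)
qed

lemma emb_eq_iff: "x \<in> carrier A \<Longrightarrow> y \<in> carrier A \<Longrightarrow> emb x = emb y \<longleftrightarrow> anorm A (x \<boxminus> y) = 0"
  unfolding completion_embed_def by (subst cls_eq_iff) (auto simp: const_cauchy LIMSEQ_const_iff)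

lemma asum_emb:
  assumes "finite I" "\<And>i. i \<in> I \<Longrightarrow> f i \<in> carrier A"
  shows "asum (completion A) (\<lambda>i. emb (f i)) I = emb (asum A f I) \<and> asum A f I \<in> carrier A"
  using assms
proof (induction I)
  case empty
  interpret K: star_alg "completion A" by (rule completion_star_alg)
  show ?case by (simp add: emb_zero)
next
  case (insert i I)
  interpret K: star_alg "completion A" by (rule completion_star_alg)
  have "(\<lambda>i. emb (f i)) ` I \<subseteq> carrier (completion A)" "f ` I \<subseteq> carrier A" using insert by auto
  thus ?case using insert by (simp add: asum_insert K.asum_insert emb_add)
qed

end

section \<open>Positive functionals, states and their extension to the completion\<close>

lemma quadratic_nonneg_imp:
  fixes a b c :: real
  assumes "\<And>t. 0 \<le> a - 2 * t * c + t\<^sup>2 * c * b" "0 \<le> b" "0 \<le> c"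
  shows "c \<le> a * b"
proof (cases "b = 0")
  case True
  have "c = 0"
  proof (rule ccontr)
    assume "c \<noteq> 0"
    hence "c > 0" using assms(3) by simp
    \<comment> \<open>This value of t makes the right-hand side equal to -1.\<close>
    have "0 \<le> a - 2 * ((a + 1) / (2 * c)) * c" using assms(1)[of "(a + 1) / (2 * c)"] True by simp
    thus False using \<open>c > 0\<close> by (simp add: field_simps)
  qed
  thus ?thesis using True by simp
next
  case False
  hence "b > 0" using assms(2) by simp
  \<comment> \<open>The quadratic is smallest at t = 1 / b.\<close>
  have "0 \<le> a - 2 * (1 / b) * c + (1 / b)\<^sup>2 * c * b" by (rule assms(1))
  also have "\<dots> = a - c / b" using \<open>b > 0\<close> by (simp add: power2_eq_square field_simps)
  finally show ?thesis using \<open>b > 0\<close> by (simp add: field_simps)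
qed

definition linear_functional :: "'a star_algebra \<Rightarrow> ('a \<Rightarrow> complex) \<Rightarrow> bool" where
  "linear_functional A \<phi> \<longleftrightarrow>
     (\<forall>x \<in> carrier A. \<forall>y \<in> carrier A. \<phi> (x \<boxplus>\<^bsub>A\<^esub> y) = \<phi> x + \<phi> y)
   \<and> (\<forall>c. \<forall>x \<in> carrier A. \<phi> (ascale A c x) = c * \<phi> x)"

definition contractive_functional :: "'a star_algebra \<Rightarrow> ('a \<Rightarrow> complex) \<Rightarrow> bool" where
  "contractive_functional A \<phi> \<longleftrightarrow> linear_functional A \<phi> \<and> (\<forall>x \<in> carrier A. cmod (\<phi> x) \<le> anorm A x)"

definition positive_functional :: "'a star_algebra \<Rightarrow> ('a \<Rightarrow> complex) \<Rightarrow> bool" where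
  "positive_functional A \<phi> \<longleftrightarrow> linear_functional A \<phi> \<and> (\<forall>x \<in> carrier A. \<phi> (astar A x \<boxtimes>\<^bsub>A\<^esub> x) \<in> \<real>\<^sub>\<ge>\<^sub>0)"

text \<open>The bound on the norm puts e into the unit ball, so a functional with value 1 at e has
  norm at least 1.\<close>

definition unit_of :: "'a star_algebra \<Rightarrow> 'a \<Rightarrow> bool" where
  "unit_of A e \<longleftrightarrow> e \<in> carrier A \<and> astar A e = e \<and> anorm A e \<le> 1
     \<and> (\<forall>x \<in> carrier A. e \<boxtimes>\<^bsub>A\<^esub> x = x \<and> x \<boxtimes>\<^bsub>A\<^esub> e = x)"

context star_alg
begin

lemma linear_functional_minus:
  "linear_functional A \<phi> \<Longrightarrow> x \<in> carrier A \<Longrightarrow> y \<in> carrier A \<Longrightarrow> \<phi> (x \<boxminus> y) = \<phi> x - \<phi> y"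
  unfolding linear_functional_def aminus_def by simp

lemma linear_functional_zero: "linear_functional A \<phi> \<Longrightarrow> \<phi> (azero A) = 0"
  using linear_functional_minus[of \<phi> "azero A" "azero A"] by simp

text \<open>Positivity is evaluated at x + c e. The choices c = 1 and c = \<i> give compatibility
  with the adjoint, and c = -t \<open>\<phi> x\<close> with real t gives the Cauchy-Schwarz
  inequality.\<close>

lemma positive_functional_expand:
  assumes "positive_functional A \<phi>" "unit_of A e" "x \<in> carrier A"
  shows "\<phi> (astar A x \<boxtimes> x) + c * \<phi> (astar A x) + cnj c * \<phi> x + c * cnj c * \<phi> e \<in> \<real>\<^sub>\<ge>\<^sub>0"
proof -
  have e: "e \<in> carrier A" "astar A e = e" "e \<boxtimes> e = e" "\<And>x. x \<in> carrier A \<Longrightarrow> e \<boxtimes> x = x" "\<And>x. x \<in> carrier A \<Longrightarrow> x \<boxtimes> e = x"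
    using assms(2) by (auto simp: unit_of_def)
  have lin: "\<And>x y. x \<in> carrier A \<Longrightarrow> y \<in> carrier A \<Longrightarrow> \<phi> (x \<boxplus> y) = \<phi> x + \<phi> y"
    "\<And>c x. x \<in> carrier A \<Longrightarrow> \<phi> (ascale A c x) = c * \<phi> x"
    using assms(1) by (auto simp: positive_functional_def linear_functional_def)
  have "\<phi> (astar A (x \<boxplus> ascale A c e) \<boxtimes> (x \<boxplus> ascale A c e))
     = \<phi> (astar A x \<boxtimes> x) + c * \<phi> (astar A x) + cnj c * \<phi> x + c * cnj c * \<phi> e"
    using e assms(3)
    by (simp add: star_add star_scale times_add add_times scale_times times_scale scale_add scale_scale lin algebra_simps)
  moreover have "x \<boxplus> ascale A c e \<in> carrier A" using e assms(3) by simp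
  ultimately show ?thesis using assms(1) unfolding positive_functional_def by metis
qed

lemma positive_functional_star:
  assumes "positive_functional A \<phi>" "unit_of A e" "x \<in> carrier A"
  shows "\<phi> (astar A x) = cnj (\<phi> x)"
proof -
  have e: "e \<in> carrier A" "astar A e \<boxtimes> e = e" using assms(2) by (auto simp: unit_of_def)
  have "Im (\<phi> (astar A x \<boxtimes> x)) = 0" "Im (\<phi> e) = 0"
    using assms e unfolding positive_functional_def by (auto simp: complex_nonneg_Reals_iff dest!: bspec[of _ _ x] bspec[of _ _ e])
  thus ?thesis
    using positive_functional_expand[OF assms, of 1] positive_functional_expand[OF assms, of \<i>]
    by (auto simp: complex_nonneg_Reals_iff complex_eq_iff)
qed

lemma positive_functional_Cauchy_Schwarz:
  assumes "positive_functional A \<phi>" "unit_of A e" "x \<in> carrier A"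
  shows "(cmod (\<phi> x))\<^sup>2 \<le> Re (\<phi> (astar A x \<boxtimes> x)) * Re (\<phi> e)"
proof (rule quadratic_nonneg_imp)
  have e: "e \<in> carrier A" "astar A e \<boxtimes> e = e" using assms(2) by (auto simp: unit_of_def)
  show "0 \<le> Re (\<phi> e)" "0 \<le> (cmod (\<phi> x))\<^sup>2"
    using assms e unfolding positive_functional_def by (auto simp: complex_nonneg_Reals_iff dest!: bspec[of _ _ e])
  fix t :: real
  have "Re (\<phi> (astar A x \<boxtimes> x) + (- of_real t * \<phi> x) * \<phi> (astar A x) + cnj (- of_real t * \<phi> x) * \<phi> x
      + (- of_real t * \<phi> x) * cnj (- of_real t * \<phi> x) * \<phi> e) \<ge> 0"
    using positive_functional_expand[OF assms, of "- of_real t * \<phi> x"] by (simp add: complex_nonneg_Reals_iff)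
  also have "\<phi> (astar A x \<boxtimes> x) + (- of_real t * \<phi> x) * \<phi> (astar A x) + cnj (- of_real t * \<phi> x) * \<phi> x
      + (- of_real t * \<phi> x) * cnj (- of_real t * \<phi> x) * \<phi> e
      = \<phi> (astar A x \<boxtimes> x) - 2 * of_real t * (\<phi> x * cnj (\<phi> x)) + of_real (t^2) * (\<phi> x * cnj (\<phi> x)) * \<phi> e"
    by (simp add: positive_functional_star[OF assms] algebra_simps power2_eq_square)
  also have "\<phi> x * cnj (\<phi> x) = of_real ((cmod (\<phi> x))\<^sup>2)" by (rule complex_norm_square[symmetric])
  finally show "0 \<le> Re (\<phi> (astar A x \<boxtimes> x)) - 2 * t * (cmod (\<phi> x))\<^sup>2 + t\<^sup>2 * (cmod (\<phi> x))\<^sup>2 * Re (\<phi> e)"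
    by (simp add: algebra_simps)
qed

text \<open>The norm condition amounts to value 1 at the unit. On the unit ball Cauchy-Schwarz
  bounds the square of the modulus of \<open>\<phi> x\<close> by \<open>\<phi> e\<close>, so a
  supremum equal to 1 forces \<open>\<phi> e\<close> to be at least 1, and e lies in the ball
  itself.\<close>

lemma is_state_iff:
  assumes e: "unit_of A e"
  shows "is_state A \<phi> \<longleftrightarrow> (\<forall>x. x \<notin> carrier A \<longrightarrow> \<phi> x = 0) \<and> positive_functional A \<phi>
           \<and> contractive_functional A \<phi> \<and> \<phi> e = 1"
    (is "_ \<longleftrightarrow> ?R")
proof
  have ec: "e \<in> carrier A" "anorm A e \<le> 1" "astar A e \<boxtimes> e = e" using e by (auto simp: unit_of_def)
  {
    assume s: "is_state A \<phi>"
    let ?S = "{cmod (\<phi> x) |x. x \<in> carrier A \<and> anorm A x \<le> 1}"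
    have lin: "linear_functional A \<phi>" and pos: "positive_functional A \<phi>"
      and bdd: "bdd_above ?S" and sup: "Sup ?S = 1"
      using s by (auto simp: is_state_def linear_functional_def positive_functional_def)
    have sc: "\<And>c x. x \<in> carrier A \<Longrightarrow> \<phi> (ascale A c x) = c * \<phi> x" using lin by (simp add: linear_functional_def)
    have le1: "cmod (\<phi> x) \<le> 1" if "x \<in> carrier A" "anorm A x \<le> 1" for x
      using cSup_upper[OF _ bdd] that sup by auto
    have bound: "cmod (\<phi> x) \<le> anorm A x" if x: "x \<in> carrier A" for x
    proof (rule field_le_epsilon)
      fix d :: real assume "d > 0"
      \<comment> \<open>Adding d > 0 allows an x of seminorm zero to be normalised.\<close>
      let ?c = "inverse (anorm A x + d)"
      have p: "anorm A x + d > 0" using x \<open>d > 0\<close> by (simp add: add_nonneg_pos)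
      hence c: "cmod (complex_of_real ?c) = ?c" by (simp only: norm_of_real) simp
      have "anorm A (ascale A (of_real ?c) x) = ?c * anorm A x"
        using x by (simp only: norm_scale c)
      also have "\<dots> \<le> 1" using p \<open>d > 0\<close> by (simp add: field_simps)
      finally have "cmod (\<phi> (ascale A (of_real ?c) x)) \<le> 1" using x by (intro le1) auto
      hence "?c * cmod (\<phi> x) \<le> 1" using x by (simp only: sc norm_mult c)
      thus "cmod (\<phi> x) \<le> anorm A x + d" using p by (simp add: field_simps)
    qed
    have fe: "\<phi> e \<in> \<real>\<^sub>\<ge>\<^sub>0" using pos ec by (metis positive_functional_def)
    have "(cmod (\<phi> x))\<^sup>2 \<le> Re (\<phi> e)" if x: "x \<in> carrier A" "anorm A x \<le> 1" for x
    proof -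
      have "anorm A (astar A x \<boxtimes> x) \<le> 1"
        using norm_times[of "astar A x" x] x mult_le_one[of "anorm A x" "anorm A x"] by simp
      hence "Re (\<phi> (astar A x \<boxtimes> x)) \<le> 1"
        using le1[of "astar A x \<boxtimes> x"] complex_Re_le_cmod[of "\<phi> (astar A x \<boxtimes> x)"] x by simp
      hence "Re (\<phi> (astar A x \<boxtimes> x)) * Re (\<phi> e) \<le> Re (\<phi> e)"
        using fe mult_right_mono[of "Re (\<phi> (astar A x \<boxtimes> x))" 1 "Re (\<phi> e)"] by (simp add: complex_nonneg_Reals_iff)
      thus ?thesis using positive_functional_Cauchy_Schwarz[OF pos e x(1)] by simp
    qed
    hence "cmod (\<phi> x) \<le> sqrt (Re (\<phi> e))" if "x \<in> carrier A" "anorm A x \<le> 1" for x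
      using that real_le_rsqrt by blast
    hence "Sup ?S \<le> sqrt (Re (\<phi> e))" using ec by (intro cSup_least) auto
    hence "Re (\<phi> e) \<ge> 1" using sup by simp
    moreover have "cmod (\<phi> e) \<le> 1" using ec by (intro le1) auto
    ultimately have "\<phi> e = 1" using fe complex_Re_le_cmod[of "\<phi> e"]
      by (auto simp: complex_nonneg_Reals_iff complex_eq_iff)
    thus ?R using s lin pos bound by (auto simp: is_state_def contractive_functional_def)
  }
  {
    assume r: ?R
    have b: "cmod (\<phi> x) \<le> 1" if "x \<in> carrier A" "anorm A x \<le> 1" for x
      using r that unfolding contractive_functional_def by force
    let ?S = "{cmod (\<phi> x) |x. x \<in> carrier A \<and> anorm A x \<le> 1}"
    have "cmod (\<phi> e) \<in> ?S" using ec by blast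
    moreover have "cmod (\<phi> e) = 1" using r by simp
    ultimately have m: "1 \<in> ?S" by (simp only:)
    have u: "y \<le> 1" if "y \<in> ?S" for y using that b by blast
    have "bdd_above ?S" by (rule bdd_aboveI[OF u])
    moreover have "Sup ?S = 1" by (rule cSup_eq_maximum[OF m u])
    ultimately show "is_state A \<phi>" using r
      unfolding is_state_def positive_functional_def linear_functional_def by blast
  }
qed

lemma emb_dense:
  assumes "x \<in> carrier (completion A)" "\<epsilon> > 0"
  obtains y where "y \<in> carrier A" "anorm (completion A) (x \<boxminus>\<^bsub>completion A\<^esub> emb y) < \<epsilon>"
proof -
  obtain X where X: "X \<in> cauchy_seqs" "x = cls X" using assms by (auto elim: carrier_completionE)
  obtain n where "norm (anorm (completion A) (cls X \<boxminus>\<^bsub>completion A\<^esub> emb (X n)) - 0) < \<epsilon>"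
    using LIMSEQ_D[OF norm_cls_minus_emb[OF X(1)] assms(2)] by blast
  hence "anorm (completion A) (x \<boxminus>\<^bsub>completion A\<^esub> emb (X n)) < \<epsilon>" using X(2) by simp
  thus ?thesis by (rule that[OF cauchy_pointwise[OF X(1)]])
qed

definition "representative x = (SOME X. X \<in> cauchy_seqs \<and> x = cls X)"

lemma representative:
  assumes "x \<in> carrier (completion A)"
  shows "representative x \<in> cauchy_seqs" "cls (representative x) = x"
  using someI_ex[of "\<lambda>X. X \<in> cauchy_seqs \<and> x = cls X"] assms
  unfolding representative_def by (auto simp: carrier_completion)

text \<open>The limit is taken along a chosen representative;
  \<open>completion_functional_tendsto\<close> shows that the choice is immaterial. Outside the
  carrier the value is 0, as \<open>is_state\<close> prescribes.\<close>

definition "completion_functional \<phi> x =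
  (if x \<in> carrier (completion A) then lim (\<lambda>n. \<phi> (representative x n)) else (0::complex))"

text \<open>A contractive functional sends Cauchy sequences to Cauchy sequences and null sequences
  to null sequences, so the chosen representative may be replaced by X.\<close>

lemma completion_functional_tendsto:
  assumes \<phi>: "contractive_functional A \<phi>" and X: "X \<in> cauchy_seqs"
  shows "(\<lambda>n. \<phi> (X n)) \<longlonglongrightarrow> completion_functional \<phi> (cls X)"
proof -
  let ?Y = "representative (cls X)"
  have Y: "?Y \<in> cauchy_seqs" "cls ?Y = cls X" using representative X by blast+
  have diff: "dist (\<phi> x) (\<phi> y) \<le> anorm A (x \<boxminus> y)" if "x \<in> carrier A" "y \<in> carrier A" for x y
    using \<phi> linear_functional_minus[of \<phi>, OF _ that] minus_closed[OF that]
    unfolding contractive_functional_def dist_norm by force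
  have "Cauchy (\<lambda>n. \<phi> (?Y n))"
    unfolding Cauchy_def
  proof (intro allI impI)
    fix \<epsilon> :: real assume "\<epsilon> > 0"
    then obtain N where "\<And>m n. m \<ge> N \<Longrightarrow> n \<ge> N \<Longrightarrow> anorm A (?Y m \<boxminus> ?Y n) < \<epsilon>"
      using Y(1) unfolding in_cauchy_carrier by meson
    thus "\<exists>M. \<forall>m\<ge>M. \<forall>n\<ge>M. dist (\<phi> (?Y m)) (\<phi> (?Y n)) < \<epsilon>"
      using diff cauchy_pointwise[OF Y(1)] by (meson order_le_less_trans)
  qed
  hence lim: "(\<lambda>n. \<phi> (?Y n)) \<longlonglongrightarrow> completion_functional \<phi> (cls X)"
    using X by (simp add: completion_functional_def Cauchy_convergent_iff convergent_LIMSEQ_iff)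
  have "(\<lambda>n. anorm A (X n \<boxminus> ?Y n)) \<longlonglongrightarrow> 0" using cls_eq_iff[OF X Y(1)] Y(2) by simp
  moreover have "norm (\<phi> (X n) - \<phi> (?Y n)) \<le> anorm A (X n \<boxminus> ?Y n)" for n
    using diff[OF cauchy_pointwise[OF X] cauchy_pointwise[OF Y(1)]] by (simp only: dist_norm)
  ultimately have "(\<lambda>n. \<phi> (X n) - \<phi> (?Y n)) \<longlonglongrightarrow> 0"
    by - (rule Lim_null_comparison[of _ "\<lambda>n. anorm A (X n \<boxminus> ?Y n)"], auto)
  from tendsto_add[OF this lim] show ?thesis by simp
qed

lemma completion_functional_emb:
  "contractive_functional A \<phi> \<Longrightarrow> x \<in> carrier A \<Longrightarrow> completion_functional \<phi> (emb x) = \<phi> x"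
  unfolding completion_embed_def
  by (rule LIMSEQ_unique[OF completion_functional_tendsto[OF _ const_cauchy] tendsto_const])

lemma completion_functional_outside: "x \<notin> carrier (completion A) \<Longrightarrow> completion_functional \<phi> x = 0"
  by (simp add: completion_functional_def)

lemma completion_functional_contractive:
  assumes "contractive_functional A \<phi>"
  shows "contractive_functional (completion A) (completion_functional \<phi>)"
proof -
  note t = completion_functional_tendsto[OF assms]
  have lin: "linear_functional A \<phi>" and b: "\<And>x. x \<in> carrier A \<Longrightarrow> cmod (\<phi> x) \<le> anorm A x"
    using assms by (auto simp: contractive_functional_def)
  have "completion_functional \<phi> (cls X \<boxplus>\<^bsub>completion A\<^esub> cls Y) = completion_functional \<phi> (cls X) + completion_functional \<phi> (cls Y)"
    if "X \<in> cauchy_seqs" "Y \<in> cauchy_seqs" for X Y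
  proof -
    have "(\<lambda>n. \<phi> (X n \<boxplus> Y n)) \<longlonglongrightarrow> completion_functional \<phi> (cls X) + completion_functional \<phi> (cls Y)"
      using tendsto_add[OF t[OF that(1)] t[OF that(2)]] lin that cauchy_pointwise
      by (simp add: linear_functional_def)
    thus ?thesis using LIMSEQ_unique[OF t[OF cauchy_add_closed[OF that]]] that by (simp add: add_completion)
  qed
  moreover have "completion_functional \<phi> (ascale (completion A) c (cls X)) = c * completion_functional \<phi> (cls X)"
    if "X \<in> cauchy_seqs" for X c
  proof -
    have "(\<lambda>n. \<phi> (ascale A c (X n))) \<longlonglongrightarrow> c * completion_functional \<phi> (cls X)"
      using tendsto_mult_left[OF t[OF that], of c] lin that cauchy_pointwise
      by (simp add: linear_functional_def)
    thus ?thesis using LIMSEQ_unique[OF t[OF cauchy_scale_closed[OF that]]] that by (simp add: scale_completion)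
  qed
  moreover have "cmod (completion_functional \<phi> (cls X)) \<le> anorm (completion A) (cls X)" if "X \<in> cauchy_seqs" for X
    using b[OF cauchy_pointwise[OF that]]
    by (intro LIMSEQ_le[OF tendsto_norm[OF t[OF that]] norm_completion_tendsto[OF that]]) simp
  ultimately show ?thesis
    unfolding contractive_functional_def linear_functional_def by (metis carrier_completionE)
qed

lemma completion_functional_positive:
  assumes "contractive_functional A \<phi>" "positive_functional A \<phi>"
  shows "positive_functional (completion A) (completion_functional \<phi>)"
proof -
  have "completion_functional \<phi> (astar (completion A) (cls X) \<boxtimes>\<^bsub>completion A\<^esub> cls X) \<in> \<real>\<^sub>\<ge>\<^sub>0" if X: "X \<in> cauchy_seqs" for X
  proof -
    have c: "(\<lambda>n. astar A (X n) \<boxtimes> X n) \<in> cauchy_seqs" by (intro cauchy_times_closed cauchy_star_closed X)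
    have "\<phi> (astar A (X n) \<boxtimes> X n) \<in> \<real>\<^sub>\<ge>\<^sub>0" for n
      using assms(2) cauchy_pointwise[OF X] by (simp add: positive_functional_def)
    hence "completion_functional \<phi> (cls (\<lambda>n. astar A (X n) \<boxtimes> X n)) \<in> \<real>\<^sub>\<ge>\<^sub>0"
      by (rule closed_sequentially[OF closed_nonneg_Reals_complex _ completion_functional_tendsto[OF assms(1) c]])
    thus ?thesis using X by (simp add: star_completion times_completion cauchy_star_closed)
  qed
  thus ?thesis using completion_functional_contractive[OF assms(1)]
    unfolding positive_functional_def contractive_functional_def by (metis carrier_completionE)
qed

end

section \<open>Extension of homomorphisms to completions\<close>

lemma completion_hom_exists:
  fixes A :: "'a star_algebra" and B :: "'b star_algebra"
  assumes "star_alg A" "star_alg B" "star_hom A B h"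
    and contr: "\<And>x. x \<in> carrier A \<Longrightarrow> anorm B (h x) \<le> anorm A x"
  obtains q where "star_hom (completion A) (completion B) q"
    and "\<And>X. X \<in> carrier (cauchy_algebra A) \<Longrightarrow> (\<lambda>n. h (X n)) \<in> carrier (cauchy_algebra B)
         \<and> q (coset (cauchy_algebra A) (null_sequences A) X)
           = coset (cauchy_algebra B) (null_sequences B) (\<lambda>n. h (X n))"
proof -
  interpret A: star_alg A by fact
  interpret B: star_alg B by fact
  have h: "\<And>x. x \<in> carrier A \<Longrightarrow> h x \<in> carrier B"
    "\<And>x y. x \<in> carrier A \<Longrightarrow> y \<in> carrier A \<Longrightarrow> h (x \<boxplus>\<^bsub>A\<^esub> y) = h x \<boxplus>\<^bsub>B\<^esub> h y"
    "\<And>x y. x \<in> carrier A \<Longrightarrow> y \<in> carrier A \<Longrightarrow> h (x \<boxtimes>\<^bsub>A\<^esub> y) = h x \<boxtimes>\<^bsub>B\<^esub> h y"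
    "\<And>c x. x \<in> carrier A \<Longrightarrow> h (ascale A c x) = ascale B c (h x)"
    "\<And>x. x \<in> carrier A \<Longrightarrow> h (astar A x) = astar B (h x)"
    using assms(3) by (auto simp: star_hom_def)
  have minus: "h (x \<boxminus>\<^bsub>A\<^esub> y) = h x \<boxminus>\<^bsub>B\<^esub> h y" if "x \<in> carrier A" "y \<in> carrier A" for x y
    using that by (simp add: aminus_def h)
  have cau: "(\<lambda>n. h (X n)) \<in> B.cauchy_seqs" if X: "X \<in> A.cauchy_seqs" for X
  proof -
    note p = A.cauchy_pointwise[OF X]
    have "anorm B (h (X m) \<boxminus>\<^bsub>B\<^esub> h (X n)) \<le> anorm A (X m \<boxminus>\<^bsub>A\<^esub> X n)" for m n
      using contr[of "X m \<boxminus>\<^bsub>A\<^esub> X n"] p by (simp add: minus)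
    thus ?thesis using X unfolding A.in_cauchy_carrier B.in_cauchy_carrier
      using h(1) p by (meson order_le_less_trans)
  qed
  \<comment> \<open>As for functionals, a representative is chosen and contractivity makes the
    choice immaterial.\<close>
  define q where "q x = B.cls (\<lambda>n. h (A.representative x n))" for x
  have q: "q (A.cls X) = B.cls (\<lambda>n. h (X n))" if X: "X \<in> A.cauchy_seqs" for X
  proof -
    let ?Y = "A.representative (A.cls X)"
    have Y: "?Y \<in> A.cauchy_seqs" "A.cls ?Y = A.cls X" using A.representative X by blast+
    have "(\<lambda>n. anorm A (?Y n \<boxminus>\<^bsub>A\<^esub> X n)) \<longlonglongrightarrow> 0" using A.cls_eq_iff[OF Y(1) X] Y(2) by simp
    moreover have "norm (anorm B (h (?Y n) \<boxminus>\<^bsub>B\<^esub> h (X n))) \<le> anorm A (?Y n \<boxminus>\<^bsub>A\<^esub> X n)" for n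
      using contr[of "?Y n \<boxminus>\<^bsub>A\<^esub> X n"] A.cauchy_pointwise[OF X] A.cauchy_pointwise[OF Y(1)]
      by (simp add: minus[symmetric] h)
    ultimately have "(\<lambda>n. anorm B (h (?Y n) \<boxminus>\<^bsub>B\<^esub> h (X n))) \<longlonglongrightarrow> 0"
      by - (rule Lim_null_comparison[of _ "\<lambda>n. anorm A (?Y n \<boxminus>\<^bsub>A\<^esub> X n)"], auto)
    thus ?thesis unfolding q_def using B.cls_eq_iff[OF cau[OF Y(1)] cau[OF X]] by simp
  qed
  have "star_hom (completion A) (completion B) q"
    unfolding star_hom_def
  proof (intro conjI ballI allI Pi_I)
    fix x assume "x \<in> carrier (completion A)"
    then obtain X where X: "X \<in> A.cauchy_seqs" "x = A.cls X" by (rule A.carrier_completionE)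
    note pX = A.cauchy_pointwise[OF X(1)]
    show "q x \<in> carrier (completion B)" using X q cau by auto
    show "q (astar (completion A) x) = astar (completion B) (q x)"
      using X(1) pX unfolding X(2)
      by (simp only: A.star_completion B.star_completion q A.cauchy_star_closed cau h)
    show "q (ascale (completion A) c x) = ascale (completion B) c (q x)" for c
      using X(1) pX unfolding X(2)
      by (simp only: A.scale_completion B.scale_completion q A.cauchy_scale_closed cau h)
    fix y assume "y \<in> carrier (completion A)"
    then obtain Y where Y: "Y \<in> A.cauchy_seqs" "y = A.cls Y" by (rule A.carrier_completionE)
    note pY = A.cauchy_pointwise[OF Y(1)]
    show "q (x \<boxplus>\<^bsub>completion A\<^esub> y) = q x \<boxplus>\<^bsub>completion B\<^esub> q y"
      using X(1) Y(1) pX pY unfolding X(2) Y(2)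
      by (simp only: A.add_completion B.add_completion q A.cauchy_add_closed cau h)
    show "q (x \<boxtimes>\<^bsub>completion A\<^esub> y) = q x \<boxtimes>\<^bsub>completion B\<^esub> q y"
      using X(1) Y(1) pX pY unfolding X(2) Y(2)
      by (simp only: A.times_completion B.times_completion q A.cauchy_times_closed cau h)
  qed
  thus ?thesis
  proof (rule that, intro conjI)
    fix X assume X: "X \<in> A.cauchy_seqs"
    show "(\<lambda>n. h (X n)) \<in> B.cauchy_seqs" by (rule cau[OF X])
    show "q (A.cls X) = B.cls (\<lambda>n. h (X n))" by (rule q[OF X])
  qed
qed

section \<open>Noncommutative *-polynomials\<close>

text \<open>With concatenation of words as addition, finitely supported functions on words form a
  ring under convolution.  It is a unital ring containing the free *-algebra as a subring.\<close>

instantiation list :: (type) monoid_add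
begin
definition zero_list :: "'a list" where "zero_list = []"
definition plus_list :: "'a list \<Rightarrow> 'a list \<Rightarrow> 'a list" where "plus_list = (@)"
instance by standard (auto simp: zero_list_def plus_list_def)
end

type_synonym 'p word = "('p \<times> bool) list"
type_synonym 'p npoly = "'p word \<Rightarrow>\<^sub>0 complex"

abbreviation coeff_of :: "'p npoly \<Rightarrow> 'p word \<Rightarrow> complex" where "coeff_of \<equiv> Poly_Mapping.lookup"
abbreviation support :: "'p npoly \<Rightarrow> 'p word set" where "support \<equiv> Poly_Mapping.keys"
abbreviation monom_of :: "'p word \<Rightarrow> complex \<Rightarrow> 'p npoly" where "monom_of \<equiv> Poly_Mapping.single"

definition adj_word :: "'p word \<Rightarrow> 'p word" where "adj_word w = map (apsnd Not) (rev w)"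

definition padj :: "'p npoly \<Rightarrow> 'p npoly" where
  "padj f = Poly_Mapping.map cnj (Poly_Mapping.map_key adj_word f)"

definition pscale :: "complex \<Rightarrow> 'p npoly \<Rightarrow> 'p npoly" where
  "pscale c f = Poly_Mapping.map ((*) c) f"

definition lin_ext :: "('p word \<Rightarrow> complex) \<Rightarrow> 'p npoly \<Rightarrow> complex" where
  "lin_ext G f = (\<Sum>w\<in>support f. coeff_of f w * G w)"

lemma adj_word_append: "adj_word (v @ w) = adj_word w @ adj_word v"
  and adj_word_adj_word [simp]: "adj_word (adj_word w) = w"
  and adj_word_Nil [simp]: "adj_word [] = []"
  and adj_word_eq_Nil [simp]: "adj_word w = [] \<longleftrightarrow> w = []"
  and adj_word_Cons: "adj_word (l # w) = adj_word w @ [apsnd Not l]"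
  and fst_set_adj_word [simp]: "fst ` set (adj_word w) = fst ` set w"
  by (auto simp: adj_word_def rev_map comp_def image_image apsnd_def map_prod_def case_prod_beta)

lemma inj_adj_word: "inj adj_word"
  by (rule inj_on_inverseI[where g=adj_word]) simp

lemma coeff_padj [simp]: "coeff_of (padj f) w = cnj (coeff_of f (adj_word w))"
  unfolding padj_def
  by (simp add: Poly_Mapping.map.rep_eq Poly_Mapping.map_key.rep_eq[OF inj_adj_word] when_def)

lemma coeff_pscale [simp]: "coeff_of (pscale c f) w = c * coeff_of f w"
  unfolding pscale_def by (simp add: Poly_Mapping.map.rep_eq when_def)

text \<open>The product of \<open>Poly_Mapping\<close> sums over all pairs of words with
  concatenation w. Such a pair is determined by the length k of its first member, which recovers the
  formula in \<open>free_algebra\<close>.\<close>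

lemma coeff_mult:
  "coeff_of (f * g) w = (\<Sum>k\<le>length w. coeff_of f (take k w) * coeff_of g (drop k w))"
proof -
  let ?h = "\<lambda>l. coeff_of f l * (\<Sum>q. coeff_of g q when w = l + q)"
  have inner: "(\<Sum>q. coeff_of g q when w = take k w + q) = coeff_of g (drop k w)" for k
  proof -
    have "(w = take k w + q) = (drop k w = q)" for q
      unfolding plus_list_def by (metis append_take_drop_id same_append_eq)
    thus ?thesis by simp
  qed
  have "l \<in> (\<lambda>k. take k w) ` {..length w}" if l: "?h l \<noteq> 0" for l
  proof -
    have "(\<Sum>q. coeff_of g q when w = l + q) \<noteq> 0" using l by auto
    then obtain q where "w = l + q" by (auto elim: Sum_any.not_neutral_obtains_not_neutral)
    hence "l = take (length l) w" "length l \<le> length w" by (auto simp: plus_list_def)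
    thus ?thesis by blast
  qed
  hence "coeff_of (f * g) w = sum ?h ((\<lambda>k. take k w) ` {..length w})"
    unfolding lookup_mult by (intro Sum_any.expand_superset) auto
  also have "\<dots> = (\<Sum>k\<le>length w. ?h (take k w))"
    by (rule sum.reindex_cong[OF _ refl refl])
      (metis (no_types, lifting) atMost_iff inj_onI length_take min.absorb2)
  finally show ?thesis by (simp add: inner)
qed

lemma monom_mult: "monom_of v a * monom_of w b = monom_of (v @ w) (a * b)"
  by (simp add: mult_single plus_list_def)

lemma padj_add: "padj (f + g) = padj f + padj g"
  and padj_zero [simp]: "padj 0 = 0"
  and padj_minus: "padj (f - g) = padj f - padj g"
  and padj_padj [simp]: "padj (padj f) = f"
  and padj_pscale: "padj (pscale c f) = pscale (cnj c) (padj f)"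
  by (rule poly_mapping_eqI, simp add: lookup_add lookup_minus)+

lemma pscale_add: "pscale c (f + g) = pscale c f + pscale c g"
  and add_pscale: "pscale (c + d) f = pscale c f + pscale d f"
  and pscale_pscale: "pscale c (pscale d f) = pscale (c * d) f"
  and pscale_one [simp]: "pscale 1 f = f"
  and pscale_nought [simp]: "pscale 0 f = 0"
  and pscale_minus_one: "pscale (-1) f = - f"
  and pscale_zero [simp]: "pscale c 0 = 0"
  by (rule poly_mapping_eqI, simp add: lookup_add algebra_simps)+

lemma pscale_mult: "pscale c f * g = pscale c (f * g)"
  and mult_pscale: "f * pscale c g = pscale c (f * g)"
  by (rule poly_mapping_eqI, simp add: coeff_mult sum_distrib_left mult_ac)+

lemma pscale_monom [simp]: "pscale c (monom_of w a) = monom_of w (c * a)"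
  by (rule poly_mapping_eqI) (simp add: lookup_single when_def)

lemma padj_monom [simp]: "padj (monom_of w a) = monom_of (adj_word w) (cnj a)"
proof (rule poly_mapping_eqI)
  fix v
  have "w = adj_word v \<longleftrightarrow> adj_word w = v" by auto
  thus "coeff_of (padj (monom_of w a)) v = coeff_of (monom_of (adj_word w) (cnj a)) v"
    by (simp add: lookup_single when_def)
qed

lemma support_padj: "support (padj f) = adj_word ` support f"
proof -
  have "support (padj f) = adj_word -` support f" by (auto simp: in_keys_iff)
  also have "\<dots> = adj_word ` support f"
  proof (intro equalityI subsetI)
    fix w assume "w \<in> adj_word -` support f"
    hence "adj_word (adj_word w) \<in> adj_word ` support f" by blast
    thus "w \<in> adj_word ` support f" by simp
  qed auto
  finally show ?thesis .
qed

lemma npoly_expand: "f = (\<Sum>w\<in>support f. monom_of w (coeff_of f w))"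
proof (rule poly_mapping_eqI)
  fix v
  have "(\<Sum>w\<in>support f. coeff_of f w when w = v) = coeff_of f v"
    by (cases "v \<in> support f") (auto simp: when_def sum.delta in_keys_iff)
  thus "coeff_of f v = coeff_of (\<Sum>w\<in>support f. monom_of w (coeff_of f w)) v"
    by (simp add: lookup_sum lookup_single)
qed

text \<open>The bound K on the support is carried along: with K the admissible words this is
  induction inside the free algebra, with K all words it is induction in the whole ring.\<close>

lemma npoly_induct [consumes 1, case_names zero monom add]:
  assumes "support f \<subseteq> K" "P 0" "\<And>w c. w \<in> K \<Longrightarrow> P (monom_of w c)"
    "\<And>f g. support f \<subseteq> K \<Longrightarrow> support g \<subseteq> K \<Longrightarrow> P f \<Longrightarrow> P g \<Longrightarrow> P (f + g)"
  shows "P f"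
proof -
  have "support (\<Sum>w\<in>S. monom_of w (coeff_of f w)) \<subseteq> K \<and> P (\<Sum>w\<in>S. monom_of w (coeff_of f w))"
    if "finite S" "S \<subseteq> K" for S
    using that
  proof (induction S)
    case (insert w S)
    have "support (monom_of w (coeff_of f w)) \<subseteq> K" using insert.prems by simp
    thus ?case using insert assms(3,4) keys_add[of "monom_of w (coeff_of f w)" "\<Sum>w\<in>S. monom_of w (coeff_of f w)"]
      by auto
  qed (use assms(2) in auto)
  thus ?thesis using assms(1) npoly_expand[of f] by (metis finite_keys)
qed

lemmas npoly_induct_all = npoly_induct[OF subset_UNIV, case_names zero monom add]

lemma lin_ext_superset:
  "finite S \<Longrightarrow> support f \<subseteq> S \<Longrightarrow> lin_ext G f = (\<Sum>w\<in>S. coeff_of f w * G w)"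
  unfolding lin_ext_def by (rule sum.mono_neutral_left) (auto simp: in_keys_iff)

lemma lin_ext_zero [simp]: "lin_ext G 0 = 0"
  and lin_ext_monom [simp]: "lin_ext G (monom_of w c) = c * G w"
  by (auto simp: lin_ext_def)

lemma lin_ext_add: "lin_ext G (f + g) = lin_ext G f + lin_ext G g"
  using keys_add[of f g]
  by (simp add: lin_ext_superset[of "support f \<union> support g"] lookup_add sum.distrib algebra_simps)

lemma lin_ext_pscale: "lin_ext G (pscale c f) = c * lin_ext G f"
proof -
  have "support (pscale c f) \<subseteq> support f" by (auto simp: in_keys_iff)
  thus ?thesis by (simp add: lin_ext_superset[of "support f"] sum_distrib_left mult_ac)
qed

lemma lin_ext_minus: "lin_ext G (f - g) = lin_ext G f - lin_ext G g"
  using lin_ext_add[of G f "- g"] lin_ext_pscale[of G "-1" g] by (simp add: pscale_minus_one)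

lemma lin_ext_sum: "lin_ext G (\<Sum>i\<in>I. f i) = (\<Sum>i\<in>I. lin_ext G (f i))"
  by (induction I rule: infinite_finite_induct) (auto simp: lin_ext_add)

lemma lin_ext_mult_fun: "lin_ext (\<lambda>w. c * G w) f = c * lin_ext G f"
  and lin_ext_zero_fun [simp]: "lin_ext (\<lambda>w. 0) f = 0"
  by (simp_all add: lin_ext_def sum_distrib_left algebra_simps)

lemma lin_ext_mult: "lin_ext G (f * g) = lin_ext (\<lambda>v. lin_ext (\<lambda>w. G (v @ w)) g) f"
proof (induction f rule: npoly_induct_all)
  case (monom v a)
  show ?case
    by (induction g rule: npoly_induct_all)
      (auto simp: monom_mult lin_ext_add distrib_left)
qed (auto simp: lin_ext_add distrib_right)

lemma padj_mult: "padj (f * g) = padj g * padj f"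
proof (induction f rule: npoly_induct_all)
  case (monom v a)
  show ?case
    by (induction g rule: npoly_induct_all)
      (auto simp: monom_mult padj_add distrib_left distrib_right adj_word_append mult.commute)
qed (auto simp: padj_add distrib_left distrib_right)

lemma padj_sum: "padj (\<Sum>i\<in>I. f i) = (\<Sum>i\<in>I. padj (f i))"
  by (induction I rule: infinite_finite_induct) (auto simp: padj_add)

section \<open>The free algebra as the polynomials without constant term\<close>

definition words :: "'p two_graph \<Rightarrow> 'p word set" where
  "words \<Lambda> = {w. w \<noteq> [] \<and> fst ` set w \<subseteq> paths \<Lambda>}"

definition fpoly :: "'p two_graph \<Rightarrow> 'p npoly set" where
  "fpoly \<Lambda> = {f. support f \<subseteq> words \<Lambda>}"

definition gen :: "'p \<Rightarrow> 'p npoly" where "gen \<kappa> = monom_of [(\<kappa>, False)] 1"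
definition gadj :: "'p \<Rightarrow> 'p npoly" where "gadj \<kappa> = monom_of [(\<kappa>, True)] 1"

lemma padj_gen [simp]: "padj (gen \<kappa>) = gadj \<kappa>" and padj_gadj [simp]: "padj (gadj \<kappa>) = gen \<kappa>"
  by (auto simp: gen_def gadj_def adj_word_def)

lemma fpoly_zero [simp, intro]: "0 \<in> fpoly \<Lambda>"
  and fpoly_monom: "w \<in> words \<Lambda> \<Longrightarrow> monom_of w c \<in> fpoly \<Lambda>"
  by (auto simp: fpoly_def)

lemma fpoly_add [simp, intro]: "f \<in> fpoly \<Lambda> \<Longrightarrow> g \<in> fpoly \<Lambda> \<Longrightarrow> f + g \<in> fpoly \<Lambda>"
  unfolding fpoly_def using keys_add[of f g] by auto

lemma fpoly_pscale [simp, intro]: "f \<in> fpoly \<Lambda> \<Longrightarrow> pscale c f \<in> fpoly \<Lambda>"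
  by (auto simp: fpoly_def in_keys_iff)

lemma fpoly_uminus [simp, intro]: "f \<in> fpoly \<Lambda> \<Longrightarrow> - f \<in> fpoly \<Lambda>"
  using fpoly_pscale[of f \<Lambda> "-1"] by (simp add: pscale_minus_one)

lemma fpoly_minus [simp, intro]: "f \<in> fpoly \<Lambda> \<Longrightarrow> g \<in> fpoly \<Lambda> \<Longrightarrow> f - g \<in> fpoly \<Lambda>"
  using fpoly_add[of f \<Lambda> "- g"] by simp

lemma fpoly_sum [intro]: "(\<And>i. i \<in> I \<Longrightarrow> f i \<in> fpoly \<Lambda>) \<Longrightarrow> (\<Sum>i\<in>I. f i) \<in> fpoly \<Lambda>"
  by (induction I rule: infinite_finite_induct) auto

lemma fpoly_mult [simp, intro]: "f \<in> fpoly \<Lambda> \<Longrightarrow> g \<in> fpoly \<Lambda> \<Longrightarrow> f * g \<in> fpoly \<Lambda>"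
  unfolding fpoly_def words_def using keys_mult[of f g] by (fastforce simp: plus_list_def)

lemma adj_word_words: "w \<in> words \<Lambda> \<Longrightarrow> adj_word w \<in> words \<Lambda>"
  by (simp only: words_def mem_Collect_eq adj_word_eq_Nil fst_set_adj_word) simp

lemma fpoly_padj [simp, intro]: "f \<in> fpoly \<Lambda> \<Longrightarrow> padj f \<in> fpoly \<Lambda>"
  using adj_word_words by (auto simp: fpoly_def support_padj)

lemma fpoly_gen [simp, intro]: "\<kappa> \<in> paths \<Lambda> \<Longrightarrow> gen \<kappa> \<in> fpoly \<Lambda>"
  and fpoly_gadj [simp, intro]: "\<kappa> \<in> paths \<Lambda> \<Longrightarrow> gadj \<kappa> \<in> fpoly \<Lambda>"
  by (auto simp: gen_def gadj_def words_def intro: fpoly_monom)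

lemma fpoly_induct [consumes 1, case_names zero monom add]:
  assumes "f \<in> fpoly \<Lambda>" "P 0" "\<And>w c. w \<in> words \<Lambda> \<Longrightarrow> P (monom_of w c)"
    "\<And>f g. f \<in> fpoly \<Lambda> \<Longrightarrow> g \<in> fpoly \<Lambda> \<Longrightarrow> P f \<Longrightarrow> P g \<Longrightarrow> P (f + g)"
  shows "P f"
  using npoly_induct[of f "words \<Lambda>" P] assms by (auto simp: fpoly_def)

text \<open>The elements of \<open>free_algebra\<close> are bare functions on words. Identifying
  them with \<open>fpoly\<close> makes ring arithmetic available for all later computations.\<close>

lemma carrier_free: "carrier (free_algebra \<Lambda> p) = coeff_of ` fpoly \<Lambda>"
proof (intro Set.set_eqI iffI)
  fix F assume "F \<in> carrier (free_algebra \<Lambda> p)"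
  hence F: "finite {w. F w \<noteq> 0}" "F [] = 0" "\<And>w. F w \<noteq> 0 \<Longrightarrow> fst ` set w \<subseteq> paths \<Lambda>"
    by (auto simp: free_algebra_def)
  have l: "coeff_of (Abs_poly_mapping F) = F" using F(1) by simp
  have "w \<in> words \<Lambda>" if "F w \<noteq> 0" for w
    using F(2) F(3)[OF that] that unfolding words_def by (cases w) auto
  hence "Abs_poly_mapping F \<in> fpoly \<Lambda>" unfolding fpoly_def by (auto simp: in_keys_iff l)
  thus "F \<in> coeff_of ` fpoly \<Lambda>" using l by (metis image_eqI)
next
  fix F assume "F \<in> coeff_of ` fpoly \<Lambda>"
  then obtain f where f: "f \<in> fpoly \<Lambda>" "F = coeff_of f" by auto
  have "f \<in> fpoly \<Lambda> \<Longrightarrow> coeff_of f w \<noteq> 0 \<Longrightarrow> w \<in> words \<Lambda>" for w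
    unfolding fpoly_def by (auto simp: in_keys_iff)
  thus "F \<in> carrier (free_algebra \<Lambda> p)" using f
    by (auto simp: free_algebra_def words_def)
qed

lemma free_sel:
  "azero (free_algebra \<Lambda> p) = coeff_of 0"
  "aplus (free_algebra \<Lambda> p) (coeff_of f) (coeff_of g) = coeff_of (f + g)"
  "ascale (free_algebra \<Lambda> p) c (coeff_of f) = coeff_of (pscale c f)"
  "atimes (free_algebra \<Lambda> p) (coeff_of f) (coeff_of g) = coeff_of (f * g)"
  "astar (free_algebra \<Lambda> p) (coeff_of f) = coeff_of (padj f)"
  "aminus (free_algebra \<Lambda> p) (coeff_of f) (coeff_of g) = coeff_of (f - g)"
  "anorm (free_algebra \<Lambda> p) F = p F"
  by (auto simp: free_algebra_def aminus_def fun_eq_iff lookup_add lookup_minus coeff_mult adj_word_def)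

lemma asum_free:
  assumes "star_alg (free_algebra \<Lambda> p)" "finite I" "\<And>i. i \<in> I \<Longrightarrow> f i \<in> fpoly \<Lambda>"
  shows "asum (free_algebra \<Lambda> p) (\<lambda>i. coeff_of (f i)) I = coeff_of (\<Sum>i\<in>I. f i)"
  using assms(2,3)
proof (induction I)
  case empty
  show ?case by (simp only: star_alg.asum_empty[OF assms(1)] free_sel sum.empty)
next
  case (insert i I)
  have "(\<lambda>i. coeff_of (f i)) ` I \<subseteq> carrier (free_algebra \<Lambda> p)" "coeff_of (f i) \<in> carrier (free_algebra \<Lambda> p)"
    using insert unfolding carrier_free by auto
  thus ?case using insert by (simp add: star_alg.asum_insert[OF assms(1)] free_sel)
qed

lemma free_generator_eq: "free_generator \<kappa> = coeff_of (gen \<kappa>)"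
  by (auto simp: free_generator_def gen_def fun_eq_iff lookup_single when_def)

section \<open>C*-seminorms and congruence modulo seminorm zero\<close>

locale cstar_on =
  fixes \<Lambda> :: "'p two_graph" and P :: "'p npoly \<Rightarrow> real"
  assumes P_nonneg: "f \<in> fpoly \<Lambda> \<Longrightarrow> 0 \<le> P f"
    and P_add: "f \<in> fpoly \<Lambda> \<Longrightarrow> g \<in> fpoly \<Lambda> \<Longrightarrow> P (f + g) \<le> P f + P g"
    and P_pscale: "f \<in> fpoly \<Lambda> \<Longrightarrow> P (pscale c f) = cmod c * P f"
    and P_mult: "f \<in> fpoly \<Lambda> \<Longrightarrow> g \<in> fpoly \<Lambda> \<Longrightarrow> P (f * g) \<le> P f * P g"
    and P_cstar: "f \<in> fpoly \<Lambda> \<Longrightarrow> P (padj f * f) = (P f)\<^sup>2"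

lemma cstar_seminorm_iff: "cstar_seminorm \<Lambda> p \<longleftrightarrow> cstar_on \<Lambda> (\<lambda>f. p (coeff_of f))"
  unfolding cstar_seminorm_def Let_def cstar_on_def carrier_free by (auto simp: free_sel)

context cstar_on
begin

lemma P_zero [simp]: "P 0 = 0"
  using P_pscale[of 0 0] by simp

lemma P_uminus: "f \<in> fpoly \<Lambda> \<Longrightarrow> P (- f) = P f"
  using P_pscale[of f "-1"] by (simp add: pscale_minus_one)

lemma P_minus_commute: "f \<in> fpoly \<Lambda> \<Longrightarrow> g \<in> fpoly \<Lambda> \<Longrightarrow> P (f - g) = P (g - f)"
  using P_uminus[of "f - g"] by simp

text \<open>The C*-identity and submultiplicativity bound the square of P g by P (padj g) times P g.
  Cancelling P g and exchanging g with its adjoint yields equality.\<close>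

lemma P_padj: assumes f: "f \<in> fpoly \<Lambda>" shows "P (padj f) = P f"
proof -
  have le: "P g \<le> P (padj g)" if g: "g \<in> fpoly \<Lambda>" for g
  proof (cases "P g = 0")
    case False
    hence "P g > 0" using P_nonneg[OF g] by simp
    moreover have "P g * P g \<le> P (padj g) * P g"
      using P_cstar[OF g] P_mult[of "padj g" g] g by (simp add: power2_eq_square)
    ultimately show ?thesis by simp
  qed (use P_nonneg g in auto)
  show ?thesis using le[OF f] le[of "padj f"] f by simp
qed

lemma free_star_alg:
  assumes "\<And>f. p (coeff_of f) = P f"
  shows "star_alg (free_algebra \<Lambda> p)"
  using assms
  by unfold_locales
    (auto simp: carrier_free free_sel algebra_simps pscale_add add_pscale pscale_pscale pscale_mult mult_pscale
      padj_add padj_pscale padj_mult P_add P_pscale P_mult P_padj)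

text \<open>Congruence modulo the kernel of the seminorm, which is equality in the completion.
  Membership in \<open>fpoly\<close> belongs to the relation, so chains of congruences carry it
  along.\<close>

definition eqv (infix "\<doteq>" 50) where "f \<doteq> g \<longleftrightarrow> f \<in> fpoly \<Lambda> \<and> g \<in> fpoly \<Lambda> \<and> P (f - g) = 0"

lemma eqv_refl [simp, intro]: "f \<in> fpoly \<Lambda> \<Longrightarrow> f \<doteq> f"
  by (simp add: eqv_def)

lemma eqv_sym: "f \<doteq> g \<Longrightarrow> g \<doteq> f"
  by (auto simp: eqv_def P_minus_commute)

lemma eqv_trans [trans]:
  assumes "f \<doteq> g" "g \<doteq> h" shows "f \<doteq> h"
proof -
  have "P (f - h) \<le> P (f - g) + P (g - h)" using P_add[of "f - g" "g - h"] assms by (auto simp: eqv_def)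
  thus ?thesis using assms P_nonneg[of "f - h"] by (auto simp: eqv_def intro: antisym)
qed

lemma eqv_fpoly: "f \<doteq> g \<Longrightarrow> f \<in> fpoly \<Lambda>" "f \<doteq> g \<Longrightarrow> g \<in> fpoly \<Lambda>"
  by (auto simp: eqv_def)

lemma eqv_add: assumes "f \<doteq> g" "f' \<doteq> g'" shows "f + f' \<doteq> g + g'"
proof -
  have "P ((f - g) + (f' - g')) \<le> 0" using P_add[of "f - g" "f' - g'"] assms by (auto simp: eqv_def)
  moreover have "(f - g) + (f' - g') = (f + f') - (g + g')" by simp
  ultimately show ?thesis using assms P_nonneg[of "f + f' - (g + g')"] by (auto simp: eqv_def intro: antisym)
qed

lemma eqv_pscale: "f \<doteq> g \<Longrightarrow> pscale c f \<doteq> pscale c g"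
proof -
  have "pscale c f - pscale c g = pscale c (f - g)" by (rule poly_mapping_eqI) (simp add: lookup_minus algebra_simps)
  thus "f \<doteq> g \<Longrightarrow> pscale c f \<doteq> pscale c g" by (auto simp: eqv_def P_pscale)
qed

lemma eqv_uminus: "f \<doteq> g \<Longrightarrow> - f \<doteq> - g"
  using eqv_pscale[of f g "-1"] by (simp add: pscale_minus_one)

lemma eqv_minus: "f \<doteq> g \<Longrightarrow> f' \<doteq> g' \<Longrightarrow> f - f' \<doteq> g - g'"
  using eqv_add[of f g "- f'" "- g'"] eqv_uminus by simp

lemma eqv_padj: "f \<doteq> g \<Longrightarrow> padj f \<doteq> padj g"
  by (auto simp: eqv_def P_padj simp flip: padj_minus)

lemma eqv_mult_left: assumes "f \<doteq> g" "h \<in> fpoly \<Lambda>" shows "h * f \<doteq> h * g"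
proof -
  have "P (h * (f - g)) \<le> 0" using P_mult[of h "f - g"] assms by (auto simp: eqv_def)
  thus ?thesis using assms P_nonneg[of "h * (f - g)"] by (auto simp: eqv_def algebra_simps intro: antisym)
qed

lemma eqv_mult_right: assumes "f \<doteq> g" "h \<in> fpoly \<Lambda>" shows "f * h \<doteq> g * h"
proof -
  have "P ((f - g) * h) \<le> 0" using P_mult[of "f - g" h] assms by (auto simp: eqv_def)
  thus ?thesis using assms P_nonneg[of "(f - g) * h"] by (auto simp: eqv_def algebra_simps intro: antisym)
qed

lemma eqv_mult: "f \<doteq> g \<Longrightarrow> f' \<doteq> g' \<Longrightarrow> f * f' \<doteq> g * g'"
  by (meson eqv_mult_left eqv_mult_right eqv_trans eqv_fpoly)

lemma eqv_sum: "(\<And>i. i \<in> I \<Longrightarrow> f i \<doteq> g i) \<Longrightarrow> (\<Sum>i\<in>I. f i) \<doteq> (\<Sum>i\<in>I. g i)"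
  by (induction I rule: infinite_finite_induct) (auto intro: eqv_add)

lemma eqv_norm: assumes "f \<doteq> g" shows "P f = P g"
proof -
  have "P f \<le> P (f - g) + P g" "P g \<le> P (g - f) + P f"
    using P_add[of "f - g" g] P_add[of "g - f" f] assms by (auto simp: eqv_def)
  thus ?thesis using assms P_minus_commute[of f g] by (auto simp: eqv_def)
qed

lemma eqv_zero_iff: "f \<doteq> 0 \<longleftrightarrow> f \<in> fpoly \<Lambda> \<and> P f = 0"
  by (auto simp: eqv_def)

text \<open>The C*-identity makes the square of P f equal to P f, leaving only the values 0 and
  1.\<close>

lemma projection_norm:
  assumes "padj f * f \<doteq> f" shows "P f \<le> 1"
proof -
  have "(P f)\<^sup>2 = P f" using eqv_norm[OF assms] P_cstar[of f] eqv_fpoly(2)[OF assms] by simp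
  hence "P f * (P f - 1) = 0" by (simp add: power2_eq_square algebra_simps)
  thus ?thesis by auto
qed

end

text \<open>Inequalities suffice. Rescaling by the inverse of c reverses the bound for scalar
  multiples; the square inequality and submultiplicativity make the adjoint isometric, which gives
  the other half of the C*-identity.\<close>

lemma cstar_onI:
  assumes nonneg: "\<And>f. f \<in> fpoly \<Lambda> \<Longrightarrow> 0 \<le> Q f"
    and add: "\<And>f g. f \<in> fpoly \<Lambda> \<Longrightarrow> g \<in> fpoly \<Lambda> \<Longrightarrow> Q (f + g) \<le> Q f + Q g"
    and scale: "\<And>f c. f \<in> fpoly \<Lambda> \<Longrightarrow> Q (pscale c f) \<le> cmod c * Q f"
    and mult: "\<And>f g. f \<in> fpoly \<Lambda> \<Longrightarrow> g \<in> fpoly \<Lambda> \<Longrightarrow> Q (f * g) \<le> Q f * Q g"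
    and square: "\<And>f. f \<in> fpoly \<Lambda> \<Longrightarrow> (Q f)\<^sup>2 \<le> Q (padj f * f)"
  shows "cstar_on \<Lambda> Q"
proof
  fix f g c assume f: "f \<in> fpoly \<Lambda>"
  show "0 \<le> Q f" by (rule nonneg[OF f])
  show "Q (pscale c f) = cmod c * Q f"
  proof (cases "c = 0")
    case True thus ?thesis using scale[OF f, of 0] nonneg[of 0] by simp
  next
    case False
    have "Q f \<le> cmod (inverse c) * Q (pscale c f)"
      using scale[of "pscale c f" "inverse c"] f False by (simp add: pscale_pscale)
    hence "cmod c * Q f \<le> Q (pscale c f)" using False by (simp add: norm_divide field_simps)
    thus ?thesis using scale[OF f, of c] by simp
  qed
  have le: "Q h \<le> Q (padj h)" if h: "h \<in> fpoly \<Lambda>" for h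
  proof (cases "Q h = 0")
    case False
    hence p: "Q h > 0" using nonneg[OF h] by simp
    have "Q h * Q h \<le> Q (padj h) * Q h"
      using square[OF h] mult[of "padj h" h] h by (simp add: power2_eq_square)
    thus ?thesis using p by simp
  qed (use nonneg h in simp)
  have "Q (padj f) = Q f" using le[OF f] le[of "padj f"] f by simp
  thus "Q (padj f * f) = (Q f)\<^sup>2"
    using mult[of "padj f" f] square[OF f] f by (simp add: power2_eq_square)
  assume g: "g \<in> fpoly \<Lambda>"
  show "Q (f + g) \<le> Q f + Q g" "Q (f * g) \<le> Q f * Q g" using add mult f g by auto
qed

section \<open>Toeplitz seminorms\<close>

context two_graph
begin

lemma factorE:
  assumes "\<kappa> \<in> paths \<Lambda>" "deg \<Lambda> \<kappa> = m + n"
  obtains \<mu> \<nu> where "\<mu> \<in> paths \<Lambda>" "\<nu> \<in> paths \<Lambda>" "src \<Lambda> \<mu> = rng \<Lambda> \<nu>" "\<kappa> = cmp \<Lambda> \<mu> \<nu>"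
    "deg \<Lambda> \<mu> = m" "deg \<Lambda> \<nu> = n"
  using factorization[OF assms] by (elim ex1E) auto

text \<open>The degree determines where a path is cut: equal degrees of the first factors force
  equal degrees of the second ones, and then the factorization is unique.\<close>

lemma factor_unique:
  assumes "\<mu> \<in> paths \<Lambda>" "\<alpha> \<in> paths \<Lambda>" "src \<Lambda> \<mu> = rng \<Lambda> \<alpha>" "\<nu> \<in> paths \<Lambda>" "\<beta> \<in> paths \<Lambda>" "src \<Lambda> \<nu> = rng \<Lambda> \<beta>"
    and eq: "cmp \<Lambda> \<mu> \<alpha> = cmp \<Lambda> \<nu> \<beta>" and "deg \<Lambda> \<mu> = deg \<Lambda> \<nu>"
  shows "\<mu> = \<nu> \<and> \<alpha> = \<beta>"
proof -
  have d: "deg \<Lambda> (cmp \<Lambda> \<mu> \<alpha>) = deg \<Lambda> \<mu> + deg \<Lambda> \<alpha>" "deg \<Lambda> (cmp \<Lambda> \<nu> \<beta>) = deg \<Lambda> \<nu> + deg \<Lambda> \<beta>"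
    by (rule deg_cmp[OF assms(1-3)], rule deg_cmp[OF assms(4-6)])
  have "deg \<Lambda> \<mu> + deg \<Lambda> \<alpha> = deg \<Lambda> \<mu> + deg \<Lambda> \<beta>" using d eq assms(8) by metis
  hence "deg \<Lambda> \<alpha> = deg \<Lambda> \<beta>" by simp
  have uniq: "\<exists>!x. Q x \<Longrightarrow> Q a \<Longrightarrow> Q b \<Longrightarrow> a = b" for Q and a b :: "'p \<times> 'p" by blast
  have "(\<mu>, \<alpha>) = (\<nu>, \<beta>)"
    by (rule uniq[OF factorization[OF cmp_closed[OF assms(1-3)] d(1)]])
      (use assms \<open>deg \<Lambda> \<alpha> = deg \<Lambda> \<beta>\<close> in simp_all)
  thus ?thesis by simp
qed

lemma cancel_left:
  assumes "\<mu> \<in> paths \<Lambda>" "\<alpha> \<in> paths \<Lambda>" "src \<Lambda> \<mu> = rng \<Lambda> \<alpha>" "\<beta> \<in> paths \<Lambda>" "src \<Lambda> \<mu> = rng \<Lambda> \<beta>"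
    and "cmp \<Lambda> \<mu> \<alpha> = cmp \<Lambda> \<mu> \<beta>"
  shows "\<alpha> = \<beta>"
  using factor_unique[of \<mu> \<alpha> \<mu> \<beta>] assms by simp

lemma cancel_right:
  assumes "\<mu> \<in> paths \<Lambda>" "\<alpha> \<in> paths \<Lambda>" "src \<Lambda> \<mu> = rng \<Lambda> \<alpha>" "\<nu> \<in> paths \<Lambda>" "src \<Lambda> \<nu> = rng \<Lambda> \<alpha>"
    and eq: "cmp \<Lambda> \<mu> \<alpha> = cmp \<Lambda> \<nu> \<alpha>"
  shows "\<mu> = \<nu>"
proof -
  have "deg \<Lambda> \<mu> + deg \<Lambda> \<alpha> = deg \<Lambda> \<nu> + deg \<Lambda> \<alpha>" using deg_cmp assms by metis
  thus ?thesis using factor_unique[of \<mu> \<alpha> \<nu> \<alpha>] assms by simp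
qed

lemma vertex_closed: "z \<in> vertices \<Lambda> \<Longrightarrow> z \<in> paths \<Lambda>"
  by (simp add: vertices_def)

text \<open>Both r(z) z and z s(z) are factorizations of z with degrees 0 + 0, so r(z) = z and z =
  s(z) by uniqueness.\<close>

lemma vertex_rng_src:
  assumes "z \<in> vertices \<Lambda>"
  shows "rng \<Lambda> z = z" "src \<Lambda> z = z"
proof -
  have z: "z \<in> paths \<Lambda>" "deg \<Lambda> z = 0" using assms by (auto simp: vertices_def)
  have "rng \<Lambda> z = z \<and> z = src \<Lambda> z"
    using z rng_closed src_closed deg_rng src_rng rng_src cmp_rng cmp_src
    by (intro factor_unique) simp_all
  thus "rng \<Lambda> z = z" "src \<Lambda> z = z" by auto
qed

lemma rng_vertex: "\<kappa> \<in> paths \<Lambda> \<Longrightarrow> rng \<Lambda> \<kappa> \<in> vertices \<Lambda>"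
  and src_vertex: "\<kappa> \<in> paths \<Lambda> \<Longrightarrow> src \<Lambda> \<kappa> \<in> vertices \<Lambda>"
  by (auto simp: vertices_def rng_closed src_closed deg_rng deg_src)

lemma min_extD:
  assumes "\<mu> \<in> paths \<Lambda>" "\<nu> \<in> paths \<Lambda>" "(\<alpha>, \<beta>) \<in> min_ext \<Lambda> \<mu> \<nu>"
  shows "\<alpha> \<in> paths \<Lambda>" "\<beta> \<in> paths \<Lambda>" "src \<Lambda> \<mu> = rng \<Lambda> \<alpha>" "src \<Lambda> \<nu> = rng \<Lambda> \<beta>"
    "cmp \<Lambda> \<mu> \<alpha> = cmp \<Lambda> \<nu> \<beta>" "deg \<Lambda> \<mu> + deg \<Lambda> \<alpha> = sup (deg \<Lambda> \<mu>) (deg \<Lambda> \<nu>)"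
    "deg \<Lambda> \<nu> + deg \<Lambda> \<beta> = sup (deg \<Lambda> \<mu>) (deg \<Lambda> \<nu>)" "src \<Lambda> \<alpha> = src \<Lambda> \<beta>"
proof -
  show a: "\<alpha> \<in> paths \<Lambda>" "\<beta> \<in> paths \<Lambda>" "src \<Lambda> \<mu> = rng \<Lambda> \<alpha>" "src \<Lambda> \<nu> = rng \<Lambda> \<beta>"
    "cmp \<Lambda> \<mu> \<alpha> = cmp \<Lambda> \<nu> \<beta>"
    using assms by (auto simp: min_ext_def)
  show "deg \<Lambda> \<mu> + deg \<Lambda> \<alpha> = sup (deg \<Lambda> \<mu>) (deg \<Lambda> \<nu>)"
    using assms deg_cmp[of \<mu> \<alpha>] a by (simp add: min_ext_def)
  show "deg \<Lambda> \<nu> + deg \<Lambda> \<beta> = sup (deg \<Lambda> \<mu>) (deg \<Lambda> \<nu>)"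
    using assms deg_cmp[of \<nu> \<beta>] a by (simp add: min_ext_def)
  show "src \<Lambda> \<alpha> = src \<Lambda> \<beta>"
    using a assms src_cmp by metis
qed

lemma min_ext_same_degree:
  assumes "\<kappa> \<in> paths \<Lambda>" "\<mu> \<in> paths \<Lambda>" "deg \<Lambda> \<kappa> = deg \<Lambda> \<mu>" "\<kappa> \<noteq> \<mu>"
  shows "min_ext \<Lambda> \<kappa> \<mu> = {}"
proof -
  have "\<kappa> = \<mu>" if "(\<alpha>, \<beta>) \<in> min_ext \<Lambda> \<kappa> \<mu>" for \<alpha> \<beta>
    using factor_unique[of \<kappa> \<alpha> \<mu> \<beta>] min_extD[OF assms(1,2) that] assms by auto
  thus ?thesis using assms(4) by auto
qed

end

text \<open>Finitely many paths of each degree make the sums in (T5) finite, and finitely many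
  vertices provide a unit of the Toeplitz algebra.\<close>

locale row_finite = two_graph \<Lambda> for \<Lambda> :: "'p two_graph" +
  assumes finite_paths_into: "finite (paths_into \<Lambda> z n)"
    and finite_vertices: "finite (vertices \<Lambda>)"
begin

text \<open>All minimal common extensions of a pair have the same two degrees, because these
  complete d(\<mu>) and d(\<nu>) to their join. The extensions thus lie in a product of two finite
  sets.\<close>

lemma finite_min_ext:
  assumes "\<mu> \<in> paths \<Lambda>" "\<nu> \<in> paths \<Lambda>"
  shows "finite (min_ext \<Lambda> \<mu> \<nu>)"
proof (cases "min_ext \<Lambda> \<mu> \<nu> = {}")
  case False
  then obtain \<alpha>0 \<beta>0 where 0: "(\<alpha>0, \<beta>0) \<in> min_ext \<Lambda> \<mu> \<nu>" by auto
  have "min_ext \<Lambda> \<mu> \<nu> \<subseteq> paths_into \<Lambda> (src \<Lambda> \<mu>) (deg \<Lambda> \<alpha>0) \<times> paths_into \<Lambda> (src \<Lambda> \<nu>) (deg \<Lambda> \<beta>0)"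
  proof
    fix i assume i: "i \<in> min_ext \<Lambda> \<mu> \<nu>"
    obtain \<alpha> \<beta> where ab: "i = (\<alpha>, \<beta>)" by fastforce
    note 1 = min_extD[OF assms i[unfolded ab]]
    have "deg \<Lambda> \<mu> + deg \<Lambda> \<alpha> = deg \<Lambda> \<mu> + deg \<Lambda> \<alpha>0" "deg \<Lambda> \<nu> + deg \<Lambda> \<beta> = deg \<Lambda> \<nu> + deg \<Lambda> \<beta>0"
      using 1(6,7) min_extD(6,7)[OF assms 0] by simp_all
    hence "deg \<Lambda> \<alpha> = deg \<Lambda> \<alpha>0" "deg \<Lambda> \<beta> = deg \<Lambda> \<beta>0" by simp_all
    thus "i \<in> paths_into \<Lambda> (src \<Lambda> \<mu>) (deg \<Lambda> \<alpha>0) \<times> paths_into \<Lambda> (src \<Lambda> \<nu>) (deg \<Lambda> \<beta>0)"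
      using 1(1-4) by (simp add: ab paths_into_def)
  qed
  thus ?thesis by (rule finite_subset) (intro finite_cartesian_product finite_paths_into)
qed simp

end

text \<open>Condition (T4) is left out: it follows from the other ones.\<close>

locale toeplitz_seminorm = row_finite \<Lambda> + cstar_on \<Lambda> P
  for \<Lambda> :: "'p two_graph" and P :: "'p npoly \<Rightarrow> real" +
  assumes t_isometry: "\<kappa> \<in> paths \<Lambda> \<Longrightarrow> gen \<kappa> * gadj \<kappa> * gen \<kappa> \<doteq> gen \<kappa>"
    and t_vertex_adj: "z \<in> vertices \<Lambda> \<Longrightarrow> gadj z \<doteq> gen z"
    and t_vertex_idem: "z \<in> vertices \<Lambda> \<Longrightarrow> gen z * gen z \<doteq> gen z"
    and t_vertex_orth: "z \<in> vertices \<Lambda> \<Longrightarrow> w \<in> vertices \<Lambda> \<Longrightarrow> z \<noteq> w \<Longrightarrow> gen z * gen w \<doteq> 0"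
    and t_mult: "\<kappa> \<in> paths \<Lambda> \<Longrightarrow> \<mu> \<in> paths \<Lambda> \<Longrightarrow> src \<Lambda> \<kappa> = rng \<Lambda> \<mu> \<Longrightarrow> gen \<kappa> * gen \<mu> \<doteq> gen (cmp \<Lambda> \<kappa> \<mu>)"
    and t_source: "\<kappa> \<in> paths \<Lambda> \<Longrightarrow> gadj \<kappa> * gen \<kappa> \<doteq> gen (src \<Lambda> \<kappa>)"
    and t_min_ext: "\<mu> \<in> paths \<Lambda> \<Longrightarrow> \<nu> \<in> paths \<Lambda> \<Longrightarrow>
       gadj \<mu> * gen \<nu> \<doteq> (\<Sum>(\<alpha>, \<beta>)\<in>min_ext \<Lambda> \<mu> \<nu>. gen \<alpha> * gadj \<beta>)"
begin

lemma t_src: "\<kappa> \<in> paths \<Lambda> \<Longrightarrow> gen \<kappa> * gen (src \<Lambda> \<kappa>) \<doteq> gen \<kappa>"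
  using t_mult[of \<kappa> "src \<Lambda> \<kappa>"] by (simp add: src_closed rng_src cmp_src)

lemma t_rng: "\<kappa> \<in> paths \<Lambda> \<Longrightarrow> gen (rng \<Lambda> \<kappa>) * gen \<kappa> \<doteq> gen \<kappa>"
  using t_mult[of "rng \<Lambda> \<kappa>" \<kappa>] by (simp add: rng_closed src_rng cmp_rng)

lemma eqv_mult_left_assoc: "f * g \<doteq> h \<Longrightarrow> k \<in> fpoly \<Lambda> \<Longrightarrow> k * f * g \<doteq> k * h"
  using eqv_mult_left[of "f * g" h k] by (simp add: mult.assoc)

text \<open>Inserting the vertex projections between the factors produces a product of two
  orthogonal ones.\<close>

lemma t_mult_zero:
  assumes "\<kappa> \<in> paths \<Lambda>" "\<mu> \<in> paths \<Lambda>" "src \<Lambda> \<kappa> \<noteq> rng \<Lambda> \<mu>"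
  shows "gen \<kappa> * gen \<mu> \<doteq> 0"
proof -
  note c = assms(1,2) rng_closed src_closed
  have "gen \<kappa> * gen \<mu> \<doteq> (gen \<kappa> * gen (src \<Lambda> \<kappa>)) * (gen (rng \<Lambda> \<mu>) * gen \<mu>)"
    using c by (intro eqv_mult eqv_sym[OF t_src] eqv_sym[OF t_rng]) auto
  also have "\<dots> = gen \<kappa> * (gen (src \<Lambda> \<kappa>) * gen (rng \<Lambda> \<mu>)) * gen \<mu>" by (simp add: mult.assoc)
  also have "\<dots> \<doteq> gen \<kappa> * 0 * gen \<mu>"
    using assms c by (intro eqv_mult eqv_refl t_vertex_orth rng_vertex src_vertex) auto
  finally show ?thesis by simp
qed

lemma t_adj_mult: "\<kappa> \<in> paths \<Lambda> \<Longrightarrow> \<mu> \<in> paths \<Lambda> \<Longrightarrow> src \<Lambda> \<kappa> = rng \<Lambda> \<mu> \<Longrightarrow> gadj \<mu> * gadj \<kappa> \<doteq> gadj (cmp \<Lambda> \<kappa> \<mu>)"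
  using eqv_padj[OF t_mult] by (simp add: padj_mult)

lemma t_adj_mult_zero: "\<kappa> \<in> paths \<Lambda> \<Longrightarrow> \<mu> \<in> paths \<Lambda> \<Longrightarrow> src \<Lambda> \<kappa> \<noteq> rng \<Lambda> \<mu> \<Longrightarrow> gadj \<mu> * gadj \<kappa> \<doteq> 0"
  using eqv_padj[OF t_mult_zero] by (simp add: padj_mult)

lemma t_same_degree:
  "\<kappa> \<in> paths \<Lambda> \<Longrightarrow> \<mu> \<in> paths \<Lambda> \<Longrightarrow> deg \<Lambda> \<kappa> = deg \<Lambda> \<mu> \<Longrightarrow> \<kappa> \<noteq> \<mu> \<Longrightarrow> gadj \<kappa> * gen \<mu> \<doteq> 0"
  using t_min_ext[of \<kappa> \<mu>] by (simp add: min_ext_same_degree)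

lemma vertex_projection:
  assumes "z \<in> vertices \<Lambda>" shows "padj (gen z) * gen z \<doteq> gen z"
  using eqv_mult_right[OF t_vertex_adj[OF assms], of "gen z"] t_vertex_idem[OF assms] vertex_closed[OF assms]
  by (auto intro: eqv_trans)

definition range_sum :: "'p set \<Rightarrow> 'p npoly" where "range_sum G = (\<Sum>\<kappa>\<in>G. gen \<kappa> * gadj \<kappa>)"

lemma range_sum_fpoly [simp]: "G \<subseteq> paths \<Lambda> \<Longrightarrow> range_sum G \<in> fpoly \<Lambda>"
  unfolding range_sum_def by auto

lemma padj_range_sum [simp]: "padj (range_sum G) = range_sum G"
  by (simp add: range_sum_def padj_sum padj_mult)

lemma range_sum_gen:
  assumes G: "finite G" "G \<subseteq> paths \<Lambda>" and orth: "\<And>\<kappa> \<mu>. \<kappa> \<in> G \<Longrightarrow> \<mu> \<in> G \<Longrightarrow> \<kappa> \<noteq> \<mu> \<Longrightarrow> gadj \<kappa> * gen \<mu> \<doteq> 0"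
    and \<mu>: "\<mu> \<in> G"
  shows "range_sum G * gen \<mu> \<doteq> gen \<mu>"
proof -
  have m: "\<mu> \<in> paths \<Lambda>" using \<mu> G by auto
  have "range_sum G * gen \<mu> = (\<Sum>\<kappa>\<in>G. gen \<kappa> * gadj \<kappa> * gen \<mu>)" by (simp add: range_sum_def sum_distrib_right)
  also have "\<dots> \<doteq> (\<Sum>\<kappa>\<in>G. if \<kappa> = \<mu> then gen \<mu> else 0)"
  proof (rule eqv_sum)
    fix \<kappa> assume k: "\<kappa> \<in> G"
    show "gen \<kappa> * gadj \<kappa> * gen \<mu> \<doteq> (if \<kappa> = \<mu> then gen \<mu> else 0)"
    proof (cases "\<kappa> = \<mu>")
      case False
      hence "gen \<kappa> * gadj \<kappa> * gen \<mu> \<doteq> gen \<kappa> * 0"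
        using orth k \<mu> G by (intro eqv_mult_left_assoc) auto
      thus ?thesis using False by simp
    qed (use t_isometry m in auto)
  qed
  also have "\<dots> = gen \<mu>" using G \<mu> by (simp add: sum.delta)
  finally show ?thesis .
qed

text \<open>E acts as a unit on the ranges of G, so E S = S and, by adjoints, S E = S for the range
  sum S; orthogonality gives S S = S. With a vertex for E this yields (T4), with
  \<open>unit_sum\<close> the complements needed for the paths with source v.\<close>

lemma complement_projection:
  assumes G: "finite G" "G \<subseteq> paths \<Lambda>" and orth: "\<And>\<kappa> \<mu>. \<kappa> \<in> G \<Longrightarrow> \<mu> \<in> G \<Longrightarrow> \<kappa> \<noteq> \<mu> \<Longrightarrow> gadj \<kappa> * gen \<mu> \<doteq> 0"
    and E: "padj E \<doteq> E" "E * E \<doteq> E" "\<And>\<kappa>. \<kappa> \<in> G \<Longrightarrow> E * gen \<kappa> \<doteq> gen \<kappa>"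
  shows "padj (E - range_sum G) * (E - range_sum G) \<doteq> E - range_sum G"
proof -
  have Ef: "E \<in> fpoly \<Lambda>" using E(1) eqv_fpoly by blast
  let ?S = "range_sum G"
  have ES: "E * ?S \<doteq> ?S"
    unfolding range_sum_def sum_distrib_left mult.assoc[symmetric]
    using G E by (intro eqv_sum eqv_mult_right) auto
  have "?S * padj E \<doteq> ?S" using eqv_padj[OF ES] by (simp add: padj_mult)
  moreover have "?S * padj E \<doteq> ?S * E" using E G by (intro eqv_mult_left) auto
  ultimately have SE: "?S * E \<doteq> ?S" using eqv_sym eqv_trans by blast
  have "?S * ?S = (\<Sum>\<mu>\<in>G. ?S * gen \<mu> * gadj \<mu>)"
    unfolding range_sum_def[of G] by (simp add: sum_distrib_left mult.assoc)
  also have "\<dots> \<doteq> (\<Sum>\<mu>\<in>G. gen \<mu> * gadj \<mu>)"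
    using G orth by (intro eqv_sum eqv_mult_right range_sum_gen) auto
  finally have SS: "?S * ?S \<doteq> ?S" by (simp add: range_sum_def)
  have "padj (E - ?S) * (E - ?S) \<doteq> (E - ?S) * (E - ?S)"
    using E G Ef by (intro eqv_mult_right) (auto simp: padj_minus intro: eqv_minus)
  also have "(E - ?S) * (E - ?S) = (E * E - E * ?S) - (?S * E - ?S * ?S)" by (simp add: algebra_simps)
  also have "\<dots> \<doteq> (E - ?S) - (?S - ?S)" by (intro eqv_minus E ES SE SS)
  finally show ?thesis by simp
qed

text \<open>The free algebra has no unit, but the sum of the vertex projections becomes one in the
  completion.\<close>

definition unit_sum :: "'p npoly" where "unit_sum = (\<Sum>z\<in>vertices \<Lambda>. gen z)"

lemma unit_sum_fpoly [simp, intro]: "unit_sum \<in> fpoly \<Lambda>"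
  unfolding unit_sum_def by (auto intro: vertex_closed)

lemma padj_unit_sum: "padj unit_sum \<doteq> unit_sum"
  unfolding unit_sum_def padj_sum by (intro eqv_sum) (simp add: t_vertex_adj)

lemma unit_sum_gen:
  assumes k: "\<kappa> \<in> paths \<Lambda>" shows "unit_sum * gen \<kappa> \<doteq> gen \<kappa>"
proof -
  have "unit_sum * gen \<kappa> = (\<Sum>z\<in>vertices \<Lambda>. gen z * gen \<kappa>)" by (simp add: unit_sum_def sum_distrib_right)
  also have "\<dots> \<doteq> (\<Sum>z\<in>vertices \<Lambda>. if z = rng \<Lambda> \<kappa> then gen \<kappa> else 0)"
    using k by (intro eqv_sum) (auto simp: t_rng vertex_closed vertex_rng_src intro!: t_mult_zero)
  also have "\<dots> = gen \<kappa>" using rng_vertex[OF k] finite_vertices by (simp add: sum.delta)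
  finally show ?thesis .
qed

lemma unit_sum_gadj:
  assumes k: "\<kappa> \<in> paths \<Lambda>" shows "unit_sum * gadj \<kappa> \<doteq> gadj \<kappa>"
proof -
  have a: "gen (src \<Lambda> \<kappa>) * gadj \<kappa> \<doteq> gadj \<kappa>"
  proof -
    have "gadj (src \<Lambda> \<kappa>) * gadj \<kappa> \<doteq> gadj \<kappa>" using eqv_padj[OF t_src[OF k]] by (simp add: padj_mult)
    moreover have "gadj (src \<Lambda> \<kappa>) * gadj \<kappa> \<doteq> gen (src \<Lambda> \<kappa>) * gadj \<kappa>"
      using k src_vertex by (intro eqv_mult_right t_vertex_adj) auto
    ultimately show ?thesis using eqv_sym eqv_trans by blast
  qed
  have "unit_sum * gadj \<kappa> \<doteq> unit_sum * (gen (src \<Lambda> \<kappa>) * gadj \<kappa>)"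
    using a by (intro eqv_mult_left) (auto intro: eqv_sym)
  also have "\<dots> = unit_sum * gen (src \<Lambda> \<kappa>) * gadj \<kappa>" by (simp add: mult.assoc)
  also have "\<dots> \<doteq> gen (src \<Lambda> \<kappa>) * gadj \<kappa>" using k src_closed by (intro eqv_mult_right unit_sum_gen) auto
  also note a
  finally show ?thesis .
qed

text \<open>Admissible words are nonempty, and the first letter alone decides the effect of left
  multiplication.\<close>

lemma unit_sum_mult:
  assumes "f \<in> fpoly \<Lambda>" shows "unit_sum * f \<doteq> f"
  using assms
proof (induction rule: fpoly_induct)
  case (monom w c)
  then obtain \<kappa> b w' where w: "w = (\<kappa>, b) # w'" "\<kappa> \<in> paths \<Lambda>" by (cases w) (auto simp: words_def)
  let ?l = "monom_of [(\<kappa>, b)] 1"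
  have l: "?l \<in> fpoly \<Lambda>" using w by (intro fpoly_monom) (auto simp: words_def)
  have ul: "unit_sum * ?l \<doteq> ?l"
    using unit_sum_gen[OF w(2)] unit_sum_gadj[OF w(2)] by (cases b) (auto simp: gen_def gadj_def)
  show ?case
  proof (cases "w' = []")
    case True
    thus ?thesis using eqv_pscale[OF ul, of c] w by (simp add: mult_pscale[symmetric])
  next
    case False
    have r: "monom_of w' c \<in> fpoly \<Lambda>" using False monom w by (intro fpoly_monom) (auto simp: words_def)
    have "monom_of w c = ?l * monom_of w' c" using w by (simp add: monom_mult)
    thus ?thesis using eqv_mult_right[OF ul r] by (simp add: mult.assoc)
  qed
qed (auto simp: distrib_left intro: eqv_add)

lemma mult_unit_sum: assumes "f \<in> fpoly \<Lambda>" shows "f * unit_sum \<doteq> f"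
proof -
  have "f * unit_sum \<doteq> f * padj unit_sum" using assms by (intro eqv_mult_left eqv_sym[OF padj_unit_sum])
  also have "\<dots> = padj (unit_sum * padj f)" by (simp add: padj_mult)
  also have "\<dots> \<doteq> f" using eqv_padj[OF unit_sum_mult[of "padj f"]] assms by simp
  finally show ?thesis .
qed

lemma P_unit_sum: "P unit_sum \<le> 1"
proof (rule projection_norm)
  have "padj unit_sum * unit_sum \<doteq> unit_sum * unit_sum" by (intro eqv_mult_right padj_unit_sum) auto
  thus "padj unit_sum * unit_sum \<doteq> unit_sum" using unit_sum_mult eqv_trans by blast
qed

lemma P_gen: assumes "\<kappa> \<in> paths \<Lambda>" shows "P (gen \<kappa>) \<le> 1"
proof -
  have "(P (gen \<kappa>))\<^sup>2 = P (gen (src \<Lambda> \<kappa>))"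
    using P_cstar[of "gen \<kappa>"] eqv_norm[OF t_source[OF assms]] assms by simp
  also have "\<dots> \<le> 1" by (intro projection_norm vertex_projection src_vertex assms)
  finally show ?thesis using P_nonneg[of "gen \<kappa>"] assms by (simp add: power_le_one_iff)
qed

lemma P_word: "w \<in> words \<Lambda> \<Longrightarrow> P (monom_of w 1) \<le> 1"
proof (induction w)
  case (Cons l w)
  obtain \<kappa> b where l: "l = (\<kappa>, b)" by fastforce
  have k: "\<kappa> \<in> paths \<Lambda>" using Cons.prems l by (auto simp: words_def)
  have lf: "monom_of [l] 1 \<in> fpoly \<Lambda>" using k l by (intro fpoly_monom) (auto simp: words_def)
  have P1: "P (monom_of [l] 1) \<le> 1"
    using P_gen[OF k] P_padj[OF fpoly_gen[OF k]] l by (cases b) (auto simp: gen_def gadj_def adj_word_def)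
  show ?case
  proof (cases "w = []")
    case False
    hence w: "w \<in> words \<Lambda>" using Cons.prems by (auto simp: words_def)
    have "P (monom_of (l # w) 1) = P (monom_of [l] 1 * monom_of w 1)" by (simp add: monom_mult)
    also have "\<dots> \<le> P (monom_of [l] 1) * P (monom_of w 1)" using lf fpoly_monom[OF w] by (rule P_mult)
    also have "\<dots> \<le> 1" using P1 Cons.IH[OF w] P_nonneg[OF lf] P_nonneg[OF fpoly_monom[OF w]]
      by (simp add: mult_le_one)
    finally show ?thesis .
  qed (use P1 in simp)
qed (simp add: words_def)

text \<open>The bound does not involve P, because every letter has seminorm at most 1. It makes the
  supremum over all Toeplitz seminorms finite.\<close>

lemma P_bound:
  assumes "f \<in> fpoly \<Lambda>" shows "P f \<le> (\<Sum>w\<in>support f. cmod (coeff_of f w))"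
proof -
  have "P (\<Sum>w\<in>S. monom_of w (coeff_of f w)) \<le> (\<Sum>w\<in>S. cmod (coeff_of f w))"
    if "finite S" "S \<subseteq> words \<Lambda>" for S
    using that
  proof (induction S)
    case (insert w S)
    have m: "monom_of w (coeff_of f w) \<in> fpoly \<Lambda>" using insert.prems by (intro fpoly_monom) auto
    have s: "(\<Sum>w\<in>S. monom_of w (coeff_of f w)) \<in> fpoly \<Lambda>" using insert.prems by (intro fpoly_sum fpoly_monom) auto
    have "P (monom_of w (coeff_of f w)) = cmod (coeff_of f w) * P (monom_of w 1)"
      using P_pscale[of "monom_of w 1" "coeff_of f w"] insert.prems by (simp add: fpoly_monom)
    also have "\<dots> \<le> cmod (coeff_of f w)" using P_word[of w] insert.prems by (simp add: mult_left_le)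
    finally show ?case using insert P_add[OF m s] by simp
  qed simp
  thus ?thesis using npoly_expand[of f] assms unfolding fpoly_def by (metis finite_keys mem_Collect_eq)
qed

end

text \<open>Two polynomials have the same image in the completion exactly when they are congruent
  modulo seminorm zero, so each equation can be read off the polynomials. Only the order relation
  (T4) needs an argument.\<close>

lemma (in row_finite) toeplitz_family_iff:
  assumes "cstar_seminorm \<Lambda> p"
  shows "toeplitz_family \<Lambda> (completion (free_algebra \<Lambda> p))
            (\<lambda>\<kappa>. completion_embed (free_algebra \<Lambda> p) (free_generator \<kappa>))
     \<longleftrightarrow> toeplitz_seminorm \<Lambda> (\<lambda>f. p (coeff_of f))"
proof -
  interpret cstar_on \<Lambda> "\<lambda>f. p (coeff_of f)" using assms by (simp add: cstar_seminorm_iff)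
  write eqv (infix "\<doteq>" 50)
  interpret F: star_alg "free_algebra \<Lambda> p" by (rule free_star_alg) simp
  interpret C: star_alg "completion (free_algebra \<Lambda> p)" by (rule F.completion_star_alg)
  let ?C = "completion (free_algebra \<Lambda> p)"
  define em where "em f = F.emb (coeff_of f)" for f
  have car: "f \<in> fpoly \<Lambda> \<Longrightarrow> coeff_of f \<in> carrier (free_algebra \<Lambda> p)" for f by (simp add: carrier_free)
  have em_closed: "f \<in> fpoly \<Lambda> \<Longrightarrow> em f \<in> carrier ?C" for f using car by (simp add: em_def)
  have em_zero: "azero ?C = em 0" unfolding em_def using F.emb_zero by (simp add: free_sel)
  have em_mult: "f \<in> fpoly \<Lambda> \<Longrightarrow> g \<in> fpoly \<Lambda> \<Longrightarrow> em f \<boxtimes>\<^bsub>?C\<^esub> em g = em (f * g)" for f g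
    using F.emb_times[OF car car, of f g] by (simp add: em_def free_sel)
  have em_minus: "f \<in> fpoly \<Lambda> \<Longrightarrow> g \<in> fpoly \<Lambda> \<Longrightarrow> em f \<boxminus>\<^bsub>?C\<^esub> em g = em (f - g)" for f g
    using F.emb_minus[OF car car, of f g] by (simp add: em_def free_sel)
  have em_star: "f \<in> fpoly \<Lambda> \<Longrightarrow> astar ?C (em f) = em (padj f)" for f
    using F.emb_star[OF car, of f] by (simp add: em_def free_sel)
  have em_eq: "em f = em g \<longleftrightarrow> f \<doteq> g" if "f \<in> fpoly \<Lambda>" "g \<in> fpoly \<Lambda>" for f g
    unfolding em_def using F.emb_eq_iff car that by (simp add: free_sel eqv_def)
  have em_sum: "asum ?C (\<lambda>i. em (f i)) I = em (\<Sum>i\<in>I. f i)" if "finite I" "\<And>i. i \<in> I \<Longrightarrow> f i \<in> fpoly \<Lambda>"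
    for f and I :: "'x set"
    unfolding em_def using F.asum_emb[of I "\<lambda>i. coeff_of (f i)"] that car
    by (simp add: asum_free[OF F.star_alg_axioms])
  have em_gen: "F.emb (free_generator \<kappa>) = em (gen \<kappa>)" for \<kappa> by (simp add: em_def free_generator_eq)
  have T5: "asum ?C (\<lambda>(\<alpha>, \<beta>). em (gen \<alpha>) \<boxtimes>\<^bsub>?C\<^esub> astar ?C (em (gen \<beta>))) (min_ext \<Lambda> \<mu> \<nu>)
      = em (\<Sum>(\<alpha>, \<beta>)\<in>min_ext \<Lambda> \<mu> \<nu>. gen \<alpha> * gadj \<beta>)" if "\<mu> \<in> paths \<Lambda>" "\<nu> \<in> paths \<Lambda>" for \<mu> \<nu>
  proof -
    have m: "fst i \<in> paths \<Lambda>" "snd i \<in> paths \<Lambda>" if "i \<in> min_ext \<Lambda> \<mu> \<nu>" for i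
      using that by (auto simp: min_ext_def)
    have "asum ?C (\<lambda>(\<alpha>, \<beta>). em (gen \<alpha>) \<boxtimes>\<^bsub>?C\<^esub> astar ?C (em (gen \<beta>))) (min_ext \<Lambda> \<mu> \<nu>)
        = asum ?C (\<lambda>i. em (gen (fst i) * gadj (snd i))) (min_ext \<Lambda> \<mu> \<nu>)"
      unfolding asum_def
      by (rule comm_monoid.finprod_cong'[OF C.comm_monoid_add])
        (auto simp: em_mult em_star em_closed min_ext_def)
    also have "\<dots> = em (\<Sum>i\<in>min_ext \<Lambda> \<mu> \<nu>. gen (fst i) * gadj (snd i))"
      using m finite_min_ext[OF that] by (intro em_sum) auto
    finally show ?thesis by (simp add: case_prod_beta)
  qed
  have sum_fpoly: "(\<Sum>(\<alpha>, \<beta>)\<in>min_ext \<Lambda> \<mu> \<nu>. gen \<alpha> * gadj \<beta>) \<in> fpoly \<Lambda>" for \<mu> \<nu>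
    by (rule fpoly_sum) (auto simp: min_ext_def)
  \<comment> \<open>The difference in (T4) is a projection c, and c equals its adjoint times itself,
    which is the form that \<open>ale\<close> asks for.\<close>
  have T4: "ale ?C (asum ?C (\<lambda>\<kappa>. em (gen \<kappa>) \<boxtimes>\<^bsub>?C\<^esub> astar ?C (em (gen \<kappa>))) G) (em (gen z))"
    if T: "toeplitz_seminorm \<Lambda> (\<lambda>f. p (coeff_of f))" and z: "z \<in> vertices \<Lambda>" and G: "finite G" "G \<subseteq> paths_into \<Lambda> z n"
    for z n G
  proof -
    interpret T: toeplitz_seminorm \<Lambda> "\<lambda>f. p (coeff_of f)" by (rule T)
    have Gp: "\<kappa> \<in> paths \<Lambda>" "deg \<Lambda> \<kappa> = n" "rng \<Lambda> \<kappa> = z" if "\<kappa> \<in> G" for \<kappa>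
      using that G by (auto simp: paths_into_def)
    let ?c = "gen z - T.range_sum G"
    have S: "T.range_sum G \<in> fpoly \<Lambda>" using Gp(1) by (simp add: subset_iff)
    have proj: "padj ?c * ?c \<doteq> ?c"
    proof (rule T.complement_projection)
      show "padj (gen z) \<doteq> gen z" "gen z * gen z \<doteq> gen z" using z T.t_vertex_adj T.t_vertex_idem by auto
      show "gen z * gen \<kappa> \<doteq> gen \<kappa>" if "\<kappa> \<in> G" for \<kappa> using T.t_rng[of \<kappa>] Gp[OF that] by simp
    qed (use G Gp in \<open>auto intro!: T.t_same_degree\<close>)
    have "asum ?C (\<lambda>\<kappa>. em (gen \<kappa>) \<boxtimes>\<^bsub>?C\<^esub> astar ?C (em (gen \<kappa>))) G = asum ?C (\<lambda>\<kappa>. em (gen \<kappa> * gadj \<kappa>)) G"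
      unfolding asum_def using Gp
      by (intro comm_monoid.finprod_cong'[OF C.comm_monoid_add]) (auto simp: em_mult em_star em_closed)
    also have "\<dots> = em (T.range_sum G)" unfolding T.range_sum_def using G Gp by (intro em_sum) auto
    finally have "em (gen z) \<boxminus>\<^bsub>?C\<^esub> asum ?C (\<lambda>\<kappa>. em (gen \<kappa>) \<boxtimes>\<^bsub>?C\<^esub> astar ?C (em (gen \<kappa>))) G = em ?c"
      using S z vertex_closed by (simp add: em_minus)
    also have "\<dots> = em (padj ?c * ?c)" using eqv_sym[OF proj] em_eq[OF eqv_fpoly(2,1)[OF proj]] by blast
    also have "\<dots> = astar ?C (em ?c) \<boxtimes>\<^bsub>?C\<^esub> em ?c" using eqv_fpoly[OF proj] by (simp add: em_mult em_star)
    finally show ?thesis unfolding ale_def using em_closed eqv_fpoly[OF proj] by blast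
  qed
  have cl: "gen \<kappa> \<in> fpoly \<Lambda>" "gadj \<kappa> \<in> fpoly \<Lambda>" if "\<kappa> \<in> paths \<Lambda>" for \<kappa> using that by auto
  have rel: "(em (gen \<kappa>) \<in> carrier ?C \<and> em (gen \<kappa>) \<boxtimes>\<^bsub>?C\<^esub> astar ?C (em (gen \<kappa>)) \<boxtimes>\<^bsub>?C\<^esub> em (gen \<kappa>) = em (gen \<kappa>))
       \<longleftrightarrow> gen \<kappa> * gadj \<kappa> * gen \<kappa> \<doteq> gen \<kappa>" if "\<kappa> \<in> paths \<Lambda>" for \<kappa>
    using that by (simp add: em_mult em_star em_closed em_eq cl)
  have relz: "(astar ?C (em (gen z)) = em (gen z) \<and> em (gen z) \<boxtimes>\<^bsub>?C\<^esub> em (gen z) = em (gen z))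
       \<longleftrightarrow> gadj z \<doteq> gen z \<and> gen z * gen z \<doteq> gen z" if "z \<in> vertices \<Lambda>" for z
    using vertex_closed[OF that] by (simp add: em_mult em_star em_closed em_eq cl)
  have relo: "em (gen z) \<boxtimes>\<^bsub>?C\<^esub> em (gen w) = azero ?C \<longleftrightarrow> gen z * gen w \<doteq> 0"
    if "z \<in> vertices \<Lambda>" "w \<in> vertices \<Lambda>" for z w
    using that[THEN vertex_closed] by (simp add: em_mult em_zero em_eq cl)
  have relm: "em (gen \<kappa>) \<boxtimes>\<^bsub>?C\<^esub> em (gen \<mu>) = em (gen (cmp \<Lambda> \<kappa> \<mu>)) \<longleftrightarrow> gen \<kappa> * gen \<mu> \<doteq> gen (cmp \<Lambda> \<kappa> \<mu>)"
    if "\<kappa> \<in> paths \<Lambda>" "\<mu> \<in> paths \<Lambda>" "src \<Lambda> \<kappa> = rng \<Lambda> \<mu>" for \<kappa> \<mu>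
    using that cmp_closed[OF that] by (simp add: em_mult em_eq cl)
  have rels: "astar ?C (em (gen \<kappa>)) \<boxtimes>\<^bsub>?C\<^esub> em (gen \<kappa>) = em (gen (src \<Lambda> \<kappa>)) \<longleftrightarrow> gadj \<kappa> * gen \<kappa> \<doteq> gen (src \<Lambda> \<kappa>)"
    if "\<kappa> \<in> paths \<Lambda>" for \<kappa>
    using that src_closed[OF that] by (simp add: em_mult em_star em_eq cl)
  have relmin: "astar ?C (em (gen \<mu>)) \<boxtimes>\<^bsub>?C\<^esub> em (gen \<nu>)
       = asum ?C (\<lambda>(\<alpha>, \<beta>). em (gen \<alpha>) \<boxtimes>\<^bsub>?C\<^esub> astar ?C (em (gen \<beta>))) (min_ext \<Lambda> \<mu> \<nu>)
     \<longleftrightarrow> gadj \<mu> * gen \<nu> \<doteq> (\<Sum>(\<alpha>, \<beta>)\<in>min_ext \<Lambda> \<mu> \<nu>. gen \<alpha> * gadj \<beta>)"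
    if "\<mu> \<in> paths \<Lambda>" "\<nu> \<in> paths \<Lambda>" for \<mu> \<nu>
    using that by (simp add: em_mult em_star em_eq cl T5 sum_fpoly)
  let ?B = "(\<forall>\<kappa> \<in> paths \<Lambda>. gen \<kappa> * gadj \<kappa> * gen \<kappa> \<doteq> gen \<kappa>)
   \<and> (\<forall>z \<in> vertices \<Lambda>. gadj z \<doteq> gen z \<and> gen z * gen z \<doteq> gen z)
   \<and> (\<forall>z \<in> vertices \<Lambda>. \<forall>w \<in> vertices \<Lambda>. z \<noteq> w \<longrightarrow> gen z * gen w \<doteq> 0)
   \<and> (\<forall>\<kappa> \<in> paths \<Lambda>. \<forall>\<mu> \<in> paths \<Lambda>. src \<Lambda> \<kappa> = rng \<Lambda> \<mu> \<longrightarrow> gen \<kappa> * gen \<mu> \<doteq> gen (cmp \<Lambda> \<kappa> \<mu>))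
   \<and> (\<forall>\<kappa> \<in> paths \<Lambda>. gadj \<kappa> * gen \<kappa> \<doteq> gen (src \<Lambda> \<kappa>))
   \<and> (\<forall>\<mu> \<in> paths \<Lambda>. \<forall>\<nu> \<in> paths \<Lambda>. gadj \<mu> * gen \<nu> \<doteq> (\<Sum>(\<alpha>, \<beta>)\<in>min_ext \<Lambda> \<mu> \<nu>. gen \<alpha> * gadj \<beta>))"
  have B: "toeplitz_seminorm \<Lambda> (\<lambda>f. p (coeff_of f)) \<longleftrightarrow> ?B"
  proof
    assume "toeplitz_seminorm \<Lambda> (\<lambda>f. p (coeff_of f))"
    then interpret T: toeplitz_seminorm \<Lambda> "\<lambda>f. p (coeff_of f)" .
    show ?B
      by (intro conjI ballI impI T.t_isometry T.t_vertex_adj T.t_vertex_idem T.t_vertex_orth T.t_mult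
          T.t_source T.t_min_ext)
  next
    assume b: ?B
    show "toeplitz_seminorm \<Lambda> (\<lambda>f. p (coeff_of f))"
      by unfold_locales (use b in \<open>simp_all only: Ball_def simp_thms\<close>)
  qed
  let ?T4 = "\<forall>z \<in> vertices \<Lambda>. \<forall>n G. finite G \<and> G \<subseteq> paths_into \<Lambda> z n
        \<longrightarrow> ale ?C (asum ?C (\<lambda>\<kappa>. em (gen \<kappa>) \<boxtimes>\<^bsub>?C\<^esub> astar ?C (em (gen \<kappa>))) G) (em (gen z))"
  \<comment> \<open>(T4) stands before (T5) in the definition; it is moved to the end so that the
    other conditions can be matched one by one.\<close>
  have conj: "(a1 \<and> a2 \<and> a3 \<and> a4 \<and> a5 \<and> t \<and> a6) = ((b1 \<and> b2 \<and> b3 \<and> b4 \<and> b5 \<and> b6) \<and> t)"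
    if "a1 = b1" "a2 = b2" "a3 = b3" "a4 = b4" "a5 = b5" "a6 = b6" for a1 a2 a3 a4 a5 a6 b1 b2 b3 b4 b5 b6 t
    using that by blast
  have "toeplitz_family \<Lambda> ?C (\<lambda>\<kappa>. F.emb (free_generator \<kappa>)) \<longleftrightarrow> ?B \<and> ?T4"
    unfolding toeplitz_family_def em_gen
    by (rule conj; intro ball_cong refl rel relz relo relm rels relmin imp_cong)
  moreover have ?T4 if "toeplitz_seminorm \<Lambda> (\<lambda>f. p (coeff_of f))"
    by (intro ballI allI impI T4[OF that]) auto
  ultimately show ?thesis using B by argo
qed

section \<open>The largest Toeplitz seminorm\<close>

abbreviation tnorm :: "'p two_graph \<Rightarrow> 'p npoly \<Rightarrow> real" where
  "tnorm \<Lambda> f \<equiv> toeplitz_norm \<Lambda> (coeff_of f)"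

context row_finite
begin

text \<open>Every function on polynomials is a function of their coefficients, so the supremum may
  range over seminorms on the polynomial ring.\<close>

lemma tnorm_eq: "tnorm \<Lambda> f = Sup {P f |P. toeplitz_seminorm \<Lambda> P}"
proof -
  have inv: "(\<lambda>f. (P \<circ> Abs_poly_mapping) (coeff_of f)) = P" for P :: "'p npoly \<Rightarrow> real"
    by (simp add: fun_eq_iff lookup_inverse)
  have cs: "toeplitz_seminorm \<Lambda> (\<lambda>f. p (coeff_of f)) \<Longrightarrow> cstar_seminorm \<Lambda> p" for p
    by (simp add: cstar_seminorm_iff toeplitz_seminorm_def)
  have "{p (coeff_of f) |p. cstar_seminorm \<Lambda> p
     \<and> toeplitz_family \<Lambda> (completion (free_algebra \<Lambda> p))
         (\<lambda>\<kappa>. completion_embed (free_algebra \<Lambda> p) (free_generator \<kappa>))}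
     = {p (coeff_of f) |p. toeplitz_seminorm \<Lambda> (\<lambda>f. p (coeff_of f))}"
    using toeplitz_family_iff cs by blast
  also have "\<dots> = {P f |P. toeplitz_seminorm \<Lambda> P}"
  proof (intro equalityI subsetI)
    fix x assume "x \<in> {P f |P. toeplitz_seminorm \<Lambda> P}"
    then obtain P where P: "x = P f" "toeplitz_seminorm \<Lambda> P" by auto
    have "toeplitz_seminorm \<Lambda> (\<lambda>f. (P \<circ> Abs_poly_mapping) (coeff_of f))" using P(2) unfolding inv .
    moreover have "x = (P \<circ> Abs_poly_mapping) (coeff_of f)" by (simp add: P lookup_inverse)
    ultimately show "x \<in> {p (coeff_of f) |p. toeplitz_seminorm \<Lambda> (\<lambda>f. p (coeff_of f))}" by blast
  qed auto
  finally show ?thesis by (simp add: toeplitz_norm_def)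
qed

text \<open>A supremum of reals is bounded by its upper bounds only over a nonempty set; the zero
  seminorm is always admissible.\<close>

lemma zero_seminorm: "toeplitz_seminorm \<Lambda> (\<lambda>f. 0)"
proof -
  have c: "cstar_on \<Lambda> (\<lambda>f. 0)" by unfold_locales auto
  have m: "(\<Sum>(\<alpha>, \<beta>)\<in>min_ext \<Lambda> \<mu> \<nu>. gen \<alpha> * gadj \<beta>) \<in> fpoly \<Lambda>" for \<mu> \<nu>
    by (rule fpoly_sum) (auto simp: min_ext_def)
  have e: "cstar_on.eqv \<Lambda> (\<lambda>f. 0) f g" if "f \<in> fpoly \<Lambda>" "g \<in> fpoly \<Lambda>" for f g
    unfolding cstar_on.eqv_def[OF c] using that by blast
  show ?thesis
    by (intro toeplitz_seminorm.intro[OF row_finite_axioms c] toeplitz_seminorm_axioms.intro e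
        fpoly_mult fpoly_gen fpoly_gadj fpoly_zero m; simp add: vertex_closed cmp_closed src_closed)
qed

lemma seminorm_le_tnorm:
  assumes "toeplitz_seminorm \<Lambda> P" "f \<in> fpoly \<Lambda>"
  shows "P f \<le> tnorm \<Lambda> f"
proof -
  have "bdd_above {P f |P. toeplitz_seminorm \<Lambda> P}"
    using toeplitz_seminorm.P_bound[OF _ assms(2)]
    by (intro bdd_aboveI[of _ "\<Sum>w\<in>support f. cmod (coeff_of f w)"]) auto
  thus ?thesis unfolding tnorm_eq using assms(1) by (intro cSup_upper) auto
qed

lemma tnorm_le: "(\<And>P. toeplitz_seminorm \<Lambda> P \<Longrightarrow> P f \<le> b) \<Longrightarrow> tnorm \<Lambda> f \<le> b"
  unfolding tnorm_eq using zero_seminorm by (intro cSup_least) auto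

lemma tnorm_nonneg: "f \<in> fpoly \<Lambda> \<Longrightarrow> 0 \<le> tnorm \<Lambda> f"
  using seminorm_le_tnorm[OF zero_seminorm] .

text \<open>Each axiom holds for every admissible P with its right-hand side enlarged to the
  supremum; the supremum is then taken on the left.\<close>

lemma tnorm_cstar_on: "cstar_on \<Lambda> (tnorm \<Lambda>)"
proof unfold_locales
  fix f g :: "'p npoly" and c assume f: "f \<in> fpoly \<Lambda>"
  note le = seminorm_le_tnorm
  show "0 \<le> tnorm \<Lambda> f" by (rule tnorm_nonneg[OF f])
  show "tnorm \<Lambda> (pscale c f) = cmod c * tnorm \<Lambda> f"
  proof (rule antisym)
    show "tnorm \<Lambda> (pscale c f) \<le> cmod c * tnorm \<Lambda> f"
    proof (rule tnorm_le)
      fix P assume P: "toeplitz_seminorm \<Lambda> P"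
      interpret toeplitz_seminorm \<Lambda> P by (rule P)
      show "P (pscale c f) \<le> cmod c * tnorm \<Lambda> f" using le[OF P f] f by (simp add: P_pscale mult_left_mono)
    qed
    show "cmod c * tnorm \<Lambda> f \<le> tnorm \<Lambda> (pscale c f)"
    proof (cases "c = 0")
      case True thus ?thesis using tnorm_nonneg[of "pscale c f"] f by simp
    next
      case False
      have "tnorm \<Lambda> f \<le> tnorm \<Lambda> (pscale c f) / cmod c"
      proof (rule tnorm_le)
        fix P assume P: "toeplitz_seminorm \<Lambda> P"
        interpret toeplitz_seminorm \<Lambda> P by (rule P)
        show "P f \<le> tnorm \<Lambda> (pscale c f) / cmod c"
          using le[OF P, of "pscale c f"] f False by (simp add: P_pscale field_simps)
      qed
      thus ?thesis using False by (simp add: field_simps)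
    qed
  qed
  show "tnorm \<Lambda> (padj f * f) = (tnorm \<Lambda> f)\<^sup>2"
  proof (rule antisym)
    show "tnorm \<Lambda> (padj f * f) \<le> (tnorm \<Lambda> f)\<^sup>2"
    proof (rule tnorm_le)
      fix P assume P: "toeplitz_seminorm \<Lambda> P"
      interpret toeplitz_seminorm \<Lambda> P by (rule P)
      show "P (padj f * f) \<le> (tnorm \<Lambda> f)\<^sup>2" using le[OF P f] P_nonneg[OF f] f by (simp add: P_cstar power_mono)
    qed
    \<comment> \<open>Bounding each P f by a square root lets the supremum be taken before
      squaring.\<close>
    have "tnorm \<Lambda> f \<le> sqrt (tnorm \<Lambda> (padj f * f))"
    proof (rule tnorm_le)
      fix P assume P: "toeplitz_seminorm \<Lambda> P"
      interpret toeplitz_seminorm \<Lambda> P by (rule P)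
      show "P f \<le> sqrt (tnorm \<Lambda> (padj f * f))"
        using le[OF P, of "padj f * f"] f by (intro real_le_rsqrt) (simp add: P_cstar)
    qed
    thus "(tnorm \<Lambda> f)\<^sup>2 \<le> tnorm \<Lambda> (padj f * f)"
      using tnorm_nonneg[OF f] tnorm_nonneg[of "padj f * f"] f
      by (metis fpoly_mult fpoly_padj power_mono real_sqrt_pow2)
  qed
  assume g: "g \<in> fpoly \<Lambda>"
  show "tnorm \<Lambda> (f + g) \<le> tnorm \<Lambda> f + tnorm \<Lambda> g"
  proof (rule tnorm_le)
    fix P assume P: "toeplitz_seminorm \<Lambda> P"
    interpret toeplitz_seminorm \<Lambda> P by (rule P)
    show "P (f + g) \<le> tnorm \<Lambda> f + tnorm \<Lambda> g" using P_add[OF f g] le[OF P f] le[OF P g] by simp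
  qed
  show "tnorm \<Lambda> (f * g) \<le> tnorm \<Lambda> f * tnorm \<Lambda> g"
  proof (rule tnorm_le)
    fix P assume P: "toeplitz_seminorm \<Lambda> P"
    interpret toeplitz_seminorm \<Lambda> P by (rule P)
    have "P f * P g \<le> tnorm \<Lambda> f * tnorm \<Lambda> g"
      using le[OF P f] le[OF P g] P_nonneg[OF f] P_nonneg[OF g] by (intro mult_mono) auto
    thus "P (f * g) \<le> tnorm \<Lambda> f * tnorm \<Lambda> g" using P_mult[OF f g] by simp
  qed
qed

text \<open>A difference that vanishes for every admissible P vanishes for the supremum. Hence the
  Toeplitz relations hold in the largest seminorm, which is itself admissible.\<close>

lemma tnorm_eqvI:
  assumes "\<And>P. toeplitz_seminorm \<Lambda> P \<Longrightarrow> cstar_on.eqv \<Lambda> P f g"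
  shows "cstar_on.eqv \<Lambda> (tnorm \<Lambda>) f g"
proof -
  have P: "f \<in> fpoly \<Lambda> \<and> g \<in> fpoly \<Lambda> \<and> P (f - g) = 0" if "toeplitz_seminorm \<Lambda> P" for P
    using assms[OF that] that by (simp add: cstar_on.eqv_def toeplitz_seminorm_def)
  have fg: "f \<in> fpoly \<Lambda>" "g \<in> fpoly \<Lambda>" using P[OF zero_seminorm] by auto
  moreover have "tnorm \<Lambda> (f - g) \<le> 0" by (rule tnorm_le) (simp add: P)
  ultimately have "tnorm \<Lambda> (f - g) = 0" using tnorm_nonneg[of "f - g"] by simp
  thus ?thesis using fg by (simp add: cstar_on.eqv_def[OF tnorm_cstar_on])
qed

lemma tnorm_seminorm: "toeplitz_seminorm \<Lambda> (tnorm \<Lambda>)"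
  by (rule toeplitz_seminorm.intro[OF row_finite_axioms tnorm_cstar_on], rule toeplitz_seminorm_axioms.intro;
      rule tnorm_eqvI;
      (intro toeplitz_seminorm.t_isometry toeplitz_seminorm.t_vertex_adj toeplitz_seminorm.t_vertex_idem
        toeplitz_seminorm.t_vertex_orth toeplitz_seminorm.t_mult toeplitz_seminorm.t_source
        toeplitz_seminorm.t_min_ext; assumption))

end

section \<open>The path representation\<close>

context two_graph
begin

text \<open>Letters act on paths as partial injections: (\<kappa>, False) prepends \<kappa>, and
  (\<kappa>, True) removes it from the front. Left cancellation makes the remaining path unique, so
  the choice operator picks a determined value.\<close>

fun step :: "'p \<times> bool \<Rightarrow> 'p \<Rightarrow> 'p option" where
  "step (\<kappa>, False) \<xi> = (if \<kappa> \<in> paths \<Lambda> \<and> \<xi> \<in> paths \<Lambda> \<and> src \<Lambda> \<kappa> = rng \<Lambda> \<xi> then Some (cmp \<Lambda> \<kappa> \<xi>) else None)"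
| "step (\<kappa>, True) \<xi> = (if \<exists>\<nu>. \<kappa> \<in> paths \<Lambda> \<and> \<nu> \<in> paths \<Lambda> \<and> src \<Lambda> \<kappa> = rng \<Lambda> \<nu> \<and> \<xi> = cmp \<Lambda> \<kappa> \<nu>
     then Some (SOME \<nu>. \<nu> \<in> paths \<Lambda> \<and> src \<Lambda> \<kappa> = rng \<Lambda> \<nu> \<and> \<xi> = cmp \<Lambda> \<kappa> \<nu>) else None)"

lemma step_False: "step (\<kappa>, False) \<xi> = Some \<mu> \<longleftrightarrow>
    \<kappa> \<in> paths \<Lambda> \<and> \<xi> \<in> paths \<Lambda> \<and> src \<Lambda> \<kappa> = rng \<Lambda> \<xi> \<and> \<mu> = cmp \<Lambda> \<kappa> \<xi>"
  by auto

lemma step_True: "step (\<kappa>, True) \<xi> = Some \<nu> \<longleftrightarrow>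
    \<kappa> \<in> paths \<Lambda> \<and> \<nu> \<in> paths \<Lambda> \<and> src \<Lambda> \<kappa> = rng \<Lambda> \<nu> \<and> \<xi> = cmp \<Lambda> \<kappa> \<nu>" (is "?L \<longleftrightarrow> ?R \<nu>")
proof -
  let ?Q = "\<lambda>\<nu>. \<nu> \<in> paths \<Lambda> \<and> src \<Lambda> \<kappa> = rng \<Lambda> \<nu> \<and> \<xi> = cmp \<Lambda> \<kappa> \<nu>"
  have u: "x = \<nu>" if "?R \<nu>" "?Q x" for x \<nu> using cancel_left[of \<kappa> x \<nu>] that by auto
  show ?thesis
  proof
    assume L: ?L
    then obtain x where x: "?R x" by (auto split: if_splits)
    hence "?Q x" by blast
    hence "?Q (SOME \<nu>. ?Q \<nu>)" by (rule someI)
    moreover have "\<nu> = (SOME \<nu>. ?Q \<nu>)" using L by (simp split: if_splits)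
    ultimately show "?R \<nu>" using x by blast
  next
    assume R: "?R \<nu>"
    hence "?Q \<nu>" by blast
    hence "?Q (SOME \<nu>. ?Q \<nu>)" by (rule someI)
    hence "(SOME \<nu>. ?Q \<nu>) = \<nu>" by (rule u[OF R])
    thus ?L using R by auto
  qed
qed

declare step.simps [simp del]

text \<open>Prepending and removing \<kappa> are inverse partial injections; adjointness in the
  representation stems from this.\<close>

lemma step_swap: "step (apsnd Not l) \<xi> = Some \<mu> \<longleftrightarrow> step l \<mu> = Some \<xi>"
proof -
  obtain \<kappa> b where l: "l = (\<kappa>, b)" by fastforce
  show ?thesis by (cases b) (auto simp: l step_False step_True)
qed

fun act :: "'p word \<Rightarrow> 'p \<Rightarrow> 'p option" where
  "act [] \<xi> = Some \<xi>"
| "act (l # w) \<xi> = Option.bind (act w \<xi>) (step l)"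

lemma act_append: "act (v @ w) \<xi> = Option.bind (act w \<xi>) (act v)"
  by (induction v) (auto simp: bind_assoc)

lemma act_adj_word: "act (adj_word w) \<xi> = Some \<mu> \<longleftrightarrow> act w \<mu> = Some \<xi>"
proof (induction w arbitrary: \<xi>)
  case (Cons l w)
  have "act (adj_word (l # w)) \<xi> = Some \<mu> \<longleftrightarrow> (\<exists>\<kappa>. step (apsnd Not l) \<xi> = Some \<kappa> \<and> act (adj_word w) \<kappa> = Some \<mu>)"
    by (auto simp: adj_word_Cons act_append bind_eq_Some_conv)
  also have "\<dots> \<longleftrightarrow> act (l # w) \<mu> = Some \<xi>"
    using Cons.IH by (auto simp: step_swap bind_eq_Some_conv)
  finally show ?case .
qed auto

text \<open>The value at \<kappa> is that of h at the preimage of \<kappa> under the partial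
  injection of w, found by running the adjoint word. A point mass at \<xi> is thereby moved to
  \<open>act w \<xi>\<close>, or to 0 if w is undefined there.\<close>

definition word_op :: "'p word \<Rightarrow> ('p \<Rightarrow> complex) \<Rightarrow> 'p \<Rightarrow> complex" where
  "word_op w h \<kappa> = (case act (adj_word w) \<kappa> of Some \<xi> \<Rightarrow> h \<xi> | None \<Rightarrow> 0)"

definition rep :: "'p npoly \<Rightarrow> ('p \<Rightarrow> complex) \<Rightarrow> 'p \<Rightarrow> complex" where
  "rep f h \<kappa> = lin_ext (\<lambda>w. word_op w h \<kappa>) f"

lemma word_op_append: "word_op (v @ w) h = word_op v (word_op w h)"
  by (rule ext) (simp add: word_op_def adj_word_append act_append split: option.split bind_split)

lemma rep_mult: "rep (f * g) h = rep f (rep g h)"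
proof
  fix \<kappa>
  have "lin_ext (\<lambda>w. word_op (v @ w) h \<kappa>) g = word_op v (rep g h) \<kappa>" for v
    unfolding word_op_append by (simp add: word_op_def[of v] rep_def[abs_def] split: option.split)
  thus "rep (f * g) h \<kappa> = rep f (rep g h) \<kappa>" by (simp add: rep_def[of _ _ \<kappa>] lin_ext_mult)
qed

lemma rep_add: "rep (f + g) h \<kappa> = rep f h \<kappa> + rep g h \<kappa>"
  and rep_minus: "rep (f - g) h \<kappa> = rep f h \<kappa> - rep g h \<kappa>"
  and rep_zero [simp]: "rep 0 h \<kappa> = 0"
  and rep_pscale: "rep (pscale c f) h \<kappa> = c * rep f h \<kappa>"
  and rep_sum: "rep (\<Sum>i\<in>I. F i) h \<kappa> = (\<Sum>i\<in>I. rep (F i) h \<kappa>)"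
  and rep_monom: "rep (monom_of w c) h \<kappa> = c * word_op w h \<kappa>"
  by (simp_all add: rep_def lin_ext_add lin_ext_minus lin_ext_pscale lin_ext_sum)

lemma rep_gen: "rep (gen \<kappa>) h \<mu> = (case step (\<kappa>, True) \<mu> of Some \<xi> \<Rightarrow> h \<xi> | None \<Rightarrow> 0)"
  and rep_gadj: "rep (gadj \<kappa>) h \<mu> = (case step (\<kappa>, False) \<mu> of Some \<xi> \<Rightarrow> h \<xi> | None \<Rightarrow> 0)"
  by (simp_all add: gen_def gadj_def rep_monom word_op_def adj_word_def)

text \<open>Words that induce the same partial map on paths act equally, so most relations reduce to
  statements about concatenation of paths.\<close>

lemma rep_monom_cong:
  assumes "\<And>\<xi> \<mu>. act v \<xi> = Some \<mu> \<longleftrightarrow> act w \<xi> = Some \<mu>"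
  shows "rep (monom_of v c) h = rep (monom_of w c) h"
proof
  fix \<kappa>
  have "act (adj_word v) \<kappa> = act (adj_word w) \<kappa>"
    using assms by (metis act_adj_word option.exhaust)
  thus "rep (monom_of v c) h \<kappa> = rep (monom_of w c) h \<kappa>" by (simp add: rep_monom word_op_def)
qed

section \<open>Inner product and operator norm on finitely supported functions\<close>

definition fin_supp :: "('p \<Rightarrow> complex) \<Rightarrow> bool" where "fin_supp h \<longleftrightarrow> finite {\<xi>. h \<xi> \<noteq> 0}"

definition ip :: "('p \<Rightarrow> complex) \<Rightarrow> ('p \<Rightarrow> complex) \<Rightarrow> complex" where
  "ip h k = (\<Sum>\<xi> | h \<xi> \<noteq> 0. h \<xi> * cnj (k \<xi>))"

definition nrm :: "('p \<Rightarrow> complex) \<Rightarrow> real" where "nrm h = L2_set (\<lambda>\<xi>. cmod (h \<xi>)) {\<xi>. h \<xi> \<noteq> 0}"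

lemma ip_superset: "finite S \<Longrightarrow> {\<xi>. h \<xi> \<noteq> 0} \<subseteq> S \<Longrightarrow> ip h k = (\<Sum>\<xi>\<in>S. h \<xi> * cnj (k \<xi>))"
  unfolding ip_def by (rule sum.mono_neutral_left) auto

lemma nrm_superset: "finite S \<Longrightarrow> {\<xi>. h \<xi> \<noteq> 0} \<subseteq> S \<Longrightarrow> nrm h = L2_set (\<lambda>\<xi>. cmod (h \<xi>)) S"
  unfolding nrm_def L2_set_def by (intro arg_cong[where f=sqrt] sum.mono_neutral_left) auto

lemma nrm_nonneg [simp]: "0 \<le> nrm h"
  by (simp add: nrm_def)

lemma ip_self: "fin_supp h \<Longrightarrow> ip h h = of_real ((nrm h)\<^sup>2)"
  unfolding ip_def nrm_def L2_set_def
  by (simp add: sum_nonneg complex_norm_square del: of_real_power)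

lemma nrm_zero_iff: "fin_supp h \<Longrightarrow> nrm h = 0 \<longleftrightarrow> h = (\<lambda>_. 0)"
  unfolding nrm_def fin_supp_def by (auto simp: L2_set_eq_0_iff)

lemma fin_supp_add: "fin_supp h \<Longrightarrow> fin_supp k \<Longrightarrow> fin_supp (\<lambda>\<xi>. h \<xi> + k \<xi>)"
  unfolding fin_supp_def by (rule finite_subset[of _ "{\<xi>. h \<xi> \<noteq> 0} \<union> {\<xi>. k \<xi> \<noteq> 0}"]) auto

lemma fin_supp_scale: "fin_supp h \<Longrightarrow> fin_supp (\<lambda>\<xi>. c * h \<xi>)"
  unfolding fin_supp_def by (rule finite_subset[of _ "{\<xi>. h \<xi> \<noteq> 0}"]) auto

lemma nrm_add:
  assumes "fin_supp h" "fin_supp k" shows "nrm (\<lambda>\<xi>. h \<xi> + k \<xi>) \<le> nrm h + nrm k"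
proof -
  let ?S = "{\<xi>. h \<xi> \<noteq> 0} \<union> {\<xi>. k \<xi> \<noteq> 0}"
  have S: "finite ?S" using assms by (auto simp: fin_supp_def)
  have "nrm (\<lambda>\<xi>. h \<xi> + k \<xi>) = L2_set (\<lambda>\<xi>. cmod (h \<xi> + k \<xi>)) ?S" by (rule nrm_superset[OF S]) auto
  also have "\<dots> \<le> L2_set (\<lambda>\<xi>. cmod (h \<xi>) + cmod (k \<xi>)) ?S" by (intro L2_set_mono norm_triangle_ineq) auto
  also have "\<dots> \<le> L2_set (\<lambda>\<xi>. cmod (h \<xi>)) ?S + L2_set (\<lambda>\<xi>. cmod (k \<xi>)) ?S" by (rule L2_set_triangle_ineq)
  also have "\<dots> = nrm h + nrm k" using nrm_superset[OF S, of h] nrm_superset[OF S, of k] by auto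
  finally show ?thesis .
qed

lemma nrm_scale: "fin_supp h \<Longrightarrow> nrm (\<lambda>\<xi>. c * h \<xi>) = cmod c * nrm h"
  using nrm_superset[of "{\<xi>. h \<xi> \<noteq> 0}" "\<lambda>\<xi>. c * h \<xi>"]
  by (simp add: fin_supp_def subset_iff nrm_def norm_mult L2_set_right_distrib)

lemma ip_Cauchy_Schwarz:
  assumes "fin_supp h" "fin_supp k" shows "cmod (ip h k) \<le> nrm h * nrm k"
proof -
  let ?S = "{\<xi>. h \<xi> \<noteq> 0} \<union> {\<xi>. k \<xi> \<noteq> 0}"
  have S: "finite ?S" using assms by (auto simp: fin_supp_def)
  have "cmod (ip h k) = cmod (\<Sum>\<xi>\<in>?S. h \<xi> * cnj (k \<xi>))" using ip_superset[OF S, of h k] by auto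
  also have "\<dots> \<le> (\<Sum>\<xi>\<in>?S. \<bar>cmod (h \<xi>)\<bar> * \<bar>cmod (k \<xi>)\<bar>)"
    by (rule order_trans[OF norm_sum]) (simp add: norm_mult)
  also have "\<dots> \<le> L2_set (\<lambda>\<xi>. cmod (h \<xi>)) ?S * L2_set (\<lambda>\<xi>. cmod (k \<xi>)) ?S" by (rule L2_set_mult_ineq)
  also have "\<dots> = nrm h * nrm k" using nrm_superset[OF S, of h] nrm_superset[OF S, of k] by auto
  finally show ?thesis .
qed

lemma word_op_support:
  "word_op w h \<kappa> \<noteq> 0 \<longleftrightarrow> (\<exists>\<xi>. act w \<xi> = Some \<kappa> \<and> h \<xi> \<noteq> 0)"
proof (cases "act (adj_word w) \<kappa>")
  case None
  hence "act w \<xi> \<noteq> Some \<kappa>" for \<xi> using act_adj_word[of w \<kappa> \<xi>] by simp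
  thus ?thesis using None by (simp add: word_op_def)
next
  case (Some \<mu>)
  hence "act w \<xi> = Some \<kappa> \<longleftrightarrow> \<xi> = \<mu>" for \<xi> using act_adj_word[of w \<kappa> \<xi>] by auto
  thus ?thesis using Some by (simp add: word_op_def)
qed

lemma word_op_act: "act w \<xi> = Some \<kappa> \<Longrightarrow> word_op w h \<kappa> = h \<xi>"
  by (simp add: word_op_def act_adj_word[THEN iffD2])

text \<open>A word acts as a partial injection on paths, hence as a partial isometry on finitely
  supported functions.\<close>

lemma word_op_bij:
  "bij_betw (\<lambda>\<xi>. the (act w \<xi>)) {\<xi>. h \<xi> \<noteq> 0 \<and> act w \<xi> \<noteq> None} {\<kappa>. word_op w h \<kappa> \<noteq> 0}"
  unfolding bij_betw_def
proof
  show "inj_on (\<lambda>\<xi>. the (act w \<xi>)) {\<xi>. h \<xi> \<noteq> 0 \<and> act w \<xi> \<noteq> None}"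
  proof (rule inj_onI)
    fix x y
    assume x: "x \<in> {\<xi>. h \<xi> \<noteq> 0 \<and> act w \<xi> \<noteq> None}" and y: "y \<in> {\<xi>. h \<xi> \<noteq> 0 \<and> act w \<xi> \<noteq> None}"
      and xy: "the (act w x) = the (act w y)"
    obtain \<kappa> where "act w x = Some \<kappa>" using x by auto
    moreover have "act w y = Some \<kappa>" using calculation xy y by auto
    ultimately have "act (adj_word w) \<kappa> = Some x" "act (adj_word w) \<kappa> = Some y"
      by (auto simp: act_adj_word)
    thus "x = y" by simp
  qed
  show "(\<lambda>\<xi>. the (act w \<xi>)) ` {\<xi>. h \<xi> \<noteq> 0 \<and> act w \<xi> \<noteq> None} = {\<kappa>. word_op w h \<kappa> \<noteq> 0}"
  proof (intro equalityI subsetI)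
    fix \<kappa> assume "\<kappa> \<in> {\<kappa>. word_op w h \<kappa> \<noteq> 0}"
    then obtain \<xi> where "act w \<xi> = Some \<kappa>" "h \<xi> \<noteq> 0" by (auto simp: word_op_support)
    thus "\<kappa> \<in> (\<lambda>\<xi>. the (act w \<xi>)) ` {\<xi>. h \<xi> \<noteq> 0 \<and> act w \<xi> \<noteq> None}"
      by (intro image_eqI[of _ _ \<xi>]) auto
  qed (auto simp: word_op_support)
qed

lemma fin_supp_word_op: "fin_supp h \<Longrightarrow> fin_supp (word_op w h)"
  using bij_betw_finite[OF word_op_bij[of w h]] by (simp add: fin_supp_def)

text \<open>Change of variables along the partial injection of w; contractivity and the adjoint
  formula are both instances.\<close>

lemma sum_word_op:
  "(\<Sum>\<kappa> | word_op w h \<kappa> \<noteq> 0. F (word_op w h \<kappa>) \<kappa>) = (\<Sum>\<xi> | h \<xi> \<noteq> 0 \<and> act w \<xi> \<noteq> None. F (h \<xi>) (the (act w \<xi>)))"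
  using sum.reindex_bij_betw[OF word_op_bij, of "\<lambda>\<kappa>. F (word_op w h \<kappa>) \<kappa>" w h]
  by (auto simp: word_op_act intro!: sum.cong)

lemma nrm_word_op: assumes "fin_supp h" shows "nrm (word_op w h) \<le> nrm h"
proof -
  have "(\<Sum>\<kappa> | word_op w h \<kappa> \<noteq> 0. (cmod (word_op w h \<kappa>))\<^sup>2) = (\<Sum>\<xi> | h \<xi> \<noteq> 0 \<and> act w \<xi> \<noteq> None. (cmod (h \<xi>))\<^sup>2)"
    by (rule sum_word_op)
  also have "\<dots> \<le> (\<Sum>\<xi> | h \<xi> \<noteq> 0. (cmod (h \<xi>))\<^sup>2)"
    using assms by (intro sum_mono2) (auto simp: fin_supp_def)
  finally show ?thesis by (simp add: nrm_def L2_set_def)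
qed

lemma ip_word_op: assumes "fin_supp h" shows "ip (word_op w h) k = ip h (word_op (adj_word w) k)"
proof -
  have "ip (word_op w h) k = (\<Sum>\<xi> | h \<xi> \<noteq> 0 \<and> act w \<xi> \<noteq> None. h \<xi> * cnj (k (the (act w \<xi>))))"
    unfolding ip_def by (rule sum_word_op)
  also have "\<dots> = (\<Sum>\<xi> | h \<xi> \<noteq> 0. h \<xi> * cnj (word_op (adj_word w) k \<xi>))"
    using assms by (intro sum.mono_neutral_cong_left) (auto simp: fin_supp_def word_op_def split: option.splits)
  finally show ?thesis by (simp add: ip_def)
qed

lemma fin_supp_rep: "fin_supp h \<Longrightarrow> fin_supp (rep f h)"
proof (induction f rule: npoly_induct_all)
  case zero thus ?case by (simp add: fin_supp_def)
next
  case (monom w c) thus ?case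
    using fin_supp_scale[OF fin_supp_word_op[of h w], of c] by (simp add: rep_monom[abs_def])
next
  case (add f g) thus ?case using fin_supp_add by (simp add: rep_add[abs_def])
qed

lemma ip_add_left:
  assumes "fin_supp h" "fin_supp k"
  shows "ip (\<lambda>\<xi>. h \<xi> + k \<xi>) g = ip h g + ip k g"
proof -
  let ?S = "{\<xi>. h \<xi> \<noteq> 0} \<union> {\<xi>. k \<xi> \<noteq> 0}"
  have S: "finite ?S" using assms by (auto simp: fin_supp_def)
  have "ip (\<lambda>\<xi>. h \<xi> + k \<xi>) g = (\<Sum>\<xi>\<in>?S. (h \<xi> + k \<xi>) * cnj (g \<xi>))" by (rule ip_superset[OF S]) auto
  also have "\<dots> = (\<Sum>\<xi>\<in>?S. h \<xi> * cnj (g \<xi>)) + (\<Sum>\<xi>\<in>?S. k \<xi> * cnj (g \<xi>))"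
    by (simp add: sum.distrib distrib_right)
  also have "(\<Sum>\<xi>\<in>?S. h \<xi> * cnj (g \<xi>)) = ip h g" by (rule ip_superset[OF S, symmetric]) auto
  also have "(\<Sum>\<xi>\<in>?S. k \<xi> * cnj (g \<xi>)) = ip k g" by (rule ip_superset[OF S, symmetric]) auto
  finally show ?thesis .
qed

lemma ip_scale_left: "fin_supp h \<Longrightarrow> ip (\<lambda>\<xi>. c * h \<xi>) g = c * ip h g"
  using ip_superset[of "{\<xi>. h \<xi> \<noteq> 0}" "\<lambda>\<xi>. c * h \<xi>" g]
  by (auto simp: fin_supp_def ip_def sum_distrib_left mult_ac)

lemma ip_add_right: "ip g (\<lambda>\<xi>. h \<xi> + k \<xi>) = ip g h + ip g k"
  and ip_scale_right: "ip g (\<lambda>\<xi>. c * h \<xi>) = cnj c * ip g h"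
  by (simp_all add: ip_def sum.distrib sum_distrib_left distrib_left mult_ac)

lemma ip_rep: assumes "fin_supp h" "fin_supp k" shows "ip (rep f h) k = ip h (rep (padj f) k)"
proof (induction f rule: npoly_induct_all)
  case zero thus ?case by (simp add: ip_def)
next
  case (monom w c) thus ?case using assms
    by (simp add: rep_monom[abs_def] ip_scale_left ip_scale_right fin_supp_word_op ip_word_op)
next
  case (add f g) thus ?case using assms
    by (simp add: rep_add[abs_def] padj_add ip_add_left ip_add_right fin_supp_rep)
qed

lemma rep_bounded: "\<exists>C. \<forall>h. fin_supp h \<longrightarrow> nrm (rep f h) \<le> C * nrm h"
proof (induction f rule: npoly_induct_all)
  case zero show ?case by (auto intro!: exI[of _ 0] simp: nrm_def)
next
  case (monom w c)
  have "nrm (rep (monom_of w c) h) \<le> cmod c * nrm h" if "fin_supp h" for h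
    using that nrm_word_op[OF that, of w] by (simp add: rep_monom[abs_def] nrm_scale fin_supp_word_op mult_left_mono)
  thus ?case by blast
next
  case (add f g)
  then obtain C D where C: "\<And>h. fin_supp h \<Longrightarrow> nrm (rep f h) \<le> C * nrm h"
    and D: "\<And>h. fin_supp h \<Longrightarrow> nrm (rep g h) \<le> D * nrm h" by blast
  have "nrm (rep (f + g) h) \<le> (C + D) * nrm h" if "fin_supp h" for h
  proof -
    have "nrm (rep (f + g) h) \<le> nrm (rep f h) + nrm (rep g h)"
      unfolding rep_add[abs_def] using that by (intro nrm_add fin_supp_rep)
    thus ?thesis using C[OF that] D[OF that] by (simp add: algebra_simps)
  qed
  thus ?case by blast
qed

text \<open>The finitely supported functions are dense in the l2 space, so the supremum over their
  unit ball is the operator norm on the Hilbert space.\<close>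

definition op_norm :: "'p npoly \<Rightarrow> real" where
  "op_norm f = Sup {nrm (rep f h) |h. fin_supp h \<and> nrm h \<le> 1}"

lemma fin_supp_zero [simp]: "fin_supp (\<lambda>_. 0)" and nrm_zero [simp]: "nrm (\<lambda>_. 0) = 0"
  by (auto simp: fin_supp_def nrm_def)

lemma op_norm_le:
  assumes "\<And>h. fin_supp h \<Longrightarrow> nrm h \<le> 1 \<Longrightarrow> nrm (rep f h) \<le> b"
  shows "op_norm f \<le> b"
  unfolding op_norm_def using fin_supp_zero nrm_zero
  by (intro cSup_least) (use assms in \<open>auto intro!: exI[of _ "\<lambda>_. 0"]\<close>)

lemma op_norm_upper:
  assumes "fin_supp h" "nrm h \<le> 1" shows "nrm (rep f h) \<le> op_norm f"
proof -
  obtain C where C: "\<And>h. fin_supp h \<Longrightarrow> nrm (rep f h) \<le> C * nrm h" using rep_bounded by blast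
  have "nrm (rep f h) \<le> max C 0" if "fin_supp h" "nrm h \<le> 1" for h
  proof -
    have "C * nrm h \<le> max C 0 * 1" using that by (intro mult_mono) auto
    thus ?thesis using C[OF that(1)] by simp
  qed
  hence "bdd_above {nrm (rep f h) |h. fin_supp h \<and> nrm h \<le> 1}" by (intro bdd_aboveI[of _ "max C 0"]) auto
  thus ?thesis unfolding op_norm_def using assms by (intro cSup_upper) auto
qed

lemma op_norm_nonneg: "0 \<le> op_norm f"
  using order_trans[OF nrm_nonneg op_norm_upper[OF fin_supp_zero]] by simp

lemma rep_scale: "rep f (\<lambda>\<xi>. c * h \<xi>) = (\<lambda>\<xi>. c * rep f h \<xi>)"
proof
  fix \<kappa>
  have "word_op w (\<lambda>\<xi>. c * h \<xi>) \<kappa> = c * word_op w h \<kappa>" for w by (simp add: word_op_def split: option.split)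
  thus "rep f (\<lambda>\<xi>. c * h \<xi>) \<kappa> = c * rep f h \<kappa>" by (simp add: rep_def lin_ext_mult_fun)
qed

lemma op_norm_bound: assumes h: "fin_supp h" shows "nrm (rep f h) \<le> op_norm f * nrm h"
proof (cases "nrm h = 0")
  case True
  hence "h = (\<lambda>_. 0)" using nrm_zero_iff[OF h] by simp
  hence "rep f h = (\<lambda>_. 0)" using rep_scale[of f 0 h] by simp
  thus ?thesis using True by simp
next
  case False
  let ?c = "complex_of_real (inverse (nrm h))"
  have p: "nrm h > 0" using False by (simp add: less_le)
  have c: "cmod ?c = inverse (nrm h)" using p by (simp only: norm_of_real) simp
  have "nrm (\<lambda>\<xi>. ?c * h \<xi>) \<le> 1" unfolding nrm_scale[OF h] c using p by simp
  hence "nrm (rep f (\<lambda>\<xi>. ?c * h \<xi>)) \<le> op_norm f" by (intro op_norm_upper fin_supp_scale h)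
  hence "inverse (nrm h) * nrm (rep f h) \<le> op_norm f"
    unfolding rep_scale nrm_scale[OF fin_supp_rep[OF h]] c .
  thus ?thesis using p by (simp add: field_simps)
qed

lemma op_norm_mult: "op_norm (f * g) \<le> op_norm f * op_norm g"
proof (rule op_norm_le)
  fix h assume h: "fin_supp h" "nrm h \<le> 1"
  have "nrm (rep (f * g) h) \<le> op_norm f * nrm (rep g h)"
    unfolding rep_mult by (intro op_norm_bound fin_supp_rep h)
  also have "\<dots> \<le> op_norm f * op_norm g" by (intro mult_left_mono op_norm_upper h op_norm_nonneg)
  finally show "nrm (rep (f * g) h) \<le> op_norm f * op_norm g" .
qed

text \<open>The squared norm of the image of h is the inner product of h with its image under the
  adjoint of f times f, which Cauchy-Schwarz estimates.\<close>

lemma op_norm_square_le: "(op_norm f)\<^sup>2 \<le> op_norm (padj f * f)"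
proof -
  have "op_norm f \<le> sqrt (op_norm (padj f * f))"
  proof (rule op_norm_le)
    fix h assume h: "fin_supp h" "nrm h \<le> 1"
    have "complex_of_real ((nrm (rep f h))\<^sup>2) = ip (rep f h) (rep f h)"
      using ip_self[OF fin_supp_rep[OF h(1)], of f] by simp
    also have "\<dots> = ip h (rep (padj f * f) h)" unfolding rep_mult by (intro ip_rep fin_supp_rep h)
    finally have "(nrm (rep f h))\<^sup>2 = cmod (ip h (rep (padj f * f) h))"
      by (metis abs_of_nonneg norm_of_real zero_le_power2)
    also have "\<dots> \<le> nrm h * nrm (rep (padj f * f) h)" by (intro ip_Cauchy_Schwarz fin_supp_rep h)
    also have "\<dots> \<le> 1 * op_norm (padj f * f)" using h by (intro mult_mono op_norm_upper) auto
    finally show "nrm (rep f h) \<le> sqrt (op_norm (padj f * f))" by (intro real_le_rsqrt) simp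
  qed
  thus ?thesis using power_mono[OF _ op_norm_nonneg, of f _ 2] op_norm_nonneg[of "padj f * f"]
    by (metis real_sqrt_pow2)
qed

lemma op_norm_cstar_on: "cstar_on \<Lambda> op_norm"
proof (rule cstar_onI)
  fix f g :: "'p npoly" and c
  show "0 \<le> op_norm f" by (rule op_norm_nonneg)
  show "op_norm (f * g) \<le> op_norm f * op_norm g" by (rule op_norm_mult)
  show "(op_norm f)\<^sup>2 \<le> op_norm (padj f * f)" by (rule op_norm_square_le)
  show "op_norm (f + g) \<le> op_norm f + op_norm g"
  proof (rule op_norm_le)
    fix h assume h: "fin_supp h" "nrm h \<le> 1"
    have "nrm (rep (f + g) h) \<le> nrm (rep f h) + nrm (rep g h)"
      unfolding rep_add[abs_def] by (intro nrm_add fin_supp_rep h)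
    thus "nrm (rep (f + g) h) \<le> op_norm f + op_norm g"
      using op_norm_upper[OF h, of f] op_norm_upper[OF h, of g] by simp
  qed
  have "nrm (rep (pscale c f) h) = cmod c * nrm (rep f h)" if "fin_supp h" for h
    unfolding rep_pscale[abs_def] using that by (intro nrm_scale fin_supp_rep)
  thus "op_norm (pscale c f) \<le> cmod c * op_norm f"
    by (intro op_norm_le) (simp add: mult_left_mono op_norm_upper)
qed

lemma op_norm_eqvI:
  assumes "f \<in> fpoly \<Lambda>" "g \<in> fpoly \<Lambda>" "\<And>h \<kappa>. rep f h \<kappa> = rep g h \<kappa>"
  shows "cstar_on.eqv \<Lambda> op_norm f g"
proof -
  have "rep (f - g) h = (\<lambda>_. 0)" for h by (rule ext) (simp add: rep_minus assms(3))
  hence "op_norm (f - g) \<le> 0" by (intro op_norm_le) simp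
  hence "op_norm (f - g) = 0" using op_norm_nonneg[of "f - g"] by simp
  thus ?thesis using assms by (simp add: cstar_on.eqv_def[OF op_norm_cstar_on])
qed

end

text \<open>All relations are checked on paths. (T1) to (T3) compare partial injections. For (T5)
  both sides are evaluated at \<xi>: the left one can be nonzero only if \<mu>\<xi> begins with
  \<nu>, and then \<xi> begins with \<alpha> for exactly one minimal extension (\<alpha>,
  \<beta>).\<close>

lemma (in row_finite) op_norm_seminorm: "toeplitz_seminorm \<Lambda> op_norm"
proof -
  interpret cstar_on \<Lambda> op_norm by (rule op_norm_cstar_on)
  have w: "gen \<kappa> * gadj \<kappa> * gen \<kappa> = monom_of [(\<kappa>, False), (\<kappa>, True), (\<kappa>, False)] 1"
    "gen \<kappa> * gen \<mu> = monom_of [(\<kappa>, False), (\<mu>, False)] 1"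
    "gadj \<kappa> * gen \<mu> = monom_of [(\<kappa>, True), (\<mu>, False)] 1" for \<kappa> \<mu> :: 'p
    by (simp_all add: gen_def gadj_def monom_mult)
  have vert: "cmp \<Lambda> z \<xi> = \<xi>" if "z \<in> vertices \<Lambda>" "\<xi> \<in> paths \<Lambda>" "src \<Lambda> z = rng \<Lambda> \<xi>" for z \<xi>
    using that cmp_rng[of \<xi>] vertex_rng_src by metis
  \<comment> \<open>A vertex acts as the projection onto the paths with that range, with or without
    adjoint.\<close>
  have vact: "act [(z, b)] \<xi> = Some \<mu> \<longleftrightarrow> \<xi> = \<mu> \<and> \<xi> \<in> paths \<Lambda> \<and> rng \<Lambda> \<xi> = z" if "z \<in> vertices \<Lambda>" for z b \<xi> \<mu>
    using that vert[OF that] vertex_closed[OF that] vertex_rng_src[OF that]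
    by (cases b) (auto simp: step_False step_True)
  show ?thesis
  proof unfold_locales
    fix \<kappa> assume k: "\<kappa> \<in> paths \<Lambda>"
    have "rep (gen \<kappa> * gadj \<kappa> * gen \<kappa>) h = rep (gen \<kappa>) h" for h
      unfolding w unfolding gen_def
      by (rule rep_monom_cong) (auto simp: step_False step_True bind_eq_Some_conv)
    thus "eqv (gen \<kappa> * gadj \<kappa> * gen \<kappa>) (gen \<kappa>)" using k by (intro op_norm_eqvI) auto
    have "rep (gadj \<kappa> * gen \<kappa>) h = rep (gen (src \<Lambda> \<kappa>)) h" for h
      unfolding w unfolding gen_def
    proof (rule rep_monom_cong)
      fix \<xi> \<nu>
      show "act [(\<kappa>, True), (\<kappa>, False)] \<xi> = Some \<nu> \<longleftrightarrow> act [(src \<Lambda> \<kappa>, False)] \<xi> = Some \<nu>"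
        unfolding vact[OF src_vertex[OF k]]
        using k by (auto simp: step_False step_True bind_eq_Some_conv intro: cancel_left)
    qed
    thus "eqv (gadj \<kappa> * gen \<kappa>) (gen (src \<Lambda> \<kappa>))" using k src_closed by (intro op_norm_eqvI) auto
    fix \<mu> assume m: "\<mu> \<in> paths \<Lambda>" "src \<Lambda> \<kappa> = rng \<Lambda> \<mu>"
    have "rep (gen \<kappa> * gen \<mu>) h = rep (gen (cmp \<Lambda> \<kappa> \<mu>)) h" for h
      unfolding w unfolding gen_def
    proof (rule rep_monom_cong)
      fix \<xi> \<nu>
      show "act [(\<kappa>, False), (\<mu>, False)] \<xi> = Some \<nu> \<longleftrightarrow> act [(cmp \<Lambda> \<kappa> \<mu>, False)] \<xi> = Some \<nu>"
      proof (cases "\<xi> \<in> paths \<Lambda> \<and> src \<Lambda> \<mu> = rng \<Lambda> \<xi>")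
        case True
        hence x: "\<xi> \<in> paths \<Lambda>" "src \<Lambda> \<mu> = rng \<Lambda> \<xi>" by auto
        have "step (\<mu>, False) \<xi> = Some (cmp \<Lambda> \<mu> \<xi>)" using m x by (simp add: step_False)
        moreover have "step (\<kappa>, False) (cmp \<Lambda> \<mu> \<xi>) = Some (cmp \<Lambda> \<kappa> (cmp \<Lambda> \<mu> \<xi>))"
          using k m(2) cmp_closed[OF m(1) x] rng_cmp[OF m(1) x] by (simp add: step_False)
        moreover have "step (cmp \<Lambda> \<kappa> \<mu>, False) \<xi> = Some (cmp \<Lambda> (cmp \<Lambda> \<kappa> \<mu>) \<xi>)"
          using x cmp_closed[OF k m] src_cmp[OF k m] by (simp add: step_False)
        ultimately show ?thesis using cmp_assoc[OF k m(1) x(1) m(2) x(2)] by simp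
      next
        case False
        have "step (\<mu>, False) \<xi> = None" using False by (auto simp: step_False simp flip: not_Some_eq)
        moreover have "step (cmp \<Lambda> \<kappa> \<mu>, False) \<xi> = None"
          using False src_cmp[OF k m] by (auto simp: step_False simp flip: not_Some_eq)
        ultimately show ?thesis by simp
      qed
    qed
    thus "eqv (gen \<kappa> * gen \<mu>) (gen (cmp \<Lambda> \<kappa> \<mu>))" using k m cmp_closed by (intro op_norm_eqvI) auto
  next
    fix z assume z: "z \<in> vertices \<Lambda>"
    have "rep (gadj z) h = rep (gen z) h" for h
      unfolding gen_def gadj_def by (rule rep_monom_cong) (simp only: vact[OF z])
    thus "eqv (gadj z) (gen z)" using z vertex_closed by (intro op_norm_eqvI) auto
    have "rep (gen z * gen z) h = rep (gen z) h" for h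
      unfolding w unfolding gen_def
    proof (rule rep_monom_cong)
      fix \<xi> \<nu>
      show "act [(z, False), (z, False)] \<xi> = Some \<nu> \<longleftrightarrow> act [(z, False)] \<xi> = Some \<nu>"
        using act_append[of "[(z, False)]" "[(z, False)]"] vact[OF z]
        by (auto simp: bind_eq_Some_conv simp del: act.simps)
    qed
    thus "eqv (gen z * gen z) (gen z)" using z vertex_closed by (intro op_norm_eqvI) auto
    fix w' assume w': "w' \<in> vertices \<Lambda>" "z \<noteq> w'"
    have "act [(z, False), (w', False)] \<xi> \<noteq> Some \<nu>" for \<xi> \<nu>
      using act_append[of "[(z, False)]" "[(w', False)]"] vact[OF z] vact[OF w'(1)] w'(2)
      by (auto simp: bind_eq_Some_conv simp del: act.simps)
    hence "act (adj_word [(z, False), (w', False)]) \<xi> = None" for \<xi>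
      using act_adj_word by (metis option.exhaust)
    hence "rep (gen z * gen w') h \<kappa> = rep 0 h \<kappa>" for h \<kappa>
      unfolding w by (simp add: rep_monom word_op_def)
    thus "eqv (gen z * gen w') 0" using z w' vertex_closed by (intro op_norm_eqvI) auto
  next
    fix \<mu> \<nu> assume m: "\<mu> \<in> paths \<Lambda>" and n: "\<nu> \<in> paths \<Lambda>"
    let ?M = "min_ext \<Lambda> \<mu> \<nu>"
    have "rep (gadj \<mu> * gen \<nu>) h \<xi> = rep (\<Sum>(\<alpha>, \<beta>)\<in>?M. gen \<alpha> * gadj \<beta>) h \<xi>" for h \<xi>
    proof -
      define T where "T i = rep (gen (fst i) * gadj (snd i)) h \<xi>" for i
      have rhs: "rep (\<Sum>(\<alpha>, \<beta>)\<in>?M. gen \<alpha> * gadj \<beta>) h \<xi> = (\<Sum>i\<in>?M. T i)"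
        by (simp add: rep_sum T_def case_prod_beta)
      have lhs: "rep (gadj \<mu> * gen \<nu>) h \<xi> = (case Option.bind (step (\<mu>, False) \<xi>) (step (\<nu>, True)) of Some \<kappa> \<Rightarrow> h \<kappa> | None \<Rightarrow> 0)"
        unfolding rep_mult by (simp add: rep_gen rep_gadj split: option.split bind_split)
      have T: "T (\<alpha>, \<beta>) = (case Option.bind (step (\<alpha>, True) \<xi>) (step (\<beta>, False)) of Some \<kappa> \<Rightarrow> h \<kappa> | None \<Rightarrow> 0)" for \<alpha> \<beta>
        unfolding T_def rep_mult by (simp add: rep_gen rep_gadj split: option.split bind_split)
      \<comment> \<open>If \<xi> begins with \<alpha>, then \<mu>\<xi> begins with \<mu>\<alpha> =
        \<nu>\<beta>, hence with \<nu>; a nonvanishing term on the right forces the left side to be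
        defined.\<close>
      have pull: "\<exists>\<nu>'. \<nu>' \<in> paths \<Lambda> \<and> src \<Lambda> \<nu> = rng \<Lambda> \<nu>' \<and> src \<Lambda> \<mu> = rng \<Lambda> \<xi> \<and> \<xi> \<in> paths \<Lambda> \<and> cmp \<Lambda> \<mu> \<xi> = cmp \<Lambda> \<nu> \<nu>'"
        if ab: "(\<alpha>, \<beta>) \<in> ?M" and s: "step (\<alpha>, True) \<xi> = Some \<xi>'" for \<alpha> \<beta> \<xi>'
      proof -
        note e = min_extD[OF m n ab]
        have l: "\<xi>' \<in> paths \<Lambda>" "src \<Lambda> \<alpha> = rng \<Lambda> \<xi>'" "\<xi> = cmp \<Lambda> \<alpha> \<xi>'" using s by (auto simp: step_True)
        have c: "cmp \<Lambda> \<beta> \<xi>' \<in> paths \<Lambda>" "rng \<Lambda> (cmp \<Lambda> \<beta> \<xi>') = rng \<Lambda> \<beta>"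
          using e l by (auto intro!: cmp_closed rng_cmp)
        have "cmp \<Lambda> \<mu> \<xi> = cmp \<Lambda> (cmp \<Lambda> \<mu> \<alpha>) \<xi>'"
          unfolding l(3) by (rule cmp_assoc[OF m e(1) l(1) e(3) l(2), symmetric])
        also have "\<dots> = cmp \<Lambda> \<nu> (cmp \<Lambda> \<beta> \<xi>')" unfolding e(5)
          using l(2) e(8) by (intro cmp_assoc[OF n e(2) l(1) e(4)]) simp
        finally show ?thesis
          using c e(1-4) l cmp_closed[OF e(1) l(1,2)] rng_cmp[OF e(1) l(1,2)]
          by (intro exI[of _ "cmp \<Lambda> \<beta> \<xi>'"]) simp
      qed
      show ?thesis
      proof (cases "Option.bind (step (\<mu>, False) \<xi>) (step (\<nu>, True))")
        case None
        have "T (\<alpha>, \<beta>) = 0" if ab: "(\<alpha>, \<beta>) \<in> ?M" for \<alpha> \<beta>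
        proof (cases "step (\<alpha>, True) \<xi>")
          case (Some \<xi>')
          from pull[OF ab this] obtain \<nu>' where "\<nu>' \<in> paths \<Lambda>" "src \<Lambda> \<nu> = rng \<Lambda> \<nu>'" "src \<Lambda> \<mu> = rng \<Lambda> \<xi>" "\<xi> \<in> paths \<Lambda>"
            "cmp \<Lambda> \<mu> \<xi> = cmp \<Lambda> \<nu> \<nu>'" by blast
          hence "step (\<mu>, False) \<xi> = Some (cmp \<Lambda> \<mu> \<xi>)" "step (\<nu>, True) (cmp \<Lambda> \<mu> \<xi>) = Some \<nu>'"
            using m n by (auto simp: step_False step_True)
          thus ?thesis using None by simp
        qed (simp add: T)
        hence "(\<Sum>i\<in>?M. T i) = 0" by (intro sum.neutral) auto
        thus ?thesis using lhs rhs None by simp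
      next
        case (Some \<nu>')
        hence 1: "\<xi> \<in> paths \<Lambda>" "src \<Lambda> \<mu> = rng \<Lambda> \<xi>" "\<nu>' \<in> paths \<Lambda>" "src \<Lambda> \<nu> = rng \<Lambda> \<nu>'" "cmp \<Lambda> \<mu> \<xi> = cmp \<Lambda> \<nu> \<nu>'"
          by (auto simp: bind_eq_Some_conv step_False step_True)
        let ?s = "sup (deg \<Lambda> \<mu>) (deg \<Lambda> \<nu>)"
        have d: "deg \<Lambda> (cmp \<Lambda> \<mu> \<xi>) = deg \<Lambda> \<mu> + deg \<Lambda> \<xi>" "deg \<Lambda> (cmp \<Lambda> \<mu> \<xi>) = deg \<Lambda> \<nu> + deg \<Lambda> \<nu>'"
          using deg_cmp[OF m 1(1,2)] deg_cmp[OF n 1(3,4)] 1(5) by simp_all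
        have split: "\<exists>c. b = a + c" if "a \<le> b" for a b :: "nat \<times> nat"
          using that by (intro exI[of _ "(fst b - fst a, snd b - snd a)"]) (auto simp: less_eq_prod_def prod_eq_iff)
        have le: "a \<le> a + c" for a c :: "nat \<times> nat" by (auto simp: less_eq_prod_def)
        have "?s \<le> deg \<Lambda> (cmp \<Lambda> \<mu> \<xi>)" using le[of "deg \<Lambda> \<mu>" "deg \<Lambda> \<xi>"] le[of "deg \<Lambda> \<nu>" "deg \<Lambda> \<nu>'"] d by (simp add: le_supI)
        then obtain c where "deg \<Lambda> (cmp \<Lambda> \<mu> \<xi>) = ?s + c" using split by blast
        \<comment> \<open>\<tau> is the initial piece of \<mu>\<xi> whose degree is the join. It
          begins with both \<mu> and \<nu>, and what remains of it after each of them forms the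
          minimal extension met by \<xi>.\<close>
        then obtain \<tau> \<xi>' where t: "\<tau> \<in> paths \<Lambda>" "\<xi>' \<in> paths \<Lambda>" "src \<Lambda> \<tau> = rng \<Lambda> \<xi>'" "cmp \<Lambda> \<mu> \<xi> = cmp \<Lambda> \<tau> \<xi>'" "deg \<Lambda> \<tau> = ?s"
          using factorE[OF cmp_closed[OF m 1(1,2)]] by metis
        have prefix: "\<exists>\<alpha>. \<alpha> \<in> paths \<Lambda> \<and> src \<Lambda> \<mu> = rng \<Lambda> \<alpha> \<and> \<tau> = cmp \<Lambda> \<mu> \<alpha> \<and> src \<Lambda> \<alpha> = rng \<Lambda> \<xi>' \<and> \<xi> = cmp \<Lambda> \<alpha> \<xi>'"
          if h: "\<mu> \<in> paths \<Lambda>" "\<xi> \<in> paths \<Lambda>" "src \<Lambda> \<mu> = rng \<Lambda> \<xi>" "cmp \<Lambda> \<mu> \<xi> = cmp \<Lambda> \<tau> \<xi>'" "deg \<Lambda> \<mu> \<le> deg \<Lambda> \<tau>" for \<mu> \<xi>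
        proof -
          obtain a where "deg \<Lambda> \<tau> = deg \<Lambda> \<mu> + a" using split[OF h(5)] by blast
          then obtain \<mu>' \<alpha> where a: "\<mu>' \<in> paths \<Lambda>" "\<alpha> \<in> paths \<Lambda>" "src \<Lambda> \<mu>' = rng \<Lambda> \<alpha>" "\<tau> = cmp \<Lambda> \<mu>' \<alpha>" "deg \<Lambda> \<mu>' = deg \<Lambda> \<mu>"
            using factorE[OF t(1)] by metis
          have sa: "src \<Lambda> \<alpha> = rng \<Lambda> \<xi>'" using src_cmp[OF a(1-3)] a(4) t(3) by simp
          have "cmp \<Lambda> \<mu> \<xi> = cmp \<Lambda> \<mu>' (cmp \<Lambda> \<alpha> \<xi>')"
            unfolding h(4) a(4) using a(1-3) t(2) sa by (simp add: cmp_assoc)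
          hence "\<mu> = \<mu>' \<and> \<xi> = cmp \<Lambda> \<alpha> \<xi>'"
            using h a sa t(2) by (intro factor_unique) (auto simp: cmp_closed rng_cmp)
          thus ?thesis using a sa by auto
        qed
        obtain \<alpha> where a: "\<alpha> \<in> paths \<Lambda>" "src \<Lambda> \<mu> = rng \<Lambda> \<alpha>" "\<tau> = cmp \<Lambda> \<mu> \<alpha>" "src \<Lambda> \<alpha> = rng \<Lambda> \<xi>'" "\<xi> = cmp \<Lambda> \<alpha> \<xi>'"
          using prefix[OF m 1(1,2) t(4)] t(5) by auto
        obtain \<beta> where b: "\<beta> \<in> paths \<Lambda>" "src \<Lambda> \<nu> = rng \<Lambda> \<beta>" "\<tau> = cmp \<Lambda> \<nu> \<beta>" "src \<Lambda> \<beta> = rng \<Lambda> \<xi>'" "\<nu>' = cmp \<Lambda> \<beta> \<xi>'"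
          using prefix[OF n 1(3,4)] 1(5) t(4,5) by auto
        have rr: "rng \<Lambda> \<mu> = rng \<Lambda> \<nu>" using rng_cmp[OF m a(1,2)] rng_cmp[OF n b(1,2)] a(3) b(3) by simp
        have dd: "deg \<Lambda> (cmp \<Lambda> \<mu> \<alpha>) = ?s" using t(5) a(3) by simp
        have ab: "(\<alpha>, \<beta>) \<in> ?M" unfolding min_ext_def using a b rr dd by auto
        \<comment> \<open>Every other term vanishes at \<xi>: \<alpha>' has the degree of \<alpha>,
          so unique factorization identifies them, and cancellation identifies \<beta>' with
          \<beta>.\<close>
        have "T i = (if i = (\<alpha>, \<beta>) then h \<nu>' else 0)" if i: "i \<in> ?M" for i
        proof -
          obtain \<alpha>' \<beta>' where ii: "i = (\<alpha>', \<beta>')" by fastforce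
          note e = min_extD[OF m n i[unfolded ii]]
          show ?thesis
          proof (cases "step (\<alpha>', True) \<xi>")
            case None
            moreover have "step (\<alpha>, True) \<xi> = Some \<xi>'" using a t(2) by (simp add: step_True)
            ultimately have "(\<alpha>', \<beta>') \<noteq> (\<alpha>, \<beta>)" by auto
            thus ?thesis using None unfolding ii T by auto
          next
            case (Some \<xi>'')
            hence l: "\<xi>'' \<in> paths \<Lambda>" "src \<Lambda> \<alpha>' = rng \<Lambda> \<xi>''" "\<xi> = cmp \<Lambda> \<alpha>' \<xi>''" by (auto simp: step_True)
            have "deg \<Lambda> \<mu> + deg \<Lambda> \<alpha>' = deg \<Lambda> \<mu> + deg \<Lambda> \<alpha>" using e(6) min_extD(6)[OF m n ab] by simp
            hence "deg \<Lambda> \<alpha>' = deg \<Lambda> \<alpha>" by simp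
            hence eq: "\<alpha>' = \<alpha> \<and> \<xi>'' = \<xi>'"
              using l a t(2) e by (intro factor_unique) auto
            have "cmp \<Lambda> \<nu> \<beta>' = cmp \<Lambda> \<nu> \<beta>" using e(5) a(3) b(3) eq by simp
            hence "\<beta>' = \<beta>" using cancel_left[OF n e(2) e(4)[THEN trans[OF refl]] b(1)] e(4) b(2) by auto
            moreover have "step (\<beta>, False) \<xi>' = Some \<nu>'" using b t(2) by (simp add: step_False)
            ultimately show ?thesis using Some eq by (simp add: ii T)
          qed
        qed
        hence "(\<Sum>i\<in>?M. T i) = (\<Sum>i\<in>?M. if i = (\<alpha>, \<beta>) then h \<nu>' else 0)" by (rule sum.cong[OF refl])
        also have "\<dots> = h \<nu>'" using ab finite_min_ext[OF m n] by (simp add: sum.delta)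
        finally show ?thesis using lhs rhs Some by simp
      qed
    qed
    thus "eqv (gadj \<mu> * gen \<nu>) (\<Sum>(\<alpha>, \<beta>)\<in>?M. gen \<alpha> * gadj \<beta>)"
      using m n by (intro op_norm_eqvI) (auto simp: min_ext_def intro!: fpoly_sum)
  qed
qed

lemma (in row_finite) op_norm_le_tnorm: "f \<in> fpoly \<Lambda> \<Longrightarrow> op_norm f \<le> tnorm \<Lambda> f"
  by (rule seminorm_le_tnorm[OF op_norm_seminorm])

section \<open>The Toeplitz algebra of a row-finite graph\<close>

definition temb :: "'p two_graph \<Rightarrow> 'p npoly \<Rightarrow> 'p toeplitz_element" where
  "temb \<Lambda> f = completion_embed (free_algebra \<Lambda> (toeplitz_norm \<Lambda>)) (coeff_of f)"

text \<open>Multiplication by a fixed element may destroy contractivity but not boundedness, and the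
  density arguments are applied to functionals of the form x \<mapsto> \<phi>(y x).\<close>

definition bounded_functional :: "'a star_algebra \<Rightarrow> ('a \<Rightarrow> complex) \<Rightarrow> bool" where
  "bounded_functional A \<phi> \<longleftrightarrow> linear_functional A \<phi> \<and> (\<exists>C. \<forall>x \<in> carrier A. cmod (\<phi> x) \<le> C * anorm A x)"

lemma contractive_imp_bounded: "contractive_functional A \<phi> \<Longrightarrow> bounded_functional A \<phi>"
  unfolding contractive_functional_def bounded_functional_def by (auto intro!: exI[of _ 1])

lemma tgen_eq: "tgen \<Lambda> \<kappa> = temb \<Lambda> (gen \<kappa>)"
  by (simp add: tgen_def temb_def free_generator_eq)

text \<open>A unit up to seminorm zero becomes an exact one in the completion, where differences of
  seminorm zero vanish.\<close>

lemma (in star_alg) completion_unit: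
  assumes e: "e \<in> carrier A" "anorm A e \<le> 1" "anorm A (astar A e \<boxminus> e) = 0"
    and unit: "\<And>x. x \<in> carrier A \<Longrightarrow> anorm A (e \<boxtimes> x \<boxminus> x) = 0" "\<And>x. x \<in> carrier A \<Longrightarrow> anorm A (x \<boxtimes> e \<boxminus> x) = 0"
  shows "unit_of (completion A) (emb e)"
  unfolding unit_of_def
proof (intro conjI ballI)
  show "emb e \<in> carrier (completion A)" "anorm (completion A) (emb e) \<le> 1" using e by (auto simp: norm_emb)
  show "astar (completion A) (emb e) = emb e" using e emb_eq_iff by (simp flip: emb_star)
  fix x assume "x \<in> carrier (completion A)"
  then obtain X where X: "X \<in> cauchy_seqs" "x = cls X" by (rule carrier_completionE)
  note c = const_cauchy[OF e(1)] cauchy_pointwise[OF X(1)]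
  show "emb e \<boxtimes>\<^bsub>completion A\<^esub> x = x"
    unfolding X(2) completion_embed_def times_completion[OF c(1) X(1)] cls_eq_iff[OF cauchy_times_closed[OF c(1) X(1)] X(1)]
    using unit(1)[OF c(2)] by simp
  show "x \<boxtimes>\<^bsub>completion A\<^esub> emb e = x"
    unfolding X(2) completion_embed_def times_completion[OF X(1) c(1)] cls_eq_iff[OF cauchy_times_closed[OF X(1) c(1)] X(1)]
    using unit(2)[OF c(2)] by simp
qed

context row_finite
begin

abbreviation "TA \<equiv> toeplitz_algebra \<Lambda>"

lemma free_star_alg_tnorm: "star_alg (free_algebra \<Lambda> (toeplitz_norm \<Lambda>))"
  by (rule cstar_on.free_star_alg[OF tnorm_cstar_on]) simp

lemma TA_star_alg: "star_alg TA"
  unfolding toeplitz_algebra_def by (rule star_alg.completion_star_alg[OF free_star_alg_tnorm])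

lemma coeff_in_free: "f \<in> fpoly \<Lambda> \<Longrightarrow> coeff_of f \<in> carrier (free_algebra \<Lambda> (toeplitz_norm \<Lambda>))"
  by (simp add: carrier_free)

lemma temb_closed [simp, intro]: "f \<in> fpoly \<Lambda> \<Longrightarrow> temb \<Lambda> f \<in> carrier TA"
  unfolding temb_def toeplitz_algebra_def by (intro star_alg.emb_closed[OF free_star_alg_tnorm] coeff_in_free)

lemma temb_zero: "temb \<Lambda> 0 = azero TA"
  using star_alg.emb_zero[OF free_star_alg_tnorm] by (simp add: temb_def toeplitz_algebra_def free_sel)

lemma temb_add: "f \<in> fpoly \<Lambda> \<Longrightarrow> g \<in> fpoly \<Lambda> \<Longrightarrow> temb \<Lambda> (f + g) = temb \<Lambda> f \<boxplus>\<^bsub>TA\<^esub> temb \<Lambda> g"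
  using star_alg.emb_add[OF free_star_alg_tnorm coeff_in_free coeff_in_free, of f g]
  by (simp add: temb_def toeplitz_algebra_def free_sel)

lemma temb_minus: "f \<in> fpoly \<Lambda> \<Longrightarrow> g \<in> fpoly \<Lambda> \<Longrightarrow> temb \<Lambda> (f - g) = temb \<Lambda> f \<boxminus>\<^bsub>TA\<^esub> temb \<Lambda> g"
  using star_alg.emb_minus[OF free_star_alg_tnorm coeff_in_free coeff_in_free, of f g]
  by (simp add: temb_def toeplitz_algebra_def free_sel)

lemma temb_mult: "f \<in> fpoly \<Lambda> \<Longrightarrow> g \<in> fpoly \<Lambda> \<Longrightarrow> temb \<Lambda> (f * g) = temb \<Lambda> f \<boxtimes>\<^bsub>TA\<^esub> temb \<Lambda> g"
  using star_alg.emb_times[OF free_star_alg_tnorm coeff_in_free coeff_in_free, of f g]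
  by (simp add: temb_def toeplitz_algebra_def free_sel)

lemma temb_pscale: "f \<in> fpoly \<Lambda> \<Longrightarrow> temb \<Lambda> (pscale c f) = ascale TA c (temb \<Lambda> f)"
  using star_alg.emb_scale[OF free_star_alg_tnorm coeff_in_free, of f c]
  by (simp add: temb_def toeplitz_algebra_def free_sel)

lemma temb_padj: "f \<in> fpoly \<Lambda> \<Longrightarrow> temb \<Lambda> (padj f) = astar TA (temb \<Lambda> f)"
  using star_alg.emb_star[OF free_star_alg_tnorm coeff_in_free, of f]
  by (simp add: temb_def toeplitz_algebra_def free_sel)

sublocale T: toeplitz_seminorm \<Lambda> "tnorm \<Lambda>"
  by (rule tnorm_seminorm)

text \<open>This turns congruences for the largest seminorm into equations in the Toeplitz
  algebra.\<close>

lemma temb_eqI: assumes "T.eqv f g" shows "temb \<Lambda> f = temb \<Lambda> g"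
proof -
  have c: "f \<in> fpoly \<Lambda>" "g \<in> fpoly \<Lambda>" using T.eqv_fpoly assms by auto
  have "anorm (free_algebra \<Lambda> (toeplitz_norm \<Lambda>)) (aminus (free_algebra \<Lambda> (toeplitz_norm \<Lambda>)) (coeff_of f) (coeff_of g)) = 0"
    using assms by (simp add: free_sel T.eqv_def)
  thus ?thesis unfolding temb_def
    using star_alg.emb_eq_iff[OF free_star_alg_tnorm coeff_in_free[OF c(1)] coeff_in_free[OF c(2)]] by simp
qed

lemma temb_unit: "unit_of TA (temb \<Lambda> T.unit_sum)"
  unfolding toeplitz_algebra_def temb_def
proof (rule star_alg.completion_unit[OF free_star_alg_tnorm])
  let ?F = "free_algebra \<Lambda> (toeplitz_norm \<Lambda>)"
  show "coeff_of T.unit_sum \<in> carrier ?F" by (simp add: coeff_in_free)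
  show "anorm ?F (coeff_of T.unit_sum) \<le> 1" using T.P_unit_sum by (simp add: free_sel)
  show "anorm ?F (astar ?F (coeff_of T.unit_sum) \<boxminus>\<^bsub>?F\<^esub> coeff_of T.unit_sum) = 0"
    using T.padj_unit_sum by (simp add: free_sel T.eqv_def)
  fix x assume "x \<in> carrier ?F"
  then obtain f where f: "x = coeff_of f" "f \<in> fpoly \<Lambda>" by (auto simp: carrier_free)
  show "anorm ?F (coeff_of T.unit_sum \<boxtimes>\<^bsub>?F\<^esub> x \<boxminus>\<^bsub>?F\<^esub> x) = 0"
    using T.unit_sum_mult[OF f(2)] by (simp add: f free_sel T.eqv_def)
  show "anorm ?F (x \<boxtimes>\<^bsub>?F\<^esub> coeff_of T.unit_sum \<boxminus>\<^bsub>?F\<^esub> x) = 0"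
    using T.mult_unit_sum[OF f(2)] by (simp add: f free_sel T.eqv_def)
qed

lemma temb_dense:
  assumes "x \<in> carrier TA" "\<epsilon> > 0"
  obtains f where "f \<in> fpoly \<Lambda>" "anorm TA (x \<boxminus>\<^bsub>TA\<^esub> temb \<Lambda> f) < \<epsilon>"
proof -
  obtain F where "F \<in> carrier (free_algebra \<Lambda> (toeplitz_norm \<Lambda>))"
    "anorm TA (x \<boxminus>\<^bsub>TA\<^esub> completion_embed (free_algebra \<Lambda> (toeplitz_norm \<Lambda>)) F) < \<epsilon>"
    using star_alg.emb_dense[OF free_star_alg_tnorm, of x \<epsilon>] assms unfolding toeplitz_algebra_def by metis
  thus ?thesis using that unfolding carrier_free temb_def by auto
qed

text \<open>Agreement on words extends to polynomials by linearity and to the whole algebra by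
  density and continuity.\<close>

lemma bounded_functional_eq:
  assumes \<phi>: "bounded_functional TA \<phi>" and \<psi>: "bounded_functional TA \<psi>"
    and words: "\<And>w. w \<in> words \<Lambda> \<Longrightarrow> \<phi> (temb \<Lambda> (monom_of w 1)) = \<psi> (temb \<Lambda> (monom_of w 1))"
    and x: "x \<in> carrier TA"
  shows "\<phi> x = \<psi> x"
proof -
  interpret A: star_alg TA by (rule TA_star_alg)
  have lin: "linear_functional TA \<phi>" "linear_functional TA \<psi>" using \<phi> \<psi> by (auto simp: bounded_functional_def)
  have poly: "\<phi> (temb \<Lambda> f) = \<psi> (temb \<Lambda> f)" if "f \<in> fpoly \<Lambda>" for f
    using that
  proof (induction rule: fpoly_induct)
    case zero show ?case using lin by (simp add: temb_zero A.linear_functional_zero)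
  next
    case (monom w c)
    have "temb \<Lambda> (monom_of w c) = ascale TA c (temb \<Lambda> (monom_of w 1))"
      using temb_pscale[OF fpoly_monom[OF monom], of c 1] by simp
    thus ?case using lin words[OF monom] fpoly_monom[OF monom, of 1] by (simp add: linear_functional_def)
  next
    case (add f g) thus ?case using lin by (simp add: temb_add linear_functional_def)
  qed
  obtain C D where C: "\<And>x. x \<in> carrier TA \<Longrightarrow> cmod (\<phi> x) \<le> C * anorm TA x"
    and D: "\<And>x. x \<in> carrier TA \<Longrightarrow> cmod (\<psi> x) \<le> D * anorm TA x"
    using \<phi> \<psi> unfolding bounded_functional_def by blast
  have "cmod (\<phi> x - \<psi> x) \<le> 0 + \<epsilon>" if e: "\<epsilon> > 0" for \<epsilon>
  proof -
    \<comment> \<open>The summand 1 makes the divisor positive for all bounds C and D.\<close>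
    let ?K = "\<bar>C\<bar> + \<bar>D\<bar> + 1"
    have K: "?K > 0" by (simp add: add_nonneg_pos)
    obtain f where f: "f \<in> fpoly \<Lambda>" "anorm TA (x \<boxminus>\<^bsub>TA\<^esub> temb \<Lambda> f) < \<epsilon> / ?K"
      using temb_dense[OF x divide_pos_pos[OF e K]] by blast
    let ?d = "x \<boxminus>\<^bsub>TA\<^esub> temb \<Lambda> f"
    have d: "?d \<in> carrier TA" using x f by simp
    have "\<phi> x - \<psi> x = \<phi> ?d - \<psi> ?d"
      using A.linear_functional_minus[OF lin(1) x temb_closed[OF f(1)]]
        A.linear_functional_minus[OF lin(2) x temb_closed[OF f(1)]] poly[OF f(1)] by simp
    hence "cmod (\<phi> x - \<psi> x) \<le> cmod (\<phi> ?d) + cmod (\<psi> ?d)" by (simp add: norm_triangle_ineq4)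
    also have "\<dots> \<le> C * anorm TA ?d + D * anorm TA ?d" using C[OF d] D[OF d] by simp
    also have "\<dots> \<le> ?K * anorm TA ?d"
    proof -
      have "(C + D) * anorm TA ?d \<le> ?K * anorm TA ?d" using A.norm_nonneg[OF d] by (intro mult_right_mono) auto
      thus ?thesis by (simp add: algebra_simps)
    qed
    also have "\<dots> \<le> ?K * (\<epsilon> / ?K)" using f(2) K by (intro mult_left_mono) auto
    finally show ?thesis using K by simp
  qed
  hence "cmod (\<phi> x - \<psi> x) \<le> 0" by (rule field_le_epsilon)
  thus ?thesis by simp
qed

lemma bounded_functional_left:
  assumes "bounded_functional TA \<phi>" "y \<in> carrier TA" shows "bounded_functional TA (\<lambda>x. \<phi> (y \<boxtimes>\<^bsub>TA\<^esub> x))"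
proof -
  interpret A: star_alg TA by (rule TA_star_alg)
  obtain C where C: "\<And>x. x \<in> carrier TA \<Longrightarrow> cmod (\<phi> x) \<le> C * anorm TA x" using assms(1) unfolding bounded_functional_def by blast
  have "cmod (\<phi> (y \<boxtimes>\<^bsub>TA\<^esub> x)) \<le> (\<bar>C\<bar> * anorm TA y) * anorm TA x" if x: "x \<in> carrier TA" for x
  proof -
    have "cmod (\<phi> (y \<boxtimes>\<^bsub>TA\<^esub> x)) \<le> \<bar>C\<bar> * anorm TA (y \<boxtimes>\<^bsub>TA\<^esub> x)"
      using C[of "y \<boxtimes>\<^bsub>TA\<^esub> x"] mult_right_mono[of C "\<bar>C\<bar>" "anorm TA (y \<boxtimes>\<^bsub>TA\<^esub> x)"] assms(2) x by force
    also have "\<dots> \<le> \<bar>C\<bar> * (anorm TA y * anorm TA x)" by (intro mult_left_mono A.norm_times assms(2) x) auto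
    finally show ?thesis by (simp add: mult.assoc)
  qed
  moreover have "linear_functional TA (\<lambda>x. \<phi> (y \<boxtimes>\<^bsub>TA\<^esub> x))"
    using assms unfolding bounded_functional_def linear_functional_def by (simp add: A.times_add A.times_scale)
  ultimately show ?thesis unfolding bounded_functional_def by blast
qed

lemma bounded_functional_right:
  assumes "bounded_functional TA \<phi>" "y \<in> carrier TA" shows "bounded_functional TA (\<lambda>x. \<phi> (x \<boxtimes>\<^bsub>TA\<^esub> y))"
proof -
  interpret A: star_alg TA by (rule TA_star_alg)
  obtain C where C: "\<And>x. x \<in> carrier TA \<Longrightarrow> cmod (\<phi> x) \<le> C * anorm TA x" using assms(1) unfolding bounded_functional_def by blast
  have "cmod (\<phi> (x \<boxtimes>\<^bsub>TA\<^esub> y)) \<le> (\<bar>C\<bar> * anorm TA y) * anorm TA x" if x: "x \<in> carrier TA" for x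
  proof -
    have "cmod (\<phi> (x \<boxtimes>\<^bsub>TA\<^esub> y)) \<le> \<bar>C\<bar> * anorm TA (x \<boxtimes>\<^bsub>TA\<^esub> y)"
      using C[of "x \<boxtimes>\<^bsub>TA\<^esub> y"] mult_right_mono[of C "\<bar>C\<bar>" "anorm TA (x \<boxtimes>\<^bsub>TA\<^esub> y)"] assms(2) x by force
    also have "\<dots> \<le> \<bar>C\<bar> * (anorm TA x * anorm TA y)" by (intro mult_left_mono A.norm_times assms(2) x) auto
    finally show ?thesis by (simp add: mult_ac)
  qed
  moreover have "linear_functional TA (\<lambda>x. \<phi> (x \<boxtimes>\<^bsub>TA\<^esub> y))"
    using assms unfolding bounded_functional_def linear_functional_def by (simp add: A.add_times A.scale_times)
  ultimately show ?thesis unfolding bounded_functional_def by blast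
qed

lemma bounded_functional_scale:
  assumes "bounded_functional TA \<phi>" shows "bounded_functional TA (\<lambda>x. c * \<phi> x)"
proof -
  obtain C where C: "\<And>x. x \<in> carrier TA \<Longrightarrow> cmod (\<phi> x) \<le> C * anorm TA x"
    using assms(1) unfolding bounded_functional_def by blast
  have "cmod (c * \<phi> x) \<le> (cmod c * C) * anorm TA x" if "x \<in> carrier TA" for x
    using mult_left_mono[OF C[OF that], of "cmod c"] by (simp add: norm_mult mult_ac)
  moreover have "linear_functional TA (\<lambda>x. c * \<phi> x)"
    using assms unfolding bounded_functional_def linear_functional_def by (simp add: algebra_simps)
  ultimately show ?thesis unfolding bounded_functional_def by blast
qed

end

section \<open>A criterion for KMS states\<close>

definition path_weight :: "'p two_graph \<Rightarrow> real \<times> real \<Rightarrow> 'p \<Rightarrow> real" where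
  "path_weight \<Lambda> r \<kappa> = fst r * real (fst (deg \<Lambda> \<kappa>)) + snd r * real (snd (deg \<Lambda> \<kappa>))"

text \<open>Adjoint letters count negatively, so the dynamics multiplies a word of weight c by
  e^{itc}.\<close>

definition word_weight :: "'p two_graph \<Rightarrow> real \<times> real \<Rightarrow> 'p word \<Rightarrow> real" where
  "word_weight \<Lambda> r w = (\<Sum>l\<leftarrow>w. if snd l then - path_weight \<Lambda> r (fst l) else path_weight \<Lambda> r (fst l))"

context row_finite
begin

lemma state_bounded: "is_state TA \<phi> \<Longrightarrow> bounded_functional TA \<phi>"
  using star_alg.is_state_iff[OF TA_star_alg temb_unit] contractive_imp_bounded by blast

lemma state_padj: "is_state TA \<phi> \<Longrightarrow> f \<in> fpoly \<Lambda> \<Longrightarrow> \<phi> (temb \<Lambda> (padj f)) = cnj (\<phi> (temb \<Lambda> f))"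
  using star_alg.is_state_iff[OF TA_star_alg temb_unit] star_alg.positive_functional_star[OF TA_star_alg _ temb_unit]
  by (simp add: temb_padj)

text \<open>The KMS condition for a generator: its entire orbit is z \<mapsto> e^{iz r.d(\<kappa>)}
  t_\<kappa>, and z = i\<beta> produces the factor.\<close>

definition twisted_trace :: "real \<times> real \<Rightarrow> real \<Rightarrow> ('p toeplitz_element \<Rightarrow> complex) \<Rightarrow> bool" where
  "twisted_trace r \<beta> \<phi> \<longleftrightarrow> (\<forall>\<kappa>\<in>paths \<Lambda>. \<forall>f\<in>fpoly \<Lambda>.
     \<phi> (temb \<Lambda> (gen \<kappa> * f)) = complex_of_real (exp (- \<beta> * path_weight \<Lambda> r \<kappa>)) * \<phi> (temb \<Lambda> (f * gen \<kappa>)))"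

text \<open>A cyclic rotation, one letter at a time. The rule for an adjoint letter is the complex
  conjugate of the rule for a generator, read in the other direction, which inverts the real
  factor.\<close>

lemma twisted_trace_word:
  assumes st: "is_state TA \<phi>" and tr: "twisted_trace r \<beta> \<phi>"
  shows "w \<in> words \<Lambda> \<Longrightarrow> f \<in> fpoly \<Lambda> \<Longrightarrow>
    \<phi> (temb \<Lambda> (monom_of w 1 * f)) = complex_of_real (exp (- \<beta> * word_weight \<Lambda> r w)) * \<phi> (temb \<Lambda> (f * monom_of w 1))"
proof (induction w arbitrary: f)
  case (Cons l w)
  obtain \<kappa> b where l: "l = (\<kappa>, b)" by fastforce
  have k: "\<kappa> \<in> paths \<Lambda>" using Cons.prems l by (auto simp: words_def)
  let ?l = "monom_of [l] 1 :: 'p npoly"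
  let ?s = "if b then - path_weight \<Lambda> r \<kappa> else path_weight \<Lambda> r \<kappa>"
  have lf: "?l \<in> fpoly \<Lambda>" using k l by (intro fpoly_monom) (auto simp: words_def)
  have letter: "\<phi> (temb \<Lambda> (?l * g)) = complex_of_real (exp (- \<beta> * ?s)) * \<phi> (temb \<Lambda> (g * ?l))" if g: "g \<in> fpoly \<Lambda>" for g
  proof (cases b)
    case False
    thus ?thesis using tr k g l by (simp add: twisted_trace_def gen_def)
  next
    case True
    have e: "\<phi> (temb \<Lambda> (gen \<kappa> * padj g)) = complex_of_real (exp (- \<beta> * path_weight \<Lambda> r \<kappa>)) * \<phi> (temb \<Lambda> (padj g * gen \<kappa>))"
      using tr k g by (simp add: twisted_trace_def)
    have 1: "\<phi> (temb \<Lambda> (gadj \<kappa> * g)) = cnj (\<phi> (temb \<Lambda> (padj g * gen \<kappa>)))"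
      using state_padj[OF st, of "padj g * gen \<kappa>"] g k by (simp add: padj_mult)
    have 2: "\<phi> (temb \<Lambda> (g * gadj \<kappa>)) = cnj (\<phi> (temb \<Lambda> (gen \<kappa> * padj g)))"
      using state_padj[OF st, of "gen \<kappa> * padj g"] g k by (simp add: padj_mult)
    have "\<phi> (temb \<Lambda> (gadj \<kappa> * g)) = complex_of_real (exp (\<beta> * path_weight \<Lambda> r \<kappa>)) * \<phi> (temb \<Lambda> (g * gadj \<kappa>))"
      unfolding 1 2 e by (simp add: exp_minus field_simps)
    thus ?thesis using True l by (simp add: gadj_def)
  qed
  show ?case
  proof (cases "w = []")
    case True
    thus ?thesis using letter[OF Cons.prems(2)] l by (simp add: word_weight_def)
  next
    case False
    hence w: "w \<in> words \<Lambda>" using Cons.prems by (auto simp: words_def)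
    let ?w = "monom_of w 1 :: 'p npoly"
    have wf: "?w \<in> fpoly \<Lambda>" by (rule fpoly_monom[OF w])
    have lw: "monom_of (l # w) 1 = ?l * ?w" by (simp add: monom_mult)
    have "\<phi> (temb \<Lambda> (?l * (?w * f))) = complex_of_real (exp (- \<beta> * ?s)) * \<phi> (temb \<Lambda> (?w * (f * ?l)))"
      using letter[of "?w * f"] wf Cons.prems(2) by (simp add: mult.assoc)
    also have "\<phi> (temb \<Lambda> (?w * (f * ?l))) = complex_of_real (exp (- \<beta> * word_weight \<Lambda> r w)) * \<phi> (temb \<Lambda> (f * ?l * ?w))"
      using Cons.IH[OF w, of "f * ?l"] lf Cons.prems(2) by simp
    finally have "\<phi> (temb \<Lambda> (?l * ?w * f))
        = complex_of_real (exp (- \<beta> * ?s) * exp (- \<beta> * word_weight \<Lambda> r w)) * \<phi> (temb \<Lambda> (f * (?l * ?w)))"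
      by (simp add: mult.assoc)
    also have "exp (- \<beta> * ?s) * exp (- \<beta> * word_weight \<Lambda> r w) = exp (- \<beta> * word_weight \<Lambda> r (l # w))"
      by (simp add: l word_weight_def flip: exp_add) (simp add: algebra_simps)
    finally show ?thesis by (simp only: lw flip: of_real_mult)
  qed
qed (simp add: words_def)

text \<open>Against the unit, rotation of a word of weight c gives \<phi>(w) = e^{-\<beta>c}
  \<phi>(w) with a factor different from 1.\<close>

lemma twisted_trace_zero:
  assumes st: "is_state TA \<phi>" and tr: "twisted_trace r \<beta> \<phi>" and "\<beta> \<noteq> 0"
    and w: "w \<in> words \<Lambda>" "word_weight \<Lambda> r w \<noteq> 0"
  shows "\<phi> (temb \<Lambda> (monom_of w 1)) = 0"
proof -
  have wf: "monom_of w 1 \<in> fpoly \<Lambda>" by (rule fpoly_monom[OF w(1)])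
  have "\<phi> (temb \<Lambda> (monom_of w 1)) = complex_of_real (exp (- \<beta> * word_weight \<Lambda> r w)) * \<phi> (temb \<Lambda> (monom_of w 1))"
    using twisted_trace_word[OF st tr w(1) T.unit_sum_fpoly] temb_eqI[OF T.unit_sum_mult[OF wf]]
      temb_eqI[OF T.mult_unit_sum[OF wf]] by simp
  hence "(1 - complex_of_real (exp (- \<beta> * word_weight \<Lambda> r w))) * \<phi> (temb \<Lambda> (monom_of w 1)) = 0"
    by (simp add: algebra_simps)
  moreover have "exp (- \<beta> * word_weight \<Lambda> r w) \<noteq> 1" using assms by simp
  hence "1 - complex_of_real (exp (- \<beta> * word_weight \<Lambda> r w)) \<noteq> 0"
    by (metis eq_iff_diff_eq_0 of_real_1 of_real_eq_iff)
  ultimately show ?thesis by simp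
qed

lemma word_weight_append: "word_weight \<Lambda> r (v @ w) = word_weight \<Lambda> r v + word_weight \<Lambda> r w"
  by (simp add: word_weight_def)

text \<open>The dynamics is prescribed on products of a generator and an adjoint generator. With the
  vertex s(\<kappa>) as second path this product is t_\<kappa> itself.\<close>

lemma dynamics_gen:
  assumes dyn: "toeplitz_dynamics \<Lambda> r \<alpha>" and k: "\<kappa> \<in> paths \<Lambda>"
  shows "\<alpha> t (temb \<Lambda> (gen \<kappa>)) = ascale TA (exp (\<i> * of_real (t * path_weight \<Lambda> r \<kappa>))) (temb \<Lambda> (gen \<kappa>))"
proof -
  have s: "src \<Lambda> \<kappa> \<in> paths \<Lambda>" using k by (rule src_closed)
  have "T.eqv (gen \<kappa> * gadj (src \<Lambda> \<kappa>)) (gen \<kappa> * gen (src \<Lambda> \<kappa>))"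
    using k by (intro T.eqv_mult_left T.t_vertex_adj src_vertex) auto
  hence "T.eqv (gen \<kappa> * gadj (src \<Lambda> \<kappa>)) (gen \<kappa>)" using T.t_src[OF k] T.eqv_trans by blast
  hence e: "temb \<Lambda> (gen \<kappa>) \<boxtimes>\<^bsub>TA\<^esub> astar TA (temb \<Lambda> (gen (src \<Lambda> \<kappa>))) = temb \<Lambda> (gen \<kappa>)"
    using temb_eqI k s by (simp flip: temb_padj add: temb_mult[symmetric])
  have "\<alpha> t (tgen \<Lambda> \<kappa> \<boxtimes>\<^bsub>TA\<^esub> astar TA (tgen \<Lambda> (src \<Lambda> \<kappa>)))
      = ascale TA (exp (\<i> * of_real (t * path_weight \<Lambda> r \<kappa>))) (tgen \<Lambda> \<kappa> \<boxtimes>\<^bsub>TA\<^esub> astar TA (tgen \<Lambda> (src \<Lambda> \<kappa>)))"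
    using dyn k s deg_src[OF k] unfolding toeplitz_dynamics_def Let_def path_weight_def by simp
  thus ?thesis unfolding tgen_eq e .
qed

lemma dynamics_word:
  assumes dyn: "toeplitz_dynamics \<Lambda> r \<alpha>"
  shows "w \<in> words \<Lambda> \<Longrightarrow> \<alpha> t (temb \<Lambda> (monom_of w 1))
     = ascale TA (exp (\<i> * of_real (t * word_weight \<Lambda> r w))) (temb \<Lambda> (monom_of w 1))"
proof (induction w)
  case (Cons l w)
  interpret A: star_alg TA by (rule TA_star_alg)
  have hom: "star_hom TA TA (\<alpha> t)" using dyn by (auto simp: toeplitz_dynamics_def star_automorphism_def Let_def)
  obtain \<kappa> b where l: "l = (\<kappa>, b)" by fastforce
  have k: "\<kappa> \<in> paths \<Lambda>" using Cons.prems l by (auto simp: words_def)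
  have lf: "monom_of [l] 1 \<in> fpoly \<Lambda>" using k l by (intro fpoly_monom) (auto simp: words_def)
  have letter: "\<alpha> t (temb \<Lambda> (monom_of [l] 1))
     = ascale TA (exp (\<i> * of_real (t * word_weight \<Lambda> r [l]))) (temb \<Lambda> (monom_of [l] 1))"
  proof (cases b)
    case False
    thus ?thesis using dynamics_gen[OF dyn k, of t] l by (simp add: gen_def word_weight_def)
  next
    case True
    have "\<alpha> t (temb \<Lambda> (gadj \<kappa>)) = astar TA (\<alpha> t (temb \<Lambda> (gen \<kappa>)))"
      using hom k temb_padj[OF fpoly_gen[OF k]] by (simp add: star_hom_def)
    also have "\<dots> = ascale TA (exp (\<i> * of_real (t * (- path_weight \<Lambda> r \<kappa>)))) (temb \<Lambda> (gadj \<kappa>))"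
      unfolding dynamics_gen[OF dyn k] using k temb_padj[OF fpoly_gen[OF k]]
      by (simp add: A.star_scale exp_cnj)
    finally show ?thesis using True l by (simp add: gadj_def word_weight_def)
  qed
  show ?case
  proof (cases "w = []")
    case False
    hence w: "w \<in> words \<Lambda>" using Cons.prems by (auto simp: words_def)
    have wf: "monom_of w 1 \<in> fpoly \<Lambda>" by (rule fpoly_monom[OF w])
    have e: "temb \<Lambda> (monom_of (l # w) 1) = temb \<Lambda> (monom_of [l] 1) \<boxtimes>\<^bsub>TA\<^esub> temb \<Lambda> (monom_of w 1)"
      using temb_mult[OF lf wf] by (simp add: monom_mult)
    have x: "exp (\<i> * of_real (t * word_weight \<Lambda> r (l # w)))
       = exp (\<i> * of_real (t * word_weight \<Lambda> r [l])) * exp (\<i> * of_real (t * word_weight \<Lambda> r w))"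
      using word_weight_append[of r "[l]" w] by (simp add: algebra_simps flip: exp_add)
    have "\<alpha> t (temb \<Lambda> (monom_of (l # w) 1)) = \<alpha> t (temb \<Lambda> (monom_of [l] 1)) \<boxtimes>\<^bsub>TA\<^esub> \<alpha> t (temb \<Lambda> (monom_of w 1))"
      unfolding e using hom lf wf by (simp add: star_hom_def)
    thus ?thesis unfolding letter Cons.IH[OF w] x unfolding e
      using lf wf by (simp add: A.scale_times A.times_scale A.scale_scale mult.commute)
  qed (use letter in simp)
qed (simp add: words_def)

text \<open>Norm differentiability passes through a bounded linear functional, so the KMS condition
  becomes a statement about scalar entire functions.\<close>

lemma entire_apply_functional:
  assumes \<phi>: "bounded_functional TA \<phi>" and F: "entire_function TA F"
  shows "(\<lambda>z. \<phi> (F z)) holomorphic_on UNIV"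
proof -
  interpret A: star_alg TA by (rule TA_star_alg)
  have lin: "linear_functional TA \<phi>" using \<phi> by (simp add: bounded_functional_def)
  obtain C where C: "\<And>x. x \<in> carrier TA \<Longrightarrow> cmod (\<phi> x) \<le> C * anorm TA x" using \<phi> unfolding bounded_functional_def by blast
  have Fc: "F z \<in> carrier TA" for z using F by (auto simp: entire_function_def)
  have "\<exists>d. ((\<lambda>z. \<phi> (F z)) has_field_derivative d) (at z)" for z
  proof -
    obtain D where D: "D \<in> carrier TA"
      "((\<lambda>h. anorm TA (ascale TA (1 / h) (F (z + h) \<boxminus>\<^bsub>TA\<^esub> F z) \<boxminus>\<^bsub>TA\<^esub> D)) \<longlongrightarrow> 0) (at 0)"
      using F unfolding entire_function_def by blast
    have "norm ((\<phi> (F (z + h)) - \<phi> (F z)) / h - \<phi> D)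
        \<le> C * anorm TA (ascale TA (1 / h) (F (z + h) \<boxminus>\<^bsub>TA\<^esub> F z) \<boxminus>\<^bsub>TA\<^esub> D)" for h
    proof -
      have "\<phi> (ascale TA (1 / h) (F (z + h) \<boxminus>\<^bsub>TA\<^esub> F z) \<boxminus>\<^bsub>TA\<^esub> D) = (\<phi> (F (z + h)) - \<phi> (F z)) / h - \<phi> D"
        using lin Fc D(1) by (simp add: A.linear_functional_minus linear_functional_def[of TA])
      thus ?thesis using C[of "ascale TA (1 / h) (F (z + h) \<boxminus>\<^bsub>TA\<^esub> F z) \<boxminus>\<^bsub>TA\<^esub> D"] Fc D(1) by simp
    qed
    moreover have "((\<lambda>h. C * anorm TA (ascale TA (1 / h) (F (z + h) \<boxminus>\<^bsub>TA\<^esub> F z) \<boxminus>\<^bsub>TA\<^esub> D)) \<longlongrightarrow> 0) (at 0)"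
      using tendsto_mult_right_zero[OF D(2)] .
    ultimately have "((\<lambda>h. (\<phi> (F (z + h)) - \<phi> (F z)) / h - \<phi> D) \<longlongrightarrow> 0) (at 0)"
      by - (rule Lim_null_comparison, auto)
    hence "((\<lambda>h. (\<phi> (F (z + h)) - \<phi> (F z)) / h) \<longlongrightarrow> \<phi> D) (at 0)" by (simp add: LIM_zero_iff)
    thus ?thesis by (auto simp: DERIV_def)
  qed
  thus ?thesis by (auto simp: holomorphic_on_def field_differentiable_def)
qed

text \<open>The identity theorem; the points e / 2 show that 0 is a limit point of the real
  axis.\<close>

lemma holomorphic_eq_on_reals:
  assumes "f holomorphic_on UNIV" "g holomorphic_on UNIV" "\<And>t::real. f (of_real t) = g (of_real t)"
  shows "f z = g z"
proof -
  have "(0::complex) islimpt range complex_of_real"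
    unfolding islimpt_approachable
  proof (intro allI impI)
    fix e :: real assume "e > 0"
    thus "\<exists>x'\<in>range complex_of_real. x' \<noteq> 0 \<and> dist x' 0 < e"
      by (intro bexI[OF _ rangeI[of complex_of_real "e / 2"]]) (simp add: norm_divide)
  qed
  hence "f z - g z = 0"
    using assms
    by (intro analytic_continuation[of "\<lambda>z. f z - g z" UNIV "range complex_of_real" 0 z])
      (auto intro: holomorphic_intros)
  thus ?thesis by simp
qed

text \<open>Both sides of the KMS identity are bounded and linear in y, so y may be a word w, of
  weight c. The trace relation gives \<phi>(x w) = e^{\<beta>c} \<phi>(w x). For real t, \<phi>(w
  \<alpha>_t(x)) = e^{-itc} \<phi>(w x), where both sides extend to entire functions of t; at t =
  i\<beta> the exponential is again e^{\<beta>c}.\<close>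

lemma twisted_trace_kms:
  assumes st: "is_state TA \<phi>" and tr: "twisted_trace r \<beta> \<phi>" and "\<beta> \<noteq> 0"
    and dyn: "toeplitz_dynamics \<Lambda> r \<alpha>"
  shows "kms_state TA \<alpha> \<beta> \<phi>"
  unfolding kms_state_def
proof (intro conjI allI impI)
  show "is_state TA \<phi>" by (rule st)
  fix x y F assume "analytic_extension TA \<alpha> x F \<and> analytic_element TA \<alpha> y"
  hence x: "x \<in> carrier TA" and F: "entire_function TA F" "\<And>t. F (complex_of_real t) = \<alpha> t x"
    and y: "y \<in> carrier TA"
    by (auto simp: analytic_extension_def analytic_element_def)
  interpret A: star_alg TA by (rule TA_star_alg)
  have b: "bounded_functional TA \<phi>" by (rule state_bounded[OF st])
  have sc: "\<And>c x. x \<in> carrier TA \<Longrightarrow> \<phi> (ascale TA c x) = c * \<phi> x" using b by (simp add: bounded_functional_def linear_functional_def)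
  have Fc: "F z \<in> carrier TA" for z using F by (auto simp: entire_function_def)
  show "\<phi> (x \<boxtimes>\<^bsub>TA\<^esub> y) = \<phi> (y \<boxtimes>\<^bsub>TA\<^esub> F (\<i> * of_real \<beta>))"
  proof (rule bounded_functional_eq[OF bounded_functional_left[OF b x] bounded_functional_right[OF b Fc] _ y])
    fix w assume w: "w \<in> words \<Lambda>"
    have wf: "monom_of w 1 \<in> fpoly \<Lambda>" by (rule fpoly_monom[OF w])
    let ?w = "temb \<Lambda> (monom_of w 1)"
    let ?c = "word_weight \<Lambda> r w"
    have wc: "?w \<in> carrier TA" using wf by simp
    have e1: "exp (- \<beta> * ?c) * exp (\<beta> * ?c) = 1" by (simp flip: exp_add)
    have 1: "\<phi> (x \<boxtimes>\<^bsub>TA\<^esub> ?w) = complex_of_real (exp (\<beta> * ?c)) * \<phi> (?w \<boxtimes>\<^bsub>TA\<^esub> x)"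
    proof (rule bounded_functional_eq[OF bounded_functional_right[OF b wc] bounded_functional_scale[OF bounded_functional_left[OF b wc]] _ x])
      fix v assume "v \<in> words \<Lambda>"
      hence v: "monom_of v 1 \<in> fpoly \<Lambda>" by (rule fpoly_monom)
      have "\<phi> (?w \<boxtimes>\<^bsub>TA\<^esub> temb \<Lambda> (monom_of v 1)) = complex_of_real (exp (- \<beta> * ?c)) * \<phi> (temb \<Lambda> (monom_of v 1) \<boxtimes>\<^bsub>TA\<^esub> ?w)"
        using twisted_trace_word[OF st tr w v] v wf by (simp add: temb_mult)
      hence "complex_of_real (exp (\<beta> * ?c)) * \<phi> (?w \<boxtimes>\<^bsub>TA\<^esub> temb \<Lambda> (monom_of v 1))
          = complex_of_real (exp (- \<beta> * ?c) * exp (\<beta> * ?c)) * \<phi> (temb \<Lambda> (monom_of v 1) \<boxtimes>\<^bsub>TA\<^esub> ?w)"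
        by (simp only: of_real_mult mult_ac)
      thus "\<phi> (temb \<Lambda> (monom_of v 1) \<boxtimes>\<^bsub>TA\<^esub> ?w) = complex_of_real (exp (\<beta> * ?c)) * \<phi> (?w \<boxtimes>\<^bsub>TA\<^esub> temb \<Lambda> (monom_of v 1))"
        by (simp only: e1 of_real_1 mult_1)
    qed
    have aut: "star_hom TA TA (\<alpha> t)" "\<And>x. x \<in> carrier TA \<Longrightarrow> anorm TA (\<alpha> t x) = anorm TA x" for t
      using dyn by (auto simp: toeplitz_dynamics_def star_automorphism_def Let_def)
    \<comment> \<open>Only components of x of weight -c can be seen against w, because \<phi>
      vanishes on words of nonzero weight; on these the dynamics acts by e^{-itc}.\<close>
    have 2: "\<phi> (?w \<boxtimes>\<^bsub>TA\<^esub> \<alpha> t x) = exp (\<i> * of_real (t * (- ?c))) * \<phi> (?w \<boxtimes>\<^bsub>TA\<^esub> x)" for t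
    proof (rule bounded_functional_eq[OF _ bounded_functional_scale[OF bounded_functional_left[OF b wc]] _ x])
      have hc: "x \<in> carrier TA \<Longrightarrow> \<alpha> t x \<in> carrier TA" for x using aut(1)[of t] by (auto simp: star_hom_def)
      obtain C where C: "\<And>x. x \<in> carrier TA \<Longrightarrow> cmod (\<phi> (?w \<boxtimes>\<^bsub>TA\<^esub> x)) \<le> C * anorm TA x"
        using bounded_functional_left[OF b wc] unfolding bounded_functional_def by blast
      have "cmod (\<phi> (?w \<boxtimes>\<^bsub>TA\<^esub> \<alpha> t x)) \<le> C * anorm TA x" if "x \<in> carrier TA" for x
        using C[OF hc[OF that]] aut(2)[OF that] by simp
      moreover have "linear_functional TA (\<lambda>x. \<phi> (?w \<boxtimes>\<^bsub>TA\<^esub> \<alpha> t x))"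
        using bounded_functional_left[OF b wc] aut(1)[of t] hc
        unfolding bounded_functional_def linear_functional_def star_hom_def by simp
      ultimately show "bounded_functional TA (\<lambda>x. \<phi> (?w \<boxtimes>\<^bsub>TA\<^esub> \<alpha> t x))" unfolding bounded_functional_def by blast
      fix v assume v: "v \<in> words \<Lambda>"
      hence vf: "monom_of v 1 \<in> fpoly \<Lambda>" by (rule fpoly_monom)
      have wv: "w @ v \<in> words \<Lambda>" using w v by (auto simp: words_def)
      have "\<phi> (?w \<boxtimes>\<^bsub>TA\<^esub> \<alpha> t (temb \<Lambda> (monom_of v 1)))
          = exp (\<i> * of_real (t * word_weight \<Lambda> r v)) * \<phi> (temb \<Lambda> (monom_of (w @ v) 1))"
        unfolding dynamics_word[OF dyn v] using wc vf temb_mult[OF wf vf]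
        by (simp add: A.times_scale sc monom_mult)
      moreover have "\<phi> (?w \<boxtimes>\<^bsub>TA\<^esub> temb \<Lambda> (monom_of v 1)) = \<phi> (temb \<Lambda> (monom_of (w @ v) 1))"
        using temb_mult[OF wf vf] by (simp add: monom_mult)
      moreover have "word_weight \<Lambda> r v = - ?c" if "\<phi> (temb \<Lambda> (monom_of (w @ v) 1)) \<noteq> 0"
        using twisted_trace_zero[OF st tr \<open>\<beta> \<noteq> 0\<close> wv] that word_weight_append[of r w v] by fastforce
      ultimately show "\<phi> (?w \<boxtimes>\<^bsub>TA\<^esub> \<alpha> t (temb \<Lambda> (monom_of v 1)))
          = exp (\<i> * of_real (t * (- ?c))) * \<phi> (?w \<boxtimes>\<^bsub>TA\<^esub> temb \<Lambda> (monom_of v 1))"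
        by (cases "\<phi> (temb \<Lambda> (monom_of (w @ v) 1)) = 0") auto
    qed
    \<comment> \<open>The identity theorem carries the formula from real t to i\<beta>.\<close>
    have "\<phi> (?w \<boxtimes>\<^bsub>TA\<^esub> F (\<i> * of_real \<beta>)) = exp (\<i> * (\<i> * of_real \<beta>) * of_real (- ?c)) * \<phi> (?w \<boxtimes>\<^bsub>TA\<^esub> x)"
    proof (rule holomorphic_eq_on_reals[of "\<lambda>z. \<phi> (?w \<boxtimes>\<^bsub>TA\<^esub> F z)" "\<lambda>z. exp (\<i> * z * of_real (- ?c)) * \<phi> (?w \<boxtimes>\<^bsub>TA\<^esub> x)"])
      show "(\<lambda>z. \<phi> (?w \<boxtimes>\<^bsub>TA\<^esub> F z)) holomorphic_on UNIV"
        by (rule entire_apply_functional[OF bounded_functional_left[OF b wc] F(1)])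
      show "\<phi> (?w \<boxtimes>\<^bsub>TA\<^esub> F (of_real t)) = exp (\<i> * of_real t * of_real (- ?c)) * \<phi> (?w \<boxtimes>\<^bsub>TA\<^esub> x)" for t :: real
        unfolding F(2) 2 by (simp add: mult.assoc)
    qed (intro holomorphic_intros)
    also have "exp (\<i> * (\<i> * of_real \<beta>) * of_real (- ?c)) = complex_of_real (exp (\<beta> * ?c))"
      by (simp add: exp_of_real[symmetric])
    finally show "\<phi> (x \<boxtimes>\<^bsub>TA\<^esub> ?w) = \<phi> (?w \<boxtimes>\<^bsub>TA\<^esub> F (\<i> * of_real \<beta>))" using 1 by simp
  qed
qed

lemma word_analytic_extension:
  assumes dyn: "toeplitz_dynamics \<Lambda> r \<alpha>" and w: "w \<in> words \<Lambda>"
  shows "analytic_extension TA \<alpha> (temb \<Lambda> (monom_of w 1))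
    (\<lambda>z. ascale TA (exp (\<i> * z * of_real (word_weight \<Lambda> r w))) (temb \<Lambda> (monom_of w 1)))"
    (is "analytic_extension TA \<alpha> ?x (\<lambda>z. ascale TA (?e z) ?x)")
  unfolding analytic_extension_def entire_function_def
proof (intro conjI allI)
  interpret A: star_alg TA by (rule TA_star_alg)
  show x: "?x \<in> carrier TA" using fpoly_monom[OF w, of 1] by simp
  show "range (\<lambda>z. ascale TA (?e z) ?x) \<subseteq> carrier TA" using x by auto
  show "ascale TA (?e (complex_of_real t)) ?x = \<alpha> t ?x" for t
    unfolding dynamics_word[OF dyn w] by (simp add: mult.assoc)
  fix z
  let ?c = "\<i> * of_real (word_weight \<Lambda> r w)"
  let ?D = "?c * ?e z"
  have "(?e has_field_derivative ?D) (at z)"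
    by (auto intro!: derivative_eq_intros)
  hence lim: "((\<lambda>h. norm ((?e (z + h) - ?e z) / h - ?D) * anorm TA ?x) \<longlongrightarrow> 0) (at 0)"
    by (intro tendsto_mult_left_zero tendsto_norm_zero) (simp add: DERIV_def LIM_zero)
  have eq: "anorm TA (ascale TA (1 / h) (ascale TA (?e (z + h)) ?x \<boxminus>\<^bsub>TA\<^esub> ascale TA (?e z) ?x) \<boxminus>\<^bsub>TA\<^esub> ascale TA ?D ?x)
      = norm ((?e (z + h) - ?e z) / h - ?D) * anorm TA ?x" for h
  proof -
    have sub: "ascale TA a ?x \<boxminus>\<^bsub>TA\<^esub> ascale TA b ?x = ascale TA (a - b) ?x" for a b
      unfolding aminus_def using x A.add_scale[of ?x a "- b"] by (simp add: A.scale_scale)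
    show ?thesis unfolding sub using x by (simp add: A.scale_scale sub A.norm_scale)
  qed
  show "\<exists>D\<in>carrier TA. ((\<lambda>h. anorm TA (ascale TA (1 / h)
      (ascale TA (?e (z + h)) ?x \<boxminus>\<^bsub>TA\<^esub> ascale TA (?e z) ?x) \<boxminus>\<^bsub>TA\<^esub> D)) \<longlongrightarrow> 0) (at 0)"
    by (rule bexI[of _ "ascale TA ?D ?x"]) (use lim x in \<open>simp_all only: eq A.scale_closed\<close>)
qed

text \<open>The entire orbit of a generator is explicit. Words are analytic, so they may be tested
  as second argument, and density extends the relation to all elements, in particular to
  polynomials.\<close>

lemma kms_twisted_trace:
  assumes kms: "kms_state TA \<alpha> \<beta> \<phi>" and dyn: "toeplitz_dynamics \<Lambda> r \<alpha>"
  shows "twisted_trace r \<beta> \<phi>"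
  unfolding twisted_trace_def
proof (intro ballI)
  fix \<kappa> f assume k: "\<kappa> \<in> paths \<Lambda>" and f: "f \<in> fpoly \<Lambda>"
  interpret A: star_alg TA by (rule TA_star_alg)
  have b: "bounded_functional TA \<phi>" using kms state_bounded by (simp add: kms_state_def)
  have kw: "[(\<kappa>, False)] \<in> words \<Lambda>" using k by (auto simp: words_def)
  let ?x = "temb \<Lambda> (gen \<kappa>)"
  let ?c = "complex_of_real (exp (- \<beta> * path_weight \<Lambda> r \<kappa>))"
  have x: "?x \<in> carrier TA" using k by simp
  have sc: "\<And>c x. x \<in> carrier TA \<Longrightarrow> \<phi> (ascale TA c x) = c * \<phi> x" using b by (simp add: bounded_functional_def linear_functional_def)
  have c: "exp (\<i> * (\<i> * of_real \<beta>) * of_real (word_weight \<Lambda> r [(\<kappa>, False)])) = ?c"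
    by (simp add: word_weight_def exp_of_real[symmetric])
  have "\<phi> (?x \<boxtimes>\<^bsub>TA\<^esub> y) = ?c * \<phi> (y \<boxtimes>\<^bsub>TA\<^esub> ?x)" if y: "y \<in> carrier TA" for y
  proof (rule bounded_functional_eq[OF bounded_functional_left[OF b x] bounded_functional_scale[OF bounded_functional_right[OF b x]] _ y])
    fix w assume w: "w \<in> words \<Lambda>"
    let ?y = "temb \<Lambda> (monom_of w 1)"
    have yc: "?y \<in> carrier TA" using fpoly_monom[OF w, of 1] by simp
    have "analytic_element TA \<alpha> ?y" unfolding analytic_element_def using word_analytic_extension[OF dyn w] by blast
    moreover note word_analytic_extension[OF dyn kw]
    ultimately have "\<phi> (temb \<Lambda> (monom_of [(\<kappa>, False)] 1) \<boxtimes>\<^bsub>TA\<^esub> ?y)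
       = \<phi> (?y \<boxtimes>\<^bsub>TA\<^esub> ascale TA (exp (\<i> * (\<i> * of_real \<beta>) * of_real (word_weight \<Lambda> r [(\<kappa>, False)]))) (temb \<Lambda> (monom_of [(\<kappa>, False)] 1)))"
      using kms unfolding kms_state_def by blast
    thus "\<phi> (?x \<boxtimes>\<^bsub>TA\<^esub> ?y) = ?c * \<phi> (?y \<boxtimes>\<^bsub>TA\<^esub> ?x)"
      unfolding c gen_def[symmetric] using x yc by (simp add: A.times_scale sc)
  qed
  from this[OF temb_closed[OF f]] show "\<phi> (temb \<Lambda> (gen \<kappa> * f)) = ?c * \<phi> (temb \<Lambda> (f * gen \<kappa>))"
    using k f by (simp add: temb_mult)
qed

lemma kms_iff:
  assumes "toeplitz_dynamics \<Lambda> r \<alpha>" "\<beta> \<noteq> 0"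
  shows "kms_state TA \<alpha> \<beta> \<phi> \<longleftrightarrow> is_state TA \<phi> \<and> twisted_trace r \<beta> \<phi>"
  using twisted_trace_kms[OF _ _ assms(2,1)] kms_twisted_trace[OF _ assms(1)] by (auto simp: kms_state_def)

end

section \<open>States from the path representation\<close>

context two_graph
begin

definition delta :: "'p \<Rightarrow> 'p \<Rightarrow> complex" where "delta \<xi> = (\<lambda>\<kappa>. if \<kappa> = \<xi> then 1 else 0)"

definition diag :: "'p npoly \<Rightarrow> 'p \<Rightarrow> complex" where "diag f \<xi> = rep f (delta \<xi>) \<xi>"

lemma fin_supp_delta [simp]: "fin_supp (delta \<xi>)"
  by (simp add: fin_supp_def delta_def)

lemma nrm_delta [simp]: "nrm (delta \<xi>) = 1"
  by (simp add: nrm_def delta_def L2_set_def)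

lemma ip_delta: "fin_supp h \<Longrightarrow> ip h (delta \<xi>) = h \<xi>"
  by (auto simp: ip_def delta_def fin_supp_def sum.delta if_distrib[of cnj] if_distrib[of "(*) _"] cong: if_cong)

lemma diag_bound: "cmod (diag f \<xi>) \<le> op_norm f"
proof -
  have "cmod (ip (rep f (delta \<xi>)) (delta \<xi>)) \<le> nrm (rep f (delta \<xi>)) * nrm (delta \<xi>)"
    by (intro ip_Cauchy_Schwarz fin_supp_rep) auto
  also have "\<dots> \<le> op_norm f" using op_norm_upper[of "delta \<xi>" f] by simp
  finally show ?thesis by (simp add: ip_delta fin_supp_rep diag_def)
qed

lemma diag_positive: "diag (padj f * f) \<xi> = of_real ((nrm (rep f (delta \<xi>)))\<^sup>2)"
proof -
  have "diag (padj f * f) \<xi> = ip (rep (padj f) (rep f (delta \<xi>))) (delta \<xi>)"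
    by (simp add: diag_def rep_mult ip_delta fin_supp_rep)
  also have "\<dots> = ip (rep f (delta \<xi>)) (rep f (delta \<xi>))" by (simp add: ip_rep fin_supp_rep)
  finally show ?thesis by (simp add: ip_self fin_supp_rep)
qed

lemma diag_add: "diag (f + g) \<xi> = diag f \<xi> + diag g \<xi>"
  and diag_pscale: "diag (pscale c f) \<xi> = c * diag f \<xi>"
  by (simp_all add: diag_def rep_add rep_pscale)

lemma rep_gen_delta: "rep (gen \<kappa>) (delta \<nu>) = (case step (\<kappa>, False) \<nu> of Some \<mu> \<Rightarrow> delta \<mu> | None \<Rightarrow> (\<lambda>_. 0))"
proof
  fix \<xi>
  have "step (\<kappa>, True) \<xi> = Some \<nu> \<longleftrightarrow> step (\<kappa>, False) \<nu> = Some \<xi>" using step_swap[of "(\<kappa>, False)" \<xi> \<nu>] by simp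
  thus "rep (gen \<kappa>) (delta \<nu>) \<xi> = (case step (\<kappa>, False) \<nu> of Some \<mu> \<Rightarrow> delta \<mu> | None \<Rightarrow> (\<lambda>_. 0)) \<xi>"
    by (auto simp: rep_gen delta_def split: option.split)
qed

lemma rep_gadj_delta: "rep (gadj \<kappa>) (delta \<nu>) = (case step (\<kappa>, True) \<nu> of Some \<mu> \<Rightarrow> delta \<mu> | None \<Rightarrow> (\<lambda>_. 0))"
proof
  fix \<xi>
  have "step (\<kappa>, False) \<xi> = Some \<nu> \<longleftrightarrow> step (\<kappa>, True) \<nu> = Some \<xi>" using step_swap[of "(\<kappa>, True)" \<xi> \<nu>] by simp
  thus "rep (gadj \<kappa>) (delta \<nu>) \<xi> = (case step (\<kappa>, True) \<nu> of Some \<mu> \<Rightarrow> delta \<mu> | None \<Rightarrow> (\<lambda>_. 0)) \<xi>"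
    by (auto simp: rep_gadj delta_def split: option.split)
qed

lemma rep_zero_vec [simp]: "rep f (\<lambda>_. 0) = (\<lambda>_. 0)"
  using rep_scale[of f 0 "\<lambda>_. 0"] by simp

text \<open>The diagonal of f t_\<kappa> at \<nu> and the diagonal of t_\<kappa> f at \<kappa>\<nu>
  are the same matrix entry of f. The trace relation is therefore a comparison of the weights at
  \<nu> and \<kappa>\<nu>.\<close>

lemma diag_mult_gen:
  "diag (f * gen \<kappa>) \<nu> = (case step (\<kappa>, False) \<nu> of Some \<mu> \<Rightarrow> rep f (delta \<mu>) \<nu> | None \<Rightarrow> 0)"
  by (simp add: diag_def rep_mult rep_gen_delta split: option.split)

lemma diag_gen_mult:
  "diag (gen \<kappa> * f) \<mu> = (case step (\<kappa>, True) \<mu> of Some \<nu> \<Rightarrow> rep f (delta \<mu>) \<nu> | None \<Rightarrow> 0)"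
  by (simp add: diag_def rep_mult rep_gen)

end

text \<open>\<omega> is a probability distribution on S. Averaging the vector states of the point
  masses with it gives a density matrix that is diagonal in the path basis.\<close>

locale path_measure = row_finite \<Lambda> for \<Lambda> :: "'p two_graph" +
  fixes S :: "'p set" and \<omega> :: "'p \<Rightarrow> real"
  assumes S_paths: "S \<subseteq> paths \<Lambda>"
    and nonneg: "\<And>\<xi>. \<xi> \<in> S \<Longrightarrow> 0 \<le> \<omega> \<xi>"
    and total: "(\<omega> has_sum 1) S"
begin

definition path_functional :: "'p npoly \<Rightarrow> complex" where
  "path_functional f = (\<Sum>\<^sub>\<infinity>\<xi>\<in>S. of_real (\<omega> \<xi>) * diag f \<xi>)"

definition path_state :: "'p toeplitz_element \<Rightarrow> complex" where
  "path_state = star_alg.completion_functional (free_algebra \<Lambda> (toeplitz_norm \<Lambda>))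
     (\<lambda>F. path_functional (Abs_poly_mapping F))"

lemma weight_summable: "\<omega> summable_on S"
  using total by (auto simp: summable_on_def)

lemma abs_summable: "(\<lambda>\<xi>. norm (complex_of_real (\<omega> \<xi>) * diag f \<xi>)) summable_on S"
proof (rule Infinite_Sum.abs_summable_on_comparison_test')
  show "(\<lambda>\<xi>. \<omega> \<xi> * op_norm f) summable_on S" by (intro summable_on_cmult_left weight_summable)
  show "norm (of_real (\<omega> \<xi>) * diag f \<xi>) \<le> \<omega> \<xi> * op_norm f" if "\<xi> \<in> S" for \<xi>
    using nonneg[OF that] diag_bound[of f \<xi>] by (simp add: norm_mult mult_left_mono)
qed

lemma summable: "(\<lambda>\<xi>. of_real (\<omega> \<xi>) * diag f \<xi>) summable_on S"
  by (rule abs_summable_summable[OF abs_summable])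

lemma path_functional_add: "path_functional (f + g) = path_functional f + path_functional g"
  using infsum_add[OF summable[of f] summable[of g]] by (simp add: path_functional_def diag_add distrib_left)

lemma path_functional_pscale: "path_functional (pscale c f) = c * path_functional f"
  unfolding path_functional_def diag_pscale
  using infsum_cmult_right[OF summable[of f], of c] by (simp add: mult.left_commute)

lemma path_functional_bound: "cmod (path_functional f) \<le> op_norm f"
proof -
  have "cmod (path_functional f) \<le> (\<Sum>\<^sub>\<infinity>\<xi>\<in>S. norm (of_real (\<omega> \<xi>) * diag f \<xi>))"
    unfolding path_functional_def by (rule norm_infsum_bound[OF abs_summable])
  also have "\<dots> \<le> (\<Sum>\<^sub>\<infinity>\<xi>\<in>S. \<omega> \<xi> * op_norm f)"
  proof (rule infsum_mono[OF abs_summable])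
    show "(\<lambda>\<xi>. \<omega> \<xi> * op_norm f) summable_on S" by (intro summable_on_cmult_left weight_summable)
    show "norm (of_real (\<omega> \<xi>) * diag f \<xi>) \<le> \<omega> \<xi> * op_norm f" if "\<xi> \<in> S" for \<xi>
      using nonneg[OF that] diag_bound[of f \<xi>] by (simp add: norm_mult mult_left_mono)
  qed
  also have "\<dots> = op_norm f"
    using infsum_cmult_left[OF weight_summable, of "op_norm f"] infsumI[OF total] by simp
  finally show ?thesis .
qed

lemma path_functional_positive: "path_functional (padj f * f) \<in> \<real>\<^sub>\<ge>\<^sub>0"
proof -
  have s: "(\<lambda>\<xi>. \<omega> \<xi> * (nrm (rep f (delta \<xi>)))\<^sup>2) summable_on S"
    using abs_summable[of "padj f * f"] nonneg unfolding diag_positive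
    by (simp add: norm_mult norm_power cong: summable_on_cong)
  have "path_functional (padj f * f) = (\<Sum>\<^sub>\<infinity>\<xi>\<in>S. complex_of_real (\<omega> \<xi> * (nrm (rep f (delta \<xi>)))\<^sup>2))"
    unfolding path_functional_def diag_positive by simp
  also have "\<dots> = complex_of_real (\<Sum>\<^sub>\<infinity>\<xi>\<in>S. \<omega> \<xi> * (nrm (rep f (delta \<xi>)))\<^sup>2)"
    using has_sum_of_real_iff[THEN iffD2, OF has_sum_infsum[OF s]] by (rule infsumI)
  finally show ?thesis using nonneg by (auto simp: complex_nonneg_Reals_iff intro!: infsum_nonneg)
qed

lemma path_functional_cong:
  "(\<And>\<xi>. \<xi> \<in> S \<Longrightarrow> diag f \<xi> = c) \<Longrightarrow> path_functional f = c"
proof -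
  assume c: "\<And>\<xi>. \<xi> \<in> S \<Longrightarrow> diag f \<xi> = c"
  have "path_functional f = (\<Sum>\<^sub>\<infinity>\<xi>\<in>S. complex_of_real (\<omega> \<xi>) * c)"
    unfolding path_functional_def by (rule infsum_cong) (simp add: c)
  also have "\<dots> = infsum (\<lambda>\<xi>. complex_of_real (\<omega> \<xi>)) S * c"
    by (rule infsum_cmult_left) (rule summable_on_of_real[OF weight_summable])
  also have "infsum (\<lambda>\<xi>. complex_of_real (\<omega> \<xi>)) S = complex_of_real 1"
    by (rule infsumI) (simp only: has_sum_of_real_iff total)
  finally show "path_functional f = c" by simp
qed

lemma diag_vertex: "z \<in> vertices \<Lambda> \<Longrightarrow> \<xi> \<in> paths \<Lambda> \<Longrightarrow> diag (gen z) \<xi> = (if rng \<Lambda> \<xi> = z then 1 else 0)"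
proof -
  assume z: "z \<in> vertices \<Lambda>" and x: "\<xi> \<in> paths \<Lambda>"
  have "step (z, False) \<xi> = (if rng \<Lambda> \<xi> = z then Some \<xi> else None)"
  proof (cases "rng \<Lambda> \<xi> = z")
    case True thus ?thesis using x z vertex_closed[OF z] vertex_rng_src[OF z] cmp_rng[OF x] by (simp add: step_False)
  next
    case False
    hence "step (z, False) \<xi> \<noteq> Some \<mu>" for \<mu> using z vertex_rng_src[OF z] by (auto simp: step_False)
    thus ?thesis using False by (cases "step (z, False) \<xi>") auto
  qed
  thus ?thesis by (simp add: diag_def rep_gen_delta) (simp add: delta_def)
qed

lemma path_functional_unit: "path_functional T.unit_sum = 1"
proof (rule path_functional_cong)
  fix \<xi> assume "\<xi> \<in> S"
  hence x: "\<xi> \<in> paths \<Lambda>" using S_paths by auto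
  have "diag T.unit_sum \<xi> = (\<Sum>z\<in>vertices \<Lambda>. diag (gen z) \<xi>)" by (simp add: diag_def T.unit_sum_def rep_sum)
  also have "\<dots> = (\<Sum>z\<in>vertices \<Lambda>. if rng \<Lambda> \<xi> = z then 1 else 0)" using x by (intro sum.cong) (auto simp: diag_vertex)
  also have "\<dots> = 1" using rng_vertex[OF x] finite_vertices by simp
  finally show "diag T.unit_sum \<xi> = 1" .
qed

text \<open>The path representation defines an admissible seminorm, so a functional bounded by
  \<open>op_norm\<close> is bounded by the largest one and extends to the completion.\<close>

lemma free_functional:
  "contractive_functional (free_algebra \<Lambda> (toeplitz_norm \<Lambda>)) (\<lambda>F. path_functional (Abs_poly_mapping F))"
  "positive_functional (free_algebra \<Lambda> (toeplitz_norm \<Lambda>)) (\<lambda>F. path_functional (Abs_poly_mapping F))"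
proof -
  have "linear_functional (free_algebra \<Lambda> (toeplitz_norm \<Lambda>)) (\<lambda>F. path_functional (Abs_poly_mapping F))"
    unfolding linear_functional_def carrier_free
    by (auto simp: free_sel lookup_inverse path_functional_add path_functional_pscale)
  moreover have "cmod (path_functional f) \<le> tnorm \<Lambda> f" if "f \<in> fpoly \<Lambda>" for f
    using path_functional_bound op_norm_le_tnorm[OF that] by (rule order_trans)
  ultimately show "contractive_functional (free_algebra \<Lambda> (toeplitz_norm \<Lambda>)) (\<lambda>F. path_functional (Abs_poly_mapping F))"
    "positive_functional (free_algebra \<Lambda> (toeplitz_norm \<Lambda>)) (\<lambda>F. path_functional (Abs_poly_mapping F))"
    unfolding contractive_functional_def positive_functional_def carrier_free
    by (auto simp: free_sel lookup_inverse path_functional_positive)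
qed

lemma path_state_temb: "f \<in> fpoly \<Lambda> \<Longrightarrow> path_state (temb \<Lambda> f) = path_functional f"
  unfolding path_state_def temb_def
  using star_alg.completion_functional_emb[OF free_star_alg_tnorm free_functional(1) coeff_in_free]
  by (simp add: lookup_inverse)

lemma path_state_is_state: "is_state TA path_state"
  unfolding star_alg.is_state_iff[OF TA_star_alg temb_unit]
proof (intro conjI allI impI)
  show "path_state (temb \<Lambda> T.unit_sum) = 1" by (simp add: path_state_temb path_functional_unit)
  show "path_state x = 0" if "x \<notin> carrier TA" for x
    using that star_alg.completion_functional_outside[OF free_star_alg_tnorm]
    unfolding path_state_def toeplitz_algebra_def by blast
  show "contractive_functional TA path_state"
    unfolding path_state_def toeplitz_algebra_def
    by (rule star_alg.completion_functional_contractive[OF free_star_alg_tnorm free_functional(1)])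
  show "positive_functional TA path_state"
    unfolding path_state_def toeplitz_algebra_def
    by (rule star_alg.completion_functional_positive[OF free_star_alg_tnorm free_functional])
qed

text \<open>The map \<nu> \<mapsto> \<kappa>\<nu> is a bijection from the paths of S with range
  s(\<kappa>) onto those that begin with \<kappa>; the reindexed sum picks up the scaling factor of
  the weights.\<close>

lemma path_state_twisted_trace:
  assumes invariant: "\<And>\<kappa> \<xi>. \<kappa> \<in> paths \<Lambda> \<Longrightarrow> \<xi> \<in> paths \<Lambda> \<Longrightarrow> src \<Lambda> \<kappa> = rng \<Lambda> \<xi> \<Longrightarrow> cmp \<Lambda> \<kappa> \<xi> \<in> S \<longleftrightarrow> \<xi> \<in> S"
    and scaling: "\<And>\<kappa> \<xi>. \<kappa> \<in> paths \<Lambda> \<Longrightarrow> \<xi> \<in> S \<Longrightarrow> src \<Lambda> \<kappa> = rng \<Lambda> \<xi> \<Longrightarrow>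
        \<omega> (cmp \<Lambda> \<kappa> \<xi>) = exp (- \<beta> * path_weight \<Lambda> r \<kappa>) * \<omega> \<xi>"
  shows "twisted_trace r \<beta> path_state"
  unfolding twisted_trace_def
proof (intro ballI)
  fix \<kappa> f assume k: "\<kappa> \<in> paths \<Lambda>" and f: "f \<in> fpoly \<Lambda>"
  let ?c = "exp (- \<beta> * path_weight \<Lambda> r \<kappa>)"
  let ?B = "{\<nu> \<in> S. src \<Lambda> \<kappa> = rng \<Lambda> \<nu>}"
  have inj: "inj_on (cmp \<Lambda> \<kappa>) ?B"
  proof (rule inj_onI)
    fix x y assume "x \<in> ?B" "y \<in> ?B" "cmp \<Lambda> \<kappa> x = cmp \<Lambda> \<kappa> y"
    thus "x = y" using S_paths k by (intro cancel_left[of \<kappa> x y]) auto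
  qed
  \<comment> \<open>Paths that do not begin with \<kappa> contribute 0, and invariance puts \<nu>
    into S together with \<kappa>\<nu>.\<close>
  have "path_functional (gen \<kappa> * f) = infsum (\<lambda>\<mu>. of_real (\<omega> \<mu>) * diag (gen \<kappa> * f) \<mu>) (cmp \<Lambda> \<kappa> ` ?B)"
    unfolding path_functional_def
  proof (rule infsum_cong_neutral)
    fix \<mu> assume m: "\<mu> \<in> S - cmp \<Lambda> \<kappa> ` ?B"
    have "step (\<kappa>, True) \<mu> \<noteq> Some \<nu>" for \<nu>
    proof
      assume "step (\<kappa>, True) \<mu> = Some \<nu>"
      hence n: "\<nu> \<in> paths \<Lambda>" "src \<Lambda> \<kappa> = rng \<Lambda> \<nu>" "\<mu> = cmp \<Lambda> \<kappa> \<nu>" by (auto simp: step_True)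
      hence "\<nu> \<in> S" using invariant[OF k n(1,2)] m by auto
      thus False using m n by auto
    qed
    thus "of_real (\<omega> \<mu>) * diag (gen \<kappa> * f) \<mu> = 0" by (simp add: diag_gen_mult split: option.split)
  next
    fix \<mu> assume "\<mu> \<in> cmp \<Lambda> \<kappa> ` ?B - S"
    then obtain \<nu> where "\<nu> \<in> S" "src \<Lambda> \<kappa> = rng \<Lambda> \<nu>" "\<mu> = cmp \<Lambda> \<kappa> \<nu>" "\<mu> \<notin> S" by auto
    moreover have "\<nu> \<in> paths \<Lambda>" using calculation(1) S_paths by auto
    ultimately show "of_real (\<omega> \<mu>) * diag (gen \<kappa> * f) \<mu> = 0" using invariant[OF k] by auto
  qed simp
  also have "\<dots> = infsum (\<lambda>\<nu>. of_real (\<omega> (cmp \<Lambda> \<kappa> \<nu>)) * diag (gen \<kappa> * f) (cmp \<Lambda> \<kappa> \<nu>)) ?B"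
    using infsum_reindex[OF inj, of "\<lambda>\<mu>. of_real (\<omega> \<mu>) * diag (gen \<kappa> * f) \<mu>"] by (simp add: comp_def)
  also have "\<dots> = infsum (\<lambda>\<nu>. of_real ?c * (of_real (\<omega> \<nu>) * diag (f * gen \<kappa>) \<nu>)) S"
  proof (rule infsum_cong_neutral)
    fix \<nu> assume "\<nu> \<in> S - ?B"
    hence "step (\<kappa>, False) \<nu> \<noteq> Some \<mu>" for \<mu> by (auto simp: step_False)
    thus "of_real ?c * (of_real (\<omega> \<nu>) * diag (f * gen \<kappa>) \<nu>) = 0"
      by (simp add: diag_mult_gen split: option.split)
  next
    fix \<nu> assume "\<nu> \<in> ?B \<inter> S"
    hence n: "\<nu> \<in> S" "src \<Lambda> \<kappa> = rng \<Lambda> \<nu>" "\<nu> \<in> paths \<Lambda>" using S_paths by auto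
    have "step (\<kappa>, False) \<nu> = Some (cmp \<Lambda> \<kappa> \<nu>)" "step (\<kappa>, True) (cmp \<Lambda> \<kappa> \<nu>) = Some \<nu>"
      using k n by (auto simp: step_False step_True)
    thus "of_real (\<omega> (cmp \<Lambda> \<kappa> \<nu>)) * diag (gen \<kappa> * f) (cmp \<Lambda> \<kappa> \<nu>)
        = of_real ?c * (of_real (\<omega> \<nu>) * diag (f * gen \<kappa>) \<nu>)"
      by (simp add: diag_mult_gen diag_gen_mult scaling[OF k n(1,2)])
  qed auto
  also have "\<dots> = of_real ?c * path_functional (f * gen \<kappa>)"
    unfolding path_functional_def by (rule infsum_cmult_right[OF summable])
  finally show "path_state (temb \<Lambda> (gen \<kappa> * f)) = of_real ?c * path_state (temb \<Lambda> (f * gen \<kappa>))"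
    using k f by (simp add: path_state_temb)
qed

end

section \<open>Uniqueness of KMS states\<close>

context row_finite
begin

lemma functional_zero: "bounded_functional TA \<phi> \<Longrightarrow> \<phi> (temb \<Lambda> 0) = 0"
  using star_alg.linear_functional_zero[OF TA_star_alg] by (simp add: temb_zero bounded_functional_def)

lemma functional_add:
  "bounded_functional TA \<phi> \<Longrightarrow> f \<in> fpoly \<Lambda> \<Longrightarrow> g \<in> fpoly \<Lambda> \<Longrightarrow> \<phi> (temb \<Lambda> (f + g)) = \<phi> (temb \<Lambda> f) + \<phi> (temb \<Lambda> g)"
  by (simp add: temb_add bounded_functional_def linear_functional_def)

lemma functional_minus:
  "bounded_functional TA \<phi> \<Longrightarrow> f \<in> fpoly \<Lambda> \<Longrightarrow> g \<in> fpoly \<Lambda> \<Longrightarrow> \<phi> (temb \<Lambda> (f - g)) = \<phi> (temb \<Lambda> f) - \<phi> (temb \<Lambda> g)"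
  using star_alg.linear_functional_minus[OF TA_star_alg] by (simp add: temb_minus bounded_functional_def)

lemma functional_sum:
  assumes "bounded_functional TA \<phi>" "\<And>i. i \<in> I \<Longrightarrow> f i \<in> fpoly \<Lambda>"
  shows "\<phi> (temb \<Lambda> (\<Sum>i\<in>I. f i)) = (\<Sum>i\<in>I. \<phi> (temb \<Lambda> (f i)))"
  using assms(2)
proof (induction I rule: infinite_finite_induct)
  case (insert i I)
  have "(\<Sum>i\<in>I. f i) \<in> fpoly \<Lambda>" using insert.prems by (intro fpoly_sum) auto
  thus ?case using insert assms(1) by (simp add: functional_add)
qed (use assms(1) in \<open>simp_all add: functional_zero\<close>)

definition monomials_agree :: "('p toeplitz_element \<Rightarrow> complex) \<Rightarrow> ('p toeplitz_element \<Rightarrow> complex) \<Rightarrow> bool" where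
  "monomials_agree \<phi> \<psi> \<longleftrightarrow>
     (\<forall>\<mu>\<in>paths \<Lambda>. \<forall>\<nu>\<in>paths \<Lambda>. \<phi> (temb \<Lambda> (gen \<mu> * gadj \<nu>)) = \<psi> (temb \<Lambda> (gen \<mu> * gadj \<nu>)))"

lemma agree_eqvI:
  assumes "T.eqv f g" "\<phi> (temb \<Lambda> g) = \<psi> (temb \<Lambda> g)" shows "\<phi> (temb \<Lambda> f) = \<psi> (temb \<Lambda> f)"
  using temb_eqI[OF assms(1)] assms(2) by simp

lemma gen_eqv: "\<kappa> \<in> paths \<Lambda> \<Longrightarrow> T.eqv (gen \<kappa>) (gen \<kappa> * gadj (src \<Lambda> \<kappa>))"
  by (rule T.eqv_trans[OF T.eqv_sym[OF T.t_src] T.eqv_mult_left[OF T.eqv_sym[OF T.t_vertex_adj]]])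
    (auto intro: src_vertex)

lemma gadj_eqv: "\<kappa> \<in> paths \<Lambda> \<Longrightarrow> T.eqv (gadj \<kappa>) (gen (src \<Lambda> \<kappa>) * gadj \<kappa>)"
  using T.eqv_padj[OF gen_eqv] by (simp add: padj_mult)

text \<open>Instead of normalising words, the induction varies the functionals: if they agree on
  monomials, so do their composites with left multiplication by a letter, because (T2) and (T5)
  rewrite a letter times a monomial as a sum of monomials.\<close>

lemma monomials_agree_words:
  assumes "w \<in> words \<Lambda>" "bounded_functional TA \<phi>" "bounded_functional TA \<psi>" "monomials_agree \<phi> \<psi>"
  shows "\<phi> (temb \<Lambda> (monom_of w 1)) = \<psi> (temb \<Lambda> (monom_of w 1))"
  using assms
proof (induction w arbitrary: \<phi> \<psi>)
  case (Cons l w)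
  obtain \<kappa> b where l: "l = (\<kappa>, b)" by fastforce
  have k: "\<kappa> \<in> paths \<Lambda>" using Cons.prems l by (auto simp: words_def)
  note bd = Cons.prems(2,3)
  have mon: "\<phi> (temb \<Lambda> (gen \<mu> * gadj \<nu>)) = \<psi> (temb \<Lambda> (gen \<mu> * gadj \<nu>))" if "\<mu> \<in> paths \<Lambda>" "\<nu> \<in> paths \<Lambda>" for \<mu> \<nu>
    using Cons.prems(4) that by (simp add: monomials_agree_def)
  have zero: "\<phi> (temb \<Lambda> 0) = \<psi> (temb \<Lambda> 0)" using bd by (simp add: functional_zero)
  have lf: "monom_of [l] 1 \<in> fpoly \<Lambda>" using k l by (intro fpoly_monom) (auto simp: words_def)
  show ?case
  proof (cases "w = []")
    case True
    have "\<phi> (temb \<Lambda> (gen \<kappa>)) = \<psi> (temb \<Lambda> (gen \<kappa>))"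
      by (rule agree_eqvI[where \<phi>=\<phi> and \<psi>=\<psi>, OF gen_eqv[OF k] mon]) (auto intro: k src_closed)
    moreover have "\<phi> (temb \<Lambda> (gadj \<kappa>)) = \<psi> (temb \<Lambda> (gadj \<kappa>))"
      by (rule agree_eqvI[where \<phi>=\<phi> and \<psi>=\<psi>, OF gadj_eqv[OF k] mon]) (auto intro: k src_closed)
    ultimately show ?thesis using True l by (cases b) (auto simp: gen_def gadj_def)
  next
    case False
    hence w: "w \<in> words \<Lambda>" using Cons.prems by (auto simp: words_def)
    let ?l = "temb \<Lambda> (monom_of [l] 1)"
    have lc: "?l \<in> carrier TA" using lf by simp
    have "\<phi> (temb \<Lambda> (monom_of [l] 1 * (gen \<mu> * gadj \<nu>))) = \<psi> (temb \<Lambda> (monom_of [l] 1 * (gen \<mu> * gadj \<nu>)))"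
      if mn: "\<mu> \<in> paths \<Lambda>" "\<nu> \<in> paths \<Lambda>" for \<mu> \<nu>
    proof (cases b)
      case False
      hence ll: "monom_of [l] 1 * (gen \<mu> * gadj \<nu>) = gen \<kappa> * gen \<mu> * gadj \<nu>"
        using l by (simp add: gen_def mult.assoc)
      show ?thesis
      proof (cases "src \<Lambda> \<kappa> = rng \<Lambda> \<mu>")
        case True
        show ?thesis unfolding ll
          by (rule agree_eqvI[where \<phi>=\<phi> and \<psi>=\<psi>, OF T.eqv_mult_right[OF T.t_mult[OF k mn(1) True]] mon])
            (use mn cmp_closed[OF k mn(1) True] in auto)
      next
        case False
        show ?thesis unfolding ll
          by (rule agree_eqvI[where \<phi>=\<phi> and \<psi>=\<psi>, OF T.eqv_mult_right[OF T.t_mult_zero[OF k mn(1) False]]])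
            (use mn zero in auto)
      qed
    next
      case True
      hence ll: "monom_of [l] 1 * (gen \<mu> * gadj \<nu>) = gadj \<kappa> * gen \<mu> * gadj \<nu>"
        using l by (simp add: gadj_def mult.assoc)
      have me: "fst i \<in> paths \<Lambda>" "snd i \<in> paths \<Lambda>" if "i \<in> min_ext \<Lambda> \<kappa> \<mu>" for i
        using that by (auto simp: min_ext_def)
      have "T.eqv (gadj \<kappa> * gen \<mu> * gadj \<nu>) ((\<Sum>(\<alpha>, \<beta>)\<in>min_ext \<Lambda> \<kappa> \<mu>. gen \<alpha> * gadj \<beta>) * gadj \<nu>)"
        by (intro T.eqv_mult_right T.t_min_ext k mn) (use mn in auto)
      also have "(\<Sum>(\<alpha>, \<beta>)\<in>min_ext \<Lambda> \<kappa> \<mu>. gen \<alpha> * gadj \<beta>) * gadj \<nu>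
          = (\<Sum>i\<in>min_ext \<Lambda> \<kappa> \<mu>. gen (fst i) * (gadj (snd i) * gadj \<nu>))"
        by (simp add: sum_distrib_right case_prod_beta mult.assoc)
      finally have e: "T.eqv (gadj \<kappa> * gen \<mu> * gadj \<nu>) (\<Sum>i\<in>min_ext \<Lambda> \<kappa> \<mu>. gen (fst i) * (gadj (snd i) * gadj \<nu>))" .
      have "\<phi> (temb \<Lambda> (gen \<alpha> * (gadj \<beta> * gadj \<nu>))) = \<psi> (temb \<Lambda> (gen \<alpha> * (gadj \<beta> * gadj \<nu>)))"
        if ab: "\<alpha> \<in> paths \<Lambda>" "\<beta> \<in> paths \<Lambda>" for \<alpha> \<beta>
      proof (cases "src \<Lambda> \<nu> = rng \<Lambda> \<beta>")
        case True
        show ?thesis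
          by (rule agree_eqvI[where \<phi>=\<phi> and \<psi>=\<psi>, OF T.eqv_mult_left[OF T.t_adj_mult[OF mn(2) ab(2) True]] mon])
            (use ab mn cmp_closed[OF mn(2) ab(2) True] in auto)
      next
        case False
        show ?thesis
          by (rule agree_eqvI[where \<phi>=\<phi> and \<psi>=\<psi>, OF T.eqv_mult_left[OF T.t_adj_mult_zero[OF mn(2) ab(2) False]]])
            (use ab zero in auto)
      qed
      hence "\<phi> (temb \<Lambda> (\<Sum>i\<in>min_ext \<Lambda> \<kappa> \<mu>. gen (fst i) * (gadj (snd i) * gadj \<nu>)))
          = \<psi> (temb \<Lambda> (\<Sum>i\<in>min_ext \<Lambda> \<kappa> \<mu>. gen (fst i) * (gadj (snd i) * gadj \<nu>)))"
        using me mn bd by (simp add: functional_sum)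
      thus ?thesis unfolding ll by (rule agree_eqvI[OF e])
    qed
    hence "monomials_agree (\<lambda>x. \<phi> (?l \<boxtimes>\<^bsub>TA\<^esub> x)) (\<lambda>x. \<psi> (?l \<boxtimes>\<^bsub>TA\<^esub> x))"
      unfolding monomials_agree_def using lf by (simp add: temb_mult)
    hence "\<phi> (?l \<boxtimes>\<^bsub>TA\<^esub> temb \<Lambda> (monom_of w 1)) = \<psi> (?l \<boxtimes>\<^bsub>TA\<^esub> temb \<Lambda> (monom_of w 1))"
      by (intro Cons.IH[OF w] bounded_functional_left bd lc)
    thus ?thesis using temb_mult[OF lf fpoly_monom[OF w, of 1]] by (simp add: monom_mult)
  qed
qed (simp add: words_def)

lemma monomials_agree_eq:
  assumes "bounded_functional TA \<phi>" "bounded_functional TA \<psi>" "monomials_agree \<phi> \<psi>" "x \<in> carrier TA"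
  shows "\<phi> x = \<psi> x"
  by (rule bounded_functional_eq[OF assms(1,2) monomials_agree_words[OF _ assms(1-3)] assms(4)])

end

section \<open>Paths in the two-vertex graph\<close>

locale two_vertex_graph = two_graph \<Lambda> for \<Lambda> :: "'p two_graph" +
  fixes u v :: 'p
  assumes vertices_eq: "vertices \<Lambda> = {u, v}" and u_neq_v: "u \<noteq> v"
    and no_edges: "paths_into \<Lambda> v e1 = {}" "paths_into \<Lambda> v e2 = {}"
    and finite_edges: "finite (paths_into \<Lambda> u e1)" "finite (paths_into \<Lambda> u e2)"
begin

lemma u_vertex: "u \<in> vertices \<Lambda>" and v_vertex: "v \<in> vertices \<Lambda>"
  by (simp_all add: vertices_eq)

lemma degree_cases:
  fixes d :: "nat \<times> nat"
  obtains "d = 0" | d' where "d = e1 + d'" | d' where "d = e2 + d'"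
proof (cases d)
  case (Pair m n)
  show ?thesis
  proof (cases m)
    case (Suc k)
    hence "d = e1 + (k, n)" using Pair by (simp add: e1_def)
    thus ?thesis by (rule that)
  next
    case 0
    show ?thesis
    proof (cases n)
      case (Suc k)
      hence "d = e2 + (m, k)" using Pair by (simp add: e2_def)
      thus ?thesis by (rule that)
    qed (use 0 Pair that(1) in \<open>simp add: zero_prod_def\<close>)
  qed
qed

text \<open>A path into v of nonzero degree would begin with an edge into v.\<close>

lemma range_v:
  assumes "\<kappa> \<in> paths \<Lambda>" "rng \<Lambda> \<kappa> = v" shows "\<kappa> = v"
proof -
  have no: False if d: "deg \<Lambda> \<kappa> = i + d'" and i: "i = e1 \<or> i = e2" for i d'
  proof -
    obtain \<mu> \<nu> where m: "\<mu> \<in> paths \<Lambda>" "\<nu> \<in> paths \<Lambda>" "src \<Lambda> \<mu> = rng \<Lambda> \<nu>" "\<kappa> = cmp \<Lambda> \<mu> \<nu>" "deg \<Lambda> \<mu> = i"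
      using factorE[OF assms(1) d] by metis
    hence "\<mu> \<in> paths_into \<Lambda> v i" using rng_cmp[OF m(1-3)] assms by (simp add: paths_into_def)
    thus False using i no_edges by auto
  qed
  have "deg \<Lambda> \<kappa> = 0" by (rule degree_cases[of "deg \<Lambda> \<kappa>"]) (use no in blast)+
  hence "\<kappa> \<in> vertices \<Lambda>" using assms by (simp add: vertices_def)
  thus ?thesis using vertex_rng_src assms by simp
qed

lemma src_cases: "\<kappa> \<in> paths \<Lambda> \<Longrightarrow> src \<Lambda> \<kappa> = u \<or> src \<Lambda> \<kappa> = v"
  and rng_cases: "\<kappa> \<in> paths \<Lambda> \<Longrightarrow> rng \<Lambda> \<kappa> = u \<or> rng \<Lambda> \<kappa> = v"
  using src_vertex rng_vertex vertices_eq by auto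

lemma src_u_rng_u: "\<kappa> \<in> paths \<Lambda> \<Longrightarrow> src \<Lambda> \<kappa> = u \<Longrightarrow> rng \<Lambda> \<kappa> = u"
  using rng_cases range_v vertex_rng_src[OF v_vertex] u_neq_v by metis

text \<open>A path of nonzero degree is an edge followed by a path of smaller total degree, whose
  range is u or v.\<close>

lemma finite_paths_into_degree: "finite (paths_into \<Lambda> z (m, n))"
proof (induction "m + n" arbitrary: z m n)
  case 0
  have "paths_into \<Lambda> z (m, n) \<subseteq> vertices \<Lambda>" using 0 by (auto simp: paths_into_def vertices_def zero_prod_def)
  thus ?case using vertices_eq finite_subset by auto
next
  case (Suc k)
  have fin: "finite (paths_into \<Lambda> z (i + d))" if i: "i = e1 \<or> i = e2" and d: "\<And>w. finite (paths_into \<Lambda> w d)" for i d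
  proof -
    have fi: "finite (paths_into \<Lambda> z i)"
    proof (cases "z = u \<or> z = v")
      case True thus ?thesis using i finite_edges no_edges by auto
    next
      case False
      have "paths_into \<Lambda> z i = {}" using rng_cases False by (auto simp: paths_into_def)
      thus ?thesis by simp
    qed
    have "paths_into \<Lambda> z (i + d) \<subseteq> (\<lambda>(\<mu>, \<nu>). cmp \<Lambda> \<mu> \<nu>) ` (paths_into \<Lambda> z i \<times> (paths_into \<Lambda> u d \<union> paths_into \<Lambda> v d))"
    proof
      fix \<kappa> assume "\<kappa> \<in> paths_into \<Lambda> z (i + d)"
      hence k: "\<kappa> \<in> paths \<Lambda>" "deg \<Lambda> \<kappa> = i + d" "rng \<Lambda> \<kappa> = z" by (auto simp: paths_into_def)
      obtain \<mu> \<nu> where m: "\<mu> \<in> paths \<Lambda>" "\<nu> \<in> paths \<Lambda>" "src \<Lambda> \<mu> = rng \<Lambda> \<nu>" "\<kappa> = cmp \<Lambda> \<mu> \<nu>" "deg \<Lambda> \<mu> = i" "deg \<Lambda> \<nu> = d"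
        by (rule factorE[OF k(1,2)])
      have "\<mu> \<in> paths_into \<Lambda> z i" "\<nu> \<in> paths_into \<Lambda> u d \<union> paths_into \<Lambda> v d"
        using m rng_cmp[OF m(1-3)] k rng_cases[OF m(2)] by (auto simp: paths_into_def)
      thus "\<kappa> \<in> (\<lambda>(\<mu>, \<nu>). cmp \<Lambda> \<mu> \<nu>) ` (paths_into \<Lambda> z i \<times> (paths_into \<Lambda> u d \<union> paths_into \<Lambda> v d))"
        using m(4) by (intro image_eqI[of _ _ "(\<mu>, \<nu>)"]) auto
    qed
    thus ?thesis using fi d by (meson finite_SigmaI finite_UnI finite_imageI finite_subset)
  qed
  show ?case
  proof (cases m)
    case (Suc m')
    hence "(m, n) = e1 + (m', n)" "k = m' + n" using \<open>Suc k = m + n\<close> by (auto simp: e1_def)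
    thus ?thesis using fin[of e1 "(m', n)"] Suc.hyps(1)[of m' n] by simp
  next
    case 0
    then obtain n' where n': "n = Suc n'" using \<open>Suc k = m + n\<close> by (cases n) auto
    hence "(m, n) = e2 + (m, n')" "k = m + n'" using \<open>Suc k = m + n\<close> by (auto simp: e2_def)
    thus ?thesis using fin[of e2 "(m, n')"] Suc.hyps(1)[of m n'] by simp
  qed
qed

end

sublocale two_vertex_graph \<subseteq> row_finite
proof unfold_locales
  show "finite (paths_into \<Lambda> z n)" for z n using finite_paths_into_degree[of z "fst n" "snd n"] by simp
  show "finite (vertices \<Lambda>)" by (simp add: vertices_eq)
qed

context two_vertex_graph
begin

text \<open>Only v itself has range v, so a path with source v cannot be prolonged; a common
  extension with \<nu> exists only if \<nu> is an initial piece of it.\<close>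

lemma min_ext_into_v:
  assumes "\<mu> \<in> paths \<Lambda>" "\<nu> \<in> paths \<Lambda>" "src \<Lambda> \<mu> = v" "(\<alpha>, \<beta>) \<in> min_ext \<Lambda> \<mu> \<nu>"
  shows "\<alpha> = v" "\<mu> = cmp \<Lambda> \<nu> \<beta>" "src \<Lambda> \<beta> = v"
proof -
  note e = min_extD[OF assms(1,2,4)]
  show a: "\<alpha> = v" using range_v[OF e(1)] e(3) assms(3) by simp
  show "\<mu> = cmp \<Lambda> \<nu> \<beta>" using e(5) cmp_src[OF assms(1)] a assms(3) by simp
  show "src \<Lambda> \<beta> = v" using e(8) a vertex_rng_src[OF v_vertex] by simp
qed

text \<open>Neither path can be prolonged, so a common extension would make them equal; the sum in
  (T5) is empty.\<close>

lemma adj_orth_v: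
  assumes "\<mu> \<in> paths \<Lambda>" "\<nu> \<in> paths \<Lambda>" "src \<Lambda> \<mu> = v" "src \<Lambda> \<nu> = v" "\<mu> \<noteq> \<nu>"
  shows "T.eqv (gadj \<mu> * gen \<nu>) 0"
proof -
  have False if ab: "(\<alpha>, \<beta>) \<in> min_ext \<Lambda> \<mu> \<nu>" for \<alpha> \<beta>
  proof -
    note e = min_extD[OF assms(1,2) ab]
    have "\<beta> = v" using range_v[OF e(2)] e(4) assms(4) by simp
    thus False using min_ext_into_v(2)[OF assms(1,2,3) ab] cmp_src[OF assms(2)] assms(4,5) by simp
  qed
  hence "min_ext \<Lambda> \<mu> \<nu> = {}" by auto
  thus ?thesis using T.t_min_ext[OF assms(1,2)] by simp
qed

end

section \<open>Weights of paths and vanishing of off-diagonal monomials\<close>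

locale kms_setup = two_vertex_graph \<Lambda> u v for \<Lambda> :: "'p two_graph" and u v +
  fixes r1 r2 \<beta> :: real and d1 d2 a1 a2 :: nat
  assumes r_pos: "0 < r1" "0 < r2" and beta_pos: "0 < \<beta>"
    and d1_def: "d1 = card (paths_between \<Lambda> u e1 u)" and d2_def: "d2 = card (paths_between \<Lambda> u e2 u)"
    and a1_def: "a1 = card (paths_between \<Lambda> u e1 v)" and a2_def: "a2 = card (paths_between \<Lambda> u e2 v)"
    and small: "real d1 * exp (- \<beta> * r1) < 1" "real d2 * exp (- \<beta> * r2) < 1"
begin

definition "x1 = exp (- \<beta> * r1)"
definition "x2 = exp (- \<beta> * r2)"

lemma x_pos [simp]: "0 < x1" "0 < x2"
  and small_x: "real d1 * x1 < 1" "real d2 * x2 < 1"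
  using small by (auto simp: x1_def x2_def)

text \<open>Under a KMS state the range projection of \<kappa> has \<open>W \<kappa>\<close> times
  the value of the vertex s(\<kappa>). The weight is multiplicative and depends on the degree
  alone.\<close>

definition W :: "'p \<Rightarrow> real" where "W \<kappa> = exp (- \<beta> * path_weight \<Lambda> (r1, r2) \<kappa>)"

lemma W_pos [simp]: "0 < W \<kappa>" "0 \<le> W \<kappa>"
  by (simp_all add: W_def)

lemma path_weight_cmp:
  "\<mu> \<in> paths \<Lambda> \<Longrightarrow> \<nu> \<in> paths \<Lambda> \<Longrightarrow> src \<Lambda> \<mu> = rng \<Lambda> \<nu> \<Longrightarrow>
   path_weight \<Lambda> r (cmp \<Lambda> \<mu> \<nu>) = path_weight \<Lambda> r \<mu> + path_weight \<Lambda> r \<nu>"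
  by (simp add: path_weight_def deg_cmp algebra_simps)

lemma W_cmp: "\<mu> \<in> paths \<Lambda> \<Longrightarrow> \<nu> \<in> paths \<Lambda> \<Longrightarrow> src \<Lambda> \<mu> = rng \<Lambda> \<nu> \<Longrightarrow> W (cmp \<Lambda> \<mu> \<nu>) = W \<mu> * W \<nu>"
  by (simp add: W_def path_weight_cmp distrib_left flip: exp_add)

lemma W_degree: "deg \<Lambda> \<kappa> = (m, n) \<Longrightarrow> W \<kappa> = x1 ^ m * x2 ^ n"
  by (simp add: W_def x1_def x2_def path_weight_def algebra_simps flip: exp_add exp_of_nat_mult)

lemma path_weight_pos:
  assumes "\<kappa> \<in> paths \<Lambda>" "deg \<Lambda> \<kappa> \<noteq> 0" shows "path_weight \<Lambda> (r1, r2) \<kappa> > 0"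
proof -
  have "fst (deg \<Lambda> \<kappa>) > 0 \<or> snd (deg \<Lambda> \<kappa>) > 0" using assms by (cases "deg \<Lambda> \<kappa>") (auto simp: zero_prod_def)
  thus ?thesis using r_pos by (auto simp: path_weight_def intro: add_pos_nonneg add_nonneg_pos)
qed

context
  fixes \<phi> :: "'p toeplitz_element \<Rightarrow> complex"
  assumes st: "is_state TA \<phi>" and tr: "twisted_trace (r1, r2) \<beta> \<phi>"
begin

lemma bdd: "bounded_functional TA \<phi>"
  by (rule state_bounded[OF st])

lemma trace: "\<kappa> \<in> paths \<Lambda> \<Longrightarrow> f \<in> fpoly \<Lambda> \<Longrightarrow> \<phi> (temb \<Lambda> (gen \<kappa> * f)) = of_real (W \<kappa>) * \<phi> (temb \<Lambda> (f * gen \<kappa>))"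
  using tr by (simp add: twisted_trace_def W_def)

text \<open>The KMS relation followed by (T5) turns a monomial into a sum over minimal extensions of
  its two paths in exchanged roles. The main vanishing arguments start from this recursion.\<close>

lemma trace_monomial:
  assumes "\<mu> \<in> paths \<Lambda>" "\<nu> \<in> paths \<Lambda>"
  shows "\<phi> (temb \<Lambda> (gen \<mu> * gadj \<nu>)) = of_real (W \<mu>) * (\<Sum>i\<in>min_ext \<Lambda> \<nu> \<mu>. \<phi> (temb \<Lambda> (gen (fst i) * gadj (snd i))))"
proof -
  have "\<phi> (temb \<Lambda> (gen \<mu> * gadj \<nu>)) = of_real (W \<mu>) * \<phi> (temb \<Lambda> (gadj \<nu> * gen \<mu>))"
    using assms by (intro trace) auto
  also have "temb \<Lambda> (gadj \<nu> * gen \<mu>) = temb \<Lambda> (\<Sum>i\<in>min_ext \<Lambda> \<nu> \<mu>. gen (fst i) * gadj (snd i))"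
    using temb_eqI[OF T.t_min_ext[OF assms(2,1)]] by (simp add: case_prod_beta)
  also have "\<phi> \<dots> = (\<Sum>i\<in>min_ext \<Lambda> \<nu> \<mu>. \<phi> (temb \<Lambda> (gen (fst i) * gadj (snd i))))"
    by (rule functional_sum[OF bdd]) (auto simp: min_ext_def)
  finally show ?thesis .
qed

lemma monomial_diff_source:
  assumes "\<mu> \<in> paths \<Lambda>" "\<nu> \<in> paths \<Lambda>" "src \<Lambda> \<mu> \<noteq> src \<Lambda> \<nu>"
  shows "\<phi> (temb \<Lambda> (gen \<mu> * gadj \<nu>)) = 0"
proof -
  note c = src_closed[OF assms(1)] src_closed[OF assms(2)]
  have "T.eqv (gen \<mu> * gadj \<nu>) ((gen \<mu> * gen (src \<Lambda> \<mu>)) * (gen (src \<Lambda> \<nu>) * gadj \<nu>))"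
    by (intro T.eqv_mult T.eqv_sym[OF T.t_src] gadj_eqv assms)
  also have "\<dots> = gen \<mu> * (gen (src \<Lambda> \<mu>) * gen (src \<Lambda> \<nu>)) * gadj \<nu>" by (simp add: mult.assoc)
  also have "T.eqv \<dots> (gen \<mu> * 0 * gadj \<nu>)"
    using assms c by (intro T.eqv_mult T.eqv_refl T.t_vertex_orth src_vertex) auto
  finally show ?thesis using temb_eqI functional_zero[OF bdd] by fastforce
qed

text \<open>The trace relation moves t_\<mu> behind the adjoint of t_\<nu>, where the orthogonality
  of paths with source v applies.\<close>

lemma monomial_source_v:
  assumes "\<mu> \<in> paths \<Lambda>" "\<nu> \<in> paths \<Lambda>" "src \<Lambda> \<mu> = v" "src \<Lambda> \<nu> = v" "\<mu> \<noteq> \<nu>"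
  shows "\<phi> (temb \<Lambda> (gen \<mu> * gadj \<nu>)) = 0"
  using trace[OF assms(1) fpoly_gadj[OF assms(2)]] temb_eqI[OF adj_orth_v[OF assms(2,1,4,3)]] assms(5)
    functional_zero[OF bdd] by auto

lemma gen_zero: assumes "\<mu> \<in> paths \<Lambda>" "deg \<Lambda> \<mu> \<noteq> 0" shows "\<phi> (temb \<Lambda> (gen \<mu>)) = 0"
  unfolding gen_def
proof (rule twisted_trace_zero[OF st tr])
  show "\<beta> \<noteq> 0" using beta_pos by simp
  show "[(\<mu>, False)] \<in> words \<Lambda>" using assms by (simp add: words_def)
  show "word_weight \<Lambda> (r1, r2) [(\<mu>, False)] \<noteq> 0" using path_weight_pos[OF assms] by (simp add: word_weight_def)
qed

lemma monomial_star:
  assumes "\<mu> \<in> paths \<Lambda>" "\<nu> \<in> paths \<Lambda>"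
  shows "\<phi> (temb \<Lambda> (gen \<nu> * gadj \<mu>)) = cnj (\<phi> (temb \<Lambda> (gen \<mu> * gadj \<nu>)))"
  using state_padj[OF st, of "gen \<mu> * gadj \<nu>"] assms by (simp add: padj_mult)

text \<open>\<nu> has to be the source of \<mu>, so the monomial is t_\<mu>, an eigenvector of the
  dynamics with nonzero weight.\<close>

lemma vertex_monomial:
  assumes "\<mu> \<in> paths \<Lambda>" "\<nu> \<in> paths \<Lambda>" "src \<Lambda> \<mu> = src \<Lambda> \<nu>" "deg \<Lambda> \<nu> = 0" "\<mu> \<noteq> \<nu>"
  shows "\<phi> (temb \<Lambda> (gen \<mu> * gadj \<nu>)) = 0"
proof -
  have v: "\<nu> \<in> vertices \<Lambda>" using assms by (simp add: vertices_def)
  have nu: "\<nu> = src \<Lambda> \<mu>" using vertex_rng_src[OF v] assms(3) by simp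
  have "deg \<Lambda> \<mu> \<noteq> 0"
  proof
    assume "deg \<Lambda> \<mu> = 0"
    hence "\<mu> \<in> vertices \<Lambda>" using assms by (simp add: vertices_def)
    thus False using vertex_rng_src nu assms(5) by simp
  qed
  thus ?thesis using temb_eqI[OF gen_eqv[OF assms(1)]] gen_zero[OF assms(1)] nu by simp
qed

text \<open>The largest of the finitely many values with \<open>\<mu>\<close>, \<open>\<nu>\<close> of degrees \<open>(m, 0)\<close>, \<open>(0, n)\<close>
  is at most \<open>(d1 * x1)\<^sup>m\<close> times itself, hence zero.\<close>

lemma monomial_orthogonal_degrees:
  assumes m: "0 < m"
    and "\<mu> \<in> paths_between \<Lambda> u (m, 0) u" "\<nu> \<in> paths_between \<Lambda> u (0, n) u"
    and card: "real (card (paths_between \<Lambda> u (m, 0) u)) * x1 ^ m < 1"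
  shows "\<phi> (temb \<Lambda> (gen \<mu> * gadj \<nu>)) = 0"
proof -
  let ?X = "paths_between \<Lambda> u (m, 0) u" and ?Y = "paths_between \<Lambda> u (0, n) u"
  define F where "F i = cmod (\<phi> (temb \<Lambda> (gen (fst i) * gadj (snd i))))" for i
  have fin: "finite (?X \<times> ?Y)" "finite ?X" using finite_paths_into by (auto simp: paths_between_def)
  define M where "M = Max (F ` (?X \<times> ?Y))"
  have ne: "F ` (?X \<times> ?Y) \<noteq> {}" using assms by auto
  have leM: "F i \<le> M" if "i \<in> ?X \<times> ?Y" for i unfolding M_def using that fin by (intro Max_ge) auto
  have M0: "M \<ge> 0" using leM[of "(\<mu>, \<nu>)"] assms by (auto simp: F_def intro: order_trans[OF norm_ge_zero])
  obtain \<mu>0 \<nu>0 where mn: "\<mu>0 \<in> ?X" "\<nu>0 \<in> ?Y" "M = F (\<mu>0, \<nu>0)"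
    using Max_in[OF finite_imageI[OF fin(1)] ne] unfolding M_def by auto
  have p: "\<mu>0 \<in> paths \<Lambda>" "\<nu>0 \<in> paths \<Lambda>" "src \<Lambda> \<mu>0 = u" "src \<Lambda> \<nu>0 = u" "deg \<Lambda> \<mu>0 = (m, 0)" "deg \<Lambda> \<nu>0 = (0, n)"
    using mn by (auto simp: paths_between_def paths_into_def)
  let ?E = "min_ext \<Lambda> \<nu>0 \<mu>0"
  let ?E' = "{i \<in> ?E. src \<Lambda> (fst i) = u}"
  have finE: "finite ?E" by (rule finite_min_ext[OF p(2,1)])
  \<comment> \<open>The recursion preserves the shape of the degrees: the join (m, n) leaves (m, 0)
    to be added to \<nu>0 and (0, n) to be added to \<mu>0.\<close>
  have E: "fst i \<in> paths \<Lambda>" "snd i \<in> paths \<Lambda>" "rng \<Lambda> (fst i) = u" "rng \<Lambda> (snd i) = u"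
    "deg \<Lambda> (fst i) = (m, 0)" "deg \<Lambda> (snd i) = (0, n)" "src \<Lambda> (fst i) = src \<Lambda> (snd i)"
    "cmp \<Lambda> \<nu>0 (fst i) = cmp \<Lambda> \<mu>0 (snd i)" if "i \<in> ?E" for i
  proof -
    have "(fst i, snd i) \<in> ?E" using that by simp
    note e = min_extD[OF p(2,1) this]
    show "fst i \<in> paths \<Lambda>" "snd i \<in> paths \<Lambda>" "rng \<Lambda> (fst i) = u" "rng \<Lambda> (snd i) = u"
      "src \<Lambda> (fst i) = src \<Lambda> (snd i)" "cmp \<Lambda> \<nu>0 (fst i) = cmp \<Lambda> \<mu>0 (snd i)"
      using e p by auto
    have s: "sup (0, n) (m, 0) = (m, n)" by (simp add: sup_prod_def sup_nat_def)
    show "deg \<Lambda> (fst i) = (m, 0)" "deg \<Lambda> (snd i) = (0, n)"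
      using e(6,7) unfolding p(5,6) s by (cases "deg \<Lambda> (fst i)"; cases "deg \<Lambda> (snd i)"; auto)+
  qed
  \<comment> \<open>Extensions with source v vanish by orthogonality, so only pairs from the
    original finite set remain.\<close>
  have zero: "\<phi> (temb \<Lambda> (gen (fst i) * gadj (snd i))) = 0" if i: "i \<in> ?E - ?E'" for i
  proof (rule monomial_source_v)
    show "fst i \<noteq> snd i" using E(5,6)[of i] i m by auto
    show "src \<Lambda> (fst i) = v" "src \<Lambda> (snd i) = v" using E[of i] i src_cases[of "fst i"] by auto
  qed (use E[of i] i in auto)
  have "M = W \<mu>0 * cmod (\<Sum>i\<in>?E. \<phi> (temb \<Lambda> (gen (fst i) * gadj (snd i))))"
    using mn(3) trace_monomial[OF p(1,2)] by (simp add: F_def norm_mult)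
  also have "(\<Sum>i\<in>?E. \<phi> (temb \<Lambda> (gen (fst i) * gadj (snd i)))) = (\<Sum>i\<in>?E'. \<phi> (temb \<Lambda> (gen (fst i) * gadj (snd i))))"
    by (rule sum.mono_neutral_right) (use finE zero in auto)
  also have "cmod \<dots> \<le> (\<Sum>i\<in>?E'. F i)" unfolding F_def by (rule norm_sum)
  also have "\<dots> \<le> (\<Sum>i\<in>?E'. M)"
  proof (rule sum_mono)
    fix i assume i: "i \<in> ?E'"
    have "i \<in> ?X \<times> ?Y" using E[of i] i by (cases i) (auto simp: paths_between_def paths_into_def)
    thus "F i \<le> M" by (rule leM)
  qed
  also have "(\<Sum>i\<in>?E'. M) = real (card ?E') * M" by simp
  also have "\<dots> \<le> real (card ?X) * M"
  proof -
    \<comment> \<open>Left cancellation recovers the second member of an extension from the first,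
      so there are at most as many terms as loops of degree (m, 0).\<close>
    have inj: "inj_on fst ?E'"
    proof (rule inj_onI)
      fix i j assume i: "i \<in> ?E'" and j: "j \<in> ?E'" and ij: "fst i = fst j"
      have "snd i = snd j" using E[of i] E[of j] i j ij p by (intro cancel_left[of \<mu>0 "snd i" "snd j"]) auto
      thus "i = j" using ij by (simp add: prod_eq_iff)
    qed
    have "fst ` ?E' \<subseteq> ?X"
    proof
      fix a assume "a \<in> fst ` ?E'"
      then obtain i where "i \<in> ?E'" "a = fst i" by auto
      thus "a \<in> ?X" using E[of i] by (auto simp: paths_between_def paths_into_def)
    qed
    hence "card ?E' \<le> card ?X" using card_inj_on_le[OF inj _ fin(2)] by simp
    thus ?thesis using M0 by (intro mult_right_mono) auto
  qed
  finally have "M \<le> W \<mu>0 * (real (card ?X) * M)" by simp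
  moreover have "W \<mu>0 = x1 ^ m" using W_degree[OF p(5)] by simp
  ultimately have "(1 - real (card ?X) * x1 ^ m) * M \<le> 0" by (simp add: algebra_simps)
  hence "M \<le> 0" using card by (simp add: mult_le_0_iff)
  moreover have "F (\<mu>, \<nu>) \<le> M" using assms by (intro leM) auto
  ultimately have "F (\<mu>, \<nu>) \<le> 0" by simp
  thus ?thesis by (simp add: F_def)
qed

end

end

section \<open>Counting paths and summing their weights\<close>

context two_vertex_graph
begin

lemma paths_between_zero: "paths_between \<Lambda> u 0 u = {u}" "paths_between \<Lambda> u 0 v = {}"
proof -
  have *: "\<kappa> \<in> paths_between \<Lambda> u 0 z \<longleftrightarrow> \<kappa> \<in> vertices \<Lambda> \<and> rng \<Lambda> \<kappa> = u \<and> src \<Lambda> \<kappa> = z" for \<kappa> z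
    by (auto simp: paths_between_def paths_into_def vertices_def)
  show "paths_between \<Lambda> u 0 u = {u}" using * vertex_rng_src u_vertex by auto
  show "paths_between \<Lambda> u 0 v = {}" using * vertex_rng_src u_neq_v by auto
qed

lemma finite_between [simp]: "finite (paths_between \<Lambda> z n w)"
  using finite_paths_into by (auto simp: paths_between_def)

text \<open>Unique factorization at degree n. Since no edge has range v, the first piece is a loop
  at u whatever the source z is.\<close>

lemma card_between_add:
  assumes i: "i = e1 \<or> i = e2"
  shows "card (paths_between \<Lambda> u (n + i) z) = card (paths_between \<Lambda> u n u) * card (paths_between \<Lambda> u i z)"
proof -
  let ?c = "\<lambda>(\<mu>, \<nu>). cmp \<Lambda> \<mu> \<nu>"
  have "bij_betw ?c (paths_between \<Lambda> u n u \<times> paths_between \<Lambda> u i z) (paths_between \<Lambda> u (n + i) z)"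
    unfolding bij_betw_def
  proof
    show "inj_on ?c (paths_between \<Lambda> u n u \<times> paths_between \<Lambda> u i z)"
    proof (rule inj_onI, clarify)
      fix \<mu> \<nu> \<mu>' \<nu>'
      assume "\<mu> \<in> paths_between \<Lambda> u n u" "\<nu> \<in> paths_between \<Lambda> u i z"
        "\<mu>' \<in> paths_between \<Lambda> u n u" "\<nu>' \<in> paths_between \<Lambda> u i z" "cmp \<Lambda> \<mu> \<nu> = cmp \<Lambda> \<mu>' \<nu>'"
      thus "\<mu> = \<mu>' \<and> \<nu> = \<nu>'"
        by (intro factor_unique) (auto simp: paths_between_def paths_into_def)
    qed
    show "?c ` (paths_between \<Lambda> u n u \<times> paths_between \<Lambda> u i z) = paths_between \<Lambda> u (n + i) z"
    proof (intro equalityI subsetI)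
      fix \<kappa> assume "\<kappa> \<in> ?c ` (paths_between \<Lambda> u n u \<times> paths_between \<Lambda> u i z)"
      thus "\<kappa> \<in> paths_between \<Lambda> u (n + i) z"
        by (auto simp: paths_between_def paths_into_def cmp_closed deg_cmp rng_cmp src_cmp)
    next
      fix \<kappa> assume "\<kappa> \<in> paths_between \<Lambda> u (n + i) z"
      hence k: "\<kappa> \<in> paths \<Lambda>" "deg \<Lambda> \<kappa> = n + i" "rng \<Lambda> \<kappa> = u" "src \<Lambda> \<kappa> = z"
        by (auto simp: paths_between_def paths_into_def)
      obtain \<mu> \<nu> where m: "\<mu> \<in> paths \<Lambda>" "\<nu> \<in> paths \<Lambda>" "src \<Lambda> \<mu> = rng \<Lambda> \<nu>" "\<kappa> = cmp \<Lambda> \<mu> \<nu>" "deg \<Lambda> \<mu> = n" "deg \<Lambda> \<nu> = i"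
        by (rule factorE[OF k(1,2)])
      have "\<nu> \<notin> paths_into \<Lambda> v i" using i no_edges by auto
      hence ru: "rng \<Lambda> \<nu> = u" using m rng_cases[OF m(2)] by (auto simp: paths_into_def)
      have "\<mu> \<in> paths_between \<Lambda> u n u" "\<nu> \<in> paths_between \<Lambda> u i z"
        using m ru k rng_cmp[OF m(1-3)] src_cmp[OF m(1-3)] by (auto simp: paths_between_def paths_into_def)
      thus "\<kappa> \<in> ?c ` (paths_between \<Lambda> u n u \<times> paths_between \<Lambda> u i z)"
        using m(4) by (intro image_eqI[of _ _ "(\<mu>, \<nu>)"]) auto
    qed
  qed
  from bij_betw_same_card[OF this] show ?thesis by (simp add: card_cartesian_product)
qed

end

lemma has_sum_geometric_real: "0 \<le> q \<Longrightarrow> q < 1 \<Longrightarrow> ((\<lambda>n. q ^ n) has_sum inverse (1 - q :: real)) UNIV"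
  using geometric_sums[of q] by (intro sums_nonneg_imp_has_sum) (auto simp: divide_inverse)

lemma has_sum_nat_shift:
  fixes f :: "nat \<Rightarrow> real"
  assumes "(\<lambda>n. f (Suc n)) sums s" "f 0 = c" "\<And>n. 0 \<le> f n"
  shows "(f has_sum (c + s)) UNIV"
  using sums_Suc[OF assms(1)] assms(2,3) by (intro sums_nonneg_imp_has_sum) (auto simp: add.commute)

context kms_setup
begin

lemma x_nonneg [simp]: "0 \<le> x1" "0 \<le> x2" "0 \<le> real d1 * x1" "0 \<le> real d2 * x2"
  by (simp_all add: less_imp_le)

lemma card_uu: "card (paths_between \<Lambda> u (m, n) u) = d1 ^ m * d2 ^ n"
proof (induction n)
  case 0
  show ?case
  proof (induction m)
    case 0 show ?case using paths_between_zero(1) by (simp add: zero_prod_def)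
  next
    case (Suc m)
    have "(Suc m, 0) = (m, 0) + e1" by (simp add: e1_def)
    thus ?case using card_between_add[of e1 "(m, 0)" u] Suc d1_def by simp
  qed
next
  case (Suc n)
  have "(m, Suc n) = (m, n) + e2" by (simp add: e2_def)
  thus ?case using card_between_add[of e2 "(m, n)" u] Suc d2_def by simp
qed

text \<open>A path from v is cut at the edge next to v, taken of degree e1 whenever the degree of
  the path allows it. This choice is the origin of the unsymmetric shape of \<open>y_v\<close>: its
  a2 term accounts only for degrees (0, n).\<close>

lemma card_uv:
  "card (paths_between \<Lambda> u (Suc m, n) v) = d1 ^ m * d2 ^ n * a1"
  "card (paths_between \<Lambda> u (0, Suc n) v) = d2 ^ n * a2"
  "card (paths_between \<Lambda> u (0, 0) v) = 0"
proof -
  have "(Suc m, n) = (m, n) + e1" by (simp add: e1_def)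
  thus "card (paths_between \<Lambda> u (Suc m, n) v) = d1 ^ m * d2 ^ n * a1"
    using card_between_add[of e1 "(m, n)" v] a1_def by (simp add: card_uu)
  have "(0, Suc n) = (0, n) + e2" by (simp add: e2_def)
  thus "card (paths_between \<Lambda> u (0, Suc n) v) = d2 ^ n * a2"
    using card_between_add[of e2 "(0, n)" v] a2_def by (simp add: card_uu)
  show "card (paths_between \<Lambda> u (0, 0) v) = 0" using paths_between_zero(2) by (simp add: zero_prod_def)
qed

text \<open>Factoring a path of degree \<open>(1, 1)\<close> from \<open>v\<close> to \<open>u\<close> in both orders.\<close>

lemma commuting_squares: "d2 * a1 = d1 * a2"
proof -
  have "(1, 1) = (1, 0) + e2" by (simp add: e2_def)
  hence "card (paths_between \<Lambda> u (1, 1) v) = d1 * a2"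
    using card_between_add[of e2 "(1, 0)" v] card_uu[of 1 0] a2_def by simp
  thus ?thesis using card_uv(1)[of 0 1] by simp
qed

definition "loops = {\<kappa> \<in> paths \<Lambda>. src \<Lambda> \<kappa> = u}"
definition "v_paths = {\<kappa> \<in> paths \<Lambda>. src \<Lambda> \<kappa> = v}"

text \<open>The weight is constant on each degree, so the sum over paths is a double series with the
  numbers of paths as coefficients.\<close>

lemma has_sum_by_degree:
  assumes g: "\<And>m n. g (m, n) = real (card (paths_between \<Lambda> u (m, n) z)) * x1 ^ m * x2 ^ n"
    and sums: "(g has_sum s) (UNIV \<times> UNIV)"
  shows "(W has_sum s) {\<kappa> \<in> paths \<Lambda>. rng \<Lambda> \<kappa> = u \<and> src \<Lambda> \<kappa> = z}"
proof -
  let ?S = "SIGMA d:UNIV \<times> UNIV. paths_between \<Lambda> u d z"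
  have img: "{\<kappa> \<in> paths \<Lambda>. rng \<Lambda> \<kappa> = u \<and> src \<Lambda> \<kappa> = z} = snd ` ?S"
    by (force simp: paths_between_def paths_into_def image_iff)
  have fst_eq: "fst i = deg \<Lambda> (snd i)" if "i \<in> ?S" for i
    using that by (cases i) (simp add: paths_between_def paths_into_def)
  have inj: "inj_on snd ?S"
  proof (rule inj_onI)
    fix i j assume "i \<in> ?S" "j \<in> ?S" "snd i = snd j"
    thus "i = j" using fst_eq[of i] fst_eq[of j] by (simp only: prod_eq_iff)
  qed
  have inner: "((\<lambda>\<kappa>. (W \<circ> snd) (d, \<kappa>)) has_sum g d) (paths_between \<Lambda> u d z)" for d
  proof -
    obtain m n where d: "d = (m, n)" by fastforce
    have "(\<Sum>\<kappa>\<in>paths_between \<Lambda> u d z. W \<kappa>) = (\<Sum>\<kappa>\<in>paths_between \<Lambda> u d z. x1 ^ m * x2 ^ n)"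
      by (intro sum.cong refl W_degree) (simp add: paths_between_def paths_into_def d)
    hence "(\<Sum>\<kappa>\<in>paths_between \<Lambda> u d z. W \<kappa>) = g d" by (simp add: g d)
    thus ?thesis using has_sum_finite[of "paths_between \<Lambda> u d z" W] by simp
  qed
  have "(W \<circ> snd) summable_on ?S"
    by (rule summable_on_SigmaI[OF inner]) (use sums in \<open>auto simp: summable_on_def\<close>)
  hence "((W \<circ> snd) has_sum s) ?S" by (intro has_sum_SigmaI[OF inner sums])
  thus ?thesis unfolding img has_sum_reindex[OF inj] .
qed

text \<open>For nonnegative terms a convergent iterated series makes the double series summable,
  with the same value.\<close>

lemma has_sum_product:
  assumes "\<And>m. ((\<lambda>n. g (m, n)) has_sum h m) UNIV" "(h has_sum s) UNIV" "\<And>i. 0 \<le> (g i :: real)"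
  shows "(g has_sum s) ((UNIV :: nat set) \<times> (UNIV :: nat set))"
proof -
  have "g summable_on (UNIV :: nat set) \<times> (UNIV :: nat set)"
    by (rule summable_on_SigmaI[OF assms(1)]) (use assms in \<open>auto simp: summable_on_def\<close>)
  thus ?thesis by (intro has_sum_SigmaI[OF assms(1,2)])
qed

lemma loops_eq: "loops = {\<kappa> \<in> paths \<Lambda>. rng \<Lambda> \<kappa> = u \<and> src \<Lambda> \<kappa> = u}"
  using src_u_rng_u by (auto simp: loops_def)

lemma W_loops: "(W has_sum (inverse (1 - d1 * x1) * inverse (1 - d2 * x2))) loops"
  unfolding loops_eq
proof (rule has_sum_by_degree)
  let ?g = "\<lambda>(m, n). real (card (paths_between \<Lambda> u (m, n) u)) * x1 ^ m * x2 ^ n"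
  show "?g (m, n) = real (card (paths_between \<Lambda> u (m, n) u)) * x1 ^ m * x2 ^ n" for m n by simp
  show "(?g has_sum (inverse (1 - d1 * x1) * inverse (1 - d2 * x2))) (UNIV \<times> UNIV)"
  proof (rule has_sum_product)
    have "((\<lambda>n. (d1 * x1) ^ m * (d2 * x2) ^ n) has_sum ((d1 * x1) ^ m * inverse (1 - d2 * x2))) UNIV" for m
      by (intro has_sum_cmult_right has_sum_geometric_real small_x) simp
    moreover have "(\<lambda>n. ?g (m, n)) = (\<lambda>n. (d1 * x1) ^ m * (d2 * x2) ^ n)" for m
      by (simp add: card_uu power_mult_distrib mult_ac)
    ultimately show "((\<lambda>n. ?g (m, n)) has_sum ((d1 * x1) ^ m * inverse (1 - d2 * x2))) UNIV" for m by simp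
    show "((\<lambda>m. (d1 * x1) ^ m * inverse (1 - d2 * x2)) has_sum (inverse (1 - d1 * x1) * inverse (1 - d2 * x2))) UNIV"
      by (intro has_sum_cmult_left has_sum_geometric_real small_x) simp
  qed auto
qed

definition "y_v = 1 + real a1 * x1 * inverse (1 - real d1 * x1) * inverse (1 - real d2 * x2)
   + real a2 * x2 * inverse (1 - real d2 * x2)"

lemma y_v_pos: "0 < y_v"
  using small_x by (auto simp: y_v_def intro!: add_pos_nonneg mult_nonneg_nonneg)

lemma W_v: "W v = 1"
  using W_degree[of v 0 0] v_vertex by (simp add: vertices_def zero_prod_def)

text \<open>The vertex v contributes 1, the degrees (0, n + 1) a geometric series in d2 x2 with
  factor a2 x2, and the degrees (k + 1, n) a double geometric series with factor a1 x1.\<close>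

lemma W_v_paths: "(W has_sum y_v) v_paths"
proof -
  let ?s = "real a2 * x2 * inverse (1 - real d2 * x2)
    + real a1 * x1 * inverse (1 - real d1 * x1) * inverse (1 - real d2 * x2)"
  have "(W has_sum ?s) {\<kappa> \<in> paths \<Lambda>. rng \<Lambda> \<kappa> = u \<and> src \<Lambda> \<kappa> = v}"
  proof (rule has_sum_by_degree)
    let ?g = "\<lambda>(m, n). real (card (paths_between \<Lambda> u (m, n) v)) * x1 ^ m * x2 ^ n"
    let ?h = "\<lambda>m. case m of 0 \<Rightarrow> real a2 * x2 * inverse (1 - real d2 * x2)
        | Suc k \<Rightarrow> real a1 * x1 * (d1 * x1) ^ k * inverse (1 - real d2 * x2)"
    show "?g (m, n) = real (card (paths_between \<Lambda> u (m, n) v)) * x1 ^ m * x2 ^ n" for m n by simp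
    show "(?g has_sum ?s) (UNIV \<times> UNIV)"
    proof (rule has_sum_product)
      show "((\<lambda>n. ?g (m, n)) has_sum ?h m) UNIV" for m
      proof (cases m)
        case 0
        have "(\<lambda>n. a2 * x2 * (d2 * x2) ^ n) sums (a2 * x2 * (1 / (1 - d2 * x2)))"
          using small_x by (intro sums_mult geometric_sums) simp
        hence "(\<lambda>n. ?g (0, Suc n)) sums (real a2 * x2 * inverse (1 - real d2 * x2))"
          by (simp add: card_uv power_mult_distrib mult_ac divide_inverse)
        hence "((\<lambda>n. ?g (0, n)) has_sum (0 + real a2 * x2 * inverse (1 - real d2 * x2))) UNIV"
          by (rule has_sum_nat_shift) (auto simp: card_uv)
        thus ?thesis using 0 by simp
      next
        case (Suc k)
        have "((\<lambda>n. real a1 * x1 * (d1 * x1) ^ k * (d2 * x2) ^ n) has_sum (real a1 * x1 * (d1 * x1) ^ k * inverse (1 - d2 * x2))) UNIV"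
          by (intro has_sum_cmult_right has_sum_geometric_real small_x) simp
        moreover have "(\<lambda>n. ?g (m, n)) = (\<lambda>n. real a1 * x1 * (d1 * x1) ^ k * (d2 * x2) ^ n)"
          by (simp add: Suc card_uv power_mult_distrib mult_ac)
        ultimately show ?thesis by (simp add: Suc)
      qed
      have "(\<lambda>k. real a1 * x1 * (d1 * x1) ^ k * inverse (1 - real d2 * x2))
          sums (real a1 * x1 * (1 / (1 - d1 * x1)) * inverse (1 - real d2 * x2))"
        using small_x by (intro sums_mult sums_mult2 geometric_sums) simp
      hence "(\<lambda>k. ?h (Suc k)) sums (real a1 * x1 * inverse (1 - real d1 * x1) * inverse (1 - real d2 * x2))"
        by (simp add: divide_inverse)
      thus "(?h has_sum ?s) UNIV"
        by (rule has_sum_nat_shift) (use small_x in \<open>auto split: nat.split\<close>)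
    qed auto
  qed
  moreover have "(W has_sum W v) {v}" using has_sum_finite[of "{v}" W] by simp
  moreover have "v_paths = {v} \<union> {\<kappa> \<in> paths \<Lambda>. rng \<Lambda> \<kappa> = u \<and> src \<Lambda> \<kappa> = v}"
    using rng_cases range_v vertex_rng_src[OF v_vertex] vertex_closed[OF v_vertex] by (auto simp: v_paths_def)
  moreover have "{v} \<inter> {\<kappa> \<in> paths \<Lambda>. rng \<Lambda> \<kappa> = u \<and> src \<Lambda> \<kappa> = v} = {}"
    using vertex_rng_src[OF v_vertex] u_neq_v by auto
  ultimately have "(W has_sum (W v + ?s)) v_paths" by (simp only: has_sum_Un_disjoint)
  moreover have "W v + ?s = y_v" by (simp add: W_v y_v_def)
  ultimately show ?thesis by simp
qed

lemma W_scaled_measure: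
  assumes "(W has_sum s) S" "0 < s" "S \<subseteq> paths \<Lambda>"
  shows "path_measure \<Lambda> S (\<lambda>\<xi>. W \<xi> / s)"
proof unfold_locales
  show "((\<lambda>\<xi>. W \<xi> / s) has_sum 1) S"
    using has_sum_cmult_left[OF assms(1), of "inverse s"] assms(2) by (simp add: divide_inverse)
qed (use assms in auto)

section \<open>Values of a KMS state on monomials and vertices\<close>

context
  fixes \<phi> :: "'p toeplitz_element \<Rightarrow> complex"
  assumes st: "is_state TA \<phi>" and tr: "twisted_trace (r1, r2) \<beta> \<phi>"
begin

text \<open>For different paths with source u, one step of the recursion passes to minimal
  extensions (\<alpha>, \<beta>'), which differ by right cancellation and whose degrees share no
  nonzero coordinate. Each term vanishes: by orthogonality if the source is v, by its weight if one
  degree is 0, and by the maximum argument otherwise.\<close>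

lemma monomial_value:
  assumes m: "\<mu> \<in> paths \<Lambda>" and n: "\<nu> \<in> paths \<Lambda>"
  shows "\<phi> (temb \<Lambda> (gen \<mu> * gadj \<nu>)) = (if \<mu> = \<nu> then of_real (W \<mu>) * \<phi> (temb \<Lambda> (gen (src \<Lambda> \<mu>))) else 0)"
proof (cases "\<mu> = \<nu>")
  case True
  thus ?thesis using trace[OF st tr m fpoly_gadj[OF m]] temb_eqI[OF T.t_source[OF m]] by simp
next
  case neq: False
  have "\<phi> (temb \<Lambda> (gen \<mu> * gadj \<nu>)) = 0"
  proof (cases "src \<Lambda> \<mu> = src \<Lambda> \<nu>")
    case False thus ?thesis by (rule monomial_diff_source[OF st tr m n])
  next
    case same: True
    show ?thesis
    proof (cases "src \<Lambda> \<mu> = v")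
      case True thus ?thesis using same neq by (intro monomial_source_v[OF st tr m n]) auto
    next
      case False
      hence su: "src \<Lambda> \<mu> = u" "src \<Lambda> \<nu> = u" using src_cases[OF m] same by auto
      have "\<phi> (temb \<Lambda> (gen \<alpha> * gadj \<beta>')) = 0" if ab: "(\<alpha>, \<beta>') \<in> min_ext \<Lambda> \<nu> \<mu>" for \<alpha> \<beta>'
      proof -
        note e = min_extD[OF n m ab]
        have ne: "\<alpha> \<noteq> \<beta>'"
        proof
          assume "\<alpha> = \<beta>'"
          hence "\<nu> = \<mu>" using e by (intro cancel_right[of \<nu> \<alpha> \<mu>]) (auto simp: n m)
          thus False using neq by simp
        qed
        show ?thesis
        proof (cases "src \<Lambda> \<alpha> = v")
          case True thus ?thesis using e ne by (intro monomial_source_v[OF st tr]) auto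
        next
          case False
          hence s: "src \<Lambda> \<alpha> = u" "src \<Lambda> \<beta>' = u" using src_cases[OF e(1)] e(8) by auto
          have r: "rng \<Lambda> \<alpha> = u" "rng \<Lambda> \<beta>' = u" using e su by auto
          obtain m1 n1 m2 n2 where d: "deg \<Lambda> \<alpha> = (m1, n1)" "deg \<Lambda> \<beta>' = (m2, n2)" by fastforce
          \<comment> \<open>In each coordinate the join equals one of the two degrees, so one of the
            two extensions adds nothing there.\<close>
          have z: "m1 = 0 \<or> m2 = 0" "n1 = 0 \<or> n2 = 0"
            using e(6,7) unfolding d
            by (cases "deg \<Lambda> \<nu>"; cases "deg \<Lambda> \<mu>"; auto simp: sup_prod_def sup_nat_def max_def split: if_splits)+
          have card: "real (card (paths_between \<Lambda> u (k, 0) u)) * x1 ^ k < 1" if "0 < k" for k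
          proof -
            have "(real d1 * x1) ^ k < 1" using small_x that by (intro power_less_one_iff[THEN iffD2]) auto
            thus ?thesis by (simp add: card_uu power_mult_distrib)
          qed
          have star: "\<phi> (temb \<Lambda> (gen \<alpha> * gadj \<beta>')) = 0" if "\<phi> (temb \<Lambda> (gen \<beta>' * gadj \<alpha>)) = 0"
            using monomial_star[OF st tr e(2,1)] that by simp
          consider "deg \<Lambda> \<beta>' = 0" | "deg \<Lambda> \<alpha> = 0" | "deg \<Lambda> \<alpha> = (m1, 0)" "deg \<Lambda> \<beta>' = (0, n2)" "0 < m1"
            | "deg \<Lambda> \<alpha> = (0, n1)" "deg \<Lambda> \<beta>' = (m2, 0)" "0 < m2"
            using z d by (auto simp: zero_prod_def)
          thus ?thesis
          proof cases
            case 1 thus ?thesis using e ne by (intro vertex_monomial[OF st tr]) auto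
          next
            case 2 thus ?thesis using e ne by (intro star vertex_monomial[OF st tr]) auto
          next
            case 3
            thus ?thesis using e s r card[OF 3(3)]
              by (intro monomial_orthogonal_degrees[OF st tr, of m1 \<alpha> \<beta>' n2]) (auto simp: paths_between_def paths_into_def)
          next
            case 4
            thus ?thesis using e s r card[OF 4(3)]
              by (intro star monomial_orthogonal_degrees[OF st tr, of m2 \<beta>' \<alpha> n1]) (auto simp: paths_between_def paths_into_def)
          qed
        qed
      qed
      hence "(\<Sum>i\<in>min_ext \<Lambda> \<nu> \<mu>. \<phi> (temb \<Lambda> (gen (fst i) * gadj (snd i)))) = 0" by (intro sum.neutral) auto
      thus ?thesis by (simp add: trace_monomial[OF st tr m n])
    qed
  qed
  thus ?thesis using neq by simp
qed

lemma unit_value: "\<phi> (temb \<Lambda> (gen u)) + \<phi> (temb \<Lambda> (gen v)) = 1"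
proof -
  have "\<phi> (temb \<Lambda> T.unit_sum) = 1" using st star_alg.is_state_iff[OF TA_star_alg temb_unit] by blast
  moreover have "T.unit_sum = gen u + gen v" using u_neq_v by (simp add: T.unit_sum_def vertices_eq)
  ultimately show ?thesis
    using functional_add[OF state_bounded[OF st], of "gen u" "gen v"] u_vertex v_vertex vertex_closed by auto
qed

lemma projection_nonneg:
  assumes "T.eqv (padj f * f) f" shows "\<phi> (temb \<Lambda> f) \<in> \<real>\<^sub>\<ge>\<^sub>0"
proof -
  have f: "f \<in> fpoly \<Lambda>" using T.eqv_fpoly(2)[OF assms] .
  have "\<phi> (astar TA (temb \<Lambda> f) \<boxtimes>\<^bsub>TA\<^esub> temb \<Lambda> f) \<in> \<real>\<^sub>\<ge>\<^sub>0"
    using st temb_closed[OF f] unfolding is_state_def by blast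
  thus ?thesis using temb_eqI[OF assms] f by (simp add: temb_mult temb_padj)
qed

text \<open>The range projections of the paths starting at \<open>v\<close> are mutually orthogonal, so the sum of
  their values under \<open>\<phi>\<close> is at most 1.\<close>

lemma vertex_v_bound:
  obtains t where "\<phi> (temb \<Lambda> (gen v)) = of_real t" "0 \<le> t" "t * y_v \<le> 1"
proof -
  have vc: "v \<in> paths \<Lambda>" by (rule vertex_closed[OF v_vertex])
  have nn: "\<phi> (temb \<Lambda> (gen v)) \<in> \<real>\<^sub>\<ge>\<^sub>0" by (rule projection_nonneg[OF T.vertex_projection[OF v_vertex]])
  define t where "t = Re (\<phi> (temb \<Lambda> (gen v)))"
  have t: "\<phi> (temb \<Lambda> (gen v)) = of_real t" "0 \<le> t"
    using nn by (auto simp: t_def complex_nonneg_Reals_iff complex_eq_iff)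
  \<comment> \<open>The sum of all range projections may be infinite and then is not an element of
    the algebra, so the bound is first shown for finite sets.\<close>
  have fin: "t * (\<Sum>\<kappa>\<in>G. W \<kappa>) \<le> 1" if G: "finite G" "G \<subseteq> v_paths" for G
  proof -
    have Gp: "G \<subseteq> paths \<Lambda>" using G by (auto simp: v_paths_def)
    have Gv: "\<And>\<kappa>. \<kappa> \<in> G \<Longrightarrow> src \<Lambda> \<kappa> = v" using G by (auto simp: v_paths_def)
    have "T.eqv (padj (T.unit_sum - T.range_sum G) * (T.unit_sum - T.range_sum G)) (T.unit_sum - T.range_sum G)"
    proof (rule T.complement_projection[OF G(1) Gp])
      show "T.eqv (gadj \<kappa> * gen \<mu>) 0" if "\<kappa> \<in> G" "\<mu> \<in> G" "\<kappa> \<noteq> \<mu>" for \<kappa> \<mu>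
        using that Gp Gv by (intro adj_orth_v) auto
      show "T.eqv (T.unit_sum * gen \<kappa>) (gen \<kappa>)" if "\<kappa> \<in> G" for \<kappa> using that Gp by (intro T.unit_sum_gen) auto
    qed (auto intro: T.padj_unit_sum T.unit_sum_mult)
    hence p: "\<phi> (temb \<Lambda> (T.unit_sum - T.range_sum G)) \<in> \<real>\<^sub>\<ge>\<^sub>0" by (rule projection_nonneg)
    have b: "bounded_functional TA \<phi>" by (rule state_bounded[OF st])
    have one: "\<phi> (temb \<Lambda> T.unit_sum) = 1" using st star_alg.is_state_iff[OF TA_star_alg temb_unit] by blast
    have "\<phi> (temb \<Lambda> (T.range_sum G)) = (\<Sum>\<kappa>\<in>G. \<phi> (temb \<Lambda> (gen \<kappa> * gadj \<kappa>)))"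
      unfolding T.range_sum_def using Gp by (intro functional_sum b) auto
    also have "\<dots> = (\<Sum>\<kappa>\<in>G. of_real (W \<kappa> * t))"
      using Gp Gv by (intro sum.cong refl) (auto simp: monomial_value t)
    also have "\<dots> = of_real (t * (\<Sum>\<kappa>\<in>G. W \<kappa>))" by (simp add: sum_distrib_left mult.commute)
    finally have "\<phi> (temb \<Lambda> (T.unit_sum - T.range_sum G)) = of_real (1 - t * (\<Sum>\<kappa>\<in>G. W \<kappa>))"
      using functional_minus[OF b, of T.unit_sum "T.range_sum G"] Gp one by simp
    thus ?thesis using p by (simp add: complex_nonneg_Reals_iff)
  qed
  have "t * y_v \<le> 1"
  proof (cases "t = 0")
    case False
    hence tp: "t > 0" using t by simp
    \<comment> \<open>The weights are nonnegative, so a bound for all finite sets bounds the whole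
      series, whose value is \<open>y_v\<close>.\<close>
    have "infsum W v_paths \<le> 1 / t"
    proof (rule infsum_le_finite_sums)
      show "W summable_on v_paths" using W_v_paths by (auto simp: summable_on_def)
      show "sum W G \<le> 1 / t" if "finite G" "G \<subseteq> v_paths" for G
        using fin[OF that] tp by (simp add: field_simps)
    qed
    thus ?thesis using infsumI[OF W_v_paths] tp by (simp add: field_simps)
  qed simp
  thus thesis using that t by blast
qed

end

end

section \<open>Removing the vertex v\<close>

lemma fpoly_mono: "paths \<Lambda> \<subseteq> paths \<Gamma> \<Longrightarrow> fpoly \<Lambda> \<subseteq> fpoly \<Gamma>"
  by (auto simp: fpoly_def words_def)

text \<open>The congruence is exchanged for an equivalent relation R, so that an instance can verify
  the Toeplitz relations in its own terms.\<close>

lemma (in row_finite) toeplitz_seminormI: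
  assumes c: "cstar_on \<Lambda> P"
    and rel: "\<And>f g. cstar_on.eqv \<Lambda> P f g \<longleftrightarrow> R f g"
    and "\<And>\<kappa>. \<kappa> \<in> paths \<Lambda> \<Longrightarrow> R (gen \<kappa> * gadj \<kappa> * gen \<kappa>) (gen \<kappa>)"
    "\<And>z. z \<in> vertices \<Lambda> \<Longrightarrow> R (gadj z) (gen z)"
    "\<And>z. z \<in> vertices \<Lambda> \<Longrightarrow> R (gen z * gen z) (gen z)"
    "\<And>z w. z \<in> vertices \<Lambda> \<Longrightarrow> w \<in> vertices \<Lambda> \<Longrightarrow> z \<noteq> w \<Longrightarrow> R (gen z * gen w) 0"
    "\<And>\<kappa> \<mu>. \<kappa> \<in> paths \<Lambda> \<Longrightarrow> \<mu> \<in> paths \<Lambda> \<Longrightarrow> src \<Lambda> \<kappa> = rng \<Lambda> \<mu> \<Longrightarrow> R (gen \<kappa> * gen \<mu>) (gen (cmp \<Lambda> \<kappa> \<mu>))"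
    "\<And>\<kappa>. \<kappa> \<in> paths \<Lambda> \<Longrightarrow> R (gadj \<kappa> * gen \<kappa>) (gen (src \<Lambda> \<kappa>))"
    "\<And>\<mu> \<nu>. \<mu> \<in> paths \<Lambda> \<Longrightarrow> \<nu> \<in> paths \<Lambda> \<Longrightarrow>
       R (gadj \<mu> * gen \<nu>) (\<Sum>(\<alpha>, \<beta>)\<in>min_ext \<Lambda> \<mu> \<nu>. gen \<alpha> * gadj \<beta>)"
  shows "toeplitz_seminorm \<Lambda> P"
  by (rule toeplitz_seminorm.intro[OF row_finite_axioms c], rule toeplitz_seminorm_axioms.intro; unfold rel;
      rule assms(3-); assumption)

context two_vertex_graph
begin

abbreviation "\<Lambda>u \<equiv> loop_graph \<Lambda> u"

lemma loop_sel [simp]: "rng \<Lambda>u = rng \<Lambda>" "src \<Lambda>u = src \<Lambda>" "cmp \<Lambda>u = cmp \<Lambda>" "deg \<Lambda>u = deg \<Lambda>"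
  by (simp_all add: loop_graph_def)

lemma loop_paths: "\<kappa> \<in> paths \<Lambda>u \<longleftrightarrow> \<kappa> \<in> paths \<Lambda> \<and> src \<Lambda> \<kappa> = u"
  using src_u_rng_u by (auto simp: loop_graph_def)

lemma loop_vertices: "vertices \<Lambda>u = {u}"
proof -
  have "z \<in> vertices \<Lambda>u \<longleftrightarrow> z \<in> vertices \<Lambda> \<and> src \<Lambda> z = u" for z by (auto simp: vertices_def loop_paths)
  thus ?thesis using vertex_rng_src u_vertex vertices_eq u_neq_v by auto
qed

lemma loop_two_graph: "two_graph \<Lambda>u"
proof
  show "countable (paths \<Lambda>u)" by (rule countable_subset[OF _ countable_paths]) (auto simp: loop_paths)
next
  fix \<kappa> m n assume k: "\<kappa> \<in> paths \<Lambda>u" and d: "deg \<Lambda>u \<kappa> = m + n"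
  hence k': "\<kappa> \<in> paths \<Lambda>" "deg \<Lambda> \<kappa> = m + n" "src \<Lambda> \<kappa> = u" by (auto simp: loop_paths)
  \<comment> \<open>A path with source u passes only through u, because a path with range v is v
    itself. The factorizations in \<open>\<Lambda>\<close> and in the loop graph are therefore the
    same pairs.\<close>
  have "(\<lambda>(\<mu>, \<nu>). \<mu> \<in> paths \<Lambda>u \<and> \<nu> \<in> paths \<Lambda>u \<and> src \<Lambda>u \<mu> = rng \<Lambda>u \<nu> \<and> \<kappa> = cmp \<Lambda>u \<mu> \<nu> \<and> deg \<Lambda>u \<mu> = m \<and> deg \<Lambda>u \<nu> = n)
      = (\<lambda>(\<mu>, \<nu>). \<mu> \<in> paths \<Lambda> \<and> \<nu> \<in> paths \<Lambda> \<and> src \<Lambda> \<mu> = rng \<Lambda> \<nu> \<and> \<kappa> = cmp \<Lambda> \<mu> \<nu> \<and> deg \<Lambda> \<mu> = m \<and> deg \<Lambda> \<nu> = n)"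
  proof (rule ext, clarify)
    fix \<mu> \<nu>
    have "src \<Lambda> \<mu> = u \<and> src \<Lambda> \<nu> = u" if "\<mu> \<in> paths \<Lambda>" "\<nu> \<in> paths \<Lambda>" "src \<Lambda> \<mu> = rng \<Lambda> \<nu>" "\<kappa> = cmp \<Lambda> \<mu> \<nu>"
      using src_cmp[OF that(1-3)] that k'(3) src_u_rng_u[OF that(2)] by simp
    thus "(\<mu> \<in> paths \<Lambda>u \<and> \<nu> \<in> paths \<Lambda>u \<and> src \<Lambda>u \<mu> = rng \<Lambda>u \<nu> \<and> \<kappa> = cmp \<Lambda>u \<mu> \<nu> \<and> deg \<Lambda>u \<mu> = m \<and> deg \<Lambda>u \<nu> = n)
       = (\<mu> \<in> paths \<Lambda> \<and> \<nu> \<in> paths \<Lambda> \<and> src \<Lambda> \<mu> = rng \<Lambda> \<nu> \<and> \<kappa> = cmp \<Lambda> \<mu> \<nu> \<and> deg \<Lambda> \<mu> = m \<and> deg \<Lambda> \<nu> = n)"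
      by (auto simp: loop_paths)
  qed
  thus "\<exists>!(\<mu>, \<nu>). \<mu> \<in> paths \<Lambda>u \<and> \<nu> \<in> paths \<Lambda>u \<and> src \<Lambda>u \<mu> = rng \<Lambda>u \<nu> \<and> \<kappa> = cmp \<Lambda>u \<mu> \<nu> \<and> deg \<Lambda>u \<mu> = m \<and> deg \<Lambda>u \<nu> = n"
    using factorization[OF k'(1,2)] by simp
next
  fix \<kappa> assume "\<kappa> \<in> paths \<Lambda>u"
  thus "cmp \<Lambda>u (rng \<Lambda>u \<kappa>) \<kappa> = \<kappa>" using cmp_rng[of \<kappa>] by (simp add: loop_paths)
qed (auto simp: loop_paths rng_closed src_closed rng_rng src_rng rng_src src_src cmp_closed rng_cmp src_cmp cmp_src
    deg_rng deg_src deg_cmp src_u_rng_u intro!: cmp_assoc)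

lemma loop_row_finite: "row_finite \<Lambda>u"
proof -
  interpret L: two_graph \<Lambda>u by (rule loop_two_graph)
  show ?thesis
  proof
    show "finite (vertices \<Lambda>u)" by (simp add: loop_vertices)
    show "finite (paths_into \<Lambda>u z n)" for z n
      by (rule finite_subset[OF _ finite_paths_into[of z n]]) (auto simp: paths_into_def loop_paths)
  qed
qed

end

sublocale two_vertex_graph \<subseteq> L: row_finite "loop_graph \<Lambda> u"
  by (rule loop_row_finite)

context two_vertex_graph
begin

definition restr :: "'p npoly \<Rightarrow> 'p npoly" where
  "restr f = Abs_poly_mapping (\<lambda>w. if fst ` set w \<subseteq> paths \<Lambda>u then coeff_of f w else 0)"

lemma coeff_restr [simp]: "coeff_of (restr f) w = (if fst ` set w \<subseteq> paths \<Lambda>u then coeff_of f w else 0)"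
proof -
  have "finite {w. (if fst ` set w \<subseteq> paths \<Lambda>u then coeff_of f w else 0) \<noteq> 0}"
    by (rule finite_subset[OF _ finite_keys[of f]]) (auto simp: in_keys_iff split: if_splits)
  thus ?thesis by (simp add: restr_def)
qed

lemma restr_add: "restr (f + g) = restr f + restr g"
  and restr_minus: "restr (f - g) = restr f - restr g"
  and restr_zero [simp]: "restr 0 = 0"
  and restr_pscale: "restr (pscale c f) = pscale c (restr f)"
  and restr_padj: "restr (padj f) = padj (restr f)"
  by (rule poly_mapping_eqI, simp add: lookup_add lookup_minus)+

text \<open>A word uses only loops at u exactly when both halves of any splitting do, so deleting
  the other words commutes with convolution.\<close>

lemma restr_mult: "restr (f * g) = restr f * restr g"
proof (rule poly_mapping_eqI)
  fix w :: "'p word"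
  have split: "fst ` set w = fst ` set (take k w) \<union> fst ` set (drop k w)" for k
    by (metis append_take_drop_id image_Un set_append)
  have key: "(if fst ` set w \<subseteq> paths \<Lambda>u then coeff_of f (take k w) * coeff_of g (drop k w) else 0)
      = coeff_of (restr f) (take k w) * coeff_of (restr g) (drop k w)" for k
    unfolding coeff_restr split[of k] Un_subset_iff by simp
  thus "coeff_of (restr (f * g)) w = coeff_of (restr f * restr g) w"
    unfolding coeff_mult coeff_restr[of "f * g"] by (simp del: coeff_restr flip: key)
qed

lemma restr_sum: "restr (\<Sum>i\<in>I. f i) = (\<Sum>i\<in>I. restr (f i))"
  by (induction I rule: infinite_finite_induct) (auto simp: restr_add)

lemma restr_fpoly [simp, intro]: "f \<in> fpoly \<Lambda> \<Longrightarrow> restr f \<in> fpoly \<Lambda>u"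
  by (auto simp: fpoly_def words_def in_keys_iff subset_iff split: if_splits)

lemma loop_fpoly: "f \<in> fpoly \<Lambda>u \<Longrightarrow> f \<in> fpoly \<Lambda>"
  using fpoly_mono[of \<Lambda>u \<Lambda>] loop_paths by blast

lemma restr_loop: assumes "f \<in> fpoly \<Lambda>u" shows "restr f = f"
proof (rule poly_mapping_eqI)
  fix w
  show "coeff_of (restr f) w = coeff_of f w"
  proof (cases "coeff_of f w = 0")
    case False
    hence "w \<in> words \<Lambda>u" using assms by (auto simp: fpoly_def in_keys_iff)
    thus ?thesis by (simp add: words_def)
  qed simp
qed

lemma restr_gen: "restr (gen \<kappa>) = (if \<kappa> \<in> paths \<Lambda>u then gen \<kappa> else 0)"
  and restr_gadj: "restr (gadj \<kappa>) = (if \<kappa> \<in> paths \<Lambda>u then gadj \<kappa> else 0)"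
  by (rule poly_mapping_eqI, auto simp: gen_def gadj_def lookup_single when_def)+

lemma loop_min_ext:
  assumes "\<mu> \<in> paths \<Lambda>u" "\<nu> \<in> paths \<Lambda>u"
  shows "min_ext \<Lambda>u \<mu> \<nu> = {i \<in> min_ext \<Lambda> \<mu> \<nu>. src \<Lambda> (fst i) = u}"
proof -
  have m: "\<mu> \<in> paths \<Lambda>" "\<nu> \<in> paths \<Lambda>" using assms by (auto simp: loop_paths)
  have "(\<alpha>, \<beta>) \<in> min_ext \<Lambda>u \<mu> \<nu> \<longleftrightarrow> (\<alpha>, \<beta>) \<in> min_ext \<Lambda> \<mu> \<nu> \<and> src \<Lambda> \<alpha> = u" for \<alpha> \<beta>
  proof
    assume "(\<alpha>, \<beta>) \<in> min_ext \<Lambda>u \<mu> \<nu>"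
    thus "(\<alpha>, \<beta>) \<in> min_ext \<Lambda> \<mu> \<nu> \<and> src \<Lambda> \<alpha> = u" by (auto simp: min_ext_def loop_paths)
  next
    assume a: "(\<alpha>, \<beta>) \<in> min_ext \<Lambda> \<mu> \<nu> \<and> src \<Lambda> \<alpha> = u"
    hence "src \<Lambda> \<beta> = u" using min_extD(8)[OF m] by auto
    thus "(\<alpha>, \<beta>) \<in> min_ext \<Lambda>u \<mu> \<nu>" using a by (auto simp: min_ext_def loop_paths)
  qed
  thus ?thesis by auto
qed

text \<open>Deletion removes the terms with source v, and the surviving minimal extensions are those
  of the loop graph.\<close>

lemma restr_min_ext_sum:
  assumes "\<mu> \<in> paths \<Lambda>u" "\<nu> \<in> paths \<Lambda>u"
  shows "restr (\<Sum>(\<alpha>, \<beta>)\<in>min_ext \<Lambda> \<mu> \<nu>. gen \<alpha> * gadj \<beta>) = (\<Sum>(\<alpha>, \<beta>)\<in>min_ext \<Lambda>u \<mu> \<nu>. gen \<alpha> * gadj \<beta>)"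
proof -
  have m: "\<mu> \<in> paths \<Lambda>" "\<nu> \<in> paths \<Lambda>" using assms by (auto simp: loop_paths)
  have in_loop: "fst i \<in> paths \<Lambda>u \<and> snd i \<in> paths \<Lambda>u" if "i \<in> min_ext \<Lambda> \<mu> \<nu>" "src \<Lambda> (fst i) = u" for i
  proof -
    have "fst i \<in> paths \<Lambda>" "snd i \<in> paths \<Lambda>" "src \<Lambda> (snd i) = u"
      using min_extD[OF m, of "fst i" "snd i"] that by simp_all
    thus ?thesis using that(2) by (simp add: loop_paths)
  qed
  have "restr (\<Sum>(\<alpha>, \<beta>)\<in>min_ext \<Lambda> \<mu> \<nu>. gen \<alpha> * gadj \<beta>)
      = (\<Sum>i\<in>min_ext \<Lambda> \<mu> \<nu>. restr (gen (fst i)) * restr (gadj (snd i)))"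
    by (simp add: restr_sum restr_mult case_prod_beta)
  also have "\<dots> = (\<Sum>i\<in>min_ext \<Lambda>u \<mu> \<nu>. restr (gen (fst i)) * restr (gadj (snd i)))"
    unfolding loop_min_ext[OF assms]
    by (rule sum.mono_neutral_right) (auto simp: finite_min_ext[OF m] restr_gen loop_paths)
  also have "\<dots> = (\<Sum>i\<in>min_ext \<Lambda>u \<mu> \<nu>. gen (fst i) * gadj (snd i))"
    using in_loop unfolding loop_min_ext[OF assms] by (intro sum.cong) (auto simp: restr_gen restr_gadj)
  finally show ?thesis by (simp add: case_prod_beta)
qed

text \<open>Sending every generator with source v to 0 respects the Toeplitz relations. Pulled back
  seminorms are thus admissible for \<open>\<Lambda>\<close>, which makes deletion contractive for
  the universal norms.\<close>

lemma restr_seminorm: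
  assumes P: "toeplitz_seminorm \<Lambda>u P"
  shows "toeplitz_seminorm \<Lambda> (\<lambda>f. P (restr f))"
proof -
  interpret P: toeplitz_seminorm \<Lambda>u P by (rule P)
  have c: "cstar_on \<Lambda> (\<lambda>f. P (restr f))"
    by standard (auto simp: restr_add restr_mult restr_pscale restr_padj P.P_nonneg P.P_add P.P_pscale P.P_mult P.P_cstar)
  let ?R = "\<lambda>f g. f \<in> fpoly \<Lambda> \<and> g \<in> fpoly \<Lambda> \<and> P.eqv (restr f) (restr g)"
  have R: "cstar_on.eqv \<Lambda> (\<lambda>f. P (restr f)) f g \<longleftrightarrow> ?R f g" for f g
    unfolding cstar_on.eqv_def[OF c] P.eqv_def by (auto simp: restr_minus)
  have vl: "z \<in> paths \<Lambda>u \<longleftrightarrow> z = u" if "z \<in> vertices \<Lambda>" for z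
    using that vertex_closed[OF that] vertex_rng_src[OF that] by (auto simp: loop_paths)
  have m: "(\<Sum>(\<alpha>, \<beta>)\<in>min_ext \<Lambda> \<mu> \<nu>. gen \<alpha> * gadj \<beta>) \<in> fpoly \<Lambda>" for \<mu> \<nu>
    by (rule fpoly_sum) (auto simp: min_ext_def)
  show ?thesis
  proof (rule toeplitz_seminormI[OF c R])
    fix \<kappa> assume k: "\<kappa> \<in> paths \<Lambda>"
    show "?R (gen \<kappa> * gadj \<kappa> * gen \<kappa>) (gen \<kappa>)"
      using k P.t_isometry[of \<kappa>] by (simp add: restr_mult restr_gen restr_gadj)
    show "?R (gadj \<kappa> * gen \<kappa>) (gen (src \<Lambda> \<kappa>))"
    proof (cases "\<kappa> \<in> paths \<Lambda>u")
      case True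
      hence "src \<Lambda> \<kappa> = u" by (simp add: loop_paths)
      thus ?thesis using True k P.t_source[of \<kappa>] u_vertex vl[of u] vertex_closed[of u]
        by (simp add: restr_mult restr_gen restr_gadj)
    next
      case False
      hence "src \<Lambda> \<kappa> = v" using k src_cases by (auto simp: loop_paths)
      thus ?thesis using False k vl[OF v_vertex] u_neq_v vertex_closed[OF v_vertex]
        by (simp add: restr_mult restr_gen restr_gadj)
    qed
    fix \<mu> assume m: "\<mu> \<in> paths \<Lambda>" "src \<Lambda> \<kappa> = rng \<Lambda> \<mu>"
    show "?R (gen \<kappa> * gen \<mu>) (gen (cmp \<Lambda> \<kappa> \<mu>))"
    proof (cases "src \<Lambda> \<mu> = u")
      case True
      hence "\<mu> \<in> paths \<Lambda>u" "\<kappa> \<in> paths \<Lambda>u" "cmp \<Lambda> \<kappa> \<mu> \<in> paths \<Lambda>u"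
        using k m cmp_closed[OF k m] src_cmp[OF k m] src_u_rng_u[OF m(1)] by (auto simp: loop_paths)
      thus ?thesis using k m cmp_closed[OF k m] P.t_mult[of \<kappa> \<mu>] by (simp add: restr_mult restr_gen)
    next
      case False
      hence "\<mu> \<notin> paths \<Lambda>u" "cmp \<Lambda> \<kappa> \<mu> \<notin> paths \<Lambda>u" using src_cmp[OF k m] by (auto simp: loop_paths)
      thus ?thesis using k m cmp_closed[OF k m] by (simp add: restr_mult restr_gen)
    qed
  next
    fix z assume z: "z \<in> vertices \<Lambda>"
    have zp: "z \<in> paths \<Lambda>" by (rule vertex_closed[OF z])
    show "?R (gadj z) (gen z)" "?R (gen z * gen z) (gen z)"
      using zp vl[OF z] P.t_vertex_adj[of z] P.t_vertex_idem[of z] loop_vertices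
      by (auto simp: restr_mult restr_gen restr_gadj)
    fix w assume w: "w \<in> vertices \<Lambda>" "z \<noteq> w"
    have "restr (gen z * gen w) = 0" using vl[OF z] vl[OF w(1)] w(2) by (cases "z = u"; cases "w = u") (auto simp: restr_mult restr_gen)
    thus "?R (gen z * gen w) 0" using zp vertex_closed[OF w(1)] by simp
  next
    fix \<mu> \<nu> assume mn: "\<mu> \<in> paths \<Lambda>" "\<nu> \<in> paths \<Lambda>"
    have vzero: "restr (gen v) = 0" "restr (gadj v) = 0" using vl[OF v_vertex] u_neq_v by (auto simp: restr_gen restr_gadj)
    have "P.eqv (restr (gadj \<mu> * gen \<nu>)) (restr (\<Sum>(\<alpha>, \<beta>)\<in>min_ext \<Lambda> \<mu> \<nu>. gen \<alpha> * gadj \<beta>))"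
    proof (cases "\<mu> \<in> paths \<Lambda>u \<and> \<nu> \<in> paths \<Lambda>u")
      case True
      thus ?thesis using P.t_min_ext[of \<mu> \<nu>] restr_min_ext_sum[of \<mu> \<nu>] by (simp add: restr_mult restr_gen restr_gadj)
    next
      case False
      hence l: "restr (gadj \<mu> * gen \<nu>) = 0" by (auto simp: restr_mult restr_gen restr_gadj)
      \<comment> \<open>If \<mu> or \<nu> has source v, the corresponding member of a minimal
        extension is v, and its generator is deleted.\<close>
      have "restr (gen \<alpha> * gadj \<beta>) = 0" if ab: "(\<alpha>, \<beta>) \<in> min_ext \<Lambda> \<mu> \<nu>" for \<alpha> \<beta>
      proof -
        note e = min_extD[OF mn ab]
        have "src \<Lambda> \<mu> = v \<or> src \<Lambda> \<nu> = v" using False mn src_cases by (auto simp: loop_paths)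
        hence "\<alpha> = v \<or> \<beta> = v" using e range_v by auto
        thus ?thesis using vzero by (auto simp: restr_mult)
      qed
      hence "restr (\<Sum>(\<alpha>, \<beta>)\<in>min_ext \<Lambda> \<mu> \<nu>. gen \<alpha> * gadj \<beta>) = 0"
        by (simp add: restr_sum case_prod_beta)
      thus ?thesis using l by simp
    qed
    thus "?R (gadj \<mu> * gen \<nu>) (\<Sum>(\<alpha>, \<beta>)\<in>min_ext \<Lambda> \<mu> \<nu>. gen \<alpha> * gadj \<beta>)" using mn m by auto
  qed
qed

lemma restr_contractive: "f \<in> fpoly \<Lambda> \<Longrightarrow> tnorm \<Lambda>u (restr f) \<le> tnorm \<Lambda> f"
  using seminorm_le_tnorm[OF restr_seminorm[OF L.tnorm_seminorm]] .

section \<open>Complements of the ranges of paths with source v\<close>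

definition "v_finite G \<longleftrightarrow> finite G \<and> G \<subseteq> {\<kappa> \<in> paths \<Lambda>. src \<Lambda> \<kappa> = v}"

text \<open>These projections decrease as G grows and annihilate the ranges of more and more paths
  with source v.\<close>

definition "co_range G = T.unit_sum - T.range_sum G"

lemma v_finite_paths: "v_finite G \<Longrightarrow> G \<subseteq> paths \<Lambda>"
  by (auto simp: v_finite_def)

lemma v_finite_Un: "v_finite G \<Longrightarrow> v_finite H \<Longrightarrow> v_finite (G \<union> H)"
  and v_finite_empty: "v_finite {}"
  by (auto simp: v_finite_def)

lemma co_range_fpoly [simp]: "v_finite G \<Longrightarrow> co_range G \<in> fpoly \<Lambda>"
  by (auto simp: co_range_def v_finite_paths)

lemma co_range_projection:
  assumes "v_finite G" shows "T.eqv (padj (co_range G) * co_range G) (co_range G)"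
  unfolding co_range_def
proof (rule T.complement_projection)
  show "T.eqv (gadj \<kappa> * gen \<mu>) 0" if "\<kappa> \<in> G" "\<mu> \<in> G" "\<kappa> \<noteq> \<mu>" for \<kappa> \<mu>
    using that assms by (intro adj_orth_v) (auto simp: v_finite_def)
qed (use assms in \<open>auto simp: v_finite_def intro: T.padj_unit_sum T.unit_sum_mult\<close>)

lemma co_range_norm: "v_finite G \<Longrightarrow> tnorm \<Lambda> (co_range G) \<le> 1"
  by (rule T.projection_norm[OF co_range_projection])

lemma gadj_co_range:
  assumes G: "v_finite G" and k: "\<kappa> \<in> G" shows "T.eqv (gadj \<kappa> * co_range G) 0"
proof -
  have kp: "\<kappa> \<in> paths \<Lambda>" using assms by (auto simp: v_finite_def)
  have "T.eqv (T.range_sum G * gen \<kappa>) (gen \<kappa>)"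
    using G k by (intro T.range_sum_gen) (auto simp: v_finite_def intro: adj_orth_v)
  from T.eqv_padj[OF this] have "T.eqv (gadj \<kappa> * T.range_sum G) (gadj \<kappa>)" by (simp add: padj_mult)
  hence "T.eqv (gadj \<kappa> * T.unit_sum - gadj \<kappa> * T.range_sum G) (gadj \<kappa> - gadj \<kappa>)"
    using kp by (intro T.eqv_minus T.mult_unit_sum) auto
  thus ?thesis by (simp add: co_range_def right_diff_distrib)
qed

text \<open>The adjoints of the generators in G annihilate \<open>co_range H\<close>, so of
  \<open>co_range G\<close> only the unit acts on it.\<close>

lemma co_range_mult:
  assumes G: "v_finite G" and H: "v_finite H" and "G \<subseteq> H" shows "T.eqv (co_range G * co_range H) (co_range H)"
proof -
  have "T.eqv (T.range_sum G * co_range H) (\<Sum>\<kappa>\<in>G. gen \<kappa> * 0)"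
    unfolding T.range_sum_def sum_distrib_right mult.assoc
    using assms v_finite_paths[OF G] by (intro T.eqv_sum T.eqv_mult_left gadj_co_range) auto
  hence "T.eqv (T.unit_sum * co_range H - T.range_sum G * co_range H) (co_range H - 0)"
    using H by (intro T.eqv_minus T.unit_sum_mult) auto
  thus ?thesis by (simp add: co_range_def[of G] left_diff_distrib)
qed

text \<open>\<open>co_range H\<close> absorbs \<open>co_range G\<close> as a left factor, and its
  norm is at most 1.\<close>

lemma co_range_antimono:
  assumes "f \<in> fpoly \<Lambda>" "v_finite G" "v_finite H" "G \<subseteq> H"
  shows "tnorm \<Lambda> (f * co_range H) \<le> tnorm \<Lambda> (f * co_range G)"
proof -
  have "tnorm \<Lambda> (f * co_range H) = tnorm \<Lambda> (f * co_range G * co_range H)"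
    unfolding mult.assoc using assms by (intro T.eqv_norm T.eqv_mult_left T.eqv_sym[OF co_range_mult]) auto
  also have "\<dots> \<le> tnorm \<Lambda> (f * co_range G) * tnorm \<Lambda> (co_range H)" using assms by (intro T.P_mult) auto
  also have "\<dots> \<le> tnorm \<Lambda> (f * co_range G)" using co_range_norm[OF assms(3)] T.P_nonneg[of "f * co_range G"] assms
    by (simp add: mult_left_le)
  finally show ?thesis .
qed

text \<open>A path with source v has no proper extension, so (T5) for \<xi> and \<mu> has at most
  one term, with first member v. Unless the product vanishes, the adjoint of t_\<xi> absorbs the
  letter that follows and keeps its form.\<close>

lemma gadj_letter:
  assumes x: "\<xi> \<in> paths \<Lambda>" "src \<Lambda> \<xi> = v" and m: "\<mu> \<in> paths \<Lambda>"
  shows "T.eqv (gadj \<xi> * gen \<mu>) 0 \<or> (\<exists>\<nu>\<in>paths \<Lambda>. src \<Lambda> \<nu> = v \<and> T.eqv (gadj \<xi> * gen \<mu>) (gadj \<nu>))"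
    and "T.eqv (gadj \<xi> * gadj \<mu>) 0 \<or> (\<exists>\<nu>\<in>paths \<Lambda>. src \<Lambda> \<nu> = v \<and> T.eqv (gadj \<xi> * gadj \<mu>) (gadj \<nu>))"
proof -
  show "T.eqv (gadj \<xi> * gen \<mu>) 0 \<or> (\<exists>\<nu>\<in>paths \<Lambda>. src \<Lambda> \<nu> = v \<and> T.eqv (gadj \<xi> * gen \<mu>) (gadj \<nu>))"
  proof (cases "min_ext \<Lambda> \<xi> \<mu> = {}")
    case True
    thus ?thesis using T.t_min_ext[OF x(1) m] by simp
  next
    case False
    then obtain \<alpha> \<nu> where ab: "(\<alpha>, \<nu>) \<in> min_ext \<Lambda> \<xi> \<mu>" by auto
    note e = min_extD[OF x(1) m ab] and ev = min_ext_into_v[OF x(1) m x(2) ab]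
    \<comment> \<open>The second member is unique because \<xi> = \<mu>\<nu> and left cancellation
      holds.\<close>
    have "min_ext \<Lambda> \<xi> \<mu> = {(v, \<nu>)}"
    proof -
      have "\<alpha>' = v \<and> \<beta>' = \<nu>" if ab': "(\<alpha>', \<beta>') \<in> min_ext \<Lambda> \<xi> \<mu>" for \<alpha>' \<beta>'
      proof -
        note e' = min_extD[OF x(1) m ab'] and ev' = min_ext_into_v[OF x(1) m x(2) ab']
        have "cmp \<Lambda> \<mu> \<beta>' = cmp \<Lambda> \<mu> \<nu>" using ev(2) ev'(2) by metis
        hence "\<beta>' = \<nu>" by (rule cancel_left[OF m e'(2) e'(4) e(2) e(4)])
        thus ?thesis using ev' by simp
      qed
      moreover have "(v, \<nu>) \<in> min_ext \<Lambda> \<xi> \<mu>" using ab unfolding ev(1) .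
      ultimately show ?thesis by (intro equalityI) (clarify; simp)+
    qed
    hence "T.eqv (gadj \<xi> * gen \<mu>) (gen v * gadj \<nu>)" using T.t_min_ext[OF x(1) m] by simp
    also have "T.eqv (gen v * gadj \<nu>) (gadj \<nu>)" using T.eqv_sym[OF gadj_eqv[OF e(2)]] ev(3) by simp
    finally show ?thesis using e(2) ev(3) by blast
  qed
  show "T.eqv (gadj \<xi> * gadj \<mu>) 0 \<or> (\<exists>\<nu>\<in>paths \<Lambda>. src \<Lambda> \<nu> = v \<and> T.eqv (gadj \<xi> * gadj \<mu>) (gadj \<nu>))"
  proof (cases "src \<Lambda> \<mu> = rng \<Lambda> \<xi>")
    case True
    thus ?thesis using T.t_adj_mult[OF m x(1) True] cmp_closed[OF m x(1) True] src_cmp[OF m x(1) True] x(2) by auto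
  qed (use T.t_adj_mult_zero[OF m x(1)] in auto)
qed

lemma gadj_word:
  assumes "\<xi> \<in> paths \<Lambda>" "src \<Lambda> \<xi> = v" "w \<in> words \<Lambda>"
  shows "T.eqv (gadj \<xi> * monom_of w 1) 0 \<or> (\<exists>\<nu>\<in>paths \<Lambda>. src \<Lambda> \<nu> = v \<and> T.eqv (gadj \<xi> * monom_of w 1) (gadj \<nu>))"
  using assms
proof (induction w arbitrary: \<xi>)
  case (Cons l w)
  obtain \<mu> b where l: "l = (\<mu>, b)" by fastforce
  have m: "\<mu> \<in> paths \<Lambda>" using Cons.prems l by (auto simp: words_def)
  have first: "T.eqv (gadj \<xi> * monom_of [l] 1) 0 \<or> (\<exists>\<nu>\<in>paths \<Lambda>. src \<Lambda> \<nu> = v \<and> T.eqv (gadj \<xi> * monom_of [l] 1) (gadj \<nu>))"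
    using gadj_letter[OF Cons.prems(1,2) m] l by (cases b) (auto simp: gen_def gadj_def)
  show ?case
  proof (cases "w = []")
    case False
    hence w: "w \<in> words \<Lambda>" using Cons.prems by (auto simp: words_def)
    have wf: "monom_of w 1 \<in> fpoly \<Lambda>" by (rule fpoly_monom[OF w])
    have lw: "gadj \<xi> * monom_of (l # w) 1 = gadj \<xi> * monom_of [l] 1 * monom_of w 1" by (simp add: mult.assoc monom_mult)
    from first show ?thesis
    proof
      assume "T.eqv (gadj \<xi> * monom_of [l] 1) 0"
      from T.eqv_mult_right[OF this wf] show ?thesis unfolding lw by simp
    next
      assume "\<exists>\<nu>\<in>paths \<Lambda>. src \<Lambda> \<nu> = v \<and> T.eqv (gadj \<xi> * monom_of [l] 1) (gadj \<nu>)"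
      then obtain \<nu> where n: "\<nu> \<in> paths \<Lambda>" "src \<Lambda> \<nu> = v" "T.eqv (gadj \<xi> * monom_of [l] 1) (gadj \<nu>)" by blast
      have "T.eqv (gadj \<xi> * monom_of (l # w) 1) (gadj \<nu> * monom_of w 1)"
        unfolding lw by (rule T.eqv_mult_right[OF n(3) wf])
      thus ?thesis using Cons.IH[OF n(1,2) w] T.eqv_trans by blast
    qed
  qed (use first in simp)
qed (simp add: words_def)

text \<open>Annihilation is required for all larger H, so that the conditions of finitely many words
  are met simultaneously by a union.\<close>

definition "eventually_killed f \<longleftrightarrow> (\<exists>G. v_finite G \<and> (\<forall>H. v_finite H \<and> G \<subseteq> H \<longrightarrow> T.eqv (f * co_range H) 0))"

text \<open>The induction finds the last letter with source v. Read as the adjoint of a generator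
  with source v, it absorbs all later letters and leaves 0 or the adjoint of some t_\<nu> with
  s(\<nu>) = v, which \<open>co_range H\<close> annihilates once \<nu> lies in H.\<close>

lemma killed_word:
  "w \<in> words \<Lambda> \<Longrightarrow> \<not> fst ` set w \<subseteq> paths \<Lambda>u \<Longrightarrow> eventually_killed (monom_of w 1)"
proof (induction w)
  case (Cons l w)
  obtain \<kappa> b where l: "l = (\<kappa>, b)" by fastforce
  have k: "\<kappa> \<in> paths \<Lambda>" using Cons.prems l by (auto simp: words_def)
  have lf: "monom_of [l] 1 \<in> fpoly \<Lambda>" using k l by (intro fpoly_monom) (auto simp: words_def)
  show ?case
  proof (cases "fst ` set w \<subseteq> paths \<Lambda>u")
    case False
    hence w: "w \<in> words \<Lambda>" using Cons.prems by (auto simp: words_def)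
    then obtain G where G: "v_finite G" "\<And>H. v_finite H \<Longrightarrow> G \<subseteq> H \<Longrightarrow> T.eqv (monom_of w 1 * co_range H) 0"
      using Cons.IH[OF w False] unfolding eventually_killed_def by blast
    have "T.eqv (monom_of (l # w) 1 * co_range H) 0" if "v_finite H" "G \<subseteq> H" for H
    proof -
      have "monom_of (l # w) 1 * co_range H = monom_of [l] 1 * (monom_of w 1 * co_range H)" by (simp add: monom_mult flip: mult.assoc)
      thus ?thesis using T.eqv_mult_left[OF G(2)[OF that] lf] by simp
    qed
    thus ?thesis using G(1) unfolding eventually_killed_def by blast
  next
    case True
    hence "\<kappa> \<notin> paths \<Lambda>u" using Cons.prems(2) l by auto
    hence sv: "src \<Lambda> \<kappa> = v" using k src_cases by (auto simp: loop_paths)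
    \<comment> \<open>An adjoint letter is used as it stands; a letter t_\<kappa> equals t_\<kappa>
      times the adjoint of t_v, and that adjoint is used instead.\<close>
    define \<xi> where "\<xi> = (if b then \<kappa> else v)"
    have x: "\<xi> \<in> paths \<Lambda>" "src \<Lambda> \<xi> = v" using k sv vertex_closed[OF v_vertex] vertex_rng_src[OF v_vertex] by (auto simp: \<xi>_def)
    have tail: "\<exists>G. v_finite G \<and> (\<forall>H. v_finite H \<and> G \<subseteq> H \<longrightarrow> T.eqv (gadj \<xi> * monom_of w 1 * co_range H) 0)"
    proof (cases "w = []")
      case True
      have "T.eqv (gadj \<xi> * monom_of w 1 * co_range H) 0" if "v_finite H" "{\<xi>} \<subseteq> H" for H
        using gadj_co_range[OF that(1), of \<xi>] that(2) True by (simp add: gadj_def monom_mult)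
      moreover have "v_finite {\<xi>}" using x by (simp add: v_finite_def)
      ultimately show ?thesis by blast
    next
      case False
      hence w: "w \<in> words \<Lambda>" using Cons.prems by (auto simp: words_def)
      from gadj_word[OF x w] show ?thesis
      proof
        assume "T.eqv (gadj \<xi> * monom_of w 1) 0"
        hence "T.eqv (gadj \<xi> * monom_of w 1 * co_range H) 0" if "v_finite H" for H
          using T.eqv_mult_right[of "gadj \<xi> * monom_of w 1" 0 "co_range H"] that by simp
        thus ?thesis using v_finite_empty by blast
      next
        assume "\<exists>\<nu>\<in>paths \<Lambda>. src \<Lambda> \<nu> = v \<and> T.eqv (gadj \<xi> * monom_of w 1) (gadj \<nu>)"
        then obtain \<nu> where n: "\<nu> \<in> paths \<Lambda>" "src \<Lambda> \<nu> = v" "T.eqv (gadj \<xi> * monom_of w 1) (gadj \<nu>)" by blast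
        have "T.eqv (gadj \<xi> * monom_of w 1 * co_range H) 0" if "v_finite H" "{\<nu>} \<subseteq> H" for H
          using T.eqv_trans[OF T.eqv_mult_right[OF n(3) co_range_fpoly[OF that(1)]] gadj_co_range[OF that(1)]] that(2) by auto
        moreover have "v_finite {\<nu>}" using n by (simp add: v_finite_def)
        ultimately show ?thesis by blast
      qed
    qed
    then obtain G where G: "v_finite G" "\<And>H. v_finite H \<Longrightarrow> G \<subseteq> H \<Longrightarrow> T.eqv (gadj \<xi> * monom_of w 1 * co_range H) 0" by blast
    have "T.eqv (monom_of (l # w) 1 * co_range H) 0" if H: "v_finite H" "G \<subseteq> H" for H
    proof (cases b)
      case True
      thus ?thesis using G(2)[OF H] l by (simp add: \<xi>_def gadj_def monom_mult)
    next
      case False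
      have e: "T.eqv (gen \<kappa>) (gen \<kappa> * gadj v)" using gen_eqv[OF k] sv by simp
      have wH: "monom_of w 1 * co_range H \<in> fpoly \<Lambda>"
      proof (cases "w = []")
        case True thus ?thesis using H by (simp add: flip: zero_list_def)
      next
        case False
        hence "w \<in> words \<Lambda>" using Cons.prems by (auto simp: words_def)
        thus ?thesis using H by (intro fpoly_mult fpoly_monom co_range_fpoly)
      qed
      have "monom_of (l # w) 1 * co_range H = gen \<kappa> * (monom_of w 1 * co_range H)"
        using False l by (simp add: gen_def monom_mult flip: mult.assoc)
      also have "T.eqv \<dots> (gen \<kappa> * gadj v * (monom_of w 1 * co_range H))" by (rule T.eqv_mult_right[OF e wH])
      also have "gen \<kappa> * gadj v * (monom_of w 1 * co_range H) = gen \<kappa> * (gadj \<xi> * monom_of w 1 * co_range H)"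
        using False by (simp add: \<xi>_def mult.assoc)
      also have "T.eqv \<dots> (gen \<kappa> * 0)" using k by (intro T.eqv_mult_left G(2)[OF H]) auto
      finally show ?thesis by simp
    qed
    thus ?thesis using G(1) unfolding eventually_killed_def by blast
  qed
qed (simp add: words_def)

lemma killed:
  assumes "f \<in> fpoly \<Lambda>" "restr f = 0" shows "eventually_killed f"
proof -
  have supp: "support f \<subseteq> {w \<in> words \<Lambda>. \<not> fst ` set w \<subseteq> paths \<Lambda>u}"
  proof
    fix w assume w: "w \<in> support f"
    have "coeff_of (restr f) w = 0" using assms(2) by simp
    thus "w \<in> {w \<in> words \<Lambda>. \<not> fst ` set w \<subseteq> paths \<Lambda>u}"
      using w assms(1) by (auto simp: fpoly_def in_keys_iff split: if_splits)
  qed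
  show ?thesis using supp
  proof (induction rule: npoly_induct)
    case zero
    have "T.eqv (0 * co_range H) 0" for H by simp
    thus ?case using v_finite_empty unfolding eventually_killed_def by blast
  next
    case (monom w c)
    hence "eventually_killed (monom_of w 1)" using killed_word[of w] by simp
    then obtain G where G: "v_finite G" "\<And>H. v_finite H \<Longrightarrow> G \<subseteq> H \<Longrightarrow> T.eqv (monom_of w 1 * co_range H) 0"
      unfolding eventually_killed_def by blast
    have "T.eqv (monom_of w c * co_range H) 0" if H: "v_finite H" "G \<subseteq> H" for H
    proof -
      have "monom_of w c * co_range H = pscale c (monom_of w 1 * co_range H)" by (simp flip: pscale_mult)
      thus ?thesis using T.eqv_pscale[OF G(2)[OF H], of c] by simp
    qed
    thus ?case using G(1) unfolding eventually_killed_def by blast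
  next
    case (add f g)
    then obtain G G' where G: "v_finite G" "\<And>H. v_finite H \<Longrightarrow> G \<subseteq> H \<Longrightarrow> T.eqv (f * co_range H) 0"
      and G': "v_finite G'" "\<And>H. v_finite H \<Longrightarrow> G' \<subseteq> H \<Longrightarrow> T.eqv (g * co_range H) 0"
      unfolding eventually_killed_def by blast
    have "T.eqv ((f + g) * co_range H) 0" if "v_finite H" "G \<union> G' \<subseteq> H" for H
      using T.eqv_add[OF G(2) G'(2), of H H] that by (simp add: distrib_right)
    thus ?case using v_finite_Un[OF G(1) G'(1)] unfolding eventually_killed_def by blast
  qed
qed

text \<open>The norm of the quotient by the ideal generated by \<open>t\<^sub>v\<close>, for which the elements
  \<open>range_sum G\<close> are an approximate unit.\<close>

definition quotient_norm :: "'p npoly \<Rightarrow> real" where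
  "quotient_norm f = Inf {tnorm \<Lambda> (f * co_range G) |G. v_finite G}"

lemma quotient_norm_le:
  assumes "f \<in> fpoly \<Lambda>" "v_finite G" shows "quotient_norm f \<le> tnorm \<Lambda> (f * co_range G)"
proof -
  have "bdd_below {tnorm \<Lambda> (f * co_range G) |G. v_finite G}"
    using assms by (intro bdd_belowI[of _ 0]) (auto intro!: T.P_nonneg)
  thus ?thesis unfolding quotient_norm_def using assms(2) by (intro cInf_lower) auto
qed

lemma quotient_norm_nonneg: "f \<in> fpoly \<Lambda> \<Longrightarrow> 0 \<le> quotient_norm f"
  unfolding quotient_norm_def using v_finite_empty by (intro cInf_greatest) (auto intro!: T.P_nonneg)

text \<open>The norms decrease along the directed family of finite sets, so a bound reached at G
  persists for all larger H, and two approximations can be made with one set.\<close>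

lemma quotient_norm_approx:
  assumes "f \<in> fpoly \<Lambda>" "0 < \<epsilon>"
  obtains G where "v_finite G" "\<And>H. v_finite H \<Longrightarrow> G \<subseteq> H \<Longrightarrow> tnorm \<Lambda> (f * co_range H) < quotient_norm f + \<epsilon>"
proof -
  have "{tnorm \<Lambda> (f * co_range G) |G. v_finite G} \<noteq> {}" using v_finite_empty by auto
  hence "\<exists>x\<in>{tnorm \<Lambda> (f * co_range G) |G. v_finite G}. x < quotient_norm f + \<epsilon>"
    unfolding quotient_norm_def using assms(2) by (intro cInf_lessD) auto
  then obtain G where G: "v_finite G" "tnorm \<Lambda> (f * co_range G) < quotient_norm f + \<epsilon>" by auto
  show ?thesis using that[OF G(1)] co_range_antimono[OF assms(1) G(1)] G(2) by (meson order_le_less_trans)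
qed

lemma quotient_norm_zero:
  assumes "f \<in> fpoly \<Lambda>" "eventually_killed f" shows "quotient_norm f = 0"
proof -
  obtain G where "v_finite G" "T.eqv (f * co_range G) 0" using assms(2) unfolding eventually_killed_def by blast
  hence "quotient_norm f \<le> 0" using quotient_norm_le[OF assms(1)] by (metis T.eqv_zero_iff)
  thus ?thesis using quotient_norm_nonneg[OF assms(1)] by simp
qed

lemma quotient_norm_le_tnorm: assumes f: "f \<in> fpoly \<Lambda>" shows "quotient_norm f \<le> tnorm \<Lambda> f"
proof -
  have "quotient_norm f \<le> tnorm \<Lambda> (f * co_range {})" by (rule quotient_norm_le[OF f v_finite_empty])
  also have "\<dots> \<le> tnorm \<Lambda> f * tnorm \<Lambda> (co_range {})" using f v_finite_empty by (intro T.P_mult) auto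
  also have "\<dots> \<le> tnorm \<Lambda> f" using co_range_norm[OF v_finite_empty] T.P_nonneg[OF f] by (simp add: mult_left_le)
  finally show ?thesis .
qed

lemma quotient_norm_add:
  assumes f: "f \<in> fpoly \<Lambda>" and g: "g \<in> fpoly \<Lambda>" shows "quotient_norm (f + g) \<le> quotient_norm f + quotient_norm g"
proof (rule field_le_epsilon)
  fix \<epsilon> :: real assume e: "\<epsilon> > 0"
  obtain G where G: "v_finite G" "\<And>H. v_finite H \<Longrightarrow> G \<subseteq> H \<Longrightarrow> tnorm \<Lambda> (f * co_range H) < quotient_norm f + \<epsilon> / 2"
    using quotient_norm_approx[OF f half_gt_zero[OF e]] by blast
  obtain G' where G': "v_finite G'" "\<And>H. v_finite H \<Longrightarrow> G' \<subseteq> H \<Longrightarrow> tnorm \<Lambda> (g * co_range H) < quotient_norm g + \<epsilon> / 2"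
    using quotient_norm_approx[OF g half_gt_zero[OF e]] by blast
  let ?H = "G \<union> G'"
  have H: "v_finite ?H" by (rule v_finite_Un[OF G(1) G'(1)])
  have "quotient_norm (f + g) \<le> tnorm \<Lambda> ((f + g) * co_range ?H)" using f g H by (intro quotient_norm_le) auto
  also have "\<dots> \<le> tnorm \<Lambda> (f * co_range ?H) + tnorm \<Lambda> (g * co_range ?H)"
    unfolding distrib_right using f g H by (intro T.P_add) auto
  also have "\<dots> \<le> quotient_norm f + quotient_norm g + \<epsilon>" using G(2)[OF H] G'(2)[OF H] by simp
  finally show "quotient_norm (f + g) \<le> quotient_norm f + quotient_norm g + \<epsilon>" .
qed

lemma restr_range_sum: assumes "v_finite G" shows "restr (T.range_sum G) = 0"
proof -
  have "restr (gen \<kappa>) = 0" if "\<kappa> \<in> G" for \<kappa>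
    using that assms u_neq_v by (auto simp: restr_gen v_finite_def loop_paths)
  thus ?thesis by (simp add: T.range_sum_def restr_sum restr_mult)
qed

text \<open>With q for \<open>co_range\<close> and s for \<open>range_sum\<close>, inserting 1 = q_G
  + s_G between f and g gives f g q_H = f q_G g q_H + f s_G g q_H. The last term vanishes for large
  H because \<open>restr\<close> deletes s_G g.\<close>

lemma quotient_norm_mult:
  assumes f: "f \<in> fpoly \<Lambda>" and g: "g \<in> fpoly \<Lambda>" shows "quotient_norm (f * g) \<le> quotient_norm f * quotient_norm g"
proof -
  have "quotient_norm (f * g) \<le> (quotient_norm f + \<epsilon>) * (quotient_norm g + \<epsilon>)" if e: "\<epsilon> > 0" for \<epsilon>
  proof -
    obtain G where G: "v_finite G" "\<And>H. v_finite H \<Longrightarrow> G \<subseteq> H \<Longrightarrow> tnorm \<Lambda> (f * co_range H) < quotient_norm f + \<epsilon>"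
      using quotient_norm_approx[OF f e] by blast
    obtain G' where G': "v_finite G'" "\<And>H. v_finite H \<Longrightarrow> G' \<subseteq> H \<Longrightarrow> tnorm \<Lambda> (g * co_range H) < quotient_norm g + \<epsilon>"
      using quotient_norm_approx[OF g e] by blast
    have S: "T.range_sum G \<in> fpoly \<Lambda>" using v_finite_paths[OF G(1)] by simp
    have "eventually_killed (T.range_sum G * g)"
      using S g restr_range_sum[OF G(1)] by (intro killed) (auto simp: restr_mult)
    then obtain K where K: "v_finite K" "\<And>H. v_finite H \<Longrightarrow> K \<subseteq> H \<Longrightarrow> T.eqv (T.range_sum G * g * co_range H) 0"
      unfolding eventually_killed_def by blast
    let ?H = "G' \<union> K"
    have H: "v_finite ?H" by (rule v_finite_Un[OF G'(1) K(1)])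
    have gH: "g * co_range ?H \<in> fpoly \<Lambda>" using g H by simp
    have cG: "co_range G \<in> fpoly \<Lambda>" using G(1) by simp
    have "T.eqv (f * g * co_range ?H) (f * T.unit_sum * (g * co_range ?H))"
      unfolding mult.assoc[of f g] using f gH by (intro T.eqv_mult_right T.eqv_sym[OF T.mult_unit_sum])
    also have "f * T.unit_sum * (g * co_range ?H) = f * co_range G * (g * co_range ?H) + f * (T.range_sum G * g * co_range ?H)"
      by (simp add: co_range_def[of G] algebra_simps)
    also have "T.eqv \<dots> (f * co_range G * (g * co_range ?H) + f * 0)"
      using f gH cG H by (intro T.eqv_add T.eqv_refl T.eqv_mult_left K(2)) auto
    finally have "tnorm \<Lambda> (f * g * co_range ?H) = tnorm \<Lambda> (f * co_range G * (g * co_range ?H))" by (intro T.eqv_norm) simp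
    also have "\<dots> \<le> tnorm \<Lambda> (f * co_range G) * tnorm \<Lambda> (g * co_range ?H)" using f cG gH by (intro T.P_mult) auto
    also have "\<dots> \<le> (quotient_norm f + \<epsilon>) * (quotient_norm g + \<epsilon>)"
      using G(2)[OF G(1) order_refl] G'(2)[OF H] T.P_nonneg[OF gH] quotient_norm_nonneg[OF f] e
      by (intro mult_mono) auto
    finally show ?thesis using quotient_norm_le[OF fpoly_mult[OF f g] H] by simp
  qed
  hence "\<forall>\<^sub>F \<epsilon> in at_right 0. quotient_norm (f * g) \<le> (quotient_norm f + \<epsilon>) * (quotient_norm g + \<epsilon>)"
    by (intro eventually_at_right_less[THEN eventually_mono]) auto
  moreover have "((\<lambda>\<epsilon>. (quotient_norm f + \<epsilon>) * (quotient_norm g + \<epsilon>)) \<longlongrightarrow> (quotient_norm f + 0) * (quotient_norm g + 0)) (at_right 0)"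
    by (intro tendsto_intros)
  ultimately have "quotient_norm (f * g) \<le> (quotient_norm f + 0) * (quotient_norm g + 0)"
    by (intro tendsto_lowerbound) auto
  thus ?thesis by simp
qed

text \<open>By the C*-identity the squared norm of f q, with q = \<open>co_range H\<close>, is the
  norm of the adjoint of q times the adjoint of f times f q, and the adjoint of q has norm at most
  1.\<close>

lemma quotient_norm_square:
  assumes f: "f \<in> fpoly \<Lambda>" shows "(quotient_norm f)\<^sup>2 \<le> quotient_norm (padj f * f)"
proof (rule field_le_epsilon)
  fix \<epsilon> :: real assume e: "\<epsilon> > 0"
  obtain H where H: "v_finite H" "tnorm \<Lambda> (padj f * f * co_range H) < quotient_norm (padj f * f) + \<epsilon>"
    using quotient_norm_approx[OF _ e, of "padj f * f"] f by blast
  have fH: "f * co_range H \<in> fpoly \<Lambda>" "padj (co_range H) \<in> fpoly \<Lambda>" "padj f * f * co_range H \<in> fpoly \<Lambda>" using f H(1) by auto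
  have "(quotient_norm f)\<^sup>2 \<le> (tnorm \<Lambda> (f * co_range H))\<^sup>2"
    using quotient_norm_le[OF f H(1)] quotient_norm_nonneg[OF f] by (rule power_mono)
  also have "\<dots> = tnorm \<Lambda> (padj (co_range H) * (padj f * f * co_range H))"
    using T.P_cstar[OF fH(1)] by (simp add: padj_mult mult.assoc)
  also have "\<dots> \<le> tnorm \<Lambda> (padj (co_range H)) * tnorm \<Lambda> (padj f * f * co_range H)" by (rule T.P_mult[OF fH(2,3)])
  also have "\<dots> \<le> tnorm \<Lambda> (padj f * f * co_range H)"
    using co_range_norm[OF H(1)] T.P_nonneg[OF fH(3)] T.P_nonneg[of "co_range H"] H(1) by (simp add: T.P_padj mult_left_le_one_le)
  finally show "(quotient_norm f)\<^sup>2 \<le> quotient_norm (padj f * f) + \<epsilon>" using H(2) by simp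
qed

lemma quotient_norm_scale:
  assumes f: "f \<in> fpoly \<Lambda>" shows "quotient_norm (pscale c f) \<le> cmod c * quotient_norm f"
proof -
  have "quotient_norm (pscale c f) \<le> cmod c * (quotient_norm f + \<epsilon>)" if e: "\<epsilon> > 0" for \<epsilon>
  proof -
    obtain H where H: "v_finite H" "tnorm \<Lambda> (f * co_range H) < quotient_norm f + \<epsilon>" using quotient_norm_approx[OF f e] by blast
    have "quotient_norm (pscale c f) \<le> tnorm \<Lambda> (pscale c f * co_range H)" using f H(1) by (intro quotient_norm_le) auto
    also have "\<dots> = cmod c * tnorm \<Lambda> (f * co_range H)" using f H(1) by (simp add: pscale_mult T.P_pscale)
    also have "\<dots> \<le> cmod c * (quotient_norm f + \<epsilon>)" using H(2) by (intro mult_left_mono) auto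
    finally show ?thesis .
  qed
  hence "\<forall>\<^sub>F \<epsilon> in at_right 0. quotient_norm (pscale c f) \<le> cmod c * (quotient_norm f + \<epsilon>)"
    by (intro eventually_at_right_less[THEN eventually_mono]) auto
  moreover have "((\<lambda>\<epsilon>. cmod c * (quotient_norm f + \<epsilon>)) \<longlongrightarrow> cmod c * (quotient_norm f + 0)) (at_right 0)"
    by (intro tendsto_intros)
  ultimately have "quotient_norm (pscale c f) \<le> cmod c * (quotient_norm f + 0)" by (intro tendsto_lowerbound) auto
  thus ?thesis by simp
qed

text \<open>As an admissible seminorm of the loop graph, the quotient norm lies below the universal
  norm there. This is the bound that permits lifts of almost the same norm.\<close>

lemma quotient_seminorm: "toeplitz_seminorm \<Lambda>u quotient_norm"
proof -
  have c: "cstar_on \<Lambda>u quotient_norm"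
    by (rule cstar_onI) (auto intro: loop_fpoly quotient_norm_nonneg quotient_norm_add quotient_norm_scale
        quotient_norm_mult quotient_norm_square)
  have eq: "cstar_on.eqv \<Lambda>u quotient_norm f g \<longleftrightarrow> f \<in> fpoly \<Lambda>u \<and> g \<in> fpoly \<Lambda>u \<and> quotient_norm (f - g) = 0" for f g
    by (rule cstar_on.eqv_def[OF c])
  \<comment> \<open>A relation of \<open>\<Lambda>\<close> becomes one of the loop graph when words
    are deleted, because h - \<open>restr h\<close> is eventually killed.\<close>
  have E: "f \<in> fpoly \<Lambda>u \<and> g \<in> fpoly \<Lambda>u \<and> quotient_norm (f - g) = 0"
    if "T.eqv f h" "restr h = g" "f \<in> fpoly \<Lambda>u" for f g h
  proof -
    have fh: "f \<in> fpoly \<Lambda>" "h \<in> fpoly \<Lambda>" using T.eqv_fpoly[OF that(1)] by auto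
    have g: "g \<in> fpoly \<Lambda>u" using that(2) fh(2) by auto
    have "quotient_norm (f - h) \<le> 0" using quotient_norm_le_tnorm[of "f - h"] that(1) fh by (simp add: T.eqv_def)
    moreover have "quotient_norm (h - g) = 0"
      using fh(2) g restr_loop[OF g] that(2) loop_fpoly by (intro quotient_norm_zero killed) (auto simp: restr_minus)
    moreover have "quotient_norm (f - g) \<le> quotient_norm (f - h) + quotient_norm (h - g)"
      using quotient_norm_add[of "f - h" "h - g"] fh loop_fpoly[OF g] by simp
    ultimately have "quotient_norm (f - g) \<le> 0" by simp
    thus ?thesis using g that(3) quotient_norm_nonneg[of "f - g"] loop_fpoly by (auto intro: antisym)
  qed
  have lp: "\<kappa> \<in> paths \<Lambda>" if "\<kappa> \<in> paths \<Lambda>u" for \<kappa> using that by (simp add: loop_paths)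
  have up: "u \<in> paths \<Lambda>u" using u_vertex vertex_closed[OF u_vertex] vertex_rng_src[OF u_vertex] by (simp add: loop_paths)
  show ?thesis
  proof (rule L.toeplitz_seminormI[OF c eq])
    fix \<kappa> assume k: "\<kappa> \<in> paths \<Lambda>u"
    show "gen \<kappa> * gadj \<kappa> * gen \<kappa> \<in> fpoly \<Lambda>u \<and> gen \<kappa> \<in> fpoly \<Lambda>u \<and> quotient_norm (gen \<kappa> * gadj \<kappa> * gen \<kappa> - gen \<kappa>) = 0"
      using k by (intro E[OF T.t_isometry]) (auto simp: restr_gen lp)
    show "gadj \<kappa> * gen \<kappa> \<in> fpoly \<Lambda>u \<and> gen (src \<Lambda>u \<kappa>) \<in> fpoly \<Lambda>u \<and> quotient_norm (gadj \<kappa> * gen \<kappa> - gen (src \<Lambda>u \<kappa>)) = 0"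
      using k up by (intro E[OF T.t_source]) (auto simp: restr_gen lp loop_paths)
    fix \<mu> assume m: "\<mu> \<in> paths \<Lambda>u" "src \<Lambda>u \<kappa> = rng \<Lambda>u \<mu>"
    have "cmp \<Lambda> \<kappa> \<mu> \<in> paths \<Lambda>u" using L.cmp_closed[OF k m] by simp
    thus "gen \<kappa> * gen \<mu> \<in> fpoly \<Lambda>u \<and> gen (cmp \<Lambda>u \<kappa> \<mu>) \<in> fpoly \<Lambda>u \<and> quotient_norm (gen \<kappa> * gen \<mu> - gen (cmp \<Lambda>u \<kappa> \<mu>)) = 0"
      using k m by (intro E[OF T.t_mult]) (auto simp: restr_gen lp)
  next
    fix z assume "z \<in> vertices \<Lambda>u"
    hence z: "z = u" by (simp add: loop_vertices)
    show "gadj z \<in> fpoly \<Lambda>u \<and> gen z \<in> fpoly \<Lambda>u \<and> quotient_norm (gadj z - gen z) = 0"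
      using z up u_vertex by (intro E[OF T.t_vertex_adj]) (auto simp: restr_gen)
    show "gen z * gen z \<in> fpoly \<Lambda>u \<and> gen z \<in> fpoly \<Lambda>u \<and> quotient_norm (gen z * gen z - gen z) = 0"
      using z up u_vertex by (intro E[OF T.t_vertex_idem]) (auto simp: restr_gen)
    fix w assume "w \<in> vertices \<Lambda>u" "z \<noteq> w"
    thus "gen z * gen w \<in> fpoly \<Lambda>u \<and> 0 \<in> fpoly \<Lambda>u \<and> quotient_norm (gen z * gen w - 0) = 0"
      using z by (simp add: loop_vertices)
  next
    fix \<mu> \<nu> assume m: "\<mu> \<in> paths \<Lambda>u" "\<nu> \<in> paths \<Lambda>u"
    show "gadj \<mu> * gen \<nu> \<in> fpoly \<Lambda>u \<and> (\<Sum>(\<alpha>, \<beta>)\<in>min_ext \<Lambda>u \<mu> \<nu>. gen \<alpha> * gadj \<beta>) \<in> fpoly \<Lambda>u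
        \<and> quotient_norm (gadj \<mu> * gen \<nu> - (\<Sum>(\<alpha>, \<beta>)\<in>min_ext \<Lambda>u \<mu> \<nu>. gen \<alpha> * gadj \<beta>)) = 0"
      using m by (intro E[OF T.t_min_ext restr_min_ext_sum]) (auto simp: lp)
  qed
qed

text \<open>The lift is y times a suitable \<open>co_range G\<close>. Deletion sends it to y t_u
  rather than to y, since the unit of \<open>\<Lambda>\<close> restricts to t_u, which is a unit
  only modulo seminorm zero.\<close>

lemma lift_loop_poly:
  assumes y: "y \<in> fpoly \<Lambda>u" and "tnorm \<Lambda>u y < b"
  obtains x where "x \<in> fpoly \<Lambda>" "restr x = y * gen u" "tnorm \<Lambda> x < b"
proof -
  have "quotient_norm y < b" using L.seminorm_le_tnorm[OF quotient_seminorm y] assms(2) by simp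
  then obtain G where G: "v_finite G" "tnorm \<Lambda> (y * co_range G) < b"
    using quotient_norm_approx[OF loop_fpoly[OF y], of "b - quotient_norm y"] by auto
  have up: "u \<in> paths \<Lambda>u" "v \<notin> paths \<Lambda>u"
    using vertex_closed[OF u_vertex] vertex_rng_src[OF u_vertex] vertex_rng_src[OF v_vertex] u_neq_v by (auto simp: loop_paths)
  have "restr T.unit_sum = gen u" using up u_neq_v by (simp add: T.unit_sum_def vertices_eq restr_add restr_gen)
  hence "restr (y * co_range G) = y * gen u"
    using G(1) by (simp add: restr_mult restr_loop[OF y] co_range_def restr_minus restr_range_sum)
  thus ?thesis using that[of "y * co_range G"] G loop_fpoly[OF y] by simp
qed

end

section \<open>The quotient map on Cauchy sequences and its surjectivity\<close>

definition pcauchy :: "'p two_graph \<Rightarrow> (nat \<Rightarrow> 'p npoly) \<Rightarrow> bool" where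
  "pcauchy \<Lambda> X \<longleftrightarrow> (\<forall>n. X n \<in> fpoly \<Lambda>) \<and> (\<forall>\<epsilon>>0. \<exists>N. \<forall>m\<ge>N. \<forall>n\<ge>N. tnorm \<Lambda> (X m - X n) < \<epsilon>)"

definition pcls :: "'p two_graph \<Rightarrow> (nat \<Rightarrow> 'p npoly) \<Rightarrow> 'p toeplitz_element" where
  "pcls \<Lambda> X = coset (cauchy_algebra (free_algebra \<Lambda> (toeplitz_norm \<Lambda>)))
     (null_sequences (free_algebra \<Lambda> (toeplitz_norm \<Lambda>))) (\<lambda>n. coeff_of (X n))"

lemma temb_pcls: "temb \<Lambda> f = pcls \<Lambda> (\<lambda>n. f)"
  by (simp add: temb_def pcls_def completion_embed_def)

context row_finite
begin

lemma pcauchy_iff: "pcauchy \<Lambda> X \<longleftrightarrow> (\<lambda>n. coeff_of (X n)) \<in> carrier (cauchy_algebra (free_algebra \<Lambda> (toeplitz_norm \<Lambda>)))"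
proof -
  have "coeff_of f \<in> carrier (free_algebra \<Lambda> (toeplitz_norm \<Lambda>)) \<longleftrightarrow> f \<in> fpoly \<Lambda>" for f
    by (auto simp: carrier_free image_iff poly_mapping.lookup_inject)
  thus ?thesis unfolding pcauchy_def star_alg.in_cauchy_carrier[OF free_star_alg_tnorm] by (simp add: free_sel)
qed

lemma pcls_closed: "pcauchy \<Lambda> X \<Longrightarrow> pcls \<Lambda> X \<in> carrier TA"
  unfolding pcauchy_iff pcls_def toeplitz_algebra_def by (rule star_alg.cls_in_completion[OF free_star_alg_tnorm])

lemma carrier_TA_E:
  assumes "x \<in> carrier TA" obtains X where "pcauchy \<Lambda> X" "x = pcls \<Lambda> X"
proof -
  let ?F = "free_algebra \<Lambda> (toeplitz_norm \<Lambda>)"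
  obtain F where F: "F \<in> carrier (cauchy_algebra ?F)" "x = coset (cauchy_algebra ?F) (null_sequences ?F) F"
    using assms unfolding toeplitz_algebra_def by (rule star_alg.carrier_completionE[OF free_star_alg_tnorm])
  have "\<forall>n. \<exists>f. F n = coeff_of f"
    using F(1) unfolding star_alg.in_cauchy_carrier[OF free_star_alg_tnorm] carrier_free by blast
  then obtain X where X: "\<And>n. F n = coeff_of (X n)" by metis
  have "F = (\<lambda>n. coeff_of (X n))" using X by blast
  thus ?thesis using that[of X] F by (simp add: pcauchy_iff pcls_def)
qed

lemma pcls_eqI:
  assumes "pcauchy \<Lambda> X" "pcauchy \<Lambda> Y" "(\<lambda>n. tnorm \<Lambda> (X n - Y n)) \<longlonglongrightarrow> 0" shows "pcls \<Lambda> X = pcls \<Lambda> Y"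
  unfolding pcls_def
  using star_alg.cls_eq_iff[OF free_star_alg_tnorm assms(1,2)[unfolded pcauchy_iff]] assms(3) by (simp add: free_sel)

lemma norm_pcls: "pcauchy \<Lambda> X \<Longrightarrow> (\<lambda>n. tnorm \<Lambda> (X n)) \<longlonglongrightarrow> anorm TA (pcls \<Lambda> X)"
  using star_alg.norm_completion_tendsto[OF free_star_alg_tnorm, of "\<lambda>n. coeff_of (X n)"]
  by (simp add: pcauchy_iff pcls_def toeplitz_algebra_def free_sel)

end

context two_vertex_graph
begin

lemma restriction_hom:
  obtains q where "star_hom TA L.TA q" "\<And>X. pcauchy \<Lambda> X \<Longrightarrow> pcauchy \<Lambda>u (\<lambda>n. restr (X n)) \<and> q (pcls \<Lambda> X) = pcls \<Lambda>u (\<lambda>n. restr (X n))"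
proof -
  let ?A = "free_algebra \<Lambda> (toeplitz_norm \<Lambda>)" and ?B = "free_algebra \<Lambda>u (toeplitz_norm \<Lambda>u)"
  let ?h = "\<lambda>F. coeff_of (restr (Abs_poly_mapping F))"
  have h: "?h (coeff_of f) = coeff_of (restr f)" for f by (simp add: poly_mapping.lookup_inverse)
  have "star_hom ?A ?B ?h"
    unfolding star_hom_def carrier_free
    by (intro conjI ballI allI Pi_I; elim imageE; simp only: free_sel h restr_add restr_mult restr_pscale restr_padj; blast)
  moreover have "anorm ?B (?h x) \<le> anorm ?A x" if "x \<in> carrier ?A" for x
    using that restr_contractive unfolding carrier_free by (elim imageE) (simp only: free_sel h)
  ultimately obtain q where q: "star_hom TA L.TA q"
    and qX: "\<And>X. X \<in> carrier (cauchy_algebra ?A) \<Longrightarrow> (\<lambda>n. ?h (X n)) \<in> carrier (cauchy_algebra ?B)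
         \<and> q (coset (cauchy_algebra ?A) (null_sequences ?A) X) = coset (cauchy_algebra ?B) (null_sequences ?B) (\<lambda>n. ?h (X n))"
    using completion_hom_exists[OF free_star_alg_tnorm L.free_star_alg_tnorm] unfolding toeplitz_algebra_def by blast
  show ?thesis
  proof (rule that[OF q])
    fix X assume "pcauchy \<Lambda> X"
    from qX[OF this[unfolded pcauchy_iff]]
    show "pcauchy \<Lambda>u (\<lambda>n. restr (X n)) \<and> q (pcls \<Lambda> X) = pcls \<Lambda>u (\<lambda>n. restr (X n))"
      unfolding L.pcauchy_iff pcls_def h .
  qed
qed

text \<open>Indices are chosen along which the increments of Y have lifts of norm below 2^{-k}. The
  first term plus the partial sums of these lifts is then a Cauchy sequence lying over Y.\<close>

lemma telescoped_lift:
  assumes Y: "pcauchy \<Lambda>u Y"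
  obtains X s where "pcauchy \<Lambda> X" "\<And>n. restr (X n) = Y (s n) * gen u" "\<And>n. n \<le> (s n :: nat)"
proof -
  have Yf: "Y n \<in> fpoly \<Lambda>u" for n using Y by (simp add: pcauchy_def)
  have uf: "gen u \<in> fpoly \<Lambda>u" "gen u \<in> fpoly \<Lambda>"
    using vertex_closed[OF u_vertex] vertex_rng_src[OF u_vertex] by (auto simp: loop_paths)
  have "\<forall>k::nat. \<exists>N. \<forall>m\<ge>N. \<forall>n\<ge>N. tnorm \<Lambda>u (Y m - Y n) < (1/2) ^ k"
    using Y unfolding pcauchy_def by (metis half_gt_zero zero_less_power zero_less_one)
  then obtain N where N: "\<And>k m n. N k \<le> m \<Longrightarrow> N k \<le> n \<Longrightarrow> tnorm \<Lambda>u (Y m - Y n) < (1/2) ^ k" by metis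
  \<comment> \<open>The sum dominates N k and grows with k; the extra summand k makes s k at least
    k.\<close>
  define s where "s k = k + (\<Sum>j\<le>k. N j)" for k
  have s: "N k \<le> s k" "s k \<le> s (Suc k)" "k \<le> s k" for k
  proof -
    have "N k \<le> (\<Sum>j\<le>k. N j)" by (rule member_le_sum) auto
    thus "N k \<le> s k" "s k \<le> s (Suc k)" "k \<le> s k" by (auto simp: s_def)
  qed
  have "\<exists>D. D \<in> fpoly \<Lambda> \<and> restr D = (Y (s (Suc k)) - Y (s k)) * gen u \<and> tnorm \<Lambda> D < (1/2) ^ k" for k
  proof -
    have "tnorm \<Lambda>u (Y (s (Suc k)) - Y (s k)) < (1/2) ^ k" using s(1,2)[of k] by (intro N) auto
    thus ?thesis using lift_loop_poly[of "Y (s (Suc k)) - Y (s k)"] Yf by (metis fpoly_minus)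
  qed
  then obtain D where D: "\<And>k. D k \<in> fpoly \<Lambda>" "\<And>k. restr (D k) = (Y (s (Suc k)) - Y (s k)) * gen u"
    "\<And>k. tnorm \<Lambda> (D k) < (1/2) ^ k" by metis
  define X where "X n = Y (s 0) * gen u + (\<Sum>i<n. D i)" for n
  have Xf: "X n \<in> fpoly \<Lambda>" for n using D(1) loop_fpoly[OF Yf] uf by (auto simp: X_def intro!: fpoly_add fpoly_sum)
  have R: "restr (X n) = Y (s n) * gen u" for n
  proof (induction n)
    case 0
    show ?case using restr_loop[of "Y (s 0) * gen u"] Yf uf by (simp add: X_def)
  next
    case (Suc n)
    have "X (Suc n) = X n + D n" by (simp add: X_def add.assoc)
    thus ?case using Suc D(2) by (simp add: restr_add left_diff_distrib)
  qed
  \<comment> \<open>The right-hand side is 2^{-m} + ... + 2^{-(m+k-1)} in closed form.\<close>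
  have step: "tnorm \<Lambda> (X (m + k) - X m) \<le> 2 * (1/2) ^ m - 2 * (1/2) ^ (m + k)" for m k
  proof (induction k)
    case 0
    show ?case by (simp only: add_0_right diff_self T.P_zero order_refl)
  next
    case (Suc k)
    have "X (m + Suc k) - X m = (X (m + k) - X m) + D (m + k)" by (simp add: X_def)
    moreover have "tnorm \<Lambda> ((X (m + k) - X m) + D (m + k)) \<le> tnorm \<Lambda> (X (m + k) - X m) + tnorm \<Lambda> (D (m + k))"
      by (intro T.P_add fpoly_minus Xf D(1))
    ultimately have "tnorm \<Lambda> (X (m + Suc k) - X m) \<le> tnorm \<Lambda> (X (m + k) - X m) + tnorm \<Lambda> (D (m + k))" by (simp only:)
    thus ?case using Suc D(3)[of "m + k"] by simp
  qed
  have le: "tnorm \<Lambda> (X n - X m) \<le> 2 * (1/2) ^ m" if "m \<le> n" for m n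
  proof -
    have "0 \<le> 2 * (1/2 :: real) ^ n" by simp
    moreover have "tnorm \<Lambda> (X n - X m) \<le> 2 * (1/2) ^ m - 2 * (1/2) ^ n" using step[of m "n - m"] that by simp
    ultimately show ?thesis by linarith
  qed
  have "pcauchy \<Lambda> X"
    unfolding pcauchy_def
  proof (intro conjI allI impI)
    fix \<epsilon> :: real assume "\<epsilon> > 0"
    then obtain M where M: "(1/2 :: real) ^ M < \<epsilon> / 2" using real_arch_pow_inv[of "\<epsilon> / 2" "1/2"] by auto
    have "tnorm \<Lambda> (X m - X n) < \<epsilon>" if mn: "M \<le> m" "M \<le> n" for m n
    proof -
      have half: "2 * (1/2 :: real) ^ k < \<epsilon>" if "M \<le> k" for k
      proof -
        have "(1/2 :: real) ^ k \<le> (1/2) ^ M" by (rule power_decreasing[OF that]) auto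
        thus ?thesis using M by linarith
      qed
      show ?thesis
      proof (cases "m \<le> n")
        case True thus ?thesis using le[OF True] half[OF mn(1)] T.P_minus_commute[OF Xf Xf, of m n] by simp
      next
        case False thus ?thesis using le[of n m] half[OF mn(2)] by simp
      qed
    qed
    thus "\<exists>N. \<forall>m\<ge>N. \<forall>n\<ge>N. tnorm \<Lambda> (X m - X n) < \<epsilon>" by blast
  qed (rule Xf)
  thus ?thesis using that R s(3) by blast
qed

lemma gen_u_right: "f \<in> fpoly \<Lambda>u \<Longrightarrow> L.T.eqv (f * gen u) f"
  using L.T.mult_unit_sum[of f] by (simp add: L.T.unit_sum_def loop_vertices)

text \<open>The lifted sequence restricts to Y (s n) t_u, and neither the factor t_u nor the passage
  to the indices s n changes the class of Y.\<close>

lemma restriction_surj: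
  assumes q: "star_hom TA L.TA q"
    and qX: "\<And>X. pcauchy \<Lambda> X \<Longrightarrow> pcauchy \<Lambda>u (\<lambda>n. restr (X n)) \<and> q (pcls \<Lambda> X) = pcls \<Lambda>u (\<lambda>n. restr (X n))"
  shows "q ` carrier TA = carrier L.TA"
proof
  show "q ` carrier TA \<subseteq> carrier L.TA" using q unfolding star_hom_def by blast
  show "carrier L.TA \<subseteq> q ` carrier TA"
  proof
    fix y assume "y \<in> carrier L.TA"
    then obtain Y where Y: "pcauchy \<Lambda>u Y" "y = pcls \<Lambda>u Y" by (rule L.carrier_TA_E)
    obtain X s where X: "pcauchy \<Lambda> X" and R: "\<And>n. restr (X n) = Y (s n) * gen u" and s: "\<And>n. n \<le> s n"
      using telescoped_lift[OF Y(1)] by metis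
    have Yf: "Y n \<in> fpoly \<Lambda>u" for n using Y(1) by (simp add: pcauchy_def)
    have eq: "tnorm \<Lambda>u (restr (X n) - Y n) = tnorm \<Lambda>u (Y (s n) - Y n)" for n
      unfolding R using Yf by (intro L.T.eqv_norm L.T.eqv_minus gen_u_right L.T.eqv_refl)
    have "(\<lambda>n. tnorm \<Lambda>u (restr (X n) - Y n)) \<longlonglongrightarrow> 0"
    proof (rule LIMSEQ_I)
      fix \<epsilon> :: real assume "\<epsilon> > 0"
      then obtain N where N: "\<And>m n. N \<le> m \<Longrightarrow> N \<le> n \<Longrightarrow> tnorm \<Lambda>u (Y m - Y n) < \<epsilon>"
        using Y(1) unfolding pcauchy_def by blast
      have "norm (tnorm \<Lambda>u (restr (X n) - Y n) - 0) < \<epsilon>" if "N \<le> n" for n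
        unfolding eq using N[of "s n" n] that s[of n] L.T.P_nonneg[of "Y (s n) - Y n"] Yf by simp
      thus "\<exists>no. \<forall>n\<ge>no. norm (tnorm \<Lambda>u (restr (X n) - Y n) - 0) < \<epsilon>" by blast
    qed
    hence "pcls \<Lambda>u (\<lambda>n. restr (X n)) = y" unfolding Y(2) using qX[OF X] Y(1) by (intro L.pcls_eqI) auto
    hence "q (pcls \<Lambda> X) = y" using qX[OF X] by simp
    thus "y \<in> q ` carrier TA" using pcls_closed[OF X] by blast
  qed
qed

lemma pcauchy_const: "f \<in> fpoly \<Lambda> \<Longrightarrow> pcauchy \<Lambda> (\<lambda>n. f)"
  using T.P_zero by (simp add: pcauchy_def)

lemma removing_v:
  obtains q where "removes_vertex \<Lambda> u v q" "\<And>f. f \<in> fpoly \<Lambda> \<Longrightarrow> q (temb \<Lambda> f) = temb \<Lambda>u (restr f)"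
    "\<And>x. x \<in> carrier TA \<Longrightarrow> anorm L.TA (q x) \<le> anorm TA x"
proof -
  obtain q where q: "star_hom TA L.TA q"
    and qX: "\<And>X. pcauchy \<Lambda> X \<Longrightarrow> pcauchy \<Lambda>u (\<lambda>n. restr (X n)) \<and> q (pcls \<Lambda> X) = pcls \<Lambda>u (\<lambda>n. restr (X n))"
    using restriction_hom by blast
  have qt: "q (temb \<Lambda> f) = temb \<Lambda>u (restr f)" if "f \<in> fpoly \<Lambda>" for f
    using qX[OF pcauchy_const[OF that]] by (simp add: temb_pcls)
  have "q (tgen \<Lambda> \<mu>) = (if src \<Lambda> \<mu> = v then azero L.TA else tgen \<Lambda>u \<mu>)" if m: "\<mu> \<in> paths \<Lambda>" for \<mu>
    unfolding tgen_eq qt[OF fpoly_gen[OF m]]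
    using m src_cases[OF m] u_neq_v L.temb_zero by (auto simp: restr_gen loop_paths)
  hence "removes_vertex \<Lambda> u v q" unfolding removes_vertex_def using q restriction_surj[OF q qX] by blast
  moreover have "anorm L.TA (q x) \<le> anorm TA x" if x: "x \<in> carrier TA" for x
  proof -
    obtain X where X: "pcauchy \<Lambda> X" "x = pcls \<Lambda> X" using x by (rule carrier_TA_E)
    have "tnorm \<Lambda>u (restr (X n)) \<le> tnorm \<Lambda> (X n)" for n using X(1) by (intro restr_contractive) (simp add: pcauchy_def)
    thus ?thesis unfolding X(2) using LIMSEQ_le[OF L.norm_pcls norm_pcls] qX[OF X(1)] X(1) by auto
  qed
  ultimately show ?thesis using that qt by blast
qed

end

section \<open>Ideals and the Cuntz-Krieger quotient\<close>

lemma ideal_generated_least: "closed_ideal A J \<Longrightarrow> S \<subseteq> J \<Longrightarrow> ideal_generated A S \<subseteq> J"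
  unfolding ideal_generated_def by blast

lemma ideal_generated_superset: "S \<subseteq> ideal_generated A S"
  unfolding ideal_generated_def by blast

context star_alg
begin

lemma closed_ideal_carrier: "closed_ideal A (carrier A)"
  unfolding closed_ideal_def by auto

lemma closed_ideal_generated:
  assumes "S \<subseteq> carrier A" shows "closed_ideal A (ideal_generated A S)"
proof -
  let ?C = "{J. closed_ideal A J \<and> S \<subseteq> J}"
  have C: "carrier A \<in> ?C" using closed_ideal_carrier assms by simp
  have cl: "x \<in> J" if "J \<in> ?C" "x \<in> carrier A" "\<And>\<epsilon>. \<epsilon> > 0 \<Longrightarrow> \<exists>y\<in>J. anorm A (x \<boxminus> y) < \<epsilon>" for x J
    using that unfolding closed_ideal_def by blast
  show ?thesis
    unfolding ideal_generated_def closed_ideal_def[of A "\<Inter>?C"]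
  proof (intro conjI ballI allI impI)
    show "\<Inter>?C \<subseteq> carrier A" using C by blast
    show "azero A \<in> \<Inter>?C" unfolding closed_ideal_def by blast
    fix x assume x: "x \<in> \<Inter>?C"
    show "x \<boxplus> y \<in> \<Inter>?C" if "y \<in> \<Inter>?C" for y using x that unfolding closed_ideal_def by blast
    show "ascale A c x \<in> \<Inter>?C" for c using x unfolding closed_ideal_def by blast
    show "x \<boxtimes> y \<in> \<Inter>?C" "y \<boxtimes> x \<in> \<Inter>?C" if "y \<in> carrier A" for y
      using x that unfolding closed_ideal_def by blast+
  next
    fix x assume x: "x \<in> carrier A" "\<forall>\<epsilon>>0. \<exists>y\<in>\<Inter>?C. anorm A (x \<boxminus> y) < \<epsilon>"
    show "x \<in> \<Inter>?C"
    proof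
      fix J assume J: "J \<in> ?C"
      show "x \<in> J"
      proof (rule cl[OF J x(1)])
        fix \<epsilon> :: real assume "\<epsilon> > 0"
        then obtain y where "y \<in> \<Inter>?C" "anorm A (x \<boxminus> y) < \<epsilon>" using x(2) by blast
        thus "\<exists>y\<in>J. anorm A (x \<boxminus> y) < \<epsilon>" using J by blast
      qed
    qed
  qed
qed

text \<open>The elements of the generated ideal whose adjoints also belong to it form a closed ideal
  containing S.\<close>

lemma star_ideal_generated:
  assumes S: "S \<subseteq> carrier A" "\<And>s. s \<in> S \<Longrightarrow> astar A s \<in> S"
  shows "star_ideal A (ideal_generated A S)"
proof -
  let ?J = "ideal_generated A S"
  have J: "closed_ideal A ?J" by (rule closed_ideal_generated[OF S(1)])
  hence sub: "x \<in> ?J \<Longrightarrow> x \<in> carrier A" and zero: "azero A \<in> ?J"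
    and add: "x \<in> ?J \<Longrightarrow> y \<in> ?J \<Longrightarrow> x \<boxplus> y \<in> ?J"
    and scale: "x \<in> ?J \<Longrightarrow> ascale A c x \<in> ?J"
    and times: "x \<in> ?J \<Longrightarrow> y \<in> carrier A \<Longrightarrow> x \<boxtimes> y \<in> ?J" "x \<in> ?J \<Longrightarrow> y \<in> carrier A \<Longrightarrow> y \<boxtimes> x \<in> ?J"
    for x y c unfolding closed_ideal_def by blast+
  have cl: "x \<in> ?J" if "x \<in> carrier A" "\<And>\<epsilon>. \<epsilon> > 0 \<Longrightarrow> \<exists>y\<in>?J. anorm A (x \<boxminus> y) < \<epsilon>" for x
    using J that unfolding closed_ideal_def by blast
  let ?K = "{x \<in> ?J. astar A x \<in> ?J}"
  have "closed_ideal A ?K"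
    unfolding closed_ideal_def
  proof (intro conjI ballI allI impI)
    show "?K \<subseteq> carrier A" using sub by auto
    have "astar A (azero A) = azero A" using star_scale[of "azero A" 0] by simp
    thus "azero A \<in> ?K" using zero by simp
    fix x assume x: "x \<in> ?K"
    show "x \<boxplus> y \<in> ?K" if "y \<in> ?K" for y using x that sub add by (simp add: star_add)
    show "ascale A c x \<in> ?K" for c using x sub scale by (simp add: star_scale)
    show "x \<boxtimes> y \<in> ?K" "y \<boxtimes> x \<in> ?K" if "y \<in> carrier A" for y
      using x that sub times by (simp_all add: star_times)
  next
    fix x assume x: "x \<in> carrier A" "\<forall>\<epsilon>>0. \<exists>y\<in>?K. anorm A (x \<boxminus> y) < \<epsilon>"
    have "x \<in> ?J" using x by (intro cl) blast+
    moreover have "astar A x \<in> ?J"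
    proof (rule cl)
      fix \<epsilon> :: real assume "\<epsilon> > 0"
      then obtain y where y: "y \<in> ?K" "anorm A (x \<boxminus> y) < \<epsilon>" using x(2) by blast
      have yc: "y \<in> carrier A" using y sub by blast
      have "anorm A (astar A x \<boxminus> astar A y) = anorm A (x \<boxminus> y)"
        using x(1) yc by (simp flip: star_minus)
      thus "\<exists>y\<in>?J. anorm A (astar A x \<boxminus> y) < \<epsilon>" using y by (intro bexI[of _ "astar A y"]) auto
    qed (use x in simp)
    ultimately show "x \<in> ?K" by simp
  qed
  moreover have "S \<subseteq> ?K" using S(2) ideal_generated_superset[of S A] by auto
  ultimately have "?J \<subseteq> ?K" by (rule ideal_generated_least)
  hence star: "x \<in> ?J \<Longrightarrow> astar A x \<in> ?J" for x by blast
  show ?thesis by unfold_locales (use sub zero add scale times star in auto)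
qed

text \<open>Contractivity makes the two-sided annihilator closed. With a unit it is contained in the
  kernel of \<phi>, so \<phi> descends to the quotient by an ideal as soon as the generators of the
  ideal are annihilated.\<close>

lemma annihilator_closed_ideal:
  assumes "contractive_functional A \<phi>"
  shows "closed_ideal A {x \<in> carrier A. \<forall>a\<in>carrier A. \<forall>b\<in>carrier A. \<phi> (a \<boxtimes> (x \<boxtimes> b)) = 0}" (is "closed_ideal A ?N")
proof -
  have lin: "linear_functional A \<phi>" and con: "\<And>x. x \<in> carrier A \<Longrightarrow> cmod (\<phi> x) \<le> anorm A x"
    using assms by (auto simp: contractive_functional_def)
  have add: "\<phi> (x \<boxplus> y) = \<phi> x + \<phi> y" and scale: "\<phi> (ascale A c x) = c * \<phi> x"
    if "x \<in> carrier A" "y \<in> carrier A" for x y c using lin that by (auto simp: linear_functional_def)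
  have z: "azero A \<boxtimes> b = azero A" "b \<boxtimes> azero A = azero A" if "b \<in> carrier A" for b
    using scale_times[of b b 0] times_scale[of b b 0] that by auto
  show ?thesis
    unfolding closed_ideal_def
  proof (intro conjI ballI allI impI)
    show "azero A \<in> ?N" using linear_functional_zero[OF lin] by (simp add: z)
    fix x assume x: "x \<in> ?N"
    show "x \<boxplus> y \<in> ?N" if "y \<in> ?N" for y using x that by (simp add: add_times times_add add)
    show "ascale A c x \<in> ?N" for c using x by (simp add: scale_times times_scale scale)
    fix y assume y: "y \<in> carrier A"
    show "x \<boxtimes> y \<in> ?N" using x y by (simp add: times_assoc)
    have "\<phi> (a \<boxtimes> ((y \<boxtimes> x) \<boxtimes> b)) = 0" if "a \<in> carrier A" "b \<in> carrier A" for a b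
    proof -
      have "a \<boxtimes> ((y \<boxtimes> x) \<boxtimes> b) = (a \<boxtimes> y) \<boxtimes> (x \<boxtimes> b)" using x y that by (simp add: times_assoc)
      thus ?thesis using x y that by simp
    qed
    thus "y \<boxtimes> x \<in> ?N" using x y by simp
  next
    fix x assume x: "x \<in> carrier A" "\<forall>\<epsilon>>0. \<exists>y\<in>?N. anorm A (x \<boxminus> y) < \<epsilon>"
    have "\<phi> (a \<boxtimes> (x \<boxtimes> b)) = 0" if ab: "a \<in> carrier A" "b \<in> carrier A" for a b
    proof -
      \<comment> \<open>The summand 1 keeps the divisor positive when a or b has norm 0.\<close>
      let ?C = "anorm A a * anorm A b + 1"
      have C: "0 < ?C" using ab by (simp add: add_nonneg_pos)
      have "cmod (\<phi> (a \<boxtimes> (x \<boxtimes> b))) \<le> 0 + \<epsilon>" if e: "\<epsilon> > 0" for \<epsilon>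
      proof -
        obtain y where y: "y \<in> ?N" "anorm A (x \<boxminus> y) < \<epsilon> / ?C" using x(2) divide_pos_pos[OF e C] by blast
        have yc: "y \<in> carrier A" using y by simp
        have "x \<boxminus> y \<boxplus> y = x"
          using x(1) yc by (simp add: aminus_def add_assoc add_commute[of "ascale A (-1) y" y] scale_minus_one_cancel)
        hence "a \<boxtimes> (x \<boxtimes> b) = a \<boxtimes> ((x \<boxminus> y) \<boxtimes> b) \<boxplus> a \<boxtimes> (y \<boxtimes> b)"
          using x(1) yc ab by (metis add_times times_add minus_closed times_closed)
        hence "\<phi> (a \<boxtimes> (x \<boxtimes> b)) = \<phi> (a \<boxtimes> ((x \<boxminus> y) \<boxtimes> b))"
          using y(1) x(1) yc ab by (simp add: add)
        also have "cmod \<dots> \<le> anorm A (a \<boxtimes> ((x \<boxminus> y) \<boxtimes> b))" using x(1) yc ab by (intro con) simp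
        also have "\<dots> \<le> anorm A a * anorm A ((x \<boxminus> y) \<boxtimes> b)" using x(1) yc ab by (intro norm_times) auto
        also have "\<dots> \<le> anorm A a * (anorm A (x \<boxminus> y) * anorm A b)"
          using x(1) yc ab by (intro mult_left_mono norm_times) auto
        also have "\<dots> = anorm A (x \<boxminus> y) * (anorm A a * anorm A b)" by simp
        also have "\<dots> \<le> anorm A (x \<boxminus> y) * ?C" using x(1) yc by (intro mult_left_mono) auto
        also have "\<dots> \<le> \<epsilon>" using y(2) C by (simp add: pos_less_divide_eq)
        finally show ?thesis by simp
      qed
      hence "cmod (\<phi> (a \<boxtimes> (x \<boxtimes> b))) \<le> 0" by (rule field_le_epsilon)
      thus ?thesis by simp
    qed
    thus "x \<in> ?N" using x by simp
  qed auto
qed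

end

text \<open>\<phi> is constant on cosets and the quotient norm is the infimum over a coset, so
  contractivity passes to the quotient; the coset of e shows that the norm is still 1.\<close>

lemma (in star_ideal) quotient_state:
  assumes st: "is_state A \<phi>" and e: "unit_of A e" and J: "\<And>x. x \<in> J \<Longrightarrow> \<phi> x = 0"
  obtains \<psi> where "is_state (quotient_algebra A J) \<psi>" "\<And>x. x \<in> carrier A \<Longrightarrow> \<phi> x = \<psi> (coset A J x)"
proof -
  have pos: "positive_functional A \<phi>" and con: "contractive_functional A \<phi>" and one: "\<phi> e = 1"
    using st is_state_iff[OF e] by auto
  have lin: "linear_functional A \<phi>" using pos by (simp add: positive_functional_def)
  have ec: "e \<in> carrier A" "anorm A e \<le> 1" using e by (auto simp: unit_of_def)
  have same: "\<phi> x = \<phi> y" if "x \<in> carrier A" "y \<in> carrier A" "coset A J x = coset A J y" for x y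
    using linear_functional_minus[OF lin that(1,2)] J that coset_eq_iff[of x y] by simp
  define \<psi> where "\<psi> X = (if X \<in> carrier (quotient_algebra A J) then \<phi> (SOME x. x \<in> carrier A \<and> X = coset A J x) else 0)" for X
  have \<psi>: "\<psi> (coset A J x) = \<phi> x" if x: "x \<in> carrier A" for x
  proof -
    let ?y = "SOME y. y \<in> carrier A \<and> coset A J x = coset A J y"
    have "?y \<in> carrier A \<and> coset A J x = coset A J ?y" by (rule someI[of _ x]) (simp add: x)
    hence "\<phi> ?y = \<phi> x" using same x by metis
    thus ?thesis using x by (simp add: \<psi>_def carrier_quotient)
  qed
  have bound: "cmod (\<phi> x) \<le> anorm (quotient_algebra A J) (coset A J x)" if x: "x \<in> carrier A" for x
    unfolding norm_quotient
  proof (rule cInf_greatest)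
    show "anorm A ` coset A J x \<noteq> {}" using in_own_coset[OF x] by blast
    fix n assume "n \<in> anorm A ` coset A J x"
    then obtain y where y: "y \<in> coset A J x" "n = anorm A y" by blast
    have yc: "y \<in> carrier A" "y \<boxminus> x \<in> J" using y(1) in_coset_iff[OF x] by auto
    have "\<phi> y = \<phi> x" using same[OF yc(1) x] yc coset_eq_iff[OF yc(1) x] by simp
    thus "cmod (\<phi> x) \<le> n" using con yc(1) y(2) unfolding contractive_functional_def by metis
  qed
  let ?B = "{cmod (\<psi> x) |x. x \<in> carrier (quotient_algebra A J) \<and> anorm (quotient_algebra A J) x \<le> 1}"
  have le: "r \<le> 1" if r: "r \<in> ?B" for r
  proof -
    obtain x where x: "x \<in> carrier A" "r = cmod (\<psi> (coset A J x))" "anorm (quotient_algebra A J) (coset A J x) \<le> 1"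
      using r by (auto simp: carrier_quotient)
    thus ?thesis using bound[OF x(1)] \<psi>[OF x(1)] by simp
  qed
  have "anorm (quotient_algebra A J) (coset A J e) \<le> anorm A e"
    unfolding norm_quotient
  proof (rule cInf_lower)
    show "bdd_below (anorm A ` coset A J e)" using coset_carrier[OF ec(1)] by (intro bdd_belowI[of _ 0]) auto
  qed (use in_own_coset[OF ec(1)] in blast)
  hence mem: "1 \<in> ?B" using ec \<psi>[OF ec(1)] one by (auto simp: carrier_quotient intro!: exI[of _ "coset A J e"])
  have "is_state (quotient_algebra A J) \<psi>"
    unfolding is_state_def
  proof (intro conjI allI ballI impI)
    show "\<psi> X = 0" if "X \<notin> carrier (quotient_algebra A J)" for X using that by (simp add: \<psi>_def)
    show "bdd_above ?B" using le by (rule bdd_aboveI)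
    show "Sup ?B = 1" using mem le by (rule cSup_eq_maximum)
    fix X assume "X \<in> carrier (quotient_algebra A J)"
    then obtain x where x: "x \<in> carrier A" "X = coset A J x" by (auto simp: carrier_quotient)
    show "\<psi> (ascale (quotient_algebra A J) c X) = c * \<psi> X" for c
      using x lin by (simp add: scale_quotient \<psi> linear_functional_def)
    show "\<psi> (astar (quotient_algebra A J) X \<boxtimes>\<^bsub>quotient_algebra A J\<^esub> X) \<in> \<real>\<^sub>\<ge>\<^sub>0"
      using x pos by (simp add: star_quotient times_quotient \<psi> positive_functional_def)
    fix Y assume "Y \<in> carrier (quotient_algebra A J)"
    then obtain y where y: "y \<in> carrier A" "Y = coset A J y" by (auto simp: carrier_quotient)
    show "\<psi> (X \<boxplus>\<^bsub>quotient_algebra A J\<^esub> Y) = \<psi> X + \<psi> Y"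
      using x y lin by (simp add: add_quotient \<psi> linear_functional_def)
  qed
  thus ?thesis using that \<psi> by simp
qed

section \<open>Gap products and the Cuntz-Krieger ideal\<close>

context row_finite
begin

definition gap_factor :: "'p \<Rightarrow> 'p \<Rightarrow> 'p npoly" where "gap_factor z e = gen z - gen e * gadj e"

definition gap :: "'p \<Rightarrow> 'p list \<Rightarrow> 'p npoly" where "gap z es = foldr (\<lambda>e f. gap_factor z e * f) es (gen z)"

lemma gap_Nil: "gap z [] = gen z" and gap_Cons: "gap z (e # es) = gap_factor z e * gap z es"
  by (simp_all add: gap_def)

lemma gap_factor_fpoly [simp, intro]: "z \<in> paths \<Lambda> \<Longrightarrow> e \<in> paths \<Lambda> \<Longrightarrow> gap_factor z e \<in> fpoly \<Lambda>"
  by (auto simp: gap_factor_def)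

lemma gap_fpoly [simp, intro]: "z \<in> paths \<Lambda> \<Longrightarrow> set es \<subseteq> paths \<Lambda> \<Longrightarrow> gap z es \<in> fpoly \<Lambda>"
  unfolding gap_def by (induction es) auto

lemma gap_product_eq:
  assumes "z \<in> paths \<Lambda>" "set es \<subseteq> paths \<Lambda>" shows "gap_product \<Lambda> z es = temb \<Lambda> (gap z es)"
  using assms(2)
proof (induction es)
  case Nil
  show ?case by (simp add: gap_product_def gap_Nil tgen_eq)
next
  case (Cons e es)
  have "gap_product \<Lambda> z (e # es) = (tgen \<Lambda> z \<boxminus>\<^bsub>TA\<^esub> (tgen \<Lambda> e \<boxtimes>\<^bsub>TA\<^esub> astar TA (tgen \<Lambda> e))) \<boxtimes>\<^bsub>TA\<^esub> gap_product \<Lambda> z es"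
    by (simp add: gap_product_def Let_def)
  also have "\<dots> = temb \<Lambda> (gap_factor z e) \<boxtimes>\<^bsub>TA\<^esub> temb \<Lambda> (gap z es)"
    using Cons assms(1) by (simp add: tgen_eq gap_factor_def temb_minus temb_mult flip: temb_padj)
  also have "\<dots> = temb \<Lambda> (gap z (e # es))"
    using Cons.prems assms(1) by (simp add: gap_Cons temb_mult)
  finally show ?case .
qed

lemma gap_factor_commutes:
  assumes z: "z \<in> vertices \<Lambda>" and e: "e \<in> paths \<Lambda>" "rng \<Lambda> e = z"
  shows "T.eqv (gap_factor z e * gen z) (gen z * gap_factor z e)"
proof -
  have zp: "z \<in> paths \<Lambda>" by (rule vertex_closed[OF z])
  have ze: "T.eqv (gen z * gen e) (gen e)" using T.t_rng[OF e(1)] e(2) by simp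
  have "T.eqv (gadj e * gen z) (gadj e * gadj z)" using e zp z by (intro T.eqv_mult_left T.eqv_sym[OF T.t_vertex_adj]) auto
  also have "T.eqv (gadj e * gadj z) (gadj e)" using T.eqv_padj[OF ze] by (simp add: padj_mult)
  finally have ez: "T.eqv (gadj e * gen z) (gadj e)" .
  have "T.eqv (gap_factor z e * gen z) (gen z - gen e * gadj e)"
    unfolding gap_factor_def left_diff_distrib mult.assoc
    using e z by (intro T.eqv_minus T.t_vertex_idem T.eqv_mult_left[OF ez]) auto
  also have "T.eqv (gen z - gen e * gadj e) (gen z * gen z - gen z * gen e * gadj e)"
    using e z by (intro T.eqv_minus T.eqv_sym[OF T.t_vertex_idem] T.eqv_mult_right[OF T.eqv_sym[OF ze]]) auto
  finally show ?thesis by (simp add: gap_factor_def right_diff_distrib mult.assoc)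
qed

text \<open>The trailing t_z can be moved in front of the last factor.\<close>

lemma gap_snoc:
  assumes z: "z \<in> vertices \<Lambda>" and es: "set es \<subseteq> paths \<Lambda>" and e: "e \<in> paths \<Lambda>" "rng \<Lambda> e = z"
  shows "T.eqv (gap z (es @ [e])) (gap z es * gap_factor z e)"
  using es
proof (induction es)
  case Nil
  show ?case using gap_factor_commutes[OF z e] by (simp add: gap_def)
next
  case (Cons e' es)
  have "T.eqv (gap_factor z e' * gap z (es @ [e])) (gap_factor z e' * (gap z es * gap_factor z e))"
    using Cons vertex_closed[OF z] by (intro T.eqv_mult_left) auto
  thus ?case by (simp add: gap_def mult.assoc)
qed

lemma padj_gap:
  assumes z: "z \<in> vertices \<Lambda>" and "set es \<subseteq> {e \<in> paths \<Lambda>. rng \<Lambda> e = z}"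
  shows "T.eqv (padj (gap z es)) (gap z (rev es))"
  using assms(2)
proof (induction es)
  case Nil
  show ?case using T.t_vertex_adj[OF z] by (simp add: gap_def)
next
  case (Cons e es)
  have zp: "z \<in> paths \<Lambda>" by (rule vertex_closed[OF z])
  have e: "e \<in> paths \<Lambda>" "rng \<Lambda> e = z" "set es \<subseteq> paths \<Lambda>" using Cons.prems by auto
  have "T.eqv (padj (gap_factor z e)) (gap_factor z e)"
    unfolding gap_factor_def padj_minus using e z by (intro T.eqv_minus) (auto simp: padj_mult intro: T.t_vertex_adj)
  hence "T.eqv (padj (gap z es) * padj (gap_factor z e)) (gap z (rev es) * gap_factor z e)"
    using Cons by (intro T.eqv_mult) auto
  also have "T.eqv (gap z (rev es) * gap_factor z e) (gap z (rev es @ [e]))"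
    using e by (intro T.eqv_sym[OF gap_snoc[OF z]]) auto
  finally show ?case by (simp add: gap_def padj_mult)
qed

lemma edges_into_paths: "edges_into \<Lambda> z \<subseteq> {e \<in> paths \<Lambda>. rng \<Lambda> e = z}"
  by (auto simp: edges_into_def paths_into_def)

text \<open>Taking the adjoint of a gap product reverses the enumeration of the exhaustive set, and
  the reversed list enumerates the same set. The generators are thus permuted by the
  adjoint.\<close>

lemma cuntz_krieger_star_ideal: "star_ideal TA (cuntz_krieger_ideal \<Lambda>)"
  unfolding cuntz_krieger_ideal_def
proof (rule star_alg.star_ideal_generated[OF TA_star_alg])
  let ?S = "{gap_product \<Lambda> z es |z es. z \<in> vertices \<Lambda> \<and> distinct es \<and> exhaustive \<Lambda> z (set es)}"
  have ex: "set es \<subseteq> {e \<in> paths \<Lambda>. rng \<Lambda> e = z}" if "exhaustive \<Lambda> z (set es)" for z es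
    using that edges_into_paths unfolding exhaustive_def by blast
  show "?S \<subseteq> carrier TA"
  proof clarify
    fix z es assume z: "z \<in> vertices \<Lambda>" and "distinct es" "exhaustive \<Lambda> z (set es)"
    hence "set es \<subseteq> paths \<Lambda>" using ex by blast
    thus "gap_product \<Lambda> z es \<in> carrier TA" using vertex_closed[OF z] by (simp add: gap_product_eq)
  qed
  fix s assume "s \<in> ?S"
  then obtain z es where s: "s = gap_product \<Lambda> z es" "z \<in> vertices \<Lambda>" "distinct es" "exhaustive \<Lambda> z (set es)" by blast
  have es: "set es \<subseteq> paths \<Lambda>" using ex[OF s(4)] by blast
  have zp: "z \<in> paths \<Lambda>" by (rule vertex_closed[OF s(2)])
  have "astar TA s = temb \<Lambda> (padj (gap z es))" using es zp by (simp add: s(1) gap_product_eq temb_padj)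
  also have "\<dots> = gap_product \<Lambda> z (rev es)" using temb_eqI[OF padj_gap[OF s(2) ex[OF s(4)]]] es zp by (simp add: gap_product_eq)
  finally show "astar TA s \<in> ?S" using s by (auto intro!: exI[of _ z] exI[of _ "rev es"])
qed

text \<open>Density is used twice: first for b with a fixed word on the left, then for a with b
  arbitrary.\<close>

lemma annihilated_by_words:
  assumes \<phi>: "bounded_functional TA \<phi>" and g: "g \<in> fpoly \<Lambda>"
    and words: "\<And>w w'. w \<in> words \<Lambda> \<Longrightarrow> w' \<in> words \<Lambda> \<Longrightarrow> \<phi> (temb \<Lambda> (monom_of w 1 * (g * monom_of w' 1))) = 0"
    and a: "a \<in> carrier TA" and b: "b \<in> carrier TA"
  shows "\<phi> (a \<boxtimes>\<^bsub>TA\<^esub> (temb \<Lambda> g \<boxtimes>\<^bsub>TA\<^esub> b)) = 0"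
proof -
  have zero: "bounded_functional TA (\<lambda>x. 0 * \<phi> x)" by (rule bounded_functional_scale[OF \<phi>])
  have "\<phi> (temb \<Lambda> (monom_of w 1) \<boxtimes>\<^bsub>TA\<^esub> (temb \<Lambda> g \<boxtimes>\<^bsub>TA\<^esub> b)) = 0 * \<phi> b" if w: "w \<in> words \<Lambda>" for w
  proof (rule bounded_functional_eq[OF _ zero _ b])
    show "bounded_functional TA (\<lambda>x. \<phi> (temb \<Lambda> (monom_of w 1) \<boxtimes>\<^bsub>TA\<^esub> (temb \<Lambda> g \<boxtimes>\<^bsub>TA\<^esub> x)))"
      using bounded_functional_left[OF bounded_functional_left[OF \<phi>, of "temb \<Lambda> (monom_of w 1)"], of "temb \<Lambda> g"] w g
      by (auto intro: fpoly_monom)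
    fix w' assume "w' \<in> words \<Lambda>"
    thus "\<phi> (temb \<Lambda> (monom_of w 1) \<boxtimes>\<^bsub>TA\<^esub> (temb \<Lambda> g \<boxtimes>\<^bsub>TA\<^esub> temb \<Lambda> (monom_of w' 1))) = 0 * \<phi> (temb \<Lambda> (monom_of w' 1))"
      using words[OF w] w g by (simp add: temb_mult fpoly_monom)
  qed
  moreover have c: "temb \<Lambda> g \<boxtimes>\<^bsub>TA\<^esub> b \<in> carrier TA" using g b by (intro star_alg.times_closed[OF TA_star_alg]) auto
  ultimately have "\<phi> (a \<boxtimes>\<^bsub>TA\<^esub> (temb \<Lambda> g \<boxtimes>\<^bsub>TA\<^esub> b)) = 0 * \<phi> a"
    by (intro bounded_functional_eq[OF bounded_functional_right[OF \<phi> c] zero _ a]) simp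
  thus ?thesis by simp
qed

lemma rep_vertex_delta:
  assumes "z \<in> vertices \<Lambda>" "\<eta> \<in> paths \<Lambda>"
  shows "rep (gen z) (delta \<eta>) = (if rng \<Lambda> \<eta> = z then delta \<eta> else (\<lambda>_. 0))"
  using assms vertex_closed[of z] vertex_rng_src[of z] cmp_rng[of \<eta>] by (auto simp: rep_gen_delta step.simps)

lemma rep_range_delta:
  assumes "e \<in> paths \<Lambda>"
  shows "rep (gen e * gadj e) (delta \<eta>) = (if \<exists>\<nu>\<in>paths \<Lambda>. src \<Lambda> e = rng \<Lambda> \<nu> \<and> \<eta> = cmp \<Lambda> e \<nu> then delta \<eta> else (\<lambda>_. 0))"
proof (cases "step (e, True) \<eta>")
  case None
  hence neg: "\<not> (\<exists>\<nu>\<in>paths \<Lambda>. src \<Lambda> e = rng \<Lambda> \<nu> \<and> \<eta> = cmp \<Lambda> e \<nu>)" using step_True[of e \<eta>] assms by auto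
  show ?thesis unfolding if_not_P[OF neg] rep_mult rep_gadj_delta None by simp
next
  case (Some \<nu>)
  hence n: "\<nu> \<in> paths \<Lambda>" "src \<Lambda> e = rng \<Lambda> \<nu>" "\<eta> = cmp \<Lambda> e \<nu>" using step_True[of e \<eta> \<nu>] by auto
  hence "step (e, False) \<nu> = Some \<eta>" using assms by (simp add: step_False)
  thus ?thesis using Some n by (auto simp: rep_mult rep_gadj_delta rep_gen_delta)
qed

lemma rep_gap_factor:
  assumes z: "z \<in> vertices \<Lambda>" and h: "\<eta> \<in> paths \<Lambda>" and e: "e \<in> paths \<Lambda>" "rng \<Lambda> e = z"
  shows "rep (gap_factor z e) (delta \<eta>) =
    (if rng \<Lambda> \<eta> = z \<and> \<not> (\<exists>\<nu>\<in>paths \<Lambda>. src \<Lambda> e = rng \<Lambda> \<nu> \<and> \<eta> = cmp \<Lambda> e \<nu>) then delta \<eta> else (\<lambda>_. 0))"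
proof -
  have "rep (gap_factor z e) (delta \<eta>) = (\<lambda>\<kappa>. rep (gen z) (delta \<eta>) \<kappa> - rep (gen e * gadj e) (delta \<eta>) \<kappa>)"
    by (rule ext) (simp add: gap_factor_def rep_minus)
  moreover have "rng \<Lambda> \<eta> = z" if "\<nu> \<in> paths \<Lambda>" "src \<Lambda> e = rng \<Lambda> \<nu>" "\<eta> = cmp \<Lambda> e \<nu>" for \<nu>
    using rng_cmp[OF e(1) that(1,2)] that(3) e(2) by simp
  ultimately show ?thesis
    unfolding rep_range_delta[OF e(1)] rep_vertex_delta[OF z h] by auto
qed

text \<open>On point masses the product is diagonal: it keeps the paths with range z that begin with
  none of the listed paths.\<close>

lemma rep_gap:
  assumes z: "z \<in> vertices \<Lambda>" and h: "\<eta> \<in> paths \<Lambda>" and es: "set es \<subseteq> {e \<in> paths \<Lambda>. rng \<Lambda> e = z}"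
  shows "rep (gap z es) (delta \<eta>) =
    (if rng \<Lambda> \<eta> = z \<and> (\<forall>e\<in>set es. \<not> (\<exists>\<nu>\<in>paths \<Lambda>. src \<Lambda> e = rng \<Lambda> \<nu> \<and> \<eta> = cmp \<Lambda> e \<nu>)) then delta \<eta> else (\<lambda>_. 0))"
  using es
proof (induction es)
  case Nil
  show ?case using rep_vertex_delta[OF z h] by (simp add: gap_def)
next
  case (Cons e es)
  have e: "e \<in> paths \<Lambda>" "rng \<Lambda> e = z" using Cons.prems by auto
  have "rep (gap z (e # es)) (delta \<eta>) = rep (gap_factor z e) (rep (gap z es) (delta \<eta>))"
    by (simp add: gap_def rep_mult)
  thus ?case using Cons rep_gap_factor[OF z h e] by auto
qed

end

section \<open>The simplex of KMS states\<close>

lemma mix_values: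
  "mix 0 p q = p" "mix 1 p q = q" "mix s (mix a p q) (mix b p q) = mix ((1 - s) * a + s * b) p q"
  by (auto simp: mix_def algebra_simps fun_eq_iff)

text \<open>The point x separates p from q, so mixtures with different parameters differ, and the
  question is reduced to the extreme points 0 and 1 of the unit interval.\<close>

lemma extreme_segment:
  assumes x: "p x = 0" "q x \<noteq> 0" shows "extreme_states (state_segment p q) = {p, q}"
proof
  have inj: "a = b" if "mix a p q = mix b p q" for a b
    using fun_cong[OF that, of x] x by (simp add: mix_def)
  have "p \<in> state_segment p q"
    unfolding state_segment_def by (rule CollectI, rule exI[of _ 0]) (simp add: mix_values(1))
  moreover have "q \<in> state_segment p q"
    unfolding state_segment_def by (rule CollectI, rule exI[of _ 1]) (simp add: mix_values(2))
  ultimately have ends: "p \<in> state_segment p q" "q \<in> state_segment p q" .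
  have pq: "p \<noteq> q" using x by auto
  show "extreme_states (state_segment p q) \<subseteq> {p, q}"
  proof
    fix \<phi> assume e: "\<phi> \<in> extreme_states (state_segment p q)"
    hence seg: "\<phi> \<in> state_segment p q"
      and ext: "\<forall>\<psi>\<in>state_segment p q. \<forall>\<eta>\<in>state_segment p q. \<forall>s. 0 < s \<and> s < 1 \<and> \<phi> = mix s \<psi> \<eta> \<longrightarrow> \<psi> = \<phi> \<and> \<eta> = \<phi>"
      by (simp_all add: extreme_states_def)
    from seg obtain s where s: "\<phi> = mix s p q" "0 \<le> s" "s \<le> 1" unfolding state_segment_def by auto
    have "p = \<phi> \<and> q = \<phi>" if "0 < s \<and> s < 1" using ext[rule_format, OF ends, of s] that s(1) by blast
    hence "\<not> (0 < s \<and> s < 1)" using pq by metis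
    hence "s = 0 \<or> s = 1" using s by linarith
    thus "\<phi> \<in> {p, q}" using s(1) mix_values(1,2)[of p q] by auto
  qed
  have extreme: "mix c p q \<in> extreme_states (state_segment p q)"
    if c: "c = 0 \<or> c = 1" for c
    unfolding extreme_states_def
  proof (intro CollectI conjI ballI allI impI)
    show "mix c p q \<in> state_segment p q" using c ends mix_values(1,2)[of p q] by auto
    fix \<psi> \<eta> s assume "\<psi> \<in> state_segment p q" "\<eta> \<in> state_segment p q" and s: "0 < s \<and> s < 1 \<and> mix c p q = mix s \<psi> \<eta>"
    then obtain a b where ab: "\<psi> = mix a p q" "\<eta> = mix b p q" "0 \<le> a" "a \<le> 1" "0 \<le> b" "b \<le> 1"
      unfolding state_segment_def by auto
    have c': "c = (1 - s) * a + s * b" using s inj unfolding ab mix_values(3) by blast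
    have "a = c \<and> b = c"
      using c
    proof
      assume "c = 0"
      hence "(1 - s) * a + s * b = 0" using c' by simp
      moreover have "0 \<le> (1 - s) * a" "0 \<le> s * b" using s ab by simp_all
      ultimately have "(1 - s) * a = 0" "s * b = 0" by linarith+
      thus ?thesis using s \<open>c = 0\<close> by simp
    next
      assume "c = 1"
      hence "(1 - s) * (1 - a) + s * (1 - b) = 0" using c' by (simp add: algebra_simps)
      moreover have "0 \<le> (1 - s) * (1 - a)" "0 \<le> s * (1 - b)" using s ab by simp_all
      ultimately have "(1 - s) * (1 - a) = 0" "s * (1 - b) = 0" by linarith+
      thus ?thesis using s \<open>c = 1\<close> by simp
    qed
    thus "\<psi> = mix c p q" "\<eta> = mix c p q" using ab by simp_all
  qed
  show "{p, q} \<subseteq> extreme_states (state_segment p q)"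
    using extreme[of 0] extreme[of 1] mix_values(1,2)[of p q] by simp
qed

lemma (in star_alg) mix_is_state:
  assumes e: "unit_of A e" and p: "is_state A p" and q: "is_state A q" and s: "0 \<le> s" "s \<le> 1"
  shows "is_state A (mix s p q)"
  unfolding is_state_iff[OF e]
proof (intro conjI allI impI)
  have P: "linear_functional A p" "linear_functional A q"
    "\<And>x. x \<in> carrier A \<Longrightarrow> p (astar A x \<boxtimes> x) \<in> \<real>\<^sub>\<ge>\<^sub>0" "\<And>x. x \<in> carrier A \<Longrightarrow> q (astar A x \<boxtimes> x) \<in> \<real>\<^sub>\<ge>\<^sub>0"
    "\<And>x. x \<in> carrier A \<Longrightarrow> cmod (p x) \<le> anorm A x" "\<And>x. x \<in> carrier A \<Longrightarrow> cmod (q x) \<le> anorm A x"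
    "p e = 1" "q e = 1" "\<And>x. x \<notin> carrier A \<Longrightarrow> p x = 0" "\<And>x. x \<notin> carrier A \<Longrightarrow> q x = 0"
    using p q unfolding is_state_iff[OF e] positive_functional_def contractive_functional_def by auto
  show "mix s p q x = 0" if "x \<notin> carrier A" for x using P(9,10)[OF that] by (simp add: mix_def)
  have lin: "linear_functional A (mix s p q)"
    using P(1,2) unfolding linear_functional_def mix_def by (auto simp: algebra_simps)
  show "positive_functional A (mix s p q)"
    unfolding positive_functional_def
  proof (intro conjI ballI lin)
    fix x assume x: "x \<in> carrier A"
    show "mix s p q (astar A x \<boxtimes> x) \<in> \<real>\<^sub>\<ge>\<^sub>0"
      unfolding mix_def using s P(3,4)[OF x]
      by (intro nonneg_Reals_add_I nonneg_Reals_mult_I) (auto simp: nonneg_Reals_of_real_iff simp del: of_real_diff)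
  qed
  show "contractive_functional A (mix s p q)"
    unfolding contractive_functional_def
  proof (intro conjI ballI lin)
    fix x assume x: "x \<in> carrier A"
    have "cmod (mix s p q x) \<le> (1 - s) * cmod (p x) + s * cmod (q x)"
      unfolding mix_def using s norm_triangle_ineq[of "of_real (1 - s) * p x" "of_real s * q x"]
      by (simp add: norm_mult del: of_real_diff)
    also have "\<dots> \<le> (1 - s) * anorm A x + s * anorm A x"
      using s P(5,6)[OF x] by (intro add_mono mult_left_mono) auto
    finally show "cmod (mix s p q x) \<le> anorm A x" by (simp add: algebra_simps)
  qed
  show "mix s p q e = 1" using P(7,8) by (simp add: mix_def)
qed

lemma (in row_finite) mix_twisted_trace:
  "twisted_trace r \<beta> p \<Longrightarrow> twisted_trace r \<beta> q \<Longrightarrow> twisted_trace r \<beta> (mix s p q)"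
  unfolding twisted_trace_def mix_def by (simp add: algebra_simps)

section \<open>Construction of the two extreme states\<close>

context kms_setup
begin

abbreviation "z_u \<equiv> inverse (1 - real d1 * x1) * inverse (1 - real d2 * x2)"

lemma z_u_pos: "0 < z_u"
  using small_x by simp

text \<open>The measure lives on all paths of the loop graph, a set closed under prepending and
  removing pieces; \<open>z_u\<close> is its total weight.\<close>

lemma loop_trace_state:
  obtains \<psi> where "is_state L.TA \<psi>" "L.twisted_trace (r1, r2) \<beta> \<psi>"
proof -
  have loops: "loops = paths \<Lambda>u" using loop_paths by (simp add: loops_def set_eq_iff)
  have tot: "path_measure \<Lambda> loops (\<lambda>\<xi>. W \<xi> / z_u)"
    by (rule W_scaled_measure[OF W_loops z_u_pos]) (auto simp: loops_def)
  have M: "path_measure \<Lambda>u loops (\<lambda>\<xi>. W \<xi> / z_u)"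
    using path_measure.total[OF tot] path_measure.nonneg[OF tot] loops
    by (intro path_measure.intro path_measure_axioms.intro L.row_finite_axioms) auto
  have "L.twisted_trace (r1, r2) \<beta> (path_measure.path_state \<Lambda>u loops (\<lambda>\<xi>. W \<xi> / z_u))"
  proof (rule path_measure.path_state_twisted_trace[OF M])
    fix \<kappa> \<xi> assume k: "\<kappa> \<in> paths \<Lambda>u" "src \<Lambda>u \<kappa> = rng \<Lambda>u \<xi>"
    show "cmp \<Lambda>u \<kappa> \<xi> \<in> loops \<longleftrightarrow> \<xi> \<in> loops" if "\<xi> \<in> paths \<Lambda>u"
      using L.cmp_closed[OF k(1) that k(2)] that unfolding loops by blast
    assume x: "\<xi> \<in> loops"
    have "\<xi> \<in> paths \<Lambda>" "\<kappa> \<in> paths \<Lambda>" using k(1) x unfolding loops loop_paths by blast+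
    hence "W (cmp \<Lambda> \<kappa> \<xi>) = W \<kappa> * W \<xi>" using k(2) W_cmp[of \<kappa> \<xi>] by simp
    thus "W (cmp \<Lambda>u \<kappa> \<xi>) / z_u = exp (- \<beta> * path_weight \<Lambda>u (r1, r2) \<kappa>) * (W \<xi> / z_u)"
      by (simp add: W_def[of \<kappa>] path_weight_def)
  qed
  thus ?thesis using that path_measure.path_state_is_state[OF M] by blast
qed

lemma restr_unit_sum: "restr T.unit_sum = gen u"
proof -
  have "u \<in> paths \<Lambda>u" "v \<notin> paths \<Lambda>u"
    using vertex_closed[OF u_vertex] vertex_rng_src[OF u_vertex] vertex_rng_src[OF v_vertex] u_neq_v by (auto simp: loop_paths)
  thus ?thesis using u_neq_v by (simp add: T.unit_sum_def vertices_eq restr_add restr_gen)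
qed

lemma unit_sum_loops: "L.T.unit_sum = gen u"
  by (simp add: L.T.unit_sum_def loop_vertices)

text \<open>The state is defined as the pull-back of the loop state along q, so the factorization
  holds by construction. In the trace relation for a generator with source v both sides are
  0.\<close>

lemma first_extreme_state:
  obtains \<phi> q \<psi> where "is_state TA \<phi>" "twisted_trace (r1, r2) \<beta> \<phi>" "removes_vertex \<Lambda> u v q" "is_state L.TA \<psi>"
    "\<And>x. x \<in> carrier TA \<Longrightarrow> \<phi> x = \<psi> (q x)" "\<phi> (temb \<Lambda> (gen u)) = 1" "\<phi> (temb \<Lambda> (gen v)) = 0"
proof -
  obtain \<psi> where \<psi>: "is_state L.TA \<psi>" "L.twisted_trace (r1, r2) \<beta> \<psi>" by (rule loop_trace_state)
  obtain q where q: "removes_vertex \<Lambda> u v q" and qt: "\<And>f. f \<in> fpoly \<Lambda> \<Longrightarrow> q (temb \<Lambda> f) = temb \<Lambda>u (restr f)"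
    and qn: "\<And>x. x \<in> carrier TA \<Longrightarrow> anorm L.TA (q x) \<le> anorm TA x"
    by (rule removing_v) blast
  have P: "linear_functional L.TA \<psi>" "\<And>x. x \<in> carrier L.TA \<Longrightarrow> \<psi> (astar L.TA x \<boxtimes>\<^bsub>L.TA\<^esub> x) \<in> \<real>\<^sub>\<ge>\<^sub>0"
    "\<And>x. x \<in> carrier L.TA \<Longrightarrow> cmod (\<psi> x) \<le> anorm L.TA x" "\<psi> (temb \<Lambda>u L.T.unit_sum) = 1"
    using \<psi>(1) unfolding star_alg.is_state_iff[OF L.TA_star_alg L.temb_unit] positive_functional_def contractive_functional_def
    by auto
  have h: "\<And>x. x \<in> carrier TA \<Longrightarrow> q x \<in> carrier L.TA"
    "\<And>x y. x \<in> carrier TA \<Longrightarrow> y \<in> carrier TA \<Longrightarrow> q (x \<boxplus>\<^bsub>TA\<^esub> y) = q x \<boxplus>\<^bsub>L.TA\<^esub> q y"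
    "\<And>x y. x \<in> carrier TA \<Longrightarrow> y \<in> carrier TA \<Longrightarrow> q (x \<boxtimes>\<^bsub>TA\<^esub> y) = q x \<boxtimes>\<^bsub>L.TA\<^esub> q y"
    "\<And>c x. x \<in> carrier TA \<Longrightarrow> q (ascale TA c x) = ascale L.TA c (q x)"
    "\<And>x. x \<in> carrier TA \<Longrightarrow> q (astar TA x) = astar L.TA (q x)"
    using q by (auto simp: removes_vertex_def star_hom_def)
  interpret A: star_alg TA by (rule TA_star_alg)
  define \<phi> where "\<phi> x = (if x \<in> carrier TA then \<psi> (q x) else 0)" for x
  have \<phi>t: "\<phi> (temb \<Lambda> f) = \<psi> (temb \<Lambda>u (restr f))" if "f \<in> fpoly \<Lambda>" for f using that by (simp add: \<phi>_def qt)
  have lin: "linear_functional TA \<phi>" using P(1) unfolding linear_functional_def by (simp add: \<phi>_def h)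
  have pos: "positive_functional TA \<phi>" unfolding positive_functional_def using lin P(2) by (simp add: \<phi>_def h)
  have "cmod (\<phi> x) \<le> anorm TA x" if x: "x \<in> carrier TA" for x
    using P(3)[OF h(1)[OF x]] qn[OF x] x by (simp add: \<phi>_def)
  hence con: "contractive_functional TA \<phi>" using lin by (simp add: contractive_functional_def)
  have "\<phi> (temb \<Lambda> T.unit_sum) = 1" using P(4) \<phi>t[of T.unit_sum] unit_of_def[of TA] temb_unit
    by (simp add: restr_unit_sum unit_sum_loops)
  hence st: "is_state TA \<phi>" unfolding A.is_state_iff[OF temb_unit] using pos con by (simp add: \<phi>_def)
  have \<psi>0: "\<psi> (temb \<Lambda>u 0) = 0" by (rule L.functional_zero[OF L.state_bounded[OF \<psi>(1)]])
  have "twisted_trace (r1, r2) \<beta> \<phi>"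
    unfolding twisted_trace_def
  proof (intro ballI)
    fix \<kappa> f assume k: "\<kappa> \<in> paths \<Lambda>" and f: "f \<in> fpoly \<Lambda>"
    have pw: "path_weight \<Lambda>u (r1, r2) \<kappa> = path_weight \<Lambda> (r1, r2) \<kappa>" by (simp add: path_weight_def)
    show "\<phi> (temb \<Lambda> (gen \<kappa> * f)) = complex_of_real (exp (- \<beta> * path_weight \<Lambda> (r1, r2) \<kappa>)) * \<phi> (temb \<Lambda> (f * gen \<kappa>))"
    proof (cases "\<kappa> \<in> paths \<Lambda>u")
      case True
      thus ?thesis using \<psi>(2) k f restr_fpoly[OF f] unfolding L.twisted_trace_def pw[symmetric]
        by (simp add: \<phi>t restr_mult restr_gen)
    next
      case False
      thus ?thesis using k f \<psi>0 by (simp add: \<phi>t restr_mult restr_gen)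
    qed
  qed
  moreover have "\<phi> (temb \<Lambda> (gen u)) = 1" "\<phi> (temb \<Lambda> (gen v)) = 0"
  proof -
    have "u \<in> paths \<Lambda>u" "v \<notin> paths \<Lambda>u"
      using vertex_closed[OF u_vertex] vertex_rng_src[OF u_vertex] vertex_rng_src[OF v_vertex] u_neq_v by (auto simp: loop_paths)
    thus "\<phi> (temb \<Lambda> (gen u)) = 1" "\<phi> (temb \<Lambda> (gen v)) = 0"
      using vertex_closed[OF u_vertex] vertex_closed[OF v_vertex] P(4) \<psi>0
      by (simp_all add: \<phi>t restr_gen unit_sum_loops)
  qed
  ultimately show ?thesis using that[OF st _ q \<psi>(1)] by (simp add: \<phi>_def)
qed

lemma v_measure: "path_measure \<Lambda> v_paths (\<lambda>\<xi>. W \<xi> / y_v)"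
  by (rule W_scaled_measure[OF W_v_paths y_v_pos]) (auto simp: v_paths_def)

interpretation V: path_measure \<Lambda> v_paths "\<lambda>\<xi>. W \<xi> / y_v"
  by (rule v_measure)

lemma v_state_trace: "twisted_trace (r1, r2) \<beta> V.path_state"
proof (rule V.path_state_twisted_trace)
  fix \<kappa> \<xi> assume k: "\<kappa> \<in> paths \<Lambda>" "src \<Lambda> \<kappa> = rng \<Lambda> \<xi>"
  show "cmp \<Lambda> \<kappa> \<xi> \<in> v_paths \<longleftrightarrow> \<xi> \<in> v_paths" if "\<xi> \<in> paths \<Lambda>"
    using cmp_closed[OF k(1) that k(2)] src_cmp[OF k(1) that k(2)] that by (simp add: v_paths_def)
  assume x: "\<xi> \<in> v_paths"
  have "W (cmp \<Lambda> \<kappa> \<xi>) = W \<kappa> * W \<xi>" using k x by (intro W_cmp) (auto simp: v_paths_def)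
  thus "W (cmp \<Lambda> \<kappa> \<xi>) / y_v = exp (- \<beta> * path_weight \<Lambda> (r1, r2) \<kappa>) * (W \<xi> / y_v)" by (simp add: W_def[of \<kappa>])
qed

text \<open>Among the paths with source v only v itself has range v, and its normalised weight is 1
  / y_v.\<close>

lemma v_state_v: "V.path_state (temb \<Lambda> (gen v)) = of_real (inverse y_v)"
proof -
  have vp: "v \<in> v_paths" "v \<in> paths \<Lambda>" "rng \<Lambda> v = v"
    using vertex_closed[OF v_vertex] vertex_rng_src[OF v_vertex] by (auto simp: v_paths_def)
  have d: "diag (gen v) \<xi> = (if \<xi> = v then 1 else 0)" if "\<xi> \<in> v_paths" for \<xi>
    using V.diag_vertex[OF v_vertex, of \<xi>] range_v[of \<xi>] vp that by (auto simp: v_paths_def)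
  have "V.path_functional (gen v) = (\<Sum>\<^sub>\<infinity>\<xi>\<in>{v}. of_real (W \<xi> / y_v) * diag (gen v) \<xi>)"
    unfolding V.path_functional_def using vp d by (intro infsum_cong_neutral) auto
  also have "\<dots> = of_real (inverse y_v)" using d[OF vp(1)] W_v by (simp add: inverse_eq_divide)
  finally show ?thesis using V.path_state_temb[of "gen v"] vp by simp
qed

text \<open>Prepending or removing a piece at the front does not change the source, so the point
  masses of these paths span an invariant subspace.\<close>

lemma rep_word_v_paths:
  assumes "w \<in> words \<Lambda> \<or> w = []" "\<xi> \<in> v_paths"
  shows "rep (monom_of w 1) (delta \<xi>) = (\<lambda>_. 0) \<or> (\<exists>\<eta>\<in>v_paths. rep (monom_of w 1) (delta \<xi>) = delta \<eta>)"
  using assms(1)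
proof (induction w)
  case Nil
  have "rep (monom_of [] 1) (delta \<xi>) = delta \<xi>" by (rule ext) (simp add: rep_monom word_op_def adj_word_def)
  thus ?case using assms(2) by blast
next
  case (Cons l w)
  obtain \<kappa> b where l: "l = (\<kappa>, b)" by fastforce
  have w: "w \<in> words \<Lambda> \<or> w = []" and k: "\<kappa> \<in> paths \<Lambda>" using Cons.prems l by (auto simp: words_def)
  have split: "rep (monom_of (l # w) 1) h = rep (monom_of [l] 1) (rep (monom_of w 1) h)" for h
    by (simp add: monom_mult flip: rep_mult)
  have letter: "rep (monom_of [l] 1) (delta \<eta>) = (\<lambda>_. 0) \<or> (\<exists>\<zeta>\<in>v_paths. rep (monom_of [l] 1) (delta \<eta>) = delta \<zeta>)"
    if h: "\<eta> \<in> v_paths" for \<eta>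
  proof (cases b)
    case True
    show ?thesis
    proof (cases "step (\<kappa>, True) \<eta>")
      case None thus ?thesis using rep_gadj_delta[of \<kappa> \<eta>] True l by (simp add: gadj_def)
    next
      case (Some \<zeta>)
      hence z: "\<zeta> \<in> paths \<Lambda>" "src \<Lambda> \<kappa> = rng \<Lambda> \<zeta>" "\<eta> = cmp \<Lambda> \<kappa> \<zeta>" using step_True[of \<kappa> \<eta> \<zeta>] by auto
      hence "\<zeta> \<in> v_paths" using h src_cmp[OF k z(1,2)] by (simp add: v_paths_def)
      thus ?thesis using rep_gadj_delta[of \<kappa> \<eta>] True l Some by (auto simp: gadj_def)
    qed
  next
    case False
    show ?thesis
    proof (cases "step (\<kappa>, False) \<eta>")
      case None thus ?thesis using rep_gen_delta[of \<kappa> \<eta>] False l by (simp add: gen_def)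
    next
      case (Some \<zeta>)
      hence z: "\<eta> \<in> paths \<Lambda>" "src \<Lambda> \<kappa> = rng \<Lambda> \<eta>" "\<zeta> = cmp \<Lambda> \<kappa> \<eta>" using step_False[of \<kappa> \<eta> \<zeta>] by auto
      hence "\<zeta> \<in> v_paths" using h src_cmp[OF k z(1,2)] cmp_closed[OF k z(1,2)] by (simp add: v_paths_def)
      thus ?thesis using rep_gen_delta[of \<kappa> \<eta>] False l Some by (auto simp: gen_def)
    qed
  qed
  from Cons.IH[OF w] show ?case
  proof
    assume "rep (monom_of w 1) (delta \<xi>) = (\<lambda>_. 0)"
    thus ?thesis by (simp add: split)
  next
    assume "\<exists>\<eta>\<in>v_paths. rep (monom_of w 1) (delta \<xi>) = delta \<eta>"
    then obtain \<eta> where "\<eta> \<in> v_paths" "rep (monom_of w 1) (delta \<xi>) = delta \<eta>" by blast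
    thus ?thesis using letter[of \<eta>] by (simp add: split)
  qed
qed

text \<open>A path from \<open>u\<close> to \<open>v\<close> cannot be extended, so an exhaustive set contains an edge with which
  the path begins.\<close>

lemma rep_exhaustive_gap:
  assumes ex: "exhaustive \<Lambda> z (set es)" and z: "z \<in> vertices \<Lambda>" and h: "\<eta> \<in> v_paths"
  shows "rep (gap z es) (delta \<eta>) = (\<lambda>_. 0)"
proof -
  have hp: "\<eta> \<in> paths \<Lambda>" "src \<Lambda> \<eta> = v" using h by (auto simp: v_paths_def)
  have es: "set es \<subseteq> {e \<in> paths \<Lambda>. rng \<Lambda> e = z}" using ex edges_into_paths[of z] unfolding exhaustive_def by blast
  have "\<exists>e\<in>set es. \<exists>\<nu>\<in>paths \<Lambda>. src \<Lambda> e = rng \<Lambda> \<nu> \<and> \<eta> = cmp \<Lambda> e \<nu>" if r: "rng \<Lambda> \<eta> = z"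
  proof -
    obtain e where e: "e \<in> set es" "min_ext \<Lambda> \<eta> e \<noteq> {}" using ex hp(1) r unfolding exhaustive_def by blast
    then obtain \<alpha> \<nu> where an: "(\<alpha>, \<nu>) \<in> min_ext \<Lambda> \<eta> e" by auto
    have ep: "e \<in> paths \<Lambda>" using e(1) es by blast
    show ?thesis using e(1) min_extD(2,4)[OF hp(1) ep an] min_ext_into_v(2)[OF hp(1) ep hp(2) an] by blast
  qed
  thus ?thesis unfolding rep_gap[OF z hp(1) es] by auto
qed

text \<open>Between two words a gap product meets only point masses of paths with source v, and it
  annihilates all of these. The generators therefore lie in the two-sided annihilator of the state,
  a closed ideal.\<close>

lemma second_extreme_state_ck:
  obtains \<psi> where "is_state (cuntz_krieger_algebra \<Lambda>) \<psi>"
    "\<And>x. x \<in> carrier TA \<Longrightarrow> V.path_state x = \<psi> (cuntz_krieger_map \<Lambda> x)"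
proof -
  interpret A: star_alg TA by (rule TA_star_alg)
  interpret I: star_ideal TA "cuntz_krieger_ideal \<Lambda>" by (rule cuntz_krieger_star_ideal)
  have st: "is_state TA V.path_state" by (rule V.path_state_is_state)
  have con: "contractive_functional TA V.path_state" using st A.is_state_iff[OF temb_unit] by blast
  let ?N = "{x \<in> carrier TA. \<forall>a\<in>carrier TA. \<forall>b\<in>carrier TA. V.path_state (a \<boxtimes>\<^bsub>TA\<^esub> (x \<boxtimes>\<^bsub>TA\<^esub> b)) = 0}"
  have gap: "gap_product \<Lambda> z es \<in> ?N" if z: "z \<in> vertices \<Lambda>" and ex: "exhaustive \<Lambda> z (set es)" for z es
  proof -
    have es: "set es \<subseteq> paths \<Lambda>" using ex edges_into_paths[of z] unfolding exhaustive_def by blast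
    have g: "gap z es \<in> fpoly \<Lambda>" using es vertex_closed[OF z] by blast
    have "V.path_state (temb \<Lambda> (monom_of w 1 * (gap z es * monom_of w' 1))) = 0"
      if w: "w \<in> words \<Lambda>" "w' \<in> words \<Lambda>" for w w'
    proof -
      have "diag (monom_of w 1 * (gap z es * monom_of w' 1)) \<xi> = 0" if x: "\<xi> \<in> v_paths" for \<xi>
      proof -
        have "rep (gap z es) (rep (monom_of w' 1) (delta \<xi>)) = (\<lambda>_. 0)"
          using rep_word_v_paths[OF disjI1[OF w(2)] x] rep_exhaustive_gap[OF ex z] by auto
        thus ?thesis by (simp add: diag_def rep_mult)
      qed
      hence "V.path_functional (monom_of w 1 * (gap z es * monom_of w' 1)) = 0" by (rule V.path_functional_cong)
      thus ?thesis using w g by (subst V.path_state_temb) (auto intro: fpoly_monom)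
    qed
    hence "V.path_state (a \<boxtimes>\<^bsub>TA\<^esub> (temb \<Lambda> (gap z es) \<boxtimes>\<^bsub>TA\<^esub> b)) = 0" if "a \<in> carrier TA" "b \<in> carrier TA" for a b
      using annihilated_by_words[OF state_bounded[OF st] g _ that] by blast
    thus ?thesis using g es vertex_closed[OF z] by (simp add: gap_product_eq)
  qed
  have sub: "cuntz_krieger_ideal \<Lambda> \<subseteq> ?N"
    unfolding cuntz_krieger_ideal_def using gap
    by (intro ideal_generated_least A.annihilator_closed_ideal con) blast
  have "V.path_state x = 0" if x: "x \<in> cuntz_krieger_ideal \<Lambda>" for x
  proof -
    have e: "temb \<Lambda> T.unit_sum \<in> carrier TA" "\<And>y. y \<in> carrier TA \<Longrightarrow> temb \<Lambda> T.unit_sum \<boxtimes>\<^bsub>TA\<^esub> y = y"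
      "\<And>y. y \<in> carrier TA \<Longrightarrow> y \<boxtimes>\<^bsub>TA\<^esub> temb \<Lambda> T.unit_sum = y"
      using temb_unit by (auto simp: unit_of_def)
    have "x \<in> ?N" using sub x by blast
    hence "x \<in> carrier TA" "V.path_state (temb \<Lambda> T.unit_sum \<boxtimes>\<^bsub>TA\<^esub> (x \<boxtimes>\<^bsub>TA\<^esub> temb \<Lambda> T.unit_sum)) = 0" using e(1) by blast+
    thus ?thesis by (simp add: e)
  qed
  from I.quotient_state[OF st temb_unit this] show ?thesis
    using that unfolding cuntz_krieger_algebra_def cuntz_krieger_map_def by blast
qed

section \<open>The segment of KMS states and the values at its ends\<close>

lemma trace_states_segment:
  assumes p: "is_state TA p" "twisted_trace (r1, r2) \<beta> p" "p (temb \<Lambda> (gen v)) = 0"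
    and q: "is_state TA q" "twisted_trace (r1, r2) \<beta> q" "q (temb \<Lambda> (gen v)) = of_real (inverse y_v)"
  shows "{\<phi>. is_state TA \<phi> \<and> twisted_trace (r1, r2) \<beta> \<phi>} = state_segment p q"
proof (intro equalityI subsetI)
  fix \<phi> assume "\<phi> \<in> state_segment p q"
  then obtain s where s: "\<phi> = mix s p q" "0 \<le> s" "s \<le> 1" unfolding state_segment_def by blast
  show "\<phi> \<in> {\<phi>. is_state TA \<phi> \<and> twisted_trace (r1, r2) \<beta> \<phi>}"
    unfolding s(1) using star_alg.mix_is_state[OF TA_star_alg temb_unit p(1) q(1) s(2,3)] mix_twisted_trace[OF p(2) q(2)] by blast
next
  fix \<phi> assume "\<phi> \<in> {\<phi>. is_state TA \<phi> \<and> twisted_trace (r1, r2) \<beta> \<phi>}"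
  hence \<phi>: "is_state TA \<phi>" "twisted_trace (r1, r2) \<beta> \<phi>" by auto
  obtain t where t: "\<phi> (temb \<Lambda> (gen v)) = of_real t" "0 \<le> t" "t * y_v \<le> 1" by (rule vertex_v_bound[OF \<phi>])
  \<comment> \<open>The mixture with parameter s has value s / y_v at t_v, and this must equal
    t.\<close>
  define s where "s = t * y_v"
  have s: "0 \<le> s" "s \<le> 1" using t y_v_pos by (auto simp: s_def)
  have m: "is_state TA (mix s p q)" "twisted_trace (r1, r2) \<beta> (mix s p q)"
    using star_alg.mix_is_state[OF TA_star_alg temb_unit p(1) q(1) s] mix_twisted_trace[OF p(2) q(2)] by blast+
  have v: "mix s p q (temb \<Lambda> (gen v)) = \<phi> (temb \<Lambda> (gen v))"
    using y_v_pos by (simp add: mix_def p(3) q(3) t(1) s_def)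
  \<comment> \<open>The two vertex projections add up to the unit, so the value at t_v determines
    the value at t_u, and with it those at all monomials.\<close>
  have u: "mix s p q (temb \<Lambda> (gen u)) = \<phi> (temb \<Lambda> (gen u))"
    using unit_value[OF \<phi>] unit_value[OF m] v by (metis add_right_cancel)
  have "monomials_agree \<phi> (mix s p q)"
    unfolding monomials_agree_def
  proof (intro ballI)
    fix \<mu> \<nu> assume mn: "\<mu> \<in> paths \<Lambda>" "\<nu> \<in> paths \<Lambda>"
    show "\<phi> (temb \<Lambda> (gen \<mu> * gadj \<nu>)) = mix s p q (temb \<Lambda> (gen \<mu> * gadj \<nu>))"
      unfolding monomial_value[OF \<phi> mn] monomial_value[OF m mn] using src_cases[OF mn(1)] u v by auto
  qed
  hence "\<phi> x = mix s p q x" for x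
  proof (cases "x \<in> carrier TA")
    case True
    thus ?thesis using monomials_agree_eq[OF state_bounded[OF \<phi>(1)] state_bounded[OF m(1)]] \<open>monomials_agree \<phi> (mix s p q)\<close> by blast
  next
    case False
    thus ?thesis using \<phi>(1) m(1) unfolding is_state_def by metis
  qed
  hence "\<phi> = mix s p q" by blast
  thus "\<phi> \<in> state_segment p q" unfolding state_segment_def using s by blast
qed

text \<open>The formula for \<open>\<phi>\<^sub>2(t\<^sub>u)\<close> is \<open>1 - 1 / y\<^sub>v\<close> rewritten by means of
  \<open>a\<^sub>1 d\<^sub>2 = a\<^sub>2 d\<^sub>1\<close>.\<close>

lemma u_value_formula:
  "1 - inverse y_v = inverse y_v * z_u * (real a2 * x2 + real a1 * x1 - real a1 * real d2 * (x1 * x2))"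
proof -
  have n: "1 - real d1 * x1 \<noteq> 0" "1 - real d2 * x2 \<noteq> 0" using small_x by auto
  have sq: "real d1 * real a2 = real a1 * real d2" using commuting_squares by (metis of_nat_mult mult.commute)
  let ?D1 = "inverse (1 - real d1 * x1)" and ?D2 = "inverse (1 - real d2 * x2)"
  \<comment> \<open>The commuting squares replace a1 d2 by d1 a2, so that 1 - d1 x1 can be factored
    out of the a2 terms and cancelled against its inverse.\<close>
  have "(real a2 * x2 + real a1 * x1 - real a1 * real d2 * (x1 * x2)) = real a2 * x2 * (1 - real d1 * x1) + real a1 * x1"
    using sq by (simp add: algebra_simps)
  note A = this
  have "z_u * (real a2 * x2 + real a1 * x1 - real a1 * real d2 * (x1 * x2))
      = real a2 * x2 * ?D2 * (?D1 * (1 - real d1 * x1)) + real a1 * x1 * ?D1 * ?D2"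
    unfolding A by (simp only: distrib_left ac_simps)
  also have "\<dots> = y_v - 1" using n(1) by (simp add: y_v_def)
  finally have z: "z_u * (real a2 * x2 + real a1 * x1 - real a1 * real d2 * (x1 * x2)) = y_v - 1" .
  show ?thesis unfolding mult.assoc[of "inverse y_v"] z using y_v_pos by (simp add: field_simps)
qed

lemma kms_simplex:
  assumes dyn: "toeplitz_dynamics \<Lambda> (r1, r2) \<alpha>"
  shows "\<exists>\<phi>1 \<phi>2.
      {\<phi>. kms_state TA \<alpha> \<beta> \<phi>} = state_segment \<phi>1 \<phi>2 \<and> \<phi>1 \<noteq> \<phi>2
    \<and> extreme_states {\<phi>. kms_state TA \<alpha> \<beta> \<phi>} = {\<phi>1, \<phi>2}
    \<and> \<phi>1 (tgen \<Lambda> u) = 1 \<and> \<phi>1 (tgen \<Lambda> v) = 0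
    \<and> \<phi>2 (tgen \<Lambda> u) = complex_of_real (inverse y_v * z_u
          * (real a2 * x2 + real a1 * x1 - real a1 * real d2 * (x1 * x2)))
    \<and> \<phi>2 (tgen \<Lambda> v) = complex_of_real (inverse y_v)
    \<and> (\<exists>q \<psi>. removes_vertex \<Lambda> u v q \<and> is_state L.TA \<psi> \<and> (\<forall>x \<in> carrier TA. \<phi>1 x = \<psi> (q x)))
    \<and> (\<exists>\<psi>. is_state (cuntz_krieger_algebra \<Lambda>) \<psi> \<and> (\<forall>x \<in> carrier TA. \<phi>2 x = \<psi> (cuntz_krieger_map \<Lambda> x)))"
proof -
  obtain p q \<psi> where p: "is_state TA p" "twisted_trace (r1, r2) \<beta> p" and q: "removes_vertex \<Lambda> u v q" "is_state L.TA \<psi>"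
    "\<And>x. x \<in> carrier TA \<Longrightarrow> p x = \<psi> (q x)" and pv: "p (temb \<Lambda> (gen u)) = 1" "p (temb \<Lambda> (gen v)) = 0"
    by (rule first_extreme_state) blast
  obtain \<rho> where ck: "is_state (cuntz_krieger_algebra \<Lambda>) \<rho>"
    "\<And>x. x \<in> carrier TA \<Longrightarrow> V.path_state x = \<rho> (cuntz_krieger_map \<Lambda> x)"
    by (rule second_extreme_state_ck) blast
  note V = V.path_state_is_state v_state_trace v_state_v
  have seg: "{\<phi>. kms_state TA \<alpha> \<beta> \<phi>} = state_segment p V.path_state"
    using trace_states_segment[OF p pv(2) V] kms_iff[OF dyn] beta_pos by simp
  have nz: "V.path_state (temb \<Lambda> (gen v)) \<noteq> 0" using v_state_v y_v_pos by simp
  have ne: "p \<noteq> V.path_state" using nz pv(2) by auto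
  have "V.path_state (temb \<Lambda> (gen u)) = complex_of_real (1 - inverse y_v)"
    using unit_value[OF V(1,2)] V(3) by (simp add: algebra_simps)
  hence u: "V.path_state (tgen \<Lambda> u) = complex_of_real (inverse y_v * z_u
          * (real a2 * x2 + real a1 * x1 - real a1 * real d2 * (x1 * x2)))"
    unfolding u_value_formula tgen_eq .
  have ex: "extreme_states (state_segment p V.path_state) = {p, V.path_state}"
    by (rule extreme_segment[where x = "temb \<Lambda> (gen v)"]) (use pv nz in simp_all)
  have factor: "\<exists>q \<psi>. removes_vertex \<Lambda> u v q \<and> is_state L.TA \<psi> \<and> (\<forall>x \<in> carrier TA. p x = \<psi> (q x))"
    using q by (intro exI[of _ q] exI[of _ \<psi>]) simp
  have ck_factor: "\<exists>\<psi>. is_state (cuntz_krieger_algebra \<Lambda>) \<psi>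
      \<and> (\<forall>x \<in> carrier TA. V.path_state x = \<psi> (cuntz_krieger_map \<Lambda> x))"
    using ck by (intro exI[of _ \<rho>]) simp
  show ?thesis
    by (rule exI[of _ p], rule exI[of _ V.path_state], unfold seg, intro conjI, rule refl, rule ne, rule ex,
        rule pv(1)[folded tgen_eq], rule pv(2)[folded tgen_eq], rule u, rule v_state_v[folded tgen_eq],
        rule factor, rule ck_factor)
qed

end

theorem proposition2p3:
  fixes \<Lambda> :: "'p two_graph" and u v :: 'p
    and a1 a2 d1 d2 :: nat and r1 r2 \<beta> y :: real
    and \<alpha> :: "real \<Rightarrow> 'p toeplitz_element \<Rightarrow> 'p toeplitz_element"
  assumes "0 < a1" "0 < a2" "0 < d1" "0 < d2"
    and "two_graph \<Lambda>" and "vertices \<Lambda> = {u, v}" and "u \<noteq> v"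
    and "card (paths_between \<Lambda> u e1 u) = d1" and "card (paths_between \<Lambda> u e2 u) = d2"
    and "card (paths_between \<Lambda> u e1 v) = a1" and "card (paths_between \<Lambda> u e2 v) = a2"
    and "paths_into \<Lambda> v e1 = {}" and "paths_into \<Lambda> v e2 = {}"
    and "0 < r1" "0 < r2" "0 < \<beta>"
    and "ln (real d1) < \<beta> * r1" "ln (real d2) < \<beta> * r2"
    and "toeplitz_dynamics \<Lambda> (r1, r2) \<alpha>"
    and "y = 1 + real a1 * exp (- \<beta> * r1) * inverse (1 - real d1 * exp (- \<beta> * r1))
                  * inverse (1 - real d2 * exp (- \<beta> * r2))
               + real a2 * exp (- \<beta> * r2) * inverse (1 - real d2 * exp (- \<beta> * r2))"
  shows "\<exists>\<phi>1 \<phi>2.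
      {\<phi>. kms_state (toeplitz_algebra \<Lambda>) \<alpha> \<beta> \<phi>} = state_segment \<phi>1 \<phi>2
    \<and> \<phi>1 \<noteq> \<phi>2
    \<and> extreme_states {\<phi>. kms_state (toeplitz_algebra \<Lambda>) \<alpha> \<beta> \<phi>} = {\<phi>1, \<phi>2}
    \<and> \<phi>1 (tgen \<Lambda> u) = 1 \<and> \<phi>1 (tgen \<Lambda> v) = 0
    \<and> \<phi>2 (tgen \<Lambda> u) = complex_of_real (inverse y
          * (inverse (1 - real d1 * exp (- \<beta> * r1)) * inverse (1 - real d2 * exp (- \<beta> * r2)))
          * (real a2 * exp (- \<beta> * r2) + real a1 * exp (- \<beta> * r1)
             - real a1 * real d2 * exp (- \<beta> * (r1 + r2))))
    \<and> \<phi>2 (tgen \<Lambda> v) = complex_of_real (inverse y)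
    \<and> (\<exists>q \<psi>. removes_vertex \<Lambda> u v q
          \<and> is_state (toeplitz_algebra (loop_graph \<Lambda> u)) \<psi>
          \<and> (\<forall>x \<in> carrier (toeplitz_algebra \<Lambda>). \<phi>1 x = \<psi> (q x)))
    \<and> (\<exists>\<psi>. is_state (cuntz_krieger_algebra \<Lambda>) \<psi>
          \<and> (\<forall>x \<in> carrier (toeplitz_algebra \<Lambda>). \<phi>2 x = \<psi> (cuntz_krieger_map \<Lambda> x)))"
proof -
  interpret two_graph \<Lambda> by fact
  have edges: "paths_into \<Lambda> u n = paths_between \<Lambda> u n u \<union> paths_between \<Lambda> u n v" for n
    using src_vertex assms(6) by (auto simp: paths_between_def paths_into_def)
  \<comment> \<open>An infinite set has \<open>card\<close> equal to 0, so the positivity of a1, a2,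
    d1, d2 yields finite edge sets.\<close>
  have fin: "finite (paths_into \<Lambda> u e1)" "finite (paths_into \<Lambda> u e2)"
    unfolding edges using assms(1-4) assms(8-11) by (auto intro!: card_ge_0_finite)
  \<comment> \<open>The lower bound on \<beta> in exponential form; d > 0 is what makes exp (ln d)
    equal to d.\<close>
  have small: "real d * exp (- \<beta> * r) < 1" if "0 < d" "ln (real d) < \<beta> * r" for d r
  proof -
    have "real d * exp (- \<beta> * r) = exp (ln (real d)) * exp (- \<beta> * r)" using that(1) by simp
    also have "\<dots> = exp (ln (real d) - \<beta> * r)" by (simp add: exp_diff exp_minus divide_inverse)
    finally show ?thesis using that(2) by simp
  qed
  interpret K: kms_setup \<Lambda> u v r1 r2 \<beta> d1 d2 a1 a2
    by unfold_locales (use assms fin small in auto)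
  have x: "K.x1 = exp (- \<beta> * r1)" "K.x2 = exp (- \<beta> * r2)" by (rule K.x1_def K.x2_def)+
  have y: "y = K.y_v" unfolding assms(20) K.y_v_def x ..
  have xx: "exp (- \<beta> * (r1 + r2)) = exp (- \<beta> * r1) * exp (- \<beta> * r2)"
    by (simp add: distrib_left flip: exp_add)
  show ?thesis using K.kms_simplex[OF assms(19)] unfolding y xx x .
qed

end
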